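(* Let $d\ge4$. The following hold, where in each assertion the constants $C$ do not depend on $z$, $W_1$, $W_2$. (1) Let $d=4$. Then $\sup_{z\in\mathbb C\setminus\mathbb R}\|R_0(z)\|_{\mathcal B(\ell^p(\mathbb Z^4),\ell^{p'}(\mathbb Z^4))}<\infty$ for every $1\le p<4/3$. Equivalently, the weighted estimate $\mathrm{WE}(r;\mathbb C\setminus\mathbb R)$ holds for every $2\le r<4$; it also holds for $1\le r<2$. At the endpoint, for all $z\in\mathbb C\setminus\mathbb R$, $$\|R_0(z)\|_{\mathcal B(\ell^{4/3}(\mathbb Z^4),\ell^4(\mathbb Z^4))}\le C\left(\log\left(2+\frac1{\operatorname{dist}(z,[0,16])}\right)\right)^{1/2},$$ and, for all $W_1,W_2\in\ell^4(\mathbb Z^4)$, $$\|W_1R_0(z)W_2\|_{\mathcal B(\ell^2(\mathbb Z^4))}\le C\left(\log\left(2+\frac1{\operatorname{dist}(z,[0,16])}\right)\right)^{1/2}\|W_1\|_{\ell^4}\|W_2\|_{\ell^4}.$$ (2) Let $d\ge5$. Then $$\sup_{z\in\mathbb C\setminus\mathbb R}\|R_0(z)\|_{\mathcal B(\ell^p(\mathbb Z^d),\ell^{p'}(\mathbb Z^d))}<\infty\quad\text{for}\quad 1\le p\le\frac{2(d+2)}{d+5},$$ and the weighted estimate $\mathrm{WE}(r;\mathbb C\setminus\mathbb R)$ holds for $1\le r\le\frac{2(d+2)}3$. (3) Let $\delta>0$ and $D_\delta=\{z\in\mathbb C:\min_{0\le j\le d}|z-4j|\ge\delta\}$. If $d\ge5$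 is odd, the ranges in (2) remain valid when the supremum is restricted to $D_\delta\setminus\mathbb R$. If $d\ge6$ is even, then $$\sup_{z\in D_\delta\setminus\mathbb R}\|R_0(z)\|_{\mathcal B(\ell^p(\mathbb Z^d),\ell^{p'}(\mathbb Z^d))}<\infty\quad\text{for}\quad 1\le p\le\frac{2(2d+5)}{2d+11},$$ and the weighted estimate $\mathrm{WE}(r;D_\delta\setminus\mathbb R)$ holds for $1\le r\le\frac{2d+5}3$.
   Context: $p'$ is the Hölder conjugate of $p$, with $p'=\infty$ when $p=1$. $\mathbb T^d=(-1/2,1/2]^d$, and $\widehat f(\xi)=\sum_{n\in\mathbb Z^d}f(n)e^{-2\pi i n\cdot\xi}$ for $f:\mathbb Z^d\to\mathbb C$. The discrete Laplacian $H_0$ on $\ell^2(\mathbb Z^d)$ is the Fourier multiplier with symbol $h_0(\xi)=4\sum_{j=1}^d\sin^2(\pi\xi_j)=2d-2\sum_{j=1}^d\cos(2\pi\xi_j)$; its spectrum is $[0,4d]$, and $R_0(z)=(H_0-z)^{-1}$ for $z\in\mathbb C\setminus[0,4d]$. A function $W:\mathbb Z^d\to\mathbb C$ also denotes the multiplication operator $(Wf)(n)=W(n)f(n)$. For $Z\subset\mathbb C\setminus\mathbb R$, the weighted estimate $\mathrm{WE}(r;Z)$ is the assertion that there is a constant $C$ such that for all $W_1,W_2\in\ell^r(\mathbb Z^d)$, $$\sup_{z\in Z}\|W_1R_0(z)W_2\|_{\mathcal B(\ell^2(\mathbb Z^d))}\le C\|W_1\|_{\ell^r(\mathbb Z^d)}\|W_2\|_{\ell^r(\mathbb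 Z^d)}.$$ *)

theory Defs
  imports "HOL-Analysis.Analysis"
begin

definition hoelder_conj :: "real \<Rightarrow> ereal" where
  "hoelder_conj p = (if p = 1 then \<infinity> else ereal (p / (p - 1)))"

definition ell :: "ereal \<Rightarrow> ('a \<Rightarrow> complex) set" where
  "ell p = {f. if p = \<infinity> then bounded (range f)
               else (\<lambda>n. cmod (f n) powr real_of_ereal p) summable_on UNIV}"

text \<open>Only meaningful for \<open>1 \<le> p\<close> and \<open>f \<in> ell p\<close>; outside \<open>ell p\<close> the value is junk.\<close>
definition ell_norm :: "ereal \<Rightarrow> ('a \<Rightarrow> complex) \<Rightarrow> real" where
  "ell_norm p f = (if p = \<infinity> then (SUP n. cmod (f n))
     else (\<Sum>\<^sub>\<infinity>n. cmod (f n) powr real_of_ereal p) powr (1 / real_of_ereal p))"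

text \<open>Operator norm from \<open>ell p\<close> to \<open>ell q\<close>. It is extended-valued: it is infinite when \<open>T\<close> does
  not map \<open>ell p\<close> boundedly into \<open>ell q\<close>.\<close>
definition opnorm :: "ereal \<Rightarrow> ereal \<Rightarrow> (('a \<Rightarrow> complex) \<Rightarrow> ('a \<Rightarrow> complex)) \<Rightarrow> ennreal" where
  "opnorm p q T = (SUP f\<in>{f \<in> ell p. ell_norm p f \<le> 1}.
      if T f \<in> ell q then ennreal (ell_norm q (T f)) else \<infinity>)"

definition mult_op :: "('a \<Rightarrow> complex) \<Rightarrow> ('a \<Rightarrow> complex) \<Rightarrow> ('a \<Rightarrow> complex)" where
  "mult_op W f = (\<lambda>n. W n * f n)"

definition torus :: "(real ^ 'd) set" where
  "torus = {\<xi>. \<forall>j. - (1/2) < \<xi> $ j \<and> \<xi> $ j \<le> 1/2}"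

definition torus_measure :: "(real ^ 'd) measure" where
  "torus_measure = restrict_space lborel torus"

text \<open>\<open>has_fourier f F\<close>: the series \<open>\<Sum>n. f n * exp (- 2 \<pi> \<i> n\<cdot>\<xi>)\<close> converges to \<open>F\<close> in \<open>L\<^sup>2\<close> of the
  torus, unconditionally (along the finite subsets of the lattice). For square-summable \<open>f\<close> this is
  the usual meaning of the Fourier series; it determines \<open>F\<close> up to null sets.\<close>
definition has_fourier :: "(int ^ 'd \<Rightarrow> complex) \<Rightarrow> (real ^ 'd \<Rightarrow> complex) \<Rightarrow> bool" where
  "has_fourier f F \<longleftrightarrow> F \<in> borel_measurable torus_measure \<and>
     ((\<lambda>A. \<integral>\<^sup>+\<xi>. ennreal ((cmod (F \<xi> -
          (\<Sum>n\<in>A. f n * exp (- 2 * of_real pi * \<i> * of_real (\<Sum>j\<in>UNIV. of_int (n $ j) * \<xi> $ j)))))\<^sup>2)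
        \<partial>torus_measure) \<longlongrightarrow> 0) (finite_subsets_at_top UNIV)"

definition fourier_multiplier ::
    "(real ^ 'd \<Rightarrow> complex) \<Rightarrow> (int ^ 'd \<Rightarrow> complex) \<Rightarrow> (int ^ 'd \<Rightarrow> complex)" where
  "fourier_multiplier m f =
     (THE g. g \<in> ell 2 \<and> (\<exists>F. has_fourier f F \<and> has_fourier g (\<lambda>\<xi>. m \<xi> * F \<xi>)))"

definition h0 :: "real ^ 'd \<Rightarrow> real" where
  "h0 \<xi> = 4 * (\<Sum>j\<in>UNIV. (sin (pi * \<xi> $ j))\<^sup>2)"

definition H0 :: "(int ^ 'd \<Rightarrow> complex) \<Rightarrow> (int ^ 'd \<Rightarrow> complex)" where
  "H0 = fourier_multiplier (\<lambda>\<xi>. of_real (h0 \<xi>))"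

text \<open>The inverse is that of \<open>H0 - z\<close> as a map of \<open>ell 2\<close> to itself, so \<open>R0 z f\<close> is meaningful for
  \<open>f \<in> ell 2\<close>, in particular for \<open>f \<in> ell p\<close> with \<open>1 \<le> p \<le> 2\<close>.\<close>
definition R0 :: "complex \<Rightarrow> (int ^ 'd \<Rightarrow> complex) \<Rightarrow> (int ^ 'd \<Rightarrow> complex)" where
  "R0 z = inv_into (ell 2) (\<lambda>u n. H0 u n - z * u n)"

text \<open>The first argument only carries the index type of the lattice \<open>int ^ 'd\<close>.\<close>
definition WE :: "'d::finite itself \<Rightarrow> real \<Rightarrow> complex set \<Rightarrow> bool" where
  "WE D r Z \<longleftrightarrow> (\<exists>C::real.
     \<forall>W1 \<in> (ell (ereal r) :: (int ^ 'd \<Rightarrow> complex) set).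
     \<forall>W2 \<in> (ell (ereal r) :: (int ^ 'd \<Rightarrow> complex) set).
       (SUP z\<in>Z. opnorm 2 2 (mult_op W1 \<circ> R0 z \<circ> mult_op W2))
         \<le> ennreal (C * ell_norm (ereal r) W1 * ell_norm (ereal r) W2))"

definition thresholds_removed :: "nat \<Rightarrow> real \<Rightarrow> complex set" where
  "thresholds_removed d \<delta> = {z. (MIN j\<in>{0..d}. cmod (z - 4 * of_nat j)) \<ge> \<delta>}"

end

theory Submission
  imports Defs "HOL-Complex_Analysis.Complex_Analysis" "HOL-Real_Asymp.Real_Asymp"
begin

text \<open>
  The proof is complex interpolation along the powers of the resolvent, fed by bounds for Bessel
  functions that are uniform in the order.

  For \<open>Im z > 0\<close> the function \<open>w = \<i> (h0 - z)\<close> has real part \<open>Im z\<close>, so its principal powers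
  \<open>w powr (- s)\<close> are Fourier symbols depending analytically on \<open>s\<close>, and \<open>s = 1\<close> is the resolvent up
  to a constant. On the line \<open>Re s = 0\<close> the symbol is bounded by \<open>exp (pi * \<bar>Im s\<bar>)\<close>, which gives an
  \<open>\<ell>\<^sup>2\<close> bound (\<open>power_kernel_l2_bound\<close>). On a line \<open>Re s = \<lambda> > 1\<close> what is needed is that the
  convolution kernel is bounded, uniformly in \<open>z\<close>. The three lines theorem, applied with the weights
  raised to the power \<open>s\<close>, then bounds \<open>W1 R0 W2\<close> on \<open>\<ell>\<^sup>2\<close> for \<open>W1, W2 \<in> \<ell>\<^sup>r\<close> with \<open>r = 2 \<lambda>\<close>
  (\<open>bilinear_bound_from_kernel\<close>). All assertions follow from this one bilinear estimate:
  the weighted ones by duality in \<open>\<ell>\<^sup>2\<close> (\<open>weighted_estimate\<close>), and the bounds from \<open>\<ell>\<^sup>p\<close> to its dual for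
  \<open>p \<le> 2 r / (r + 2)\<close> by writing \<open>f\<close> as a weight in \<open>\<ell>\<^sup>r\<close> times a function in \<open>\<ell>\<^sup>2\<close>
  (\<open>resolvent_estimate\<close>). Smaller \<open>p\<close> and \<open>r\<close> come from the inclusions of the sequence spaces.

  The kernel on \<open>Re s = \<lambda>\<close> is computed from
  \<open>Gamma s * w powr (- s) = \<integral> t powr (s - 1) * exp (- t w) dt\<close> over \<open>t > 0\<close>. The torus integral of
  \<open>exp (- t w)\<close> against a character splits over the coordinates, so the kernel at \<open>k\<close> is a Mellin
  transform of a unimodular factor times \<open>exp (- t Im z)\<close> times the product over \<open>j\<close> of
  \<open>bessel (k $ j) t\<close>, where \<open>bessel n t = \<i>^n J\<^sub>n(2 t)\<close> (\<open>Gamma_power_kernel\<close>). A product of \<open>d\<close> numbers is at most the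
  sum of their \<open>d\<close>-th powers, hence everything rests on bounding the integral of
  \<open>t powr (\<lambda> - 1) * \<bar>J\<^sub>n(2 t)\<bar> ^ d\<close> independently of \<open>n\<close>.

  With turning point \<open>N = \<bar>n\<bar> / 2\<close> one has \<open>\<bar>J\<^sub>n(2 t)\<bar>\<close> at most a constant times \<open>t powr (-1/3)\<close>, times
  \<open>(t \<bar>t - N\<bar>) powr (-1/4)\<close>, and times \<open>1 / N\<close> for \<open>t \<le> N / 2\<close>. For \<open>d \<ge> 5\<close> the dangerous region is
  \<open>\<bar>t - N\<bar> \<le> N powr (1/3)\<close>, which contributes \<open>N\<close> to the power \<open>\<lambda> - 1 - d/3 + 1/3\<close>; this is bounded
  exactly for \<open>\<lambda> \<le> (d + 2) / 3\<close>, whence \<open>r = 2 (d + 2) / 3\<close>. For \<open>d = 4\<close> the tails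
  \<open>1 / \<bar>t - N\<bar>\<close> produce \<open>N powr (\<lambda> - 2) * ln N\<close>, bounded for \<open>\<lambda> < 2\<close>; at \<open>\<lambda> = 2\<close> the damping
  \<open>exp (- t Im z)\<close> turns this into \<open>ln (2 + 1 / Im z)\<close>, and interpolation takes its square root.

  Two further ideas are needed. When \<open>d\<close> is even and \<open>z\<close> stays away from the threshold \<open>2 d\<close>, the unimodular factor is
  \<open>exp (\<i> t (z - 2 d))\<close> up to the damping, and one integration by parts in \<open>t\<close> replaces one Bessel function by its
  derivative. That derivative is \<open>O(t powr (-1/2))\<close> uniformly in the order, better than
  \<open>t powr (-1/3)\<close>, and the integral of \<open>t powr (\<lambda> - 3/2)\<close> against the other \<open>d - 1\<close> factors is bounded for
  \<open>\<lambda> = (2 d + 5) / 6\<close> (\<open>bilinear_bound_off_centre\<close>). Secondly, the logarithm at the endpoint involves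
  the distance to the spectrum and not \<open>Im z\<close>. If the distance is much larger than \<open>Im z\<close>, then \<open>Re z\<close>
  lies outside the spectrum, \<open>h0 - Re z\<close> has a constant sign, and the resolvent symbol at \<open>z\<close> is
  dominated by a multiple of the real part of the symbol at the point above \<open>z\<close> whose imaginary part is that
  distance (\<open>bilinear_bound_dominated\<close>). The lower half plane follows by complex conjugation.
\<close>

section \<open>Interpolation of analytic families\<close>

text \<open>
  Dividing \<open>F\<close> by the exponential that interpolates the two boundary constants reduces this to
  constants \<open>1\<close>. The factor \<open>exp (\<epsilon> * s\<^sup>2)\<close> makes the quotient small at high imaginary parts, so that
  the maximum principle applies on a tall rectangle; then \<open>\<epsilon> \<rightarrow> 0\<close>.
\<close>
lemma hadamard_three_lines:
  fixes F :: "complex \<Rightarrow> complex"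
  assumes L: "0 < L"
    and hol: "F holomorphic_on {s. 0 < Re s \<and> Re s < L}"
    and cont: "continuous_on {s. 0 \<le> Re s \<and> Re s \<le> L} F"
    and bd: "\<And>s. 0 \<le> Re s \<Longrightarrow> Re s \<le> L \<Longrightarrow> cmod (F s) \<le> B"
    and M: "0 < M0" "0 < M1"
    and left: "\<And>s. Re s = 0 \<Longrightarrow> cmod (F s) \<le> M0"
    and right: "\<And>s. Re s = L \<Longrightarrow> cmod (F s) \<le> M1"
    and s: "0 \<le> Re s" "Re s \<le> L"
  shows "cmod (F s) \<le> M0 powr (1 - Re s / L) * M1 powr (Re s / L)"
proof -
  define N where "N = (\<lambda>s::complex. exp (- ((1 - s / of_real L) * of_real (ln M0) + s / of_real L * of_real (ln M1))))"
  define P where "P = (\<lambda>\<sigma>. M0 powr (1 - \<sigma> / L) * M1 powr (\<sigma> / L))"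
  have Ppos: "P \<sigma> > 0" for \<sigma> using M by (simp add: P_def)
  have normN: "cmod (N s) = inverse (P (Re s))" for s
  proof -
    have "cmod (N s) = exp (- ((1 - Re s / L) * ln M0 + Re s / L * ln M1))"
      by (simp add: N_def)
    also have "\<dots> = inverse (P (Re s))"
      using M by (simp add: P_def powr_def exp_minus exp_diff divide_inverse)
    finally show ?thesis .
  qed
  have "continuous_on {0..L} (\<lambda>\<sigma>. inverse (P \<sigma>))"
    unfolding P_def using M L by (intro continuous_intros) auto
  then have "bounded ((\<lambda>\<sigma>. inverse (P \<sigma>)) ` {0..L})"
    by (intro compact_imp_bounded compact_continuous_image) auto
  then obtain K where K: "\<And>\<sigma>. 0 \<le> \<sigma> \<Longrightarrow> \<sigma> \<le> L \<Longrightarrow> inverse (P \<sigma>) \<le> K"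
    unfolding bounded_iff by (metis abs_le_iff atLeastAtMost_iff image_eqI real_norm_def)
  have bound_eps: "cmod (F s) \<le> P (Re s) * exp (\<epsilon> * (L\<^sup>2 + (Im s)\<^sup>2))" if "\<epsilon> > 0" for \<epsilon>
  proof -
    define G where "G = (\<lambda>s. F s * N s * exp (of_real \<epsilon> * s\<^sup>2))"
    have normG: "cmod (G s) = cmod (F s) * inverse (P (Re s)) * exp (\<epsilon> * ((Re s)\<^sup>2 - (Im s)\<^sup>2))" for s
      by (simp add: G_def norm_mult normN power2_eq_square)
    \<comment> \<open>At this height the Gaussian factor beats the crude bound \<open>B * K\<close> on the horizontal sides.\<close>
    define R where "R = max (\<bar>Im s\<bar>) (sqrt (\<bar>B * K\<bar> / \<epsilon>)) "
    have R1: "\<bar>Im s\<bar> \<le> R" by (simp add: R_def)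
    have R2: "\<bar>B * K\<bar> \<le> exp (\<epsilon> * R\<^sup>2)"
    proof -
      have "\<bar>B * K\<bar> / \<epsilon> = (sqrt (\<bar>B * K\<bar> / \<epsilon>))\<^sup>2" using that by simp
      also have "\<dots> \<le> R\<^sup>2" by (intro power_mono) (use that in \<open>auto simp: R_def\<close>)
      finally have "\<bar>B * K\<bar> \<le> \<epsilon> * R\<^sup>2" using that by (simp add: field_simps)
      also have "\<dots> \<le> exp (\<epsilon> * R\<^sup>2)" using exp_ge_add_one_self[of "\<epsilon> * R\<^sup>2"] by linarith
      finally show ?thesis .
    qed
    let ?S = "cbox (Complex 0 (-R)) (Complex L R)"
    have inS: "z \<in> ?S \<longleftrightarrow> 0 \<le> Re z \<and> Re z \<le> L \<and> - R \<le> Im z \<and> Im z \<le> R" for z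
      by (auto simp: in_cbox_complex_iff)
    have inB: "z \<in> box (Complex 0 (-R)) (Complex L R) \<longleftrightarrow> 0 < Re z \<and> Re z < L \<and> - R < Im z \<and> Im z < R" for z
      by (auto simp: in_box_complex_iff)
    have "cmod (G s) \<le> exp (\<epsilon> * L\<^sup>2)"
    proof (rule maximum_modulus_frontier[where S = ?S and f = G])
      show "G holomorphic_on interior ?S"
        unfolding G_def N_def interior_cbox using L
        by (intro holomorphic_intros holomorphic_on_subset[OF hol]) (auto simp: inB)
      show "continuous_on (closure ?S) G"
        unfolding G_def N_def using L
        by (intro continuous_intros continuous_on_subset[OF cont]) (auto simp: inS)
      show "bounded ?S" by simp
      show "s \<in> ?S" using s R1 by (auto simp: inS)
      fix z assume "z \<in> frontier ?S"
      then have zS: "z \<in> ?S" and zB: "z \<notin> box (Complex 0 (-R)) (Complex L R)"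
        by (auto simp: frontier_def)
      have re: "(Re z)\<^sup>2 \<le> L\<^sup>2" using zS by (intro power_mono) (auto simp: inS)
      consider "Re z = 0" | "Re z = L" | "\<bar>Im z\<bar> = R" using zS zB by (auto simp: inS inB)
      then show "cmod (G z) \<le> exp (\<epsilon> * L\<^sup>2)"
      proof cases
        case 1
        then have "cmod (F z) * inverse (P (Re z)) \<le> 1"
          using left[of z] M L by (simp add: P_def field_simps)
        moreover have "exp (\<epsilon> * ((Re z)\<^sup>2 - (Im z)\<^sup>2)) \<le> exp (\<epsilon> * L\<^sup>2)"
          using re that zero_le_power2[of "Im z"] by (simp, linarith)
        ultimately have "cmod (G z) \<le> 1 * exp (\<epsilon> * L\<^sup>2)"
          unfolding normG using Ppos[of "Re z"] by (intro mult_mono) auto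
        then show ?thesis by simp
      next
        case 2
        then have "cmod (F z) * inverse (P (Re z)) \<le> 1"
          using right[of z] M L by (simp add: P_def field_simps)
        moreover have "exp (\<epsilon> * ((Re z)\<^sup>2 - (Im z)\<^sup>2)) \<le> exp (\<epsilon> * L\<^sup>2)"
          using re that zero_le_power2[of "Im z"] by (simp, linarith)
        ultimately have "cmod (G z) \<le> 1 * exp (\<epsilon> * L\<^sup>2)"
          unfolding normG using Ppos[of "Re z"] by (intro mult_mono) auto
        then show ?thesis by simp
      next
        case 3
        have Fz: "cmod (F z) \<le> B" "inverse (P (Re z)) \<le> K"
          using bd[of z] K[of "Re z"] zS by (auto simp: inS)
        have "(Im z)\<^sup>2 = R\<^sup>2" using 3 by (metis power2_abs)
        then have ex: "exp (\<epsilon> * ((Re z)\<^sup>2 - (Im z)\<^sup>2)) \<le> exp (\<epsilon> * L\<^sup>2 - \<epsilon> * R\<^sup>2)"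
          using re that by (simp add: algebra_simps)
        have "0 \<le> B" using Fz(1) norm_ge_zero order_trans by blast
        have "cmod (G z) \<le> (B * K) * exp (\<epsilon> * L\<^sup>2 - \<epsilon> * R\<^sup>2)"
          unfolding normG using Fz ex Ppos[of "Re z"] \<open>0 \<le> B\<close> by (intro mult_mono mult_nonneg_nonneg) (auto intro: order_trans[of _ "inverse (P (Re z))"])
        also have "\<dots> \<le> exp (\<epsilon> * R\<^sup>2) * exp (\<epsilon> * L\<^sup>2 - \<epsilon> * R\<^sup>2)"
          using R2 by (intro mult_right_mono) auto
        also have "\<dots> = exp (\<epsilon> * L\<^sup>2)" by (simp flip: exp_add)
        finally show ?thesis .
      qed
    qed
    then have "cmod (F s) * inverse (P (Re s)) * exp (\<epsilon> * ((Re s)\<^sup>2 - (Im s)\<^sup>2)) \<le> exp (\<epsilon> * L\<^sup>2)"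
      by (simp add: normG)
    then have "cmod (F s) \<le> P (Re s) * (exp (\<epsilon> * L\<^sup>2) / exp (\<epsilon> * ((Re s)\<^sup>2 - (Im s)\<^sup>2)))"
      using Ppos[of "Re s"] by (simp add: field_simps)
    also have "exp (\<epsilon> * L\<^sup>2) / exp (\<epsilon> * ((Re s)\<^sup>2 - (Im s)\<^sup>2)) = exp (\<epsilon> * (L\<^sup>2 + (Im s)\<^sup>2) - \<epsilon> * (Re s)\<^sup>2)"
      by (simp flip: exp_diff add: algebra_simps)
    also have "\<dots> \<le> exp (\<epsilon> * (L\<^sup>2 + (Im s)\<^sup>2))" using that by simp
    finally show ?thesis using Ppos[of "Re s"] by (simp add: mult_left_mono)
  qed
  have "((\<lambda>\<epsilon>. P (Re s) * exp (\<epsilon> * (L\<^sup>2 + (Im s)\<^sup>2))) \<longlongrightarrow> P (Re s) * exp (0 * (L\<^sup>2 + (Im s)\<^sup>2))) (at_right 0)"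
    by (intro tendsto_intros)
  then have "cmod (F s) \<le> P (Re s) * exp (0 * (L\<^sup>2 + (Im s)\<^sup>2))"
    by (rule tendsto_lowerbound) (auto simp: eventually_at_right_less intro!: eventually_mono[OF eventually_at_right_less[of 0]] bound_eps)
  then show ?thesis by (simp add: P_def)
qed

lemma holomorphic_of_real_powr:
  "(\<lambda>s. complex_of_real v powr s) holomorphic_on A"
proof (cases "v = 0")
  case True then show ?thesis by simp
next
  case False
  then show ?thesis by (simp add: powr_def) (intro holomorphic_intros)
qed

text \<open>
  The weights are inserted as \<open>V powr s\<close>. On \<open>Re s = 0\<close> they have modulus at most one and the \<open>\<ell>\<^sup>2\<close>
  bound applies; on \<open>Re s = L\<close> the functions \<open>V powr L * x\<close> are in \<open>\<ell>\<^sup>1\<close> by Cauchy--Schwarz, and a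
  bounded kernel acts from \<open>\<ell>\<^sup>1\<close> to \<open>\<ell>\<^sup>\<infinity>\<close>; at \<open>s = 1\<close> the weights are \<open>V\<close> itself.
  Restricting to a finite set \<open>A\<close> removes every question of convergence.
\<close>
lemma stein_interpolation_weighted:
  fixes a :: "complex \<Rightarrow> 'k \<Rightarrow> 'k \<Rightarrow> complex" and V1 V2 :: "'k \<Rightarrow> real" and x y :: "'k \<Rightarrow> complex"
  assumes fin: "finite A" and L: "1 \<le> L" and M: "0 < M0" "0 < M1"
    and hol: "\<And>m n. m \<in> A \<Longrightarrow> n \<in> A \<Longrightarrow> (\<lambda>s. a s m n) holomorphic_on {s. 0 < Re s \<and> Re s < L}"
    and cont: "\<And>m n. m \<in> A \<Longrightarrow> n \<in> A \<Longrightarrow> continuous_on {s. 0 \<le> Re s \<and> Re s \<le> L} (\<lambda>s. a s m n)"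
    and bd: "\<And>s m n. m \<in> A \<Longrightarrow> n \<in> A \<Longrightarrow> 0 \<le> Re s \<Longrightarrow> Re s \<le> L \<Longrightarrow> cmod (a s m n) \<le> B"
    and l2: "\<And>s f g. Re s = 0 \<Longrightarrow> (\<Sum>m\<in>A. (cmod (f m))\<^sup>2) \<le> 1 \<Longrightarrow> (\<Sum>m\<in>A. (cmod (g m))\<^sup>2) \<le> 1 \<Longrightarrow>
        cmod (\<Sum>m\<in>A. \<Sum>n\<in>A. a s m n * f m * g n) \<le> M0"
    and l1: "\<And>s m n. Re s = L \<Longrightarrow> m \<in> A \<Longrightarrow> n \<in> A \<Longrightarrow> cmod (a s m n) \<le> M1"
    and V: "\<And>n. 0 \<le> V1 n" "\<And>n. 0 \<le> V2 n"
      "(\<Sum>n\<in>A. V1 n powr (2 * L)) \<le> 1" "(\<Sum>n\<in>A. V2 n powr (2 * L)) \<le> 1"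
    and x: "(\<Sum>n\<in>A. (cmod (x n))\<^sup>2) \<le> 1" and y: "(\<Sum>n\<in>A. (cmod (y n))\<^sup>2) \<le> 1"
  shows "cmod (\<Sum>m\<in>A. \<Sum>n\<in>A. a 1 m n * (V2 m * x m) * (V1 n * y n)) \<le> M0 powr (1 - 1 / L) * M1 powr (1 / L)"
proof -
  define f where "f = (\<lambda>s m. complex_of_real (V2 m) powr s * x m)"
  define g where "g = (\<lambda>s m. complex_of_real (V1 m) powr s * y m)"
  define F where "F = (\<lambda>s. \<Sum>m\<in>A. \<Sum>n\<in>A. a s m n * f s m * g s n)"
  have nf: "cmod (f s m) = V2 m powr Re s * cmod (x m)" for s m
    using V by (simp add: f_def norm_mult norm_powr_real_powr)
  have ng: "cmod (g s m) = V1 m powr Re s * cmod (y m)" for s m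
    using V by (simp add: g_def norm_mult norm_powr_real_powr)
  have bdV: "v powr \<sigma> \<le> (1 + v) powr L" if "0 \<le> v" "0 \<le> \<sigma>" "\<sigma> \<le> L" for v \<sigma> :: real
  proof -
    have "v powr \<sigma> \<le> (1 + v) powr \<sigma>" using that by (intro powr_mono2) auto
    also have "\<dots> \<le> (1 + v) powr L" using that by (intro powr_mono) auto
    finally show ?thesis .
  qed
  have half: "(\<Sum>m\<in>A. W m powr L * cmod (w m)) \<le> 1"
    if "\<And>n. 0 \<le> W n" "(\<Sum>n\<in>A. W n powr (2 * L)) \<le> 1" "(\<Sum>n\<in>A. (cmod (w n))\<^sup>2) \<le> 1" for W :: "'k \<Rightarrow> real" and w :: "'k \<Rightarrow> complex"
  proof -
    have "W m powr L * cmod (w m) \<le> (W m powr (2 * L) + (cmod (w m))\<^sup>2) / 2" for m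
    proof -
      have "W m powr (2 * L) = (W m powr L)\<^sup>2"
        by (simp add: power2_eq_square flip: powr_add)
      then show ?thesis using sum_squares_bound[of "W m powr L" "cmod (w m)"] by simp
    qed
    then have "(\<Sum>m\<in>A. W m powr L * cmod (w m)) \<le> (\<Sum>m\<in>A. (W m powr (2 * L) + (cmod (w m))\<^sup>2) / 2)"
      by (intro sum_mono) auto
    also have "\<dots> = ((\<Sum>n\<in>A. W n powr (2 * L)) + (\<Sum>n\<in>A. (cmod (w n))\<^sup>2)) / 2"
      by (simp only: sum_divide_distrib sum.distrib add_divide_distrib)
    also have "\<dots> \<le> 1" using that by simp
    finally show ?thesis .
  qed
  have "cmod (F 1) \<le> M0 powr (1 - Re 1 / L) * M1 powr (Re 1 / L)"
  proof (rule hadamard_three_lines[where B = "\<Sum>m\<in>A. \<Sum>n\<in>A. \<bar>B\<bar> * ((1 + V2 m) powr L * cmod (x m)) * ((1 + V1 n) powr L * cmod (y n))"])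
    show "0 < L" "0 < M0" "0 < M1" "0 \<le> Re 1" "Re 1 \<le> L" using L M by auto
    show "F holomorphic_on {s. 0 < Re s \<and> Re s < L}"
      unfolding F_def f_def g_def by (intro holomorphic_intros hol holomorphic_of_real_powr)
    show "continuous_on {s. 0 \<le> Re s \<and> Re s \<le> L} F"
      unfolding F_def f_def g_def
      by (intro continuous_intros cont holomorphic_on_imp_continuous_on[OF holomorphic_of_real_powr])
  next
    fix s assume s: "0 \<le> Re s" "Re s \<le> L"
    show "cmod (F s) \<le> (\<Sum>m\<in>A. \<Sum>n\<in>A. \<bar>B\<bar> * ((1 + V2 m) powr L * cmod (x m)) * ((1 + V1 n) powr L * cmod (y n)))"
      unfolding F_def
    proof (intro sum_norm_le)
      fix m n assume mn: "m \<in> A" "n \<in> A"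
      have "cmod (a s m n) \<le> \<bar>B\<bar>" using bd[OF mn s] by linarith
      moreover have "cmod (f s m) \<le> (1 + V2 m) powr L * cmod (x m)"
        unfolding nf by (intro mult_right_mono bdV V s) auto
      moreover have "cmod (g s n) \<le> (1 + V1 n) powr L * cmod (y n)"
        unfolding ng by (intro mult_right_mono bdV V s) auto
      ultimately show "cmod (a s m n * f s m * g s n) \<le> \<bar>B\<bar> * ((1 + V2 m) powr L * cmod (x m)) * ((1 + V1 n) powr L * cmod (y n))"
        unfolding norm_mult by (intro mult_mono mult_nonneg_nonneg) auto
    qed
  next
    fix s assume s: "Re s = 0"
    have "(cmod (f s m))\<^sup>2 \<le> (cmod (x m))\<^sup>2" "(cmod (g s m))\<^sup>2 \<le> (cmod (y m))\<^sup>2" for m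
      unfolding nf ng s by (auto simp: powr_def)
    then have "(\<Sum>m\<in>A. (cmod (f s m))\<^sup>2) \<le> (\<Sum>n\<in>A. (cmod (x n))\<^sup>2)" "(\<Sum>m\<in>A. (cmod (g s m))\<^sup>2) \<le> (\<Sum>n\<in>A. (cmod (y n))\<^sup>2)"
      by (auto intro: sum_mono)
    then show "cmod (F s) \<le> M0" unfolding F_def using x y by (intro l2 s) auto
  next
    fix s assume s: "Re s = L"
    have "cmod (F s) \<le> (\<Sum>m\<in>A. \<Sum>n\<in>A. M1 * (V2 m powr L * cmod (x m)) * (V1 n powr L * cmod (y n)))"
      unfolding F_def
    proof (intro sum_norm_le)
      fix m n assume "m \<in> A" "n \<in> A"
      then show "cmod (a s m n * f s m * g s n) \<le> M1 * (V2 m powr L * cmod (x m)) * (V1 n powr L * cmod (y n))"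
        unfolding norm_mult nf ng s using l1[OF s, of m n] M by (intro mult_mono mult_nonneg_nonneg) auto
    qed
    also have "\<dots> = M1 * ((\<Sum>m\<in>A. V2 m powr L * cmod (x m)) * (\<Sum>n\<in>A. V1 n powr L * cmod (y n)))"
      by (subst sum_product) (simp add: sum_distrib_left mult.assoc)
    also have "\<dots> \<le> M1 * (1 * 1)"
      using V x y M by (intro mult_left_mono mult_mono half sum_nonneg) auto
    finally show "cmod (F s) \<le> M1" by simp
  qed
  moreover have "F 1 = (\<Sum>m\<in>A. \<Sum>n\<in>A. a 1 m n * (V2 m * x m) * (V1 n * y n))"
    unfolding F_def f_def g_def using V by (simp add: powr_to_1)
  ultimately show ?thesis by simp
qed

section \<open>Bessel functions, uniformly in the order\<close>

text \<open>
  The integrand is \<open>H\<close> times the derivative of \<open>cis \<phi>\<close> up to a factor \<open>\<i>\<close>. The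
  derivative of \<open>H\<close> may contain a large part as long as that is controlled by the derivative of some \<open>G\<close>: it
  then enters only through the increment of \<open>G\<close>, as for a function of bounded variation.
\<close>
lemma oscillatory_integral_by_parts:
  fixes \<phi> \<psi> H H' G G' :: "real \<Rightarrow> real"
  assumes pq: "p \<le> q"
    and \<phi>: "\<And>x. x \<in> {p..q} \<Longrightarrow> (\<phi> has_real_derivative \<psi> x) (at x)"
    and H: "\<And>x. x \<in> {p..q} \<Longrightarrow> (H has_real_derivative H' x) (at x)"
    and G: "\<And>x. x \<in> {p..q} \<Longrightarrow> (G has_real_derivative G' x) (at x)"
    and cont: "continuous_on {p..q} \<psi>" "continuous_on {p..q} H'"
    and bd: "\<And>x. x \<in> {p..q} \<Longrightarrow> \<bar>H' x\<bar> \<le> K + G' x"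
  shows "cmod (integral {p..q} (\<lambda>x. of_real (H x * \<psi> x) * cis (\<phi> x)))
     \<le> \<bar>H p\<bar> + \<bar>H q\<bar> + K * (q - p) + (G q - G p)"
proof -
  have cH: "continuous_on {p..q} H"
    by (intro continuous_at_imp_continuous_on ballI DERIV_isCont[OF H])
  have c\<phi>: "continuous_on {p..q} \<phi>"
    by (intro continuous_at_imp_continuous_on ballI DERIV_isCont[OF \<phi>])
  have ccis: "continuous_on {p..q} (\<lambda>x. cis (\<phi> x))"
    by (rule continuous_on_cis[OF c\<phi>])
  have der: "((\<lambda>x. of_real (H x) * cis (\<phi> x)) has_vector_derivative
      of_real (H' x) * cis (\<phi> x) + of_real (H x) * (\<i> * of_real (\<psi> x) * cis (\<phi> x))) (at x within {p..q})"
    if "x \<in> {p..q}" for x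
  proof -
    have 1: "((\<lambda>x. complex_of_real (H x)) has_vector_derivative of_real (H' x)) (at x within {p..q})"
      by (rule has_vector_derivative_of_real[OF has_field_derivative_at_within[OF H[OF that]]])
    have 2: "((\<lambda>x. cis (\<phi> x)) has_vector_derivative (\<i> * of_real (\<psi> x) * cis (\<phi> x))) (at x within {p..q})"
    proof -
      have "((\<lambda>x. \<i> * complex_of_real (\<phi> x)) has_vector_derivative \<i> * of_real (\<psi> x)) (at x within {p..q})"
        by (rule has_vector_derivative_mult_right[OF has_vector_derivative_of_real[OF has_field_derivative_at_within[OF \<phi>[OF that]]]])
      from field_vector_diff_chain_within[OF this, of exp]
      have "((\<lambda>x. cis (\<phi> x)) has_vector_derivative (\<i> * of_real (\<psi> x)) * exp (\<i> * of_real (\<phi> x))) (at x within {p..q})"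
        by (simp add: o_def cis_conv_exp DERIV_exp has_field_derivative_at_within)
      then show ?thesis by (simp add: cis_conv_exp)
    qed
    show ?thesis using has_vector_derivative_mult[OF 1 2] by (simp add: add.commute)
  qed
  have i1: "(\<lambda>x. of_real (H' x) * cis (\<phi> x)) integrable_on {p..q}"
    by (intro integrable_continuous_real continuous_intros ccis cont)
  have i2: "(\<lambda>x. of_real (H x) * (\<i> * of_real (\<psi> x) * cis (\<phi> x))) integrable_on {p..q}"
    by (intro integrable_continuous_real continuous_intros ccis cont cH)
  have "((\<lambda>x. of_real (H' x) * cis (\<phi> x) + of_real (H x) * (\<i> * of_real (\<psi> x) * cis (\<phi> x))) has_integral
      (of_real (H q) * cis (\<phi> q) - of_real (H p) * cis (\<phi> p))) {p..q}"
    by (rule fundamental_theorem_of_calculus[OF pq der])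
  then have eq: "integral {p..q} (\<lambda>x. of_real (H' x) * cis (\<phi> x)) + integral {p..q} (\<lambda>x. of_real (H x) * (\<i> * of_real (\<psi> x) * cis (\<phi> x)))
     = of_real (H q) * cis (\<phi> q) - of_real (H p) * cis (\<phi> p)"
    using integral_add[OF i1 i2] by (simp add: integral_unique)
  have "integral {p..q} (\<lambda>x. of_real (H x) * (\<i> * of_real (\<psi> x) * cis (\<phi> x))) = \<i> * integral {p..q} (\<lambda>x. of_real (H x * \<psi> x) * cis (\<phi> x))"
    by (simp flip: integral_mult_right add: mult_ac)
  then have "cmod (integral {p..q} (\<lambda>x. of_real (H x * \<psi> x) * cis (\<phi> x)))
     = cmod (integral {p..q} (\<lambda>x. of_real (H x) * (\<i> * of_real (\<psi> x) * cis (\<phi> x))))"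
    by (simp add: norm_mult)
  also have "integral {p..q} (\<lambda>x. of_real (H x) * (\<i> * of_real (\<psi> x) * cis (\<phi> x)))
      = of_real (H q) * cis (\<phi> q) - of_real (H p) * cis (\<phi> p) - integral {p..q} (\<lambda>x. of_real (H' x) * cis (\<phi> x))"
    using eq by (simp only: eq_diff_eq add.commute)
  also have "cmod \<dots> \<le> cmod (of_real (H q) * cis (\<phi> q)) + cmod (of_real (H p) * cis (\<phi> p)) + cmod (integral {p..q} (\<lambda>x. of_real (H' x) * cis (\<phi> x)))"
    by (intro order_trans[OF norm_triangle_ineq4] add_mono norm_triangle_ineq4 order_refl)
  also have "cmod (integral {p..q} (\<lambda>x. of_real (H' x) * cis (\<phi> x))) \<le> integral {p..q} (\<lambda>x. K + G' x)"
  proof (rule integral_norm_bound_integral[OF i1])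
    have "(G' has_integral (G q - G p)) {p..q}"
      by (rule fundamental_theorem_of_calculus[OF pq])
        (simp add: G has_field_derivative_at_within flip: has_real_derivative_iff_has_vector_derivative)
    then show "(\<lambda>x. K + G' x) integrable_on {p..q}" by (intro integrable_add) auto
    show "cmod (of_real (H' x) * cis (\<phi> x)) \<le> K + G' x" if "x \<in> {p..q}" for x
      using bd[OF that] by (simp add: norm_mult)
  qed
  also have "integral {p..q} (\<lambda>x. K + G' x) = K * (q - p) + (G q - G p)"
  proof -
    have "(G' has_integral (G q - G p)) {p..q}"
      by (rule fundamental_theorem_of_calculus[OF pq])
        (simp add: G has_field_derivative_at_within flip: has_real_derivative_iff_has_vector_derivative)
    from has_integral_add[OF has_integral_const_real[of K p q] this] show ?thesis
      using pq by (simp add: integral_unique mult.commute)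
  qed
  finally show ?thesis by (simp add: norm_mult)
qed

text \<open>
  The phase of the integral representation of the Bessel function of order \<open>n\<close> at \<open>\<tau>\<close>. Its
  derivative \<open>n - \<tau> * sin \<theta>\<close> vanishes where \<open>sin \<theta> = n / \<tau>\<close>.
\<close>
definition bessel_phase :: "real \<Rightarrow> real \<Rightarrow> real \<Rightarrow> real" where
  "bessel_phase n \<tau> \<theta> = \<tau> * cos \<theta> + n * \<theta>"

text \<open>
  Integration by parts with \<open>A / \<psi>\<close> as the amplitude, where \<open>\<psi>\<close> is the derivative of the phase. On
  this half circle \<open>cos\<close> is nonnegative, so \<open>1 / \<psi>\<close> is monotone and its total variation is at most
  \<open>1 / \<mu>\<close>.
\<close>
lemma bessel_phase_nonstationary:
  fixes A A' :: "real \<Rightarrow> real"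
  assumes pq: "- pi / 2 \<le> p" "p \<le> q" "q \<le> pi / 2" and "0 < \<tau>" "0 < \<mu>"
    and A: "\<And>x. (A has_real_derivative A' x) (at x)" "continuous_on UNIV A'"
      "\<And>x. x \<in> {p..q} \<Longrightarrow> 0 \<le> A x" "\<And>x. A x \<le> 1" "\<And>x. \<bar>A' x\<bar> \<le> 1"
    and ns: "(\<forall>x\<in>{p..q}. \<mu> \<le> n - \<tau> * sin x) \<or> (\<forall>x\<in>{p..q}. n - \<tau> * sin x \<le> - \<mu>)"
  shows "cmod (integral {p..q} (\<lambda>x. of_real (A x) * cis (bessel_phase n \<tau> x))) \<le> 7 / \<mu>"
proof -
  define \<psi> where "\<psi> = (\<lambda>x. n - \<tau> * sin x)"
  have nz: "\<mu> \<le> \<bar>\<psi> x\<bar>" if "x \<in> {p..q}" for x using ns that \<open>0 < \<mu>\<close> unfolding \<psi>_def by fastforce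
  have nz': "\<psi> x \<noteq> 0" if "x \<in> {p..q}" for x using nz[OF that] \<open>0 < \<mu>\<close> by auto
  have inv: "\<bar>1 / \<psi> x\<bar> \<le> 1 / \<mu>" if "x \<in> {p..q}" for x
    using nz[OF that] \<open>0 < \<mu>\<close> by (simp add: abs_divide frac_le)
  have "cmod (integral {p..q} (\<lambda>x. of_real (A x / \<psi> x * \<psi> x) * cis (bessel_phase n \<tau> x)))
     \<le> \<bar>A p / \<psi> p\<bar> + \<bar>A q / \<psi> q\<bar> + (1 / \<mu>) * (q - p) + (1 / \<psi> q - 1 / \<psi> p)"
  proof (rule oscillatory_integral_by_parts[where H' = "\<lambda>x. A' x / \<psi> x + A x * (\<tau> * cos x) / (\<psi> x)\<^sup>2"
        and G' = "\<lambda>x. \<tau> * cos x / (\<psi> x)\<^sup>2"])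
    fix x assume x: "x \<in> {p..q}"
    show "(bessel_phase n \<tau> has_real_derivative \<psi> x) (at x)"
      unfolding bessel_phase_def \<psi>_def by (auto intro!: derivative_eq_intros)
    have d\<psi>: "(\<psi> has_real_derivative (- \<tau> * cos x)) (at x)"
      unfolding \<psi>_def by (auto intro!: derivative_eq_intros)
    show "((\<lambda>x. A x / \<psi> x) has_real_derivative A' x / \<psi> x + A x * (\<tau> * cos x) / (\<psi> x)\<^sup>2) (at x)"
      by (rule derivative_eq_intros A d\<psi> nz'[OF x] refl)+ (use nz'[OF x] in \<open>simp add: field_simps power2_eq_square\<close>)
    show "((\<lambda>x. 1 / \<psi> x) has_real_derivative \<tau> * cos x / (\<psi> x)\<^sup>2) (at x)"
      by (rule derivative_eq_intros d\<psi> nz'[OF x] refl)+ (use nz'[OF x] in \<open>simp add: field_simps power2_eq_square\<close>)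
    have cos0: "0 \<le> cos x" using x pq by (intro cos_ge_zero) auto
    have "\<bar>A' x / \<psi> x\<bar> \<le> 1 * (1 / \<mu>)"
      using inv[OF x] A(5)[of x] by (simp only: divide_inverse abs_mult) (intro mult_mono, auto simp: divide_inverse)
    moreover have "\<bar>A x * (\<tau> * cos x) / (\<psi> x)\<^sup>2\<bar> \<le> \<tau> * cos x / (\<psi> x)\<^sup>2"
      using cos0 A(3)[OF x] A(4)[of x] \<open>0 < \<tau>\<close> by (auto simp: abs_mult intro!: divide_right_mono mult_left_le_one_le)
    ultimately show "\<bar>A' x / \<psi> x + A x * (\<tau> * cos x) / (\<psi> x)\<^sup>2\<bar> \<le> 1 / \<mu> + \<tau> * cos x / (\<psi> x)\<^sup>2"
      by linarith
  next
    show "continuous_on {p..q} \<psi>" unfolding \<psi>_def by (intro continuous_intros)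
    have "continuous_on {p..q} A"
      by (intro continuous_at_imp_continuous_on ballI DERIV_isCont[OF A(1)])
    then show "continuous_on {p..q} (\<lambda>x. A' x / \<psi> x + A x * (\<tau> * cos x) / (\<psi> x)\<^sup>2)"
      using nz' unfolding \<psi>_def by (intro continuous_intros continuous_on_subset[OF A(2)]) auto
  qed (use pq in auto)
  also have "integral {p..q} (\<lambda>x. of_real (A x / \<psi> x * \<psi> x) * cis (bessel_phase n \<tau> x)) = integral {p..q} (\<lambda>x. of_real (A x) * cis (bessel_phase n \<tau> x))"
    by (rule integral_cong) (use nz' in auto)
  also have "\<bar>A p / \<psi> p\<bar> + \<bar>A q / \<psi> q\<bar> + (1 / \<mu>) * (q - p) + (1 / \<psi> q - 1 / \<psi> p) \<le> 1 / \<mu> + 1 / \<mu> + (1 / \<mu>) * 4 + 1 / \<mu>"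
  proof (intro add_mono mult_left_mono)
    have pin: "p \<in> {p..q}" and qin: "q \<in> {p..q}" using pq by auto
    have "\<bar>A y / \<psi> y\<bar> \<le> 1 * (1 / \<mu>)" if "y \<in> {p..q}" for y
      using inv[OF that] A(3,4)[of y] that by (simp only: divide_inverse abs_mult) (intro mult_mono, auto simp: divide_inverse)
    from this[OF pin] this[OF qin] show "\<bar>A p / \<psi> p\<bar> \<le> 1 / \<mu>" "\<bar>A q / \<psi> q\<bar> \<le> 1 / \<mu>" by auto
    show "q - p \<le> 4" using pq pi_less_4 by linarith
    show "0 \<le> 1 / \<mu>" using \<open>0 < \<mu>\<close> by simp
    from ns show "1 / \<psi> q - 1 / \<psi> p \<le> 1 / \<mu>"
    proof
      assume "\<forall>x\<in>{p..q}. \<mu> \<le> n - \<tau> * sin x"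
      then have "0 \<le> 1 / \<psi> p" using pin \<open>0 < \<mu>\<close> by (fastforce simp: \<psi>_def)
      then show ?thesis using inv[OF qin] by linarith
    next
      assume "\<forall>x\<in>{p..q}. n - \<tau> * sin x \<le> - \<mu>"
      then have "1 / \<psi> q \<le> 0" using qin \<open>0 < \<mu>\<close> by (fastforce simp: \<psi>_def)
      then show ?thesis using inv[OF pin] by linarith
    qed
  qed
  finally show ?thesis by simp
qed

text \<open>
  Truncation to \<open>[-1, 1]\<close>: \<open>arcsin (clip x)\<close> is the point of \<open>[- pi/2, pi/2]\<close> where \<open>sin\<close> passes the
  level \<open>x\<close>, with the endpoints as values when the level is not attained.
\<close>
definition clip :: "real \<Rightarrow> real" where "clip x = max (-1) (min 1 x)"

text \<open>
  Outside the window where \<open>\<bar>n - \<tau> * sin x\<bar> < \<mu>\<close> the phase is nonstationary; on the window the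
  integrand is bounded by its amplitude. The level \<open>\<mu>\<close> is left free, to be balanced against the length
  of the window.
\<close>
lemma bessel_half_split:
  fixes A A' :: "real \<Rightarrow> real" and n :: real
  assumes "0 < \<tau>" "0 < \<mu>"
    and A: "\<And>x. (A has_real_derivative A' x) (at x)" "continuous_on UNIV A'"
      "\<And>x. x \<in> {-pi/2..pi/2} \<Longrightarrow> 0 \<le> A x" "\<And>x. A x \<le> 1" "\<And>x. \<bar>A' x\<bar> \<le> 1"
  defines "\<alpha> \<equiv> arcsin (clip ((n - \<mu>) / \<tau>))" and "\<beta> \<equiv> arcsin (clip ((n + \<mu>) / \<tau>))"
  shows "cmod (integral {-pi/2..pi/2} (\<lambda>x. of_real (A x) * cis (bessel_phase n \<tau> x)))
     \<le> 14 / \<mu> + integral {\<alpha>..\<beta>} A"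
proof -
  let ?f = "\<lambda>x. of_real (A x) * cis (bessel_phase n \<tau> x)"
  have cA: "continuous_on S A" for S
    by (intro continuous_at_imp_continuous_on ballI DERIV_isCont[OF A(1)])
  have int: "?f integrable_on {c..d}" for c d
    unfolding bessel_phase_def
    by (rule integrable_continuous_real)
       (rule continuous_on_mult[OF continuous_on_of_real[OF cA] continuous_on_cis], intro continuous_intros)
  have c1: "-1 \<le> clip x" "clip x \<le> 1" for x by (auto simp: clip_def)
  have a1: "- pi/2 \<le> \<alpha>" "\<alpha> \<le> pi/2" "- pi/2 \<le> \<beta>" "\<beta> \<le> pi/2"
    unfolding \<alpha>_def \<beta>_def using arcsin_lbound[OF c1, of "(n - \<mu>) / \<tau>"] arcsin_ubound[OF c1, of "(n - \<mu>) / \<tau>"]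
      arcsin_lbound[OF c1, of "(n + \<mu>) / \<tau>"] arcsin_ubound[OF c1, of "(n + \<mu>) / \<tau>"] by simp_all
  have "(n - \<mu>) / \<tau> \<le> (n + \<mu>) / \<tau>" using assms(1,2) by (intro divide_right_mono) auto
  then have ab: "\<alpha> \<le> \<beta>" unfolding \<alpha>_def \<beta>_def by (intro arcsin_le_arcsin) (auto simp: clip_def)
  have sa: "sin \<alpha> = clip ((n - \<mu>) / \<tau>)" "sin \<beta> = clip ((n + \<mu>) / \<tau>)"
    unfolding \<alpha>_def \<beta>_def using c1 by auto
  have left: "cmod (integral {-pi/2..\<alpha>} ?f) \<le> 7 / \<mu>"
  proof (cases "\<alpha> = -pi/2")
    case True then show ?thesis using assms by simp
  next
    case False
    then have "-1 < (n - \<mu>) / \<tau>"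
    proof -
      have "clip ((n - \<mu>) / \<tau>) \<noteq> -1" using False by (auto simp: \<alpha>_def)
      then show ?thesis by (auto simp: clip_def split: if_splits)
    qed
    then have "clip ((n - \<mu>) / \<tau>) \<le> (n - \<mu>) / \<tau>" by (simp add: clip_def)
    then have "sin \<alpha> \<le> (n - \<mu>) / \<tau>" by (simp add: sa)
    then have *: "\<mu> \<le> n - \<tau> * sin \<alpha>" using \<open>0 < \<tau>\<close> by (simp add: field_simps)
    show ?thesis
    proof (rule bessel_phase_nonstationary[where A' = A'])
      show "(\<forall>x\<in>{-pi/2..\<alpha>}. \<mu> \<le> n - \<tau> * sin x) \<or> (\<forall>x\<in>{-pi/2..\<alpha>}. n - \<tau> * sin x \<le> - \<mu>)"
      proof (intro disjI1 ballI)
        fix x assume "x \<in> {-pi/2..\<alpha>}"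
        then have "sin x \<le> sin \<alpha>" using a1 by (intro sin_monotone_2pi_le) auto
        then have "\<tau> * sin x \<le> \<tau> * sin \<alpha>" using assms by simp
        then show "\<mu> \<le> n - \<tau> * sin x" using * by linarith
      qed
    qed (use assms a1 in auto)
  qed
  have right: "cmod (integral {\<beta>..pi/2} ?f) \<le> 7 / \<mu>"
  proof (cases "\<beta> = pi/2")
    case True then show ?thesis unfolding True using \<open>0 < \<mu>\<close> by simp
  next
    case False
    then have "(n + \<mu>) / \<tau> < 1"
    proof -
      have "clip ((n + \<mu>) / \<tau>) \<noteq> 1" using False by (auto simp: \<beta>_def)
      then show ?thesis by (auto simp: clip_def split: if_splits)
    qed
    then have "clip ((n + \<mu>) / \<tau>) \<ge> (n + \<mu>) / \<tau>" by (simp add: clip_def)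
    then have "sin \<beta> \<ge> (n + \<mu>) / \<tau>" by (simp add: sa)
    then have *: "n - \<tau> * sin \<beta> \<le> - \<mu>" using \<open>0 < \<tau>\<close> by (simp add: field_simps)
    show ?thesis
    proof (rule bessel_phase_nonstationary[where A' = A'])
      show "(\<forall>x\<in>{\<beta>..pi/2}. \<mu> \<le> n - \<tau> * sin x) \<or> (\<forall>x\<in>{\<beta>..pi/2}. n - \<tau> * sin x \<le> - \<mu>)"
      proof (intro disjI2 ballI)
        fix x assume "x \<in> {\<beta>..pi/2}"
        then have "sin x \<ge> sin \<beta>" using a1 by (intro sin_monotone_2pi_le) auto
        then have "\<tau> * sin x \<ge> \<tau> * sin \<beta>" using assms by simp
        then show "n - \<tau> * sin x \<le> - \<mu>" using * by linarith
      qed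
    qed (use assms a1 in auto)
  qed
  have mid: "cmod (integral {\<alpha>..\<beta>} ?f) \<le> integral {\<alpha>..\<beta>} A"
    using A(3) a1 by (intro integral_norm_bound_integral int integrable_continuous_real cA) (auto simp: norm_mult)
  have "integral {-pi/2..pi/2} ?f = integral {-pi/2..\<alpha>} ?f + (integral {\<alpha>..\<beta>} ?f + integral {\<beta>..pi/2} ?f)"
    using a1 ab int by (simp add: Henstock_Kurzweil_Integration.integral_combine)
  then have "cmod (integral {-pi/2..pi/2} ?f) \<le> cmod (integral {-pi/2..\<alpha>} ?f) + (cmod (integral {\<alpha>..\<beta>} ?f) + cmod (integral {\<beta>..pi/2} ?f))"
    by (simp only:) (intro order_trans[OF norm_triangle_ineq] add_mono norm_triangle_ineq order_refl)
  also have "\<dots> \<le> 7 / \<mu> + (integral {\<alpha>..\<beta>} A + 7 / \<mu>)"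
    by (intro add_mono left mid right)
  finally show ?thesis by simp
qed

lemma sin_ge_half:
  fixes x :: real
  assumes "0 \<le> x" "x \<le> pi / 2"
  shows "x / 2 \<le> sin x"
proof -
  have "concave_on {0..pi/2} sin"
    by (rule f''_le0_imp_concave[where f' = cos and f'' = "\<lambda>x. - sin x"])
       (auto intro!: derivative_eq_intros sin_ge_zero)
  from concave_onD[OF this, of "x / (pi / 2)" 0 "pi / 2"] assms
  have "x / (pi / 2) \<le> sin x" by (auto simp: field_simps)
  moreover have "x / 2 \<le> x / (pi / 2)"
    using assms pi_less_4 by (intro divide_left_mono) auto
  ultimately show ?thesis by linarith
qed

text \<open>
  At worst the interval touches an endpoint \<open>\<plusminus> pi/2\<close>, where \<open>sin\<close> is quadratic. This bounds the
  length of a window in terms of the corresponding gap of sines.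
\<close>
lemma sin_gap_quadratic:
  fixes \<alpha> \<beta> :: real
  assumes "- pi / 2 \<le> \<alpha>" "\<alpha> \<le> \<beta>" "\<beta> \<le> pi / 2"
  shows "(\<beta> - \<alpha>)\<^sup>2 / 8 \<le> sin \<beta> - sin \<alpha>"
proof -
  define \<delta> where "\<delta> = (\<beta> - \<alpha>) / 2"
  have \<delta>: "0 \<le> \<delta>" "\<delta> \<le> pi / 2" using assms by (auto simp: \<delta>_def)
  have "sin \<delta> = cos (pi / 2 - \<delta>)" by (simp add: cos_diff)
  also have "\<dots> \<le> cos \<bar>(\<beta> + \<alpha>) / 2\<bar>"
    using assms by (intro cos_monotone_0_pi_le) (auto simp: \<delta>_def field_simps abs_le_iff)
  finally have c: "sin \<delta> \<le> cos ((\<beta> + \<alpha>) / 2)" by (simp only: cos_abs_real)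
  have s: "\<delta> / 2 \<le> sin \<delta>" using \<delta> by (rule sin_ge_half)
  have "(\<beta> - \<alpha>)\<^sup>2 / 8 = 2 * (\<delta> / 2) * (\<delta> / 2)" by (simp add: \<delta>_def power2_eq_square)
  also have "\<dots> \<le> 2 * sin \<delta> * cos ((\<beta> + \<alpha>) / 2)"
    using s c \<delta> by (intro mult_mono) auto
  also have "\<dots> = sin \<beta> - sin \<alpha>" by (simp add: sin_diff_sin \<delta>_def)
  finally show ?thesis .
qed

text \<open>
  Away from \<open>\<plusminus> pi/2\<close> the sine has slope comparable with \<open>cos \<theta>\<close>, which improves the quadratic
  bound for windows around a fixed angle \<open>\<theta>\<close>.
\<close>
lemma sin_gap_linear:
  fixes x \<theta> :: real
  assumes x: "- pi / 2 \<le> x" "x \<le> pi / 2" and \<theta>: "0 \<le> \<theta>" "\<theta> \<le> pi / 2"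
  shows "cos \<theta> * \<bar>x - \<theta>\<bar> / 4 \<le> \<bar>sin x - sin \<theta>\<bar>"
proof -
  have "cos \<theta> / 2 \<le> sin ((pi / 2 - \<theta>) / 2)"
  proof -
    let ?y = "(pi / 2 - \<theta>) / 2"
    have "cos \<theta> = sin (2 * ?y)" by (simp add: cos_sin_eq diff_divide_distrib)
    also have "\<dots> = 2 * sin ?y * cos ?y" by (rule sin_double)
    also have "\<dots> \<le> 2 * sin ?y * 1"
      using \<theta> by (intro mult_left_mono) (auto intro!: sin_ge_zero)
    finally show ?thesis by simp
  qed
  also have "\<dots> = cos (pi / 2 - (pi / 2 - \<theta>) / 2)" by (simp add: cos_diff)
  also have "\<dots> \<le> cos \<bar>(x + \<theta>) / 2\<bar>"
  proof (rule cos_monotone_0_pi_le)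
    show "\<bar>(x + \<theta>) / 2\<bar> \<le> pi / 2 - (pi / 2 - \<theta>) / 2" using assms by (cases "0 \<le> x + \<theta>") (simp_all add: abs_if field_simps)
    show "pi / 2 - (pi / 2 - \<theta>) / 2 \<le> pi" using \<theta> by (simp add: field_simps)
  qed auto
  finally have c: "cos \<theta> / 2 \<le> cos ((x + \<theta>) / 2)" by (simp only: cos_abs_real)
  have "\<bar>(x - \<theta>) / 2\<bar> / 2 \<le> sin \<bar>(x - \<theta>) / 2\<bar>"
    using assms by (intro sin_ge_half) (auto simp: field_simps abs_le_iff)
  also have "\<dots> \<le> \<bar>sin ((x - \<theta>) / 2)\<bar>"
    by (cases "0 \<le> (x - \<theta>) / 2") (simp_all only: abs_if sin_minus, auto)
  finally have s: "\<bar>x - \<theta>\<bar> / 4 \<le> \<bar>sin ((x - \<theta>) / 2)\<bar>" by simp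
  have c0: "0 \<le> cos \<theta>" using \<theta> by (intro cos_ge_zero) auto
  have "cos \<theta> * \<bar>x - \<theta>\<bar> / 4 = 2 * (\<bar>x - \<theta>\<bar> / 4) * (cos \<theta> / 2)" by simp
  also have "\<dots> \<le> 2 * \<bar>sin ((x - \<theta>) / 2)\<bar> * \<bar>cos ((x + \<theta>) / 2)\<bar>"
    using s c c0 by (intro mult_mono) auto
  also have "\<dots> = \<bar>sin x - sin \<theta>\<bar>" by (simp add: sin_diff_sin abs_mult)
  finally show ?thesis .
qed

text \<open>
  The part of the Bessel integral over the half circle where \<open>cos\<close> is nonnegative. The amplitude \<open>A\<close>
  is \<open>1\<close> for the function itself and \<open>cos\<close> for its derivative.
\<close>
definition bessel_half :: "(real \<Rightarrow> real) \<Rightarrow> real \<Rightarrow> real \<Rightarrow> complex" where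
  "bessel_half A n \<tau> = integral {-pi/2..pi/2} (\<lambda>x. of_real (A x) * cis (bessel_phase n \<tau> x))"

lemma bessel_half_split1:
  assumes "0 < \<tau>" "0 < \<mu>"
  shows "cmod (bessel_half (\<lambda>_. 1) n \<tau>) \<le> 14 / \<mu> + (arcsin (clip ((n + \<mu>) / \<tau>)) - arcsin (clip ((n - \<mu>) / \<tau>)))"
proof -
  have "(n - \<mu>) / \<tau> \<le> (n + \<mu>) / \<tau>" using assms(1,2) by (intro divide_right_mono) auto
  then have "arcsin (clip ((n - \<mu>) / \<tau>)) \<le> arcsin (clip ((n + \<mu>) / \<tau>))"
    by (intro arcsin_le_arcsin) (auto simp: clip_def)
  then show ?thesis
    using bessel_half_split[OF assms, of "\<lambda>_. 1" "\<lambda>_. 0" n] by (simp add: bessel_half_def)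
qed

lemma clip_bounds: "-1 \<le> clip x" "clip x \<le> 1" by (auto simp: clip_def)

lemma sin_arcsin_clip [simp]: "sin (arcsin (clip x)) = clip x"
  by (simp add: clip_bounds)

lemma clip_diff: "x \<le> y \<Longrightarrow> clip y - clip x \<le> y - x"
  by (auto simp: clip_def)

text \<open>
  A window of height \<open>\<mu> / \<tau>\<close> in the sine has length at most of order \<open>sqrt (\<mu> / \<tau>)\<close>; this equals
  \<open>1 / \<mu>\<close> for \<open>\<mu> = \<tau> powr (1/3)\<close>.
\<close>
lemma bessel_half_airy:
  assumes "0 < \<tau>"
  shows "cmod (bessel_half (\<lambda>_. 1) n \<tau>) \<le> 18 * \<tau> powr (-1/3)"
proof -
  define \<mu> where "\<mu> = \<tau> powr (1/3)"
  have \<mu>: "0 < \<mu>" using assms by (simp add: \<mu>_def)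
  define \<alpha> where "\<alpha> = arcsin (clip ((n - \<mu>) / \<tau>))"
  define \<beta> where "\<beta> = arcsin (clip ((n + \<mu>) / \<tau>))"
  have le: "(n - \<mu>) / \<tau> \<le> (n + \<mu>) / \<tau>" using assms \<mu> by (intro divide_right_mono) auto
  then have ab: "\<alpha> \<le> \<beta>" unfolding \<alpha>_def \<beta>_def by (intro arcsin_le_arcsin) (auto simp: clip_def)
  have "(\<beta> - \<alpha>)\<^sup>2 / 8 \<le> sin \<beta> - sin \<alpha>"
    using arcsin_lbound[OF clip_bounds] arcsin_ubound[OF clip_bounds] ab
    by (intro sin_gap_quadratic) (auto simp: \<alpha>_def \<beta>_def)
  also have "\<dots> \<le> (n + \<mu>) / \<tau> - (n - \<mu>) / \<tau>" using clip_diff[OF le] by (simp add: \<alpha>_def \<beta>_def)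
  also have "\<dots> = 2 * \<mu> / \<tau>" by (simp add: diff_divide_distrib[symmetric])
  also have "2 * \<mu> / \<tau> = 2 * (\<mu> / \<tau>)" by simp
  also have "\<mu> / \<tau> = (\<tau> powr (-1/3))\<^sup>2"
  proof -
    have "\<mu> / \<tau> = \<tau> powr (1/3) / \<tau> powr 1" using assms by (simp add: \<mu>_def)
    also have "\<dots> = \<tau> powr (-1/3 + -1/3)" by (subst powr_diff[symmetric]) simp
    also have "\<dots> = (\<tau> powr (-1/3))\<^sup>2" by (simp only: powr_add power2_eq_square)
    finally show ?thesis .
  qed
  finally have "(\<beta> - \<alpha>)\<^sup>2 \<le> (4 * \<tau> powr (-1/3))\<^sup>2" by (simp add: power_mult_distrib)
  then have "\<beta> - \<alpha> \<le> 4 * \<tau> powr (-1/3)" by (rule power2_le_imp_le) simp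
  moreover have "14 / \<mu> = 14 * \<tau> powr (-1/3)" using powr_minus_divide[of \<tau> "1/3"] by (simp add: \<mu>_def)
  ultimately show ?thesis using bessel_half_split1[OF assms \<mu>, of n] by (simp add: \<alpha>_def \<beta>_def)
qed

text \<open>
  With \<open>a = sqrt (\<tau> * \<bar>\<tau> - n\<bar>)\<close>, the size of \<open>\<tau> * cos\<close> at the stationary point, the window has
  length of order \<open>\<mu> / a\<close>; this equals \<open>1 / \<mu>\<close> for \<open>\<mu> = sqrt a\<close>. For \<open>\<tau> < n\<close> there is no stationary
  point, and a window of level \<open>\<mu>\<close> can only sit next to \<open>pi / 2\<close>.
\<close>
lemma bessel_half_far:
  assumes "0 < \<tau>" "0 \<le> n" "\<tau> \<noteq> n"
  shows "cmod (bessel_half (\<lambda>_. 1) n \<tau>) \<le> 22 * (\<tau> * \<bar>\<tau> - n\<bar>) powr (-1/4)"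
proof -
  define a where "a = sqrt (\<tau> * \<bar>\<tau> - n\<bar>)"
  have a: "0 < a" using assms by (simp add: a_def)
  define \<mu> where "\<mu> = sqrt a"
  have \<mu>: "0 < \<mu>" and \<mu>2: "\<mu>\<^sup>2 = a" using a by (simp_all add: \<mu>_def)
  have a2: "a\<^sup>2 = \<tau> * \<bar>\<tau> - n\<bar>" using assms by (simp add: a_def)
  define \<alpha> where "\<alpha> = arcsin (clip ((n - \<mu>) / \<tau>))"
  define \<beta> where "\<beta> = arcsin (clip ((n + \<mu>) / \<tau>))"
  have bnd: "- pi/2 \<le> \<alpha>" "\<alpha> \<le> pi/2" "- pi/2 \<le> \<beta>" "\<beta> \<le> pi/2"
    using arcsin_lbound[OF clip_bounds] arcsin_ubound[OF clip_bounds] by (auto simp: \<alpha>_def \<beta>_def)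
  have "\<beta> - \<alpha> \<le> 8 * \<mu> / a"
  proof (cases "n < \<tau>")
    case True
    define \<theta> where "\<theta> = arcsin (n / \<tau>)"
    have nt: "0 \<le> n / \<tau>" "n / \<tau> \<le> 1" "-1 \<le> n / \<tau>" using assms True by (auto simp: field_simps)
    have \<theta>: "0 \<le> \<theta>" "\<theta> \<le> pi / 2" using arcsin_ubound[OF nt(3,2)] arcsin_nonneg[of "n / \<tau>"] nt by (simp_all add: \<theta>_def)
    have sin\<theta>: "sin \<theta> = n / \<tau>" using nt by (simp add: \<theta>_def)
    have clipnt: "clip (n / \<tau>) = n / \<tau>" using nt by (auto simp: clip_def)
    have "cos \<theta> = sqrt (1 - (n / \<tau>)\<^sup>2)" unfolding \<theta>_def using nt by (intro cos_arcsin) auto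
    also have "\<dots> \<ge> sqrt (1 - n / \<tau>)"
    proof -
      have "n / \<tau> * (n / \<tau>) \<le> n / \<tau>" using nt by (intro mult_left_le)
      then show ?thesis by (simp add: power2_eq_square)
    qed
    finally have "sqrt (1 - n / \<tau>) \<le> cos \<theta>" .
    then have "\<tau> * sqrt (1 - n / \<tau>) \<le> \<tau> * cos \<theta>" using assms by simp
    moreover have "\<tau> * sqrt (1 - n / \<tau>) = a"
    proof -
      have "\<tau> * sqrt (1 - n / \<tau>) = sqrt (\<tau>\<^sup>2 * (1 - n / \<tau>))" using assms by (simp add: real_sqrt_mult)
      also have "\<tau>\<^sup>2 * (1 - n / \<tau>) = \<tau> * \<bar>\<tau> - n\<bar>" using assms True by (simp add: field_simps power2_eq_square)
      finally show ?thesis by (simp add: a_def)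
    qed
    ultimately have ac: "a \<le> \<tau> * cos \<theta>" by simp
    have near: "\<bar>x - \<theta>\<bar> \<le> 4 * \<mu> / a" if "- pi/2 \<le> x" "x \<le> pi/2" "\<bar>sin x - sin \<theta>\<bar> \<le> \<mu> / \<tau>" for x
    proof -
      have "cos \<theta> * \<bar>x - \<theta>\<bar> / 4 \<le> \<mu> / \<tau>" by (rule order_trans[OF sin_gap_linear that(3)]) (use that \<theta> in auto)
      then have "\<tau> * cos \<theta> * \<bar>x - \<theta>\<bar> \<le> 4 * \<mu>" using assms by (simp add: field_simps)
      moreover have "a * \<bar>x - \<theta>\<bar> \<le> \<tau> * cos \<theta> * \<bar>x - \<theta>\<bar>" using ac by (intro mult_right_mono) auto
      ultimately show ?thesis using a by (simp add: field_simps)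
    qed
    have "\<bar>\<alpha> - \<theta>\<bar> \<le> 4 * \<mu> / a"
    proof (rule near)
      have "clip (n / \<tau>) - clip ((n - \<mu>) / \<tau>) \<le> n / \<tau> - (n - \<mu>) / \<tau>"
        using assms \<mu> by (intro clip_diff divide_right_mono) auto
      moreover have "clip ((n - \<mu>) / \<tau>) \<le> clip (n / \<tau>)"
        using divide_right_mono[of "n - \<mu>" n \<tau>] assms \<mu> by (auto simp: clip_def)
      ultimately show "\<bar>sin \<alpha> - sin \<theta>\<bar> \<le> \<mu> / \<tau>" by (simp add: \<alpha>_def sin\<theta> clipnt diff_divide_distrib)
    qed (use bnd in auto)
    moreover have "\<bar>\<beta> - \<theta>\<bar> \<le> 4 * \<mu> / a"
    proof (rule near)
      have "clip ((n + \<mu>) / \<tau>) - clip (n / \<tau>) \<le> (n + \<mu>) / \<tau> - n / \<tau>"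
        using assms \<mu> by (intro clip_diff divide_right_mono) auto
      moreover have "clip ((n + \<mu>) / \<tau>) \<ge> clip (n / \<tau>)"
        using divide_right_mono[of n "n + \<mu>" \<tau>] assms \<mu> by (auto simp: clip_def)
      ultimately show "\<bar>sin \<beta> - sin \<theta>\<bar> \<le> \<mu> / \<tau>" by (simp add: \<beta>_def sin\<theta> clipnt add_divide_distrib)
    qed (use bnd in auto)
    ultimately show ?thesis by linarith
  next
    case False
    then have n: "\<tau> < n" using assms by simp
    show ?thesis
    proof (cases "(n - \<mu>) / \<tau> \<ge> 1")
      case True
      then have "\<alpha> = pi / 2" by (simp add: \<alpha>_def clip_def)
      then show ?thesis using bnd a \<mu> by (auto intro: order_trans[of _ 0])
    next
      case False
      then have "clip ((n - \<mu>) / \<tau>) \<ge> (n - \<mu>) / \<tau>" by (auto simp: clip_def)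
      then have "sin \<alpha> \<ge> (n - \<mu>) / \<tau>" by (simp add: \<alpha>_def)
      then have 1: "n - \<tau> * sin \<alpha> \<le> \<mu>" using assms by (simp add: field_simps)
      have "(pi / 2 - \<alpha>)\<^sup>2 / 8 \<le> sin (pi / 2) - sin \<alpha>"
        using bnd by (intro sin_gap_quadratic) auto
      then have "\<tau> * ((pi / 2 - \<alpha>)\<^sup>2 / 8) \<le> \<tau> * (1 - sin \<alpha>)" using assms by simp
      then have 2: "(n - \<tau>) + \<tau> * ((pi / 2 - \<alpha>)\<^sup>2 / 8) \<le> \<mu>" using 1 by (simp add: algebra_simps)
      let ?u = "n - \<tau>" and ?v = "\<tau> * ((pi / 2 - \<alpha>)\<^sup>2 / 8)"
      have "4 * u * v \<le> (u + v)\<^sup>2" for u v :: real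
        using zero_le_power2[of "u - v"] by (simp add: power2_eq_square algebra_simps)
      then have "4 * ?u * ?v \<le> (?u + ?v)\<^sup>2" .
      also have "\<dots> \<le> \<mu>\<^sup>2" using 2 n assms by (intro power_mono) auto
      finally have "a\<^sup>2 * (pi / 2 - \<alpha>)\<^sup>2 \<le> 2 * \<mu>\<^sup>2" using n by (simp add: a2 algebra_simps)
      also have "\<dots> \<le> (8 * \<mu>)\<^sup>2" by (simp add: power_mult_distrib)
      finally have "(a * (pi / 2 - \<alpha>))\<^sup>2 \<le> (8 * \<mu>)\<^sup>2" by (simp add: power_mult_distrib)
      then have "a * (pi / 2 - \<alpha>) \<le> 8 * \<mu>" by (rule power2_le_imp_le) (use \<mu> in simp)
      then have "pi / 2 - \<alpha> \<le> 8 * \<mu> / a" using a by (simp add: field_simps)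
      then show ?thesis using bnd by linarith
    qed
  qed
  also have "8 * \<mu> / a = 8 / \<mu>" using \<mu> by (simp add: \<mu>2[symmetric] power2_eq_square)
  finally have "cmod (bessel_half (\<lambda>_. 1) n \<tau>) \<le> 22 / \<mu>"
    using bessel_half_split1[OF \<open>0 < \<tau>\<close> \<mu>, of n] by (simp add: \<alpha>_def \<beta>_def)
  also have "22 / \<mu> = 22 * (\<tau> * \<bar>\<tau> - n\<bar>) powr (-1/4)"
  proof -
    have "\<mu> = a powr (1/2)" using a by (simp add: \<mu>_def powr_half_sqrt)
    also have "a = (\<tau> * \<bar>\<tau> - n\<bar>) powr (1/2)" using assms by (simp add: a_def powr_half_sqrt)
    finally have "\<mu> = (\<tau> * \<bar>\<tau> - n\<bar>) powr (1/4)" by (simp add: powr_powr)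
    moreover have "(\<tau> * \<bar>\<tau> - n\<bar>) powr (-1/4) = 1 / (\<tau> * \<bar>\<tau> - n\<bar>) powr (1/4)"
      using powr_minus_divide[of "\<tau> * \<bar>\<tau> - n\<bar>" "1/4"] by simp
    ultimately show ?thesis by simp
  qed
  finally show ?thesis .
qed

text \<open>
  For \<open>\<tau> \<le> n / 2\<close> the derivative of the phase never drops below \<open>n / 2\<close>.
\<close>
lemma bessel_half_small:
  assumes "0 < \<tau>" "\<tau> \<le> n / 2"
  shows "cmod (bessel_half (\<lambda>_. 1) n \<tau>) \<le> 14 / n"
proof -
  have "cmod (bessel_half (\<lambda>_. 1) n \<tau>) \<le> 7 / (n / 2)"
    unfolding bessel_half_def
  proof (rule bessel_phase_nonstationary[where A' = "\<lambda>_. 0"])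
    have "\<tau> * sin x \<le> \<tau> * 1" for x using assms by (intro mult_left_mono) auto
    then show "(\<forall>x\<in>{- pi / 2..pi / 2}. n / 2 \<le> n - \<tau> * sin x) \<or> (\<forall>x\<in>{- pi / 2..pi / 2}. n - \<tau> * sin x \<le> - (n / 2))"
      using assms by (intro disjI1 ballI) (smt (verit) field_sum_of_halves mult_cancel_left2)
  qed (use assms in auto)
  then show ?thesis by simp
qed

text \<open>
  The amplitude \<open>cos\<close> vanishes exactly where the stationary point degenerates: its integral over the
  window is the gap of the sines, at most \<open>2 * \<mu> / \<tau>\<close>, with no square root. The choice
  \<open>\<mu> = sqrt \<tau>\<close> balances this with \<open>1 / \<mu>\<close>.
\<close>
lemma bessel_half_cos:
  assumes "0 < \<tau>"
  shows "cmod (bessel_half cos n \<tau>) \<le> 16 * \<tau> powr (-1/2)"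
proof -
  define \<mu> where "\<mu> = sqrt \<tau>"
  have \<mu>: "0 < \<mu>" "\<mu> * \<mu> = \<tau>" using assms by (simp_all add: \<mu>_def)
  define \<alpha> where "\<alpha> = arcsin (clip ((n - \<mu>) / \<tau>))"
  define \<beta> where "\<beta> = arcsin (clip ((n + \<mu>) / \<tau>))"
  have le: "(n - \<mu>) / \<tau> \<le> (n + \<mu>) / \<tau>" using assms \<mu> by (intro divide_right_mono) auto
  then have ab: "\<alpha> \<le> \<beta>" unfolding \<alpha>_def \<beta>_def by (intro arcsin_le_arcsin) (auto simp: clip_def)
  have "(cos has_integral (sin \<beta> - sin \<alpha>)) {\<alpha>..\<beta>}"
    by (intro fundamental_theorem_of_calculus ab)
       (auto intro!: derivative_eq_intros simp flip: has_real_derivative_iff_has_vector_derivative)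
  then have "integral {\<alpha>..\<beta>} cos = clip ((n + \<mu>) / \<tau>) - clip ((n - \<mu>) / \<tau>)"
    by (simp add: integral_unique \<alpha>_def \<beta>_def)
  also have "\<dots> \<le> (n + \<mu>) / \<tau> - (n - \<mu>) / \<tau>" by (rule clip_diff[OF le])
  also have "\<dots> = 2 / \<mu>" using \<mu> by (simp add: diff_divide_distrib[symmetric] \<mu>(2)[symmetric])
  finally have "integral {\<alpha>..\<beta>} cos \<le> 2 / \<mu>" .
  moreover have "cmod (bessel_half cos n \<tau>) \<le> 14 / \<mu> + integral {\<alpha>..\<beta>} cos"
    unfolding bessel_half_def \<alpha>_def \<beta>_def
  proof (rule bessel_half_split[where A' = "\<lambda>x. - sin x"])
    show "(cos has_real_derivative - sin x) (at x)" for x :: real by (rule DERIV_cos)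
    show "continuous_on UNIV (\<lambda>x::real. - sin x)" by (intro continuous_intros)
    show "0 \<le> cos x" if "x \<in> {- pi / 2..pi / 2}" for x using that by (intro cos_ge_zero) auto
  qed (use assms \<mu> in auto)
  moreover have "16 / \<mu> = 16 * \<tau> powr (-1/2)"
  proof -
    have "\<mu> = \<tau> powr (1/2)" using assms by (simp add: \<mu>_def powr_half_sqrt)
    moreover have "\<tau> powr (-1/2) = 1 / \<tau> powr (1/2)" using powr_minus_divide[of \<tau> "1/2"] by simp
    ultimately show ?thesis by simp
  qed
  ultimately show ?thesis by simp
qed

lemma integral_affine_pos:
  fixes f :: "real \<Rightarrow> complex"
  assumes "0 < m" "continuous_on UNIV f"
  shows "integral {a..b} (\<lambda>x. f (m * x + c)) = (1 / m) *\<^sub>R integral {m * a + c..m * b + c} f"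
proof (cases "a \<le> b")
  case True
  have "(f has_integral integral {m * a + c..m * b + c} f) (cbox (m * a + c) (m * b + c))"
    unfolding cbox_interval
    by (rule integrable_integral[OF integrable_continuous_real[OF continuous_on_subset[OF assms(2)]]]) simp
  from has_integral_affinity[OF this, of m c] assms(1)
  have "((\<lambda>x. f (m * x + c)) has_integral (1 / m) *\<^sub>R integral {m * a + c..m * b + c} f)
      ((\<lambda>x. (1/m) * x + - (c / m)) ` {m * a + c..m * b + c})"
    by (simp add: divide_inverse_commute)
  also have "(\<lambda>x. (1/m) * x + - (c / m)) ` {m * a + c..m * b + c} = {a..b}"
    using assms(1) True by (subst image_affinity_atLeastAtMost) (auto simp: field_simps)
  finally show ?thesis by (rule integral_unique)
next
  case False
  then show ?thesis using assms(1) by simp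
qed

text \<open>
  The reflection \<open>x \<mapsto> pi - x\<close> carries the right half of the circle to the left one.
\<close>
lemma integral_circle_halves:
  fixes f :: "real \<Rightarrow> complex"
  assumes c: "continuous_on UNIV f" and p: "\<And>x. f (x + 2 * pi) = f x"
  shows "integral {-pi..pi} f = integral {-pi/2..pi/2} f + integral {-pi/2..pi/2} (\<lambda>x. f (pi - x))"
proof -
  have int: "f integrable_on {a..b}" for a b
    by (rule integrable_continuous_real[OF continuous_on_subset[OF c]]) simp
  have "integral {-pi/2..pi/2} (\<lambda>x. f (pi - x)) = integral {-pi/2..pi/2} (\<lambda>x. f (pi + x))"
    using Henstock_Kurzweil_Integration.integral_reflect_real[where a = "-pi/2" and b = "pi/2" and f = "\<lambda>x. f (pi + x)"] by (simp del: Henstock_Kurzweil_Integration.integral_reflect_real)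
  also have "\<dots> = integral {-pi/2..pi/2} (\<lambda>x. f (1 * x + pi))" by (simp add: add.commute)
  also have "\<dots> = integral {pi/2..3*pi/2} f" by (subst integral_affine_pos[OF _ c]) auto
  also have "\<dots> = integral {pi/2..pi} f + integral {pi..3*pi/2} f"
    by (rule Henstock_Kurzweil_Integration.integral_combine[symmetric]) (auto intro: int)
  also have "integral {pi..3*pi/2} f = integral {-pi..-pi/2} (\<lambda>x. f (1 * x + 2 * pi))"
    by (subst integral_affine_pos[OF _ c]) auto
  also have "\<dots> = integral {-pi..-pi/2} f" by (simp add: p)
  finally have 1: "integral {-pi/2..pi/2} (\<lambda>x. f (pi - x)) = integral {pi/2..pi} f + integral {-pi..-pi/2} f" .
  have 2: "integral {-pi..-pi/2} f + integral {-pi/2..pi} f = integral {-pi..pi} f"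
    by (rule Henstock_Kurzweil_Integration.integral_combine) (use pi_gt_zero int in \<open>auto simp del: pi_gt_zero\<close>)
  have 3: "integral {-pi/2..pi/2} f + integral {pi/2..pi} f = integral {-pi/2..pi} f"
    by (rule Henstock_Kurzweil_Integration.integral_combine) (use pi_gt_zero int in \<open>auto simp del: pi_gt_zero\<close>)
  show ?thesis unfolding 1 2[symmetric] 3[symmetric] by simp
qed

lemma bessel_half_minus:
  assumes ev: "\<And>x. A (- x) = A x"
  shows "bessel_half A (- n) \<tau> = bessel_half A n \<tau>"
  using Henstock_Kurzweil_Integration.integral_reflect_real[where a = "-pi/2" and b = "pi/2" and f = "\<lambda>x. of_real (A x) * cis (bessel_phase n \<tau> x)"]
  by (simp add: bessel_half_def bessel_phase_def ev del: Henstock_Kurzweil_Integration.integral_reflect_real)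

text \<open>
  Under the reflection of the circle the integrand turns into its complex conjugate up to a unimodular
  constant, so that both halves have the same modulus.
\<close>
lemma bessel_full_le_half:
  fixes n :: int and A :: "real \<Rightarrow> real" and \<sigma> :: real
  assumes A: "continuous_on UNIV A" "\<And>x. A (x + 2 * pi) = A x" "\<And>x. A (pi - x) = \<sigma> * A x" "\<bar>\<sigma>\<bar> = 1"
    and ev: "\<And>x. A (- x) = A x"
  shows "cmod (integral {-pi..pi} (\<lambda>x. of_real (A x) * cis (bessel_phase n \<tau> x))) \<le> 2 * cmod (bessel_half A \<bar>n\<bar> \<tau>)"
proof -
  let ?f = "\<lambda>x. of_real (A x) * cis (bessel_phase n \<tau> x)"
  have c: "continuous_on UNIV ?f"
    unfolding bessel_phase_def
    by (rule continuous_on_mult[OF continuous_on_of_real[OF A(1)] continuous_on_cis]) (intro continuous_intros)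
  have p: "?f (x + 2 * pi) = ?f x" for x
  proof -
    have "bessel_phase n \<tau> (x + 2 * pi) = bessel_phase n \<tau> x + n * (2 * pi)"
      by (simp add: bessel_phase_def distrib_left)
    then have "cis (bessel_phase n \<tau> (x + 2 * pi)) = cis (bessel_phase n \<tau> x) * cis (2 * pi * n)"
      by (simp only: cis_mult mult.commute)
    also have "cis (2 * pi * n) = 1" by (intro cis_multiple_2pi) auto
    finally show ?thesis by (simp add: A(2))
  qed
  have r: "?f (pi - x) = of_real \<sigma> * cis (n * pi) * cnj (?f x)" for x
    by (simp add: A(3) bessel_phase_def cis_cnj cis_mult algebra_simps)
  have "integral {-pi/2..pi/2} (\<lambda>x. ?f (pi - x)) = of_real \<sigma> * cis (n * pi) * cnj (bessel_half A n \<tau>)"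
    unfolding r bessel_half_def by (subst integral_mult_right) (simp add: integral_cnj)
  then have "cmod (integral {-pi..pi} ?f) \<le> cmod (bessel_half A n \<tau>) + cmod (bessel_half A n \<tau>)"
    using integral_circle_halves[of ?f, OF c p] A(4) norm_triangle_ineq[of "bessel_half A n \<tau>" "of_real \<sigma> * cis (n * pi) * cnj (bessel_half A n \<tau>)"]
    by (simp add: norm_mult bessel_half_def)
  also have "bessel_half A n \<tau> = bessel_half A \<bar>n\<bar> \<tau>"
    using bessel_half_minus[of A "real_of_int n" \<tau>, OF ev] by (cases "0 \<le> n") auto
  finally show ?thesis by simp
qed

text \<open>
  Up to the factor \<open>\<i> ^ n\<close> this is the Bessel function \<open>J\<^sub>n(2 t)\<close>, the form in which it appears in
  the kernel of \<open>exp (- \<i> * t * H0)\<close> in one dimension.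
\<close>
definition bessel :: "int \<Rightarrow> real \<Rightarrow> complex" where
  "bessel n t = integral {-1/2..1/2} (\<lambda>x. cis (bessel_phase n (2 * t) (2 * pi * x)))"

definition bessel' :: "int \<Rightarrow> real \<Rightarrow> complex" where
  "bessel' n t = integral {-1/2..1/2} (\<lambda>x. 2 * \<i> * of_real (cos (2 * pi * x)) * cis (bessel_phase n (2 * t) (2 * pi * x)))"

lemma integral_unit_to_circle:
  fixes f :: "real \<Rightarrow> complex"
  assumes "continuous_on UNIV f"
  shows "integral {-1/2..1/2} (\<lambda>x. f (2 * pi * x)) = (1 / (2 * pi)) *\<^sub>R integral {-pi..pi} f"
  using integral_affine_pos[OF _ assms, of "2 * pi" "-1/2" "1/2" 0] by simp

lemma bessel_le_half: "cmod (bessel n t) \<le> cmod (bessel_half (\<lambda>_. 1) \<bar>n\<bar> (2 * t))"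
proof -
  have c: "continuous_on UNIV (\<lambda>x. cis (bessel_phase n (2 * t) x))"
    unfolding bessel_phase_def by (rule continuous_on_cis) (intro continuous_intros)
  have "cmod (bessel n t) = (1 / (2 * pi)) * cmod (integral {-pi..pi} (\<lambda>x. cis (bessel_phase n (2 * t) x)))"
    unfolding bessel_def integral_unit_to_circle[OF c] by simp
  also have "\<dots> \<le> (1 / (2 * pi)) * (2 * cmod (bessel_half (\<lambda>_. 1) \<bar>n\<bar> (2 * t)))"
    using bessel_full_le_half[of "\<lambda>_. 1" 1 n "2 * t"] by (intro mult_left_mono) auto
  also have "\<dots> \<le> 1 * cmod (bessel_half (\<lambda>_. 1) \<bar>n\<bar> (2 * t))"
    using pi_ge_two mult_right_mono[of 1 pi "cmod (bessel_half (\<lambda>_. 1) \<bar>n\<bar> (2 * t))"] by (simp add: field_simps)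
  finally show ?thesis by simp
qed

lemma bessel_airy:
  assumes "0 < t" shows "cmod (bessel n t) \<le> 22 * t powr (-1/3)"
proof -
  have "cmod (bessel n t) \<le> 18 * (2 * t) powr (-1/3)"
    using bessel_le_half[of n t] bessel_half_airy[of "2 * t" "\<bar>n\<bar>"] assms by simp
  also have "\<dots> \<le> 22 * t powr (-1/3)" using assms by (intro mult_mono powr_mono2') auto
  finally show ?thesis .
qed

lemma bessel_far:
  assumes "0 < t" "t \<noteq> \<bar>n\<bar> / 2" shows "cmod (bessel n t) \<le> 22 * (t * \<bar>t - \<bar>n\<bar> / 2\<bar>) powr (-1/4)"
proof -
  have "cmod (bessel n t) \<le> 22 * ((2 * t) * \<bar>2 * t - \<bar>n\<bar>\<bar>) powr (-1/4)"
    using bessel_le_half[of n t] bessel_half_far[of "2 * t" "\<bar>n\<bar>"] assms by simp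
  also have "(2 * t) * \<bar>2 * t - \<bar>n\<bar>\<bar> = 4 * (t * \<bar>t - \<bar>n\<bar> / 2\<bar>)" by (simp add: abs_if)
  also have "22 * \<dots> powr (-1/4) \<le> 22 * (t * \<bar>t - \<bar>n\<bar> / 2\<bar>) powr (-1/4)"
    using assms by (intro mult_left_mono powr_mono2') auto
  finally show ?thesis by simp
qed

lemma bessel_small:
  assumes "0 < t" "t \<le> \<bar>n\<bar> / 4" shows "cmod (bessel n t) \<le> 14 / \<bar>n\<bar>"
  using bessel_le_half[of n t] bessel_half_small[of "2 * t" "\<bar>n\<bar>"] assms by simp

lemma bessel_le_1: "cmod (bessel n t) \<le> 1"
proof -
  have "cmod (bessel n t) \<le> integral {-1/2..1/2} (\<lambda>x::real. 1::real)"
    unfolding bessel_def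
    by (intro integral_norm_bound_integral integrable_continuous_real)
       (auto simp: bessel_phase_def intro!: continuous_intros)
  then show ?thesis by simp
qed

lemma bessel_deriv: "(bessel n has_vector_derivative bessel' n t) (at t)"
proof -
  have "((\<lambda>t. integral (cbox (-1/2) (1/2)) (\<lambda>x. cis (bessel_phase n (2 * t) (2 * pi * x)))) has_vector_derivative
      integral (cbox (-1/2) (1/2)) (\<lambda>x. 2 * \<i> * of_real (cos (2 * pi * x)) * cis (bessel_phase n (2 * t) (2 * pi * x)))) (at t within UNIV)"
  proof (rule leibniz_rule_vector_derivative)
    fix t x :: real
    have "((\<lambda>t. \<i> * complex_of_real (bessel_phase n (2 * t) (2 * pi * x))) has_vector_derivative \<i> * of_real (2 * cos (2 * pi * x))) (at t)"
      unfolding bessel_phase_def by (rule has_vector_derivative_mult_right[OF has_vector_derivative_of_real]) (auto intro!: derivative_eq_intros)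
    from field_vector_diff_chain_within[OF this has_field_derivative_at_within[OF DERIV_exp]]
    show "((\<lambda>t. cis (bessel_phase n (2 * t) (2 * pi * x))) has_vector_derivative
       2 * \<i> * of_real (cos (2 * pi * x)) * cis (bessel_phase n (2 * t) (2 * pi * x))) (at t within UNIV)"
      by (simp add: o_def cis_conv_exp mult_ac)
  next
    fix t :: real
    show "(\<lambda>x. cis (bessel_phase n (2 * t) (2 * pi * x))) integrable_on cbox (- 1 / 2) (1 / 2)"
      unfolding bessel_phase_def by (intro integrable_continuous continuous_intros)
    show "continuous_on (UNIV \<times> cbox (- 1 / 2) (1 / 2)) (\<lambda>(t, x). 2 * \<i> * of_real (cos (2 * pi * x)) * cis (bessel_phase n (2 * t) (2 * pi * x)))"
      unfolding bessel_phase_def split_def by (intro continuous_intros)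
  qed auto
  moreover have "bessel n = (\<lambda>t. integral (cbox (-1/2) (1/2)) (\<lambda>x. cis (bessel_phase n (2 * t) (2 * pi * x))))"
    by (simp add: bessel_def fun_eq_iff)
  ultimately show ?thesis by (simp add: bessel'_def)
qed

lemma bessel_continuous: "continuous_on S (bessel n)"
  by (intro continuous_at_imp_continuous_on ballI has_vector_derivative_continuous[OF bessel_deriv])

lemma bessel'_continuous: "continuous_on UNIV (bessel' n)"
proof -
  have "continuous_on UNIV (\<lambda>t. integral (cbox (-1/2) (1/2)) (\<lambda>x. 2 * \<i> * of_real (cos (2 * pi * x)) * cis (bessel_phase n (2 * t) (2 * pi * x))))"
    by (rule integral_continuous_on_param) (auto simp: bessel_phase_def split_def intro!: continuous_intros)
  then show ?thesis by (simp add: bessel'_def[abs_def])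
qed

text \<open>
  Uniform in \<open>n\<close>, even through the turning point, where the function itself only decays like
  \<open>t powr (-1/3)\<close>. This is the gain exploited in even dimensions.
\<close>
lemma bessel'_bound:
  assumes "0 < t" shows "cmod (bessel' n t) \<le> 32 * t powr (-1/2)"
proof -
  let ?g = "\<lambda>x. 2 * \<i> * (of_real (cos x) * cis (bessel_phase n (2 * t) x))"
  have c: "continuous_on UNIV ?g"
    unfolding bessel_phase_def by (intro continuous_intros)
  have "bessel' n t = (1 / (2 * pi)) *\<^sub>R integral {-pi..pi} ?g"
    unfolding bessel'_def using integral_unit_to_circle[OF c] by (simp add: mult.assoc)
  also have "integral {-pi..pi} ?g = 2 * \<i> * integral {-pi..pi} (\<lambda>x. of_real (cos x) * cis (bessel_phase n (2 * t) x))"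
    by (rule integral_mult_right)
  finally have "cmod (bessel' n t) = (1 / pi) * cmod (integral {-pi..pi} (\<lambda>x. of_real (cos x) * cis (bessel_phase n (2 * t) x)))"
    by (simp add: norm_mult)
  also have "\<dots> \<le> (1 / pi) * (2 * cmod (bessel_half cos \<bar>n\<bar> (2 * t)))"
    by (intro mult_left_mono bessel_full_le_half[where \<sigma> = "-1"]) (auto intro: continuous_intros)
  also have "\<dots> \<le> (1 / pi) * (2 * (16 * (2 * t) powr (-1/2)))"
    using assms by (intro mult_left_mono bessel_half_cos) auto
  also have "\<dots> \<le> 1 * (2 * (16 * t powr (-1/2)))"
    using assms pi_ge_two by (intro mult_mono powr_mono2') (auto simp: field_simps)
  finally show ?thesis by simp
qed

section \<open>Weighted integrals of powers of Bessel functions\<close>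

lemma nn_integral_powr_tail:
  fixes a p :: real
  assumes "0 < a" "1 < p"
  shows "(\<integral>\<^sup>+u. ennreal (indicator {a..} u * u powr (- p)) \<partial>lborel) = ennreal (a powr (1 - p) / (p - 1))"
proof -
  have "(\<integral>\<^sup>+u. ennreal (indicator {a..} u * u powr (- p)) \<partial>lborel)
     = (\<integral>\<^sup>+u. ennreal (u powr (- p)) * indicator {a..} u \<partial>lborel)"
    by (intro nn_integral_cong) (auto simp: indicator_def)
  also have "\<dots> = ennreal (0 - (- (a powr (1 - p) / (p - 1))))"
  proof (rule nn_integral_FTC_atLeast)
    fix x assume "a \<le> x"
    then show "((\<lambda>x. - (x powr (1 - p) / (p - 1))) has_real_derivative x powr (- p)) (at x)"
    proof -
      have "((\<lambda>x. x powr (1 - p)) has_real_derivative (1 - p) * x powr (1 - p - 1)) (at x)"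
        using assms \<open>a \<le> x\<close> by (intro has_real_derivative_powr) auto
      from DERIV_cmult[OF this, of "- (1 / (p - 1))"]
      have "((\<lambda>x. - (x powr (1 - p) / (p - 1))) has_real_derivative - (1 / (p - 1)) * ((1 - p) * x powr (- p))) (at x)"
        by simp
      moreover have "- (1 / (p - 1)) * ((1 - p) * X) = X" for X :: real
        using assms by (simp add: divide_simps) (simp add: algebra_simps)
      ultimately show ?thesis by metis
    qed
  next
    have "((\<lambda>x. x powr (1 - p)) \<longlongrightarrow> 0) at_top"
      using assms by (intro tendsto_neg_powr filterlim_ident) auto
    then have "((\<lambda>x. - (x powr (1 - p) / (p - 1))) \<longlongrightarrow> - (0 / (p - 1))) at_top"
      using assms by (intro tendsto_intros) auto
    then show "((\<lambda>x. - (x powr (1 - p) / (p - 1))) \<longlongrightarrow> 0) at_top" by simp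
  qed auto
  finally show ?thesis by simp
qed

lemma nn_integral_shift_real:
  fixes b :: real
  assumes [measurable]: "f \<in> borel_measurable borel"
  shows "(\<integral>\<^sup>+t. f (t - b) \<partial>lborel) = (\<integral>\<^sup>+u. f u \<partial>lborel)"
  using nn_integral_real_affine[of f 1 "-b"] by (simp add: add.commute)

lemma nn_integral_flip_real:
  fixes b :: real
  assumes [measurable]: "f \<in> borel_measurable borel"
  shows "(\<integral>\<^sup>+t. f (b - t) \<partial>lborel) = (\<integral>\<^sup>+u. f u \<partial>lborel)"
  using nn_integral_real_affine[of f "-1" b] by simp

lemma nn_integral_inverse_Icc:
  fixes M :: real
  assumes "1 \<le> M"
  shows "(\<integral>\<^sup>+u. ennreal (indicator {1..M} u * (1 / u)) \<partial>lborel) = ennreal (ln M)"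
proof -
  have "(\<integral>\<^sup>+u. ennreal (indicator {1..M} u * (1 / u)) \<partial>lborel)
     = (\<integral>\<^sup>+u. ennreal (1 / u) * indicator {1..M} u \<partial>lborel)"
    by (intro nn_integral_cong) (auto simp: indicator_def)
  also have "\<dots> = ennreal (ln M - ln 1)"
    by (rule nn_integral_FTC_Icc) (use assms in \<open>auto intro!: derivative_eq_intros simp: divide_inverse\<close>)
  finally show ?thesis by simp
qed

lemma ennreal_linear:
  assumes "0 \<le> X" "0 \<le> i" "0 \<le> K" "0 \<le> a" "0 \<le> b"
  shows "ennreal (X * i + K * (a + b)) = ennreal X * ennreal i + ennreal K * (ennreal a + ennreal b)"
  using assms by (simp add: ennreal_mult)

text \<open>
  The size of \<open>\<bar>J\<^sub>n(2 t)\<bar>\<close> as a function of \<open>t\<close>, with turning point \<open>N = \<bar>n\<bar> / 2\<close>. Only these bounds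
  enter the weighted integrals, and the constant \<open>c\<close> serves every order \<open>n\<close>.
\<close>
locale airy_profile =
  fixes g :: "real \<Rightarrow> real" and N c :: real
  assumes g_meas [measurable]: "g \<in> borel_measurable borel"
    and g0: "\<And>t. 0 \<le> g t" and g1: "\<And>t. g t \<le> 1"
    and N0: "0 \<le> N" and c1: "1 \<le> c"
    and airy: "\<And>t. 0 < t \<Longrightarrow> g t \<le> c * t powr (-1/3)"
    and far: "\<And>t. 0 < t \<Longrightarrow> t \<noteq> N \<Longrightarrow> g t \<le> c * (t * \<bar>t - N\<bar>) powr (-1/4)"
    and small: "\<And>t. 0 < t \<Longrightarrow> t \<le> N / 2 \<Longrightarrow> g t \<le> c / N"
begin

text \<open>
  Beyond \<open>2 * N\<close> the distance \<open>\<bar>t - N\<bar>\<close> is comparable with \<open>t\<close>; before \<open>N / 2\<close> the function is at most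
  \<open>c / N \<le> c / t\<close>. Either way it decays like a Bessel function of fixed order.
\<close>
lemma outside:
  assumes "1 \<le> t" "t \<le> N / 2 \<or> 2 * N \<le> t"
  shows "g t \<le> 2 * c * t powr (-1/2)"
proof (cases "t \<le> N / 2")
  case True
  have "g t \<le> c / N" using small[of t] assms True by simp
  also have "\<dots> \<le> c / t" using assms True c1 by (intro divide_left_mono) auto
  also have "\<dots> = c * t powr (-1)" using assms by (simp add: powr_minus_divide)
  also have "\<dots> \<le> 2 * c * t powr (-1/2)" using assms c1 by (intro mult_mono powr_mono) auto
  finally show ?thesis .
next
  case False
  then have t: "2 * N \<le> t" using assms by auto
  have "g t \<le> c * (t * \<bar>t - N\<bar>) powr (-1/4)" using far[of t] assms t N0 by auto
  also have "\<dots> \<le> c * (t * (t / 2)) powr (-1/4)"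
    using assms t c1 by (intro mult_left_mono powr_mono2') auto
  also have "(t * (t / 2)) powr (-1/4) = (1/2) powr (-1/4) * (t powr (-1/4) * t powr (-1/4))"
    using assms by (simp add: powr_mult[symmetric])
  also have "t powr (-1/4) * t powr (-1/4) = t powr (-1/2)"
    by (simp flip: powr_add)
  finally have "g t \<le> c * ((1/2) powr (-1/4) * t powr (-1/2))" .
  also have "(1/2) powr (-1/4) \<le> (1/2 :: real) powr (-1)"
    by (rule powr_mono') auto
  then have "c * ((1/2) powr (-1/4) * t powr (-1/2)) \<le> c * (2 * t powr (-1/2))"
    using c1 by (intro mult_left_mono mult_right_mono) (auto simp: powr_neg_one)
  finally show ?thesis by simp
qed

lemma outside_pow:
  assumes "1 \<le> t" "t \<le> N / 2 \<or> 2 * N \<le> t"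
  shows "g t ^ k \<le> (2 * c) ^ k * t powr (- (real k / 2))"
proof -
  have "g t ^ k \<le> (2 * c * t powr (-1/2)) ^ k" using outside[OF assms] g0 by (intro power_mono) auto
  also have "\<dots> = (2 * c) ^ k * t powr (- (real k / 2))"
    using assms by (simp add: power_mult_distrib powr_power mult.commute)
  finally show ?thesis .
qed

lemma airy_pow:
  assumes "0 < t" shows "g t ^ k \<le> c ^ k * t powr (- (real k / 3))"
proof -
  have "g t ^ k \<le> (c * t powr (-1/3)) ^ k" using airy[OF assms] g0 by (intro power_mono) auto
  also have "\<dots> = c ^ k * t powr (- (real k / 3))"
    using assms by (simp add: power_mult_distrib powr_power mult.commute)
  finally show ?thesis .
qed

lemma far_pow:
  assumes "0 < t" "t \<noteq> N" shows "g t ^ k \<le> c ^ k * (t * \<bar>t - N\<bar>) powr (- (real k / 4))"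
proof -
  have "g t ^ k \<le> (c * (t * \<bar>t - N\<bar>) powr (-1/4)) ^ k" using far[OF assms] g0 by (intro power_mono) auto
  also have "\<dots> = c ^ k * (t * \<bar>t - N\<bar>) powr (- (real k / 4))"
    using assms by (simp add: power_mult_distrib powr_power mult.commute)
  finally show ?thesis .
qed

text \<open>
  Within \<open>N powr (1/3)\<close> of the turning point the Airy bound is the better one, further out the other. For
  the fifth power the exponent \<open>5/4 > 1\<close> makes the tails integrable.
\<close>
lemma near_pointwise5:
  assumes t: "1 \<le> t" "N / 2 \<le> t" "t \<le> 2 * N"
  defines "\<rho> \<equiv> N powr (1/3)"
  shows "t powr (4/3) * g t ^ 5 \<le> 2 * c ^ 5 / \<rho> * indicator {N - \<rho>..N + \<rho>} t
     + 2 * c ^ 5 * N powr (1/12) * (indicator {\<rho>..} (t - N) * (t - N) powr (-(5/4)) + indicator {\<rho>..} (N - t) * (N - t) powr (-(5/4)))"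
proof -
  have N: "0 < N" using t by simp
  then have \<rho>: "0 < \<rho>" by (simp add: \<rho>_def)
  show ?thesis
  proof (cases "\<bar>t - N\<bar> \<le> \<rho>")
    case True
    have "t powr (4/3) * g t ^ 5 \<le> t powr (4/3) * (c ^ 5 * t powr (- 5 / 3))"
      using airy_pow[of t 5] t by (intro mult_left_mono) auto
    also have "\<dots> = c ^ 5 * t powr (-1/3)" by (simp flip: powr_add)
    also have "\<dots> \<le> c ^ 5 * (N / 2) powr (-1/3)" using t N c1 by (intro mult_left_mono powr_mono2') auto
    also have "(N / 2) powr (-1/3) = (1/2) powr (-1/3) * N powr (-1/3)" using N by (simp add: powr_mult[symmetric])
    also have "\<dots> \<le> (1/2 :: real) powr (-1) * N powr (-1/3)" by (intro mult_right_mono powr_mono') auto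
    also have "\<dots> = 2 / \<rho>" using powr_minus_divide[of N "1/3"] by (simp add: \<rho>_def powr_neg_one)
    finally have "t powr (4/3) * g t ^ 5 \<le> c ^ 5 * (2 / \<rho>)" using c1 by (simp add: mult_left_mono)
    then show ?thesis using True c1 \<rho>
      by (intro order_trans[OF _ add_increasing2]) (auto simp: indicator_def abs_le_iff mult.commute)
  next
    case False
    then have tN: "t \<noteq> N" using \<rho> by auto
    have "t powr (4/3) * g t ^ 5 \<le> t powr (4/3) * (c ^ 5 * (t * \<bar>t - N\<bar>) powr (- 5 / 4))"
      using far_pow[of t 5] t tN by (intro mult_left_mono) auto
    also have "\<dots> = c ^ 5 * (t powr (4/3) * t powr (- 5 / 4)) * \<bar>t - N\<bar> powr (- 5 / 4)"
      using t by (simp add: powr_mult)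
    also have "t powr (4/3) * t powr (- 5 / 4) = t powr (1/12)" by (simp flip: powr_add)
    also have "t powr (1/12) \<le> (2 * N) powr (1/12)" using t by (intro powr_mono2) auto
    also have "(2 * N) powr (1/12) = 2 powr (1/12) * N powr (1/12)" using N by (simp add: powr_mult)
    also have "\<dots> \<le> 2 powr 1 * N powr (1/12)" by (intro mult_right_mono powr_mono) auto
    finally have *: "t powr (4/3) * g t ^ 5 \<le> 2 * c ^ 5 * N powr (1/12) * \<bar>t - N\<bar> powr (- 5 / 4)"
      using c1 by (simp add: mult_left_mono mult_right_mono mult.assoc)
    show ?thesis
    proof (cases "N < t")
      case True
      then show ?thesis using * False c1 \<rho> by (auto simp: indicator_def)
    next
      case 2: False
      then show ?thesis using * False c1 \<rho> by (auto simp: indicator_def)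
    qed
  qed
qed

text \<open>
  The window of length \<open>2 * \<rho>\<close> contributes \<open>(1 / \<rho>) * \<rho>\<close> and the tails
  \<open>N powr (1/12) * \<rho> powr (-1/4)\<close>; both are of order one for \<open>\<rho> = N powr (1/3)\<close>. Outside,
  \<open>t powr (4/3 - 5/2)\<close> is integrable at infinity.
\<close>
lemma integral_fifth_power:
  "(\<integral>\<^sup>+t. ennreal (indicator {0<..} t * (t powr (4/3) * g t ^ 5)) \<partial>lborel) \<le> ennreal (1 + 212 * c ^ 5)"
proof -
  define \<rho> where "\<rho> = N powr (1/3)"
  define W where "W = (\<lambda>t. 2 * c ^ 5 / \<rho> * indicator {N - \<rho>..N + \<rho>} t
     + 2 * c ^ 5 * N powr (1/12) * (indicator {\<rho>..} (t - N) * (t - N) powr (-(5/4)) + indicator {\<rho>..} (N - t) * (N - t) powr (-(5/4))))"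
  have W0: "0 \<le> W t" for t using c1 by (auto simp: W_def \<rho>_def)
  have pw: "indicator {0<..} t * (t powr (4/3) * g t ^ 5)
      \<le> indicator {0..1} t + (2 * c) ^ 5 * (indicator {1..} t * t powr (-(7/6))) + W t" for t
  proof -
    consider "t \<le> 0" | "0 < t" "t \<le> 1" | "1 < t" "t \<le> N / 2 \<or> 2 * N \<le> t" | "1 < t" "N / 2 \<le> t" "t \<le> 2 * N" by linarith
    then show ?thesis
    proof cases
      case 1 then show ?thesis using W0[of t] c1 by (auto simp: indicator_def)
    next
      case 2
      have "t powr (4/3) * g t ^ 5 \<le> 1 * 1"
        using 2 g0 g1 by (intro mult_mono power_le_one powr_le1) auto
      moreover have "0 \<le> (2 * c) ^ 5 * (indicator {1..} t * t powr (-(7/6)))" using c1 by auto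
      moreover have "indicator {0<..} t = (1::real)" "indicator {0..1} t = (1::real)" using 2 by auto
      ultimately show ?thesis using W0[of t] by (simp only:)
    next
      case 3
      have "t powr (4/3) * g t ^ 5 \<le> t powr (4/3) * ((2 * c) ^ 5 * t powr (- 5 / 2))"
        using outside_pow[of t 5] 3 by (intro mult_left_mono) auto
      also have "\<dots> = (2 * c) ^ 5 * t powr (-(7/6))" by (simp flip: powr_add)
      finally show ?thesis using 3 W0[of t] by (simp add: power_mult_distrib)
    next
      case 4
      have "t powr (4/3) * g t ^ 5 \<le> W t" unfolding W_def \<rho>_def using near_pointwise5[of t] 4 by auto
      moreover have "0 \<le> (2 * c) ^ 5 * (indicator {1..} t * t powr (-(7/6)))" using c1 by auto
      ultimately show ?thesis using 4 by (simp add: indicator_def)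
    qed
  qed
  have Wint: "(\<integral>\<^sup>+t. ennreal (W t) \<partial>lborel) \<le> ennreal (20 * c ^ 5)"
  proof (cases "N = 0")
    case True then show ?thesis using c1 by (simp add: W_def \<rho>_def)
  next
    case False
    then have N: "0 < N" and \<rho>: "0 < \<rho>" using N0 by (auto simp: \<rho>_def)
    define h where "h = (\<lambda>u. ennreal (indicator {\<rho>..} u * u powr (-(5/4))))"
    have [measurable]: "h \<in> borel_measurable borel" unfolding h_def by measurable
    have h: "(\<integral>\<^sup>+u. h u \<partial>lborel) = ennreal (4 * \<rho> powr (-1/4))"
      unfolding h_def using nn_integral_powr_tail[OF \<rho>, of "5/4"] by (simp add: mult.commute)
    have "(\<integral>\<^sup>+t. ennreal (W t) \<partial>lborel) = (\<integral>\<^sup>+t. ennreal (2 * c ^ 5 / \<rho>) * indicator {N - \<rho>..N + \<rho>} t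
       + ennreal (2 * c ^ 5 * N powr (1/12)) * (h (t - N) + h (N - t)) \<partial>lborel)"
      unfolding W_def h_def using c1 \<rho>
      by (intro nn_integral_cong) (subst ennreal_linear, auto simp: ennreal_indicator)
    also have "\<dots> = ennreal (2 * c ^ 5 / \<rho>) * ennreal (2 * \<rho>) + ennreal (2 * c ^ 5 * N powr (1/12)) *
        (ennreal (4 * \<rho> powr (-1/4)) + ennreal (4 * \<rho> powr (-1/4)))"
      using \<rho> by (simp add: nn_integral_add nn_integral_cmult nn_integral_cmult_indicator
          nn_integral_shift_real[of h N] nn_integral_flip_real[of h N] h)
    also have "\<dots> = ennreal (2 * c ^ 5 / \<rho> * (2 * \<rho>) + 2 * c ^ 5 * N powr (1/12) * (8 * \<rho> powr (-1/4)))"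
      using \<rho> c1 by (simp add: ennreal_mult'[symmetric] ennreal_plus[symmetric] del: ennreal_plus)
    also have "2 * c ^ 5 / \<rho> * (2 * \<rho>) + 2 * c ^ 5 * N powr (1/12) * (8 * \<rho> powr (-1/4)) = 20 * c ^ 5"
    proof -
      have "N powr (1/12) * \<rho> powr (-1/4) = 1"
        using N by (simp add: \<rho>_def powr_powr flip: powr_add)
      then show ?thesis using \<rho> by (simp add: mult.assoc)
    qed
    finally show ?thesis by simp
  qed
  have "(\<integral>\<^sup>+t. ennreal (indicator {0<..} t * (t powr (4/3) * g t ^ 5)) \<partial>lborel)
     \<le> (\<integral>\<^sup>+t. indicator {0..1} t + (ennreal ((2 * c) ^ 5) * ennreal (indicator {1..} t * t powr (-(7/6)))) + ennreal (W t) \<partial>lborel)"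
  proof (intro nn_integral_mono)
    fix t :: real
    have "ennreal (indicator {0<..} t * (t powr (4/3) * g t ^ 5)) \<le> ennreal (indicator {0..1} t + (2 * c) ^ 5 * (indicator {1..} t * t powr (-(7/6))) + W t)"
      by (rule ennreal_leI[OF pw])
    also have "\<dots> = indicator {0..1} t + (ennreal ((2 * c) ^ 5) * ennreal (indicator {1..} t * t powr (-(7/6)))) + ennreal (W t)"
      using W0[of t] c1 by (simp add: ennreal_plus ennreal_mult ennreal_indicator)
    finally show "ennreal (indicator {0<..} t * (t powr (4/3) * g t ^ 5)) \<le> \<dots>" .
  qed
  also have "\<dots> = 1 + ennreal ((2 * c) ^ 5) * ennreal 6 + (\<integral>\<^sup>+t. ennreal (W t) \<partial>lborel)"
    using nn_integral_powr_tail[of 1 "7/6"] by (simp add: nn_integral_add nn_integral_cmult W_def)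
  also have "\<dots> \<le> 1 + ennreal ((2 * c) ^ 5) * ennreal 6 + ennreal (20 * c ^ 5)"
    by (intro add_left_mono Wint)
  also have "\<dots> = ennreal (1 + 212 * c ^ 5)"
  proof -
    have "1 + ennreal X * ennreal 6 + ennreal Y = ennreal (1 + X * 6 + Y)" if "0 \<le> X" "0 \<le> Y" for X Y
      using that by (simp add: ennreal_mult)
    from this[of "(2 * c) ^ 5" "20 * c ^ 5"] show ?thesis using c1 by (simp add: power_mult_distrib)
  qed
  finally show ?thesis .
qed

text \<open>
  Each factor beyond the fifth is bounded by \<open>t powr (-1/3)\<close>, which is compensated by the increase of the weight.
\<close>
lemma integral_high_power:
  assumes "5 \<le> k"
  shows "(\<integral>\<^sup>+t. ennreal (indicator {0<..} t * (t powr ((real k - 1) / 3) * g t ^ k)) \<partial>lborel)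
    \<le> ennreal (c ^ (k - 5) * (1 + 212 * c ^ 5))"
proof -
  have pw: "indicator {0<..} t * (t powr ((real k - 1) / 3) * g t ^ k) \<le> c ^ (k - 5) * (indicator {0<..} t * (t powr (4/3) * g t ^ 5))" for t
  proof (cases "0 < t")
    case True
    have "g t ^ k = g t ^ 5 * g t ^ (k - 5)" using assms by (simp flip: power_add)
    then have "t powr ((real k - 1) / 3) * g t ^ k = t powr ((real k - 1) / 3) * g t ^ 5 * g t ^ (k - 5)" by simp
    also have "\<dots> \<le> t powr ((real k - 1) / 3) * g t ^ 5 * (c ^ (k - 5) * t powr (- real (k - 5) / 3))"
      using airy_pow[OF True, of "k - 5"] g0 by (intro mult_left_mono) auto
    also have "\<dots> = c ^ (k - 5) * ((t powr ((real k - 1) / 3) * t powr (- real (k - 5) / 3)) * g t ^ 5)" by simp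
    also have "t powr ((real k - 1) / 3) * t powr (- real (k - 5) / 3) = t powr (4/3)"
      using assms by (simp add: powr_add[symmetric] field_simps of_nat_diff)
    finally show ?thesis using True by simp
  qed auto
  have "(\<integral>\<^sup>+t. ennreal (indicator {0<..} t * (t powr ((real k - 1) / 3) * g t ^ k)) \<partial>lborel)
     \<le> (\<integral>\<^sup>+t. ennreal (c ^ (k - 5)) * ennreal (indicator {0<..} t * (t powr (4/3) * g t ^ 5)) \<partial>lborel)"
    using c1 by (intro nn_integral_mono) (simp add: ennreal_mult'[symmetric] ennreal_leI pw)
  also have "\<dots> = ennreal (c ^ (k - 5)) * (\<integral>\<^sup>+t. ennreal (indicator {0<..} t * (t powr (4/3) * g t ^ 5)) \<partial>lborel)"
    by (rule nn_integral_cmult) simp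
  also have "\<dots> \<le> ennreal (c ^ (k - 5)) * ennreal (1 + 212 * c ^ 5)"
    by (intro mult_left_mono integral_fifth_power) auto
  also have "\<dots> = ennreal (c ^ (k - 5) * (1 + 212 * c ^ 5))" using c1 by (simp add: ennreal_mult)
  finally show ?thesis .
qed

text \<open>
  For the fourth power the tails are \<open>1 / \<bar>t - N\<bar>\<close>, so that the width of the inner window
  changes the resulting logarithm at most by a constant factor; it is taken of order one.
\<close>
lemma near_pointwise4:
  assumes t: "1 \<le> t" "N / 2 \<le> t" "t \<le> 2 * N"
  defines "M \<equiv> max 1 N"
  shows "t * g t ^ 4 \<le> c ^ 4 * (indicator {N - 1..N + 1} t
     + (indicator {1..M} (t - N) * (1 / (t - N)) + indicator {1..M} (N - t) * (1 / (N - t))))"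
proof (cases "\<bar>t - N\<bar> \<le> 1")
  case True
  have "t * g t ^ 4 \<le> t * (c ^ 4 * t powr (- (4 / 3)))"
    using airy_pow[of t 4] t by (intro mult_left_mono) auto
  also have "\<dots> = c ^ 4 * (t powr 1 * t powr (- (4 / 3)))" using t by simp
  also have "t powr 1 * t powr (- (4 / 3)) = t powr (-1/3)" by (subst powr_add[symmetric]) simp
  also have "t powr (-1/3) \<le> t powr 0" using t by (intro powr_mono) auto
  finally have "t * g t ^ 4 \<le> c ^ 4 * 1" using c1 t by (simp add: mult_left_mono)
  also have "\<dots> \<le> c ^ 4 * (indicator {N - 1..N + 1} t
     + (indicator {1..M} (t - N) * (1 / (t - N)) + indicator {1..M} (N - t) * (1 / (N - t))))"
    using True c1 by (intro mult_left_mono) (auto simp: indicator_def abs_le_iff)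
  finally show ?thesis .
next
  case False
  then have tN: "t \<noteq> N" by auto
  have "t * g t ^ 4 \<le> t * (c ^ 4 * (t * \<bar>t - N\<bar>) powr (- (4 / 4)))"
    using far_pow[of t 4] t tN by (intro mult_left_mono) auto
  also have "\<dots> = c ^ 4 * (1 / \<bar>t - N\<bar>)" using t tN by (simp add: powr_neg_one)
  also have "\<dots> \<le> c ^ 4 * (indicator {N - 1..N + 1} t
     + (indicator {1..M} (t - N) * (1 / (t - N)) + indicator {1..M} (N - t) * (1 / (N - t))))"
    using False t c1 by (intro mult_left_mono) (auto simp: indicator_def M_def abs_if)
  finally show ?thesis .
qed

lemma near_integral4:
  defines "M \<equiv> max 1 N"
  shows "(\<integral>\<^sup>+t. ennreal (c ^ 4 * (indicator {N - 1..N + 1} t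
     + (indicator {1..M} (t - N) * (1 / (t - N)) + indicator {1..M} (N - t) * (1 / (N - t))))) \<partial>lborel)
     = ennreal (c ^ 4 * (2 + 2 * ln M))"
proof -
  define h where "h = (\<lambda>u. ennreal (indicator {1..M} u * (1 / u)))"
  have [measurable]: "h \<in> borel_measurable borel" unfolding h_def by measurable
  have M: "1 \<le> M" by (simp add: M_def)
  have h: "(\<integral>\<^sup>+u. h u \<partial>lborel) = ennreal (ln M)" unfolding h_def by (rule nn_integral_inverse_Icc[OF M])
  have ind0: "0 \<le> indicator {1..M} u * (1 / u)" for u :: real by (auto simp: indicator_def)
  have "(\<integral>\<^sup>+t. ennreal (c ^ 4 * (indicator {N - 1..N + 1} t
     + (indicator {1..M} (t - N) * (1 / (t - N)) + indicator {1..M} (N - t) * (1 / (N - t))))) \<partial>lborel)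
     = (\<integral>\<^sup>+t. ennreal (c ^ 4) * (indicator {N - 1..N + 1} t + (h (t - N) + h (N - t))) \<partial>lborel)"
  proof (intro nn_integral_cong)
    fix t
    have "ennreal (c ^ 4 * (i + (a + b))) = ennreal (c ^ 4) * (ennreal i + (ennreal a + ennreal b))" if "0 \<le> i" "0 \<le> a" "0 \<le> b" for i a b
      using that c1 by (simp add: ennreal_mult)
    from this[of "indicator {N - 1..N + 1} t", OF _ ind0 ind0]
    show "ennreal (c ^ 4 * (indicator {N - 1..N + 1} t
      + (indicator {1..M} (t - N) * (1 / (t - N)) + indicator {1..M} (N - t) * (1 / (N - t)))))
      = ennreal (c ^ 4) * (indicator {N - 1..N + 1} t + (h (t - N) + h (N - t)))"
      by (simp only: h_def ennreal_indicator) simp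
  qed
  also have "\<dots> = ennreal (c ^ 4) * (2 + (ennreal (ln M) + ennreal (ln M)))"
    by (simp add: nn_integral_add nn_integral_cmult nn_integral_shift_real[of h N] nn_integral_flip_real[of h N] h
        del: ennreal_plus)
  also have "\<dots> = ennreal (c ^ 4 * (2 + 2 * ln M))"
  proof -
    have "2 + (ennreal (ln M) + ennreal (ln M)) = ennreal (2 + 2 * ln M)"
      using M by (simp add: ennreal_plus[symmetric] ennreal_numeral[symmetric] del: ennreal_plus ennreal_numeral)
    then show ?thesis using c1 M by (simp add: ennreal_mult)
  qed
  finally show ?thesis .
qed

lemma near_nonneg: "0 \<le> c ^ 4 * (indicator {N - 1..N + 1} t
     + (indicator {1..M} (t - N) * (1 / (t - N)) + indicator {1..M} (N - t) * (1 / (N - t))))"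
  using c1 by (auto simp: indicator_def)

text \<open>
  The neighbourhood of the turning point contributes \<open>M powr (l - 2) * ln M\<close>, which is bounded in
  \<open>M\<close> because \<open>l < 2\<close>; the same condition gives convergence at infinity.
\<close>
lemma integral4_subcritical:
  assumes l: "1 < l" "l < 2"
  shows "(\<integral>\<^sup>+t. ennreal (indicator {0<..} t * (t powr (l - 1) * g t ^ 4)) \<partial>lborel)
    \<le> ennreal (1 + 16 * c ^ 4 / (2 - l) + 2 * c ^ 4 * (2 + 2 / (2 - l)))"
proof -
  define M where "M = max 1 N"
  define W where "W = (\<lambda>t. c ^ 4 * (indicator {N - 1..N + 1} t
     + (indicator {1..M} (t - N) * (1 / (t - N)) + indicator {1..M} (N - t) * (1 / (N - t)))))"
  have W0: "0 \<le> W t" for t using near_nonneg by (simp add: W_def)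
  have M: "1 \<le> M" by (simp add: M_def)
  define a where "a = 2 - l"
  have a: "0 < a" "a < 1" using l by (auto simp: a_def)
  have I0: "0 \<le> 16 * c ^ 4 * (indicator {1..} t * t powr (-(3 - l)))" for t :: real using c1 by auto
  have J0: "0 \<le> 2 * M powr (- a) * W t" for t using W0 by simp
  have pw: "indicator {0<..} t * (t powr (l - 1) * g t ^ 4)
      \<le> indicator {0..1} t + 16 * c ^ 4 * (indicator {1..} t * t powr (-(3 - l))) + 2 * M powr (- a) * W t" for t
  proof -
    consider "t \<le> 0" | "0 < t" "t \<le> 1" | "1 < t" "t \<le> N / 2 \<or> 2 * N \<le> t" | "1 < t" "N / 2 \<le> t" "t \<le> 2 * N" by linarith
    then show ?thesis
    proof cases
      case 1
      then have "indicator {0<..} t = (0::real)" by auto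
      then show ?thesis using I0[of t] J0[of t] by (simp add: add_nonneg_nonneg)
    next
      case 2
      have "t powr (l - 1) * g t ^ 4 \<le> 1 * 1"
        using 2 g0 g1 l by (intro mult_mono power_le_one powr_le1) auto
      moreover have "indicator {0<..} t = (1::real)" "indicator {0..1} t = (1::real)" using 2 by auto
      ultimately show ?thesis using I0[of t] J0[of t] by (simp only:)
    next
      case 3
      have "t powr (l - 1) * g t ^ 4 \<le> t powr (l - 1) * ((2 * c) ^ 4 * t powr (- (4 / 2)))"
        using outside_pow[of t 4] 3 by (intro mult_left_mono) auto
      also have "\<dots> = 16 * c ^ 4 * t powr (-(3 - l))" by (simp add: power_mult_distrib flip: powr_add)
      finally have "t powr (l - 1) * g t ^ 4 \<le> 16 * c ^ 4 * t powr (-(3 - l))" .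
      moreover have "indicator {0<..} t = (1::real)" "indicator {1..} t = (1::real)" "0 \<le> (indicator {0..1} t::real)" using 3 by auto
      ultimately show ?thesis using J0[of t] by (simp only: mult_1; linarith?)
    next
      case 4
      have "t powr (l - 1) * g t ^ 4 = t powr (- a) * (t * g t ^ 4)"
        using 4 powr_add[of t "l - 2" 1] by (simp add: a_def)
      also have "\<dots> \<le> (M / 2) powr (- a) * W t"
      proof (rule mult_mono)
        have "M / 2 \<le> t" using 4 by (simp add: M_def)
        then show "t powr (- a) \<le> (M / 2) powr (- a)" using M a by (intro powr_mono2') auto
        show "t * g t ^ 4 \<le> W t" unfolding W_def M_def by (rule near_pointwise4) (use 4 in auto)
      qed (use g0 4 in auto)
      also have "(M / 2) powr (- a) = (1 / 2) powr (- a) * M powr (- a)"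
        using M by (simp add: powr_mult[symmetric])
      also have "\<dots> * W t \<le> (1/2) powr (- 1) * M powr (- a) * W t"
        using a W0 by (intro mult_right_mono powr_mono') auto
      finally have "t powr (l - 1) * g t ^ 4 \<le> 2 * M powr (- a) * W t" by (simp add: powr_neg_one)
      moreover have "indicator {0<..} t = (1::real)" "0 \<le> (indicator {0..1} t::real)" using 4 by auto
      ultimately show ?thesis using I0[of t] by (simp only: mult_1; linarith?)
    qed
  qed
  have "(\<integral>\<^sup>+t. ennreal (indicator {0<..} t * (t powr (l - 1) * g t ^ 4)) \<partial>lborel)
     \<le> (\<integral>\<^sup>+t. indicator {0..1} t + (ennreal (16 * c ^ 4) * ennreal (indicator {1..} t * t powr (-(3 - l)))) + ennreal (2 * M powr (- a)) * ennreal (W t) \<partial>lborel)"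
  proof (intro nn_integral_mono)
    fix t :: real
    have "ennreal (indicator {0<..} t * (t powr (l - 1) * g t ^ 4)) \<le> ennreal (indicator {0..1} t + 16 * c ^ 4 * (indicator {1..} t * t powr (-(3 - l))) + 2 * M powr (- a) * W t)"
      by (rule ennreal_leI[OF pw])
    also have "\<dots> = ennreal (indicator {0..1} t) + ennreal (16 * c ^ 4 * (indicator {1..} t * t powr (-(3 - l)))) + ennreal (2 * M powr (- a) * W t)"
      using I0 J0 by (subst ennreal_plus; (subst ennreal_plus)?) auto
    also have "\<dots> = indicator {0..1} t + (ennreal (16 * c ^ 4) * ennreal (indicator {1..} t * t powr (-(3 - l)))) + ennreal (2 * M powr (- a)) * ennreal (W t)"
      using c1 by (subst (1 2) ennreal_mult) (auto simp: W0 ennreal_indicator)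
    finally show "ennreal (indicator {0<..} t * (t powr (l - 1) * g t ^ 4)) \<le> \<dots>" .
  qed
  also have "\<dots> = 1 + ennreal (16 * c ^ 4) * ennreal (1 / (2 - l)) + ennreal (2 * M powr (- a)) * (\<integral>\<^sup>+t. ennreal (W t) \<partial>lborel)"
    using nn_integral_powr_tail[of 1 "3 - l"] l by (simp add: nn_integral_add nn_integral_cmult W_def)
  also have "(\<integral>\<^sup>+t. ennreal (W t) \<partial>lborel) = ennreal (c ^ 4 * (2 + 2 * ln M))"
    using near_integral4 unfolding W_def M_def .
  also have "1 + ennreal (16 * c ^ 4) * ennreal (1 / (2 - l)) + ennreal (2 * M powr (- a)) * ennreal (c ^ 4 * (2 + 2 * ln M))
     = ennreal (1 + 16 * c ^ 4 * (1 / (2 - l)) + 2 * M powr (- a) * (c ^ 4 * (2 + 2 * ln M)))"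
  proof -
    have "1 + ennreal X * ennreal P + ennreal Q * ennreal R = ennreal (1 + X * P + Q * R)"
      if "0 \<le> X" "0 \<le> P" "0 \<le> Q" "0 \<le> R" for X P Q R
      using that by (simp add: ennreal_mult)
    then show ?thesis using c1 M l by simp
  qed
  also have "\<dots> \<le> ennreal (1 + 16 * c ^ 4 / (2 - l) + 2 * c ^ 4 * (2 + 2 / (2 - l)))"
  proof (rule ennreal_leI)
    have "M powr (- a) * ln M \<le> M powr (- a) * (M powr a / a)"
      using ln_powr_bound[OF M a(1)] by (intro mult_left_mono) auto
    also have "\<dots> = 1 / a" using M by (simp add: powr_minus field_simps)
    finally have 1: "M powr (- a) * ln M \<le> 1 / a" .
    have 2: "M powr (- a) \<le> 1" using M a by (simp add: powr_le1 powr_minus_divide ge_one_powr_ge_zero)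
    have "M powr (- a) * (2 + 2 * ln M) = 2 * M powr (- a) + 2 * (M powr (- a) * ln M)" by (simp add: algebra_simps)
    also have "\<dots> \<le> 2 * 1 + 2 * (1 / a)" using 1 2 by linarith
    finally have "2 * c ^ 4 * (M powr (- a) * (2 + 2 * ln M)) \<le> 2 * c ^ 4 * (2 + 2 / a)"
      using c1 by (intro mult_left_mono) auto
    then show "1 + 16 * c ^ 4 * (1 / (2 - l)) + 2 * M powr (- a) * (c ^ 4 * (2 + 2 * ln M))
      \<le> 1 + 16 * c ^ 4 / (2 - l) + 2 * c ^ 4 * (2 + 2 / (2 - l))"
      by (simp add: a_def mult_ac)
  qed
  finally show ?thesis .
qed

text \<open>
  The damping restricts the integral to \<open>t \<le> 1 / e\<close>, essentially. Hence both logarithms, the one at infinity and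
  \<open>exp (- e * N / 2) * ln N\<close> from the turning point, are at most of order \<open>ln (2 + 1 / e)\<close>.
\<close>
lemma integral4_critical:
  assumes e: "0 < e"
  shows "(\<integral>\<^sup>+t. ennreal (indicator {0<..} t * (t * exp (- e * t) * g t ^ 4)) \<partial>lborel)
    \<le> ennreal (60 * c ^ 4 * ln (2 + 1 / e))"
proof -
  define M where "M = max 1 N"
  define T where "T = max 1 (1 / e)"
  define W where "W = (\<lambda>t. c ^ 4 * (indicator {N - 1..N + 1} t
     + (indicator {1..M} (t - N) * (1 / (t - N)) + indicator {1..M} (N - t) * (1 / (N - t)))))"
  define L where "L = ln (2 + 1 / e)"
  have W0: "0 \<le> W t" for t using near_nonneg by (simp add: W_def)
  have M: "1 \<le> M" and T: "1 \<le> T" by (simp_all add: M_def T_def)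
  define E where "E = exp (- (e * N / 2))"
  have E: "0 < E" "E \<le> 1" using e N0 by (auto simp: E_def)
  define I1 where "I1 = (\<lambda>t::real. indicator {1..T} t * (1 / t))"
  define I2 where "I2 = (\<lambda>t. e * exp (- e * t) * indicator {0..} t)"
  have I10: "0 \<le> I1 t" and I20: "0 \<le> I2 t" for t using e by (auto simp: I1_def I2_def indicator_def)
  have I0: "0 \<le> 16 * c ^ 4 * (I1 t + I2 t)" for t using c1 I10 I20 by (simp add: add_nonneg_nonneg)
  have J0: "0 \<le> E * W t" for t using E W0 by simp
  have pw: "indicator {0<..} t * (t * exp (- e * t) * g t ^ 4)
      \<le> indicator {0..1} t + 16 * c ^ 4 * (I1 t + I2 t) + E * W t" for t
  proof -
    consider "t \<le> 0" | "0 < t" "t \<le> 1" | "1 < t" "t \<le> N / 2 \<or> 2 * N \<le> t" | "1 < t" "N / 2 \<le> t" "t \<le> 2 * N" by linarith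
    then show ?thesis
    proof cases
      case 1
      then have "indicator {0<..} t = (0::real)" by auto
      then show ?thesis using I0[of t] J0[of t] by (simp add: add_nonneg_nonneg)
    next
      case 2
      have "t * exp (- e * t) * g t ^ 4 \<le> 1 * 1 * 1"
        using 2 g0 g1 e by (intro mult_mono power_le_one) auto
      then have "t * exp (- e * t) * g t ^ 4 \<le> 1" by simp
      moreover have "indicator {0<..} t = (1::real)" "indicator {0..1} t = (1::real)" using 2 by auto
      ultimately show ?thesis using I0[of t] J0[of t] by (simp only: mult_1; linarith?)
    next
      case 3
      have "t * exp (- e * t) * g t ^ 4 \<le> t * exp (- e * t) * ((2 * c) ^ 4 * t powr (- (4 / 2)))"
        using outside_pow[of t 4] 3 by (intro mult_left_mono) auto
      also have "\<dots> = 16 * c ^ 4 * (exp (- e * t) * (1 / t))"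
        using 3 powr_minus_divide[of t 2] by (simp add: power_mult_distrib power2_eq_square)
      also have "\<dots> \<le> 16 * c ^ 4 * (I1 t + I2 t)"
      proof (rule mult_left_mono)
        show "exp (- e * t) * (1 / t) \<le> I1 t + I2 t"
        proof (cases "t \<le> T")
          case True
          have "exp (- e * t) * (1 / t) \<le> 1 * (1 / t)" using 3 e by (intro mult_right_mono) auto
          then show ?thesis using True 3 I20[of t] by (simp add: I1_def)
        next
          case False
          then have "1 / e \<le> t" by (simp add: T_def)
          then have "1 / t \<le> e" using e 3 by (simp add: field_simps)
          then have "exp (- e * t) * (1 / t) \<le> exp (- e * t) * e" by (intro mult_left_mono) auto
          then show ?thesis using 3 I10[of t] by (simp add: I2_def mult.commute)
        qed
      qed (use c1 in auto)
      finally have "t * exp (- e * t) * g t ^ 4 \<le> 16 * c ^ 4 * (I1 t + I2 t)" .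
      moreover have "indicator {0<..} t = (1::real)" "indicator {1..} t = (1::real)" "0 \<le> (indicator {0..1} t::real)" using 3 by auto
      ultimately show ?thesis using J0[of t] by (simp only: mult_1; linarith?)
    next
      case 4
      have "t * exp (- e * t) * g t ^ 4 = exp (- e * t) * (t * g t ^ 4)" by simp
      also have "\<dots> \<le> E * W t"
      proof (rule mult_mono)
        have "e * (N / 2) \<le> e * t" using 4 e by (intro mult_left_mono) auto
        then show "exp (- e * t) \<le> E" by (simp add: E_def)
        show "t * g t ^ 4 \<le> W t" unfolding W_def M_def by (rule near_pointwise4) (use 4 in auto)
      qed (use g0 4 E in auto)
      finally have "t * exp (- e * t) * g t ^ 4 \<le> E * W t" .
      moreover have "indicator {0<..} t = (1::real)" "0 \<le> (indicator {0..1} t::real)" using 4 by auto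
      ultimately show ?thesis using I0[of t] by (simp only: mult_1; linarith?)
    qed
  qed
  have "(\<integral>\<^sup>+t. ennreal (indicator {0<..} t * (t * exp (- e * t) * g t ^ 4)) \<partial>lborel)
     \<le> (\<integral>\<^sup>+t. indicator {0..1} t + ennreal (16 * c ^ 4) * (ennreal (I1 t) + ennreal (I2 t)) + ennreal E * ennreal (W t) \<partial>lborel)"
  proof (intro nn_integral_mono)
    fix t :: real
    have "ennreal (indicator {0<..} t * (t * exp (- e * t) * g t ^ 4)) \<le> ennreal (indicator {0..1} t + 16 * c ^ 4 * (I1 t + I2 t) + E * W t)"
      by (rule ennreal_leI[OF pw])
    also have "\<dots> = ennreal (indicator {0..1} t) + ennreal (16 * c ^ 4 * (I1 t + I2 t)) + ennreal (E * W t)"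
      using I0 J0 by (subst ennreal_plus; (subst ennreal_plus)?) auto
    also have "\<dots> = indicator {0..1} t + ennreal (16 * c ^ 4) * (ennreal (I1 t) + ennreal (I2 t)) + ennreal E * ennreal (W t)"
      using c1 E I10 I20 by (subst (1 2) ennreal_mult) (auto simp: W0 ennreal_indicator)
    finally show "ennreal (indicator {0<..} t * (t * exp (- e * t) * g t ^ 4)) \<le> \<dots>" .
  qed
  also have "\<dots> = 1 + ennreal (16 * c ^ 4) * ((\<integral>\<^sup>+t. ennreal (I1 t) \<partial>lborel) + (\<integral>\<^sup>+t. ennreal (I2 t) \<partial>lborel)) + ennreal E * (\<integral>\<^sup>+t. ennreal (W t) \<partial>lborel)"
    by (simp add: nn_integral_add nn_integral_cmult W_def I1_def I2_def)
  also have "(\<integral>\<^sup>+t. ennreal (W t) \<partial>lborel) = ennreal (c ^ 4 * (2 + 2 * ln M))"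
    using near_integral4 unfolding W_def M_def .
  also have "(\<integral>\<^sup>+t. ennreal (I1 t) \<partial>lborel) = ennreal (ln T)"
    unfolding I1_def by (rule nn_integral_inverse_Icc[OF T])
  also have "(\<integral>\<^sup>+t. ennreal (I2 t) \<partial>lborel) = ennreal (0 - (- exp (- e * 0)))"
  proof -
    have "(\<integral>\<^sup>+t. ennreal (I2 t) \<partial>lborel) = (\<integral>\<^sup>+t. ennreal (e * exp (- e * t)) * indicator {0..} t \<partial>lborel)"
      by (intro nn_integral_cong) (auto simp: I2_def indicator_def)
    also have "\<dots> = ennreal (0 - (- exp (- e * 0)))"
    proof (rule nn_integral_FTC_atLeast)
      show "((\<lambda>t. - exp (- e * t)) has_real_derivative e * exp (- e * t)) (at t)" for t
        by (auto intro!: derivative_eq_intros)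
      show "((\<lambda>t. - exp (- e * t)) \<longlongrightarrow> 0) at_top"
        using e by real_asymp
    qed (use e in auto)
    finally show ?thesis .
  qed
  also have "1 + ennreal (16 * c ^ 4) * (ennreal (ln T) + ennreal (0 - (- exp (- e * 0)))) + ennreal E * ennreal (c ^ 4 * (2 + 2 * ln M))
     = ennreal (1 + 16 * c ^ 4 * (ln T + 1) + E * (c ^ 4 * (2 + 2 * ln M)))"
  proof -
    have "1 + ennreal X * (ennreal P + ennreal P') + ennreal Q * ennreal R = ennreal (1 + X * (P + P') + Q * R)"
      if "0 \<le> X" "0 \<le> P" "0 \<le> P'" "0 \<le> Q" "0 \<le> R" for X P P' Q R
      using that by (simp add: ennreal_mult)
    from this[of "16 * c ^ 4" "ln T" "0 - (- exp (- e * 0))" E "c ^ 4 * (2 + 2 * ln M)"] show ?thesis using c1 M T E by simp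
  qed
  also have "\<dots> \<le> ennreal (60 * c ^ 4 * ln (2 + 1 / e))"
  proof (rule ennreal_leI)
    have L2: "1 / 2 \<le> L"
    proof -
      have "ln 2 \<le> L" unfolding L_def using e by (intro ln_mono) auto
      then show ?thesis using ln2_ge_two_thirds by linarith
    qed
    have "T \<le> 2 + 1 / e" using e by (simp add: T_def)
    then have lT: "ln T \<le> L" unfolding L_def using T e by (intro ln_mono) auto
    \<comment> \<open>With \<open>y = e * N\<close> the logarithm is \<open>ln y + ln (1 / e)\<close>, and \<open>E = exp (- y / 2)\<close> absorbs \<open>ln y\<close>.\<close>
    have lM: "E * ln M \<le> 1 + L"
    proof (cases "N \<le> 1")
      case True then show ?thesis using L2 by (simp add: M_def max_def)
    next
      case False
      then have N: "1 < N" "M = N" by (auto simp: M_def)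
      define y where "y = e * N"
      have y: "0 < y" using e N by (simp add: y_def)
      have "ln N = ln (y * (1 / e))" using e by (simp add: y_def)
      also have "\<dots> = ln y + ln (1 / e)" using y e by (subst ln_mult) auto
      finally have lnN: "ln N = ln y + ln (1 / e)" .
      have "ln (1 / e) \<le> ln (2 + 1 / e)" using e by (intro ln_mono) auto
      then have le: "E * ln (1 / e) \<le> L"
      proof (cases "0 \<le> ln (1 / e)")
        case True
        then have "E * ln (1 / e) \<le> 1 * ln (1 / e)" using E by (intro mult_right_mono) auto
        then show ?thesis using \<open>ln (1 / e) \<le> ln (2 + 1 / e)\<close> by (simp add: L_def)
      next
        case False
        then have "E * ln (1 / e) \<le> 0" using E by (simp add: mult_nonneg_nonpos)
        then show ?thesis using L2 by linarith
      qed
      have "E * ln y \<le> E * y" using E y by (intro mult_left_mono) (auto intro: ln_bound)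
      also have "E * y \<le> 1"
      proof -
        have "y / 2 \<le> exp (y / 2 - 1)" using exp_ge_add_one_self[of "y / 2 - 1"] by simp
        then have "2 * (y / 2) \<le> exp 1 * exp (y / 2 - 1)" using exp_ge_add_one_self[of 1] y by (intro mult_mono) auto
        also have "\<dots> = exp (y / 2)" by (simp flip: exp_add)
        finally have "y \<le> exp (y / 2)" by simp
        then show ?thesis by (simp add: E_def y_def exp_minus field_simps)
      qed
      finally show ?thesis using le by (simp add: N lnN distrib_left)
    qed
    have "E * (c ^ 4 * (2 + 2 * ln M)) = c ^ 4 * (2 * E + 2 * (E * ln M))" by (simp add: algebra_simps)
    also have "\<dots> \<le> c ^ 4 * (2 * 1 + 2 * (1 + L))" using lM E c1 by (intro mult_left_mono add_mono) auto
    also have "\<dots> \<le> c ^ 4 * (10 * L)" using L2 c1 by (intro mult_left_mono) auto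
    finally have A: "E * (c ^ 4 * (2 + 2 * ln M)) \<le> 10 * (c ^ 4 * L)" by simp
    have "16 * c ^ 4 * (ln T + 1) \<le> 16 * c ^ 4 * (3 * L)" using lT L2 c1 by (intro mult_left_mono) auto
    moreover have "1 \<le> 2 * (c ^ 4 * L)"
    proof -
      have "1 * (1 / 2) \<le> c ^ 4 * L" using c1 L2 by (intro mult_mono) auto
      then show ?thesis by simp
    qed
    ultimately show "1 + 16 * c ^ 4 * (ln T + 1) + E * (c ^ 4 * (2 + 2 * ln M)) \<le> 60 * c ^ 4 * ln (2 + 1 / e)"
      using A unfolding L_def[symmetric] by (simp only: mult.assoc; linarith?)
  qed
  finally show ?thesis .
qed

end

section \<open>Fourier series on the torus\<close>

definition character :: "int ^ 'd \<Rightarrow> real ^ 'd \<Rightarrow> complex" where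
  "character n \<xi> = cis (2 * pi * (\<Sum>j\<in>UNIV. of_int (n $ j) * \<xi> $ j))"

lemma character_add: "character (m + n) \<xi> = character m \<xi> * character n \<xi>"
  by (simp add: character_def cis_mult distrib_right sum.distrib flip: distrib_left)

lemma character_minus: "character (- n) \<xi> = cnj (character n \<xi>)"
  by (simp add: character_def cis_cnj sum_negf)

lemma character_diff: "character (m - n) \<xi> = character m \<xi> * cnj (character n \<xi>)"
  using character_add[of m "- n" \<xi>] by (simp add: character_minus)

lemma character_0 [simp]: "character 0 \<xi> = 1"
  by (simp add: character_def)

lemma norm_character [simp]: "cmod (character n \<xi>) = 1"
  by (simp add: character_def)

lemma character_continuous [continuous_intros]: "continuous_on S (character n)"
  unfolding character_def by (intro continuous_intros)

lemma character_measurable [measurable]: "character n \<in> borel_measurable borel"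
  by (intro borel_measurable_continuous_onI continuous_intros)

lemma character_axis: "character (axis j 1) \<xi> = cis (2 * pi * \<xi> $ j)"
proof -
  have "(\<Sum>i\<in>UNIV. of_int ((axis j 1 :: int ^ 'a) $ i) * \<xi> $ i) = (\<Sum>i\<in>UNIV. if i = j then \<xi> $ i else 0)"
    by (intro sum.cong) (auto simp: axis_def)
  then show ?thesis by (simp add: character_def)
qed

lemma character_prod: "character n \<xi> = (\<Prod>j\<in>UNIV. cis (2 * pi * (of_int (n $ j) * \<xi> $ j)))"
proof -
  have "(\<Prod>j\<in>J. cis (f j)) = cis (\<Sum>j\<in>J. f j)" if "finite J" for J and f :: "'a \<Rightarrow> real"
    using that by induction (auto simp: cis_mult)
  then show ?thesis by (simp add: character_def sum_distrib_left)
qed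

lemma exp_eq_character:
  "exp (- 2 * of_real pi * \<i> * of_real (\<Sum>j\<in>UNIV. of_int (n $ j) * \<xi> $ j)) = character (- n) \<xi>"
  by (simp add: character_def cis_conv_exp sum_negf mult_ac)

lemma torus_borel [measurable]: "(torus :: (real ^ 'd) set) \<in> sets borel"
proof -
  have "(torus :: (real ^ 'd) set) = (\<Inter>j. {\<xi>. - (1/2) < \<xi> $ j} \<inter> {\<xi>. \<xi> $ j \<le> 1/2})"
    by (auto simp: torus_def)
  also have "\<dots> \<in> sets borel"
    by (intro sets.countable_INT'' sets.Int) (auto intro!: borel_open borel_closed open_Collect_less closed_Collect_le continuous_intros)
  finally show ?thesis .
qed

lemma torus_measurableI: "f \<in> borel_measurable borel \<Longrightarrow> f \<in> borel_measurable torus_measure"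
  by (simp add: torus_measure_def measurable_restrict_space1)

text \<open>
  Fubini for a product of functions of one coordinate. The measure on \<open>real ^ 'd\<close> is the image of
  the product measure indexed by the standard basis, and \<open>idx\<close> translates basis vectors to indices.
\<close>
lemma torus_integral_prod:
  fixes g :: "'d::finite \<Rightarrow> real \<Rightarrow> complex"
  assumes [measurable]: "\<And>j. g j \<in> borel_measurable borel" and bd: "\<And>j x. cmod (g j x) \<le> B"
  shows "(\<integral>\<xi>. (\<Prod>j\<in>UNIV. g j (\<xi> $ j)) \<partial>(torus_measure :: (real ^ 'd) measure))
    = (\<Prod>j\<in>UNIV. \<integral>x. indicator {-1/2<..1/2} x *\<^sub>R g j x \<partial>lborel)"
proof -
  define G where "G = (\<lambda>j x. indicator {-1/2<..1/2} x *\<^sub>R g j x)"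
  have Gm [measurable]: "G j \<in> borel_measurable borel" for j unfolding G_def by measurable
  have Gint: "integrable lborel (G j)" for j
    unfolding G_def
    by (rule integrableI_bounded_set_indicator[where B = B]) (auto simp: bd)
  define idx :: "real ^ 'd \<Rightarrow> 'd" where "idx = (\<lambda>b. THE j. b = axis j 1)"
  have idx: "idx (axis j 1) = j" for j unfolding idx_def by (auto simp: axis_eq_axis)
  have basis: "(Basis :: (real ^ 'd) set) = range (\<lambda>j. axis j 1)" by (auto simp: Basis_vec_def)
  have inj: "inj (\<lambda>j::'d. axis j (1::real))" by (auto simp: inj_on_def axis_eq_axis)
  have coord: "(\<Sum>b\<in>Basis. f b *\<^sub>R b) $ j = f (axis j 1)" for f :: "real ^ 'd \<Rightarrow> real" and j
  proof -
    have "(\<Sum>b\<in>Basis. f b *\<^sub>R b) $ j = (\<Sum>b\<in>Basis. f b * b $ j)" by simp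
    also have "\<dots> = (\<Sum>i\<in>UNIV. f (axis i 1) * (axis i 1 :: real ^ 'd) $ j)"
      unfolding basis by (subst sum.reindex[OF inj]) simp
    also have "\<dots> = (\<Sum>i\<in>UNIV. if i = j then f (axis i 1) else 0)"
      by (intro sum.cong) (auto simp: axis_def)
    finally show ?thesis by simp
  qed
  interpret product_sigma_finite "\<lambda>b::real ^ 'd. lborel :: real measure" by standard
  have "(\<integral>\<xi>. (\<Prod>j\<in>UNIV. g j (\<xi> $ j)) \<partial>(torus_measure :: (real ^ 'd) measure))
     = (\<integral>\<xi>. indicator torus \<xi> *\<^sub>R (\<Prod>j\<in>UNIV. g j (\<xi> $ j)) \<partial>lborel)"
    unfolding torus_measure_def by (subst integral_restrict_space) auto
  also have "\<dots> = (\<integral>\<xi>. (\<Prod>j\<in>UNIV. G j (\<xi> $ j)) \<partial>(lborel :: (real ^ 'd) measure))"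
  proof (intro Bochner_Integration.integral_cong refl)
    fix \<xi> :: "real ^ 'd"
    show "indicator torus \<xi> *\<^sub>R (\<Prod>j\<in>UNIV. g j (\<xi> $ j)) = (\<Prod>j\<in>UNIV. G j (\<xi> $ j))"
    proof (cases "\<xi> \<in> torus")
      case True then show ?thesis by (auto simp: G_def torus_def intro!: prod.cong)
    next
      case False
      then obtain j where "\<xi> $ j \<notin> {-1/2<..1/2}" by (auto simp: torus_def)
      then have "G j (\<xi> $ j) = 0" by (simp add: G_def)
      then have "(\<Prod>j\<in>UNIV. G j (\<xi> $ j)) = 0" by (intro prod_zero) auto
      then show ?thesis using False by simp
    qed
  qed
  also have "\<dots> = (\<integral>f. (\<Prod>j\<in>UNIV. G j ((\<Sum>b\<in>Basis. f b *\<^sub>R b :: real ^ 'd) $ j)) \<partial>(\<Pi>\<^sub>M b\<in>Basis. lborel))"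
    by (subst lborel_eq, subst integral_distr) auto
  also have "\<dots> = (\<integral>f. (\<Prod>b\<in>Basis. G (idx b) (f b)) \<partial>(\<Pi>\<^sub>M b\<in>(Basis :: (real ^ 'd) set). lborel))"
    unfolding coord unfolding basis by (simp add: prod.reindex[OF inj] idx o_def)
  also have "\<dots> = (\<Prod>b\<in>(Basis :: (real ^ 'd) set). \<integral>x. G (idx b) x \<partial>lborel)"
    by (rule product_integral_prod) (auto simp: Gint)
  also have "\<dots> = (\<Prod>j\<in>UNIV. \<integral>x. G j x \<partial>lborel)"
    unfolding basis by (simp add: prod.reindex[OF inj] idx o_def)
  finally show ?thesis unfolding G_def .
qed

lemma lborel_integral_Ioc_eq:
  fixes f :: "real \<Rightarrow> complex"
  assumes "continuous_on {a..b} f" 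
  shows "(\<integral>x. indicator {a<..b} x *\<^sub>R f x \<partial>lborel) = integral {a..b} f"
proof -
  have "set_integrable lborel {a..b} f"
    by (rule borel_integrable_atLeastAtMost') (rule assms)
  then have "(\<integral>x. indicator {a..b} x *\<^sub>R f x \<partial>lborel) = integral {a..b} f"
    using set_borel_integral_eq_integral(2) by (fastforce simp: set_lebesgue_integral_def)
  moreover have "(\<integral>x. indicator {a<..b} x *\<^sub>R f x \<partial>lborel) = (\<integral>x. indicator {a..b} x *\<^sub>R f x \<partial>lborel)"
  proof (rule integral_cong_AE)
    have m: "(\<lambda>x. indicator {a..b} x *\<^sub>R f x) \<in> borel_measurable borel"
      using borel_integrable_atLeastAtMost'[OF assms] by (auto simp: set_integrable_def)
    then show "(\<lambda>x. indicator {a..b} x *\<^sub>R f x) \<in> borel_measurable lborel" by simp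
    have "(\<lambda>x. indicator {a<..b} x *\<^sub>R (indicator {a..b} x *\<^sub>R f x)) \<in> borel_measurable borel"
      using m by measurable
    also have "(\<lambda>x. indicator {a<..b} x *\<^sub>R (indicator {a..b} x *\<^sub>R f x)) = (\<lambda>x. indicator {a<..b} x *\<^sub>R f x)"
      by (auto simp: indicator_def fun_eq_iff)
    finally show "(\<lambda>x. indicator {a<..b} x *\<^sub>R f x) \<in> borel_measurable lborel" by simp
    have "AE x in lborel. x \<noteq> a" by (rule AE_lborel_singleton)
    then show "AE x in lborel. indicator {a<..b} x *\<^sub>R f x = indicator {a..b} x *\<^sub>R f x"
      by eventually_elim (auto simp: indicator_def)
  qed
  ultimately show ?thesis by simp
qed

lemma integral_cis_int:
  "integral {-1/2..1/2} (\<lambda>x. cis (2 * pi * (of_int k * x))) = (if k = 0 then 1 else 0)"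
proof (cases "k = 0")
  case True then show ?thesis by simp
next
  case False
  let ?F = "\<lambda>x. cis (2 * pi * (of_int k * x)) / (2 * pi * \<i> * of_int k)"
  have "((\<lambda>x. cis (2 * pi * (of_int k * x))) has_integral (?F (1/2) - ?F (-1/2))) {-1/2..1/2}"
  proof (rule fundamental_theorem_of_calculus)
    fix x :: real
    have "((\<lambda>x. \<i> * complex_of_real (2 * pi * (of_int k * x))) has_vector_derivative \<i> * of_real (2 * pi * of_int k)) (at x within {-1/2..1/2})"
      by (rule has_vector_derivative_mult_right[OF has_vector_derivative_of_real]) (auto intro!: derivative_eq_intros)
    from field_vector_diff_chain_within[OF this has_field_derivative_at_within[OF DERIV_exp]]
    have "((\<lambda>x. cis (2 * pi * (of_int k * x))) has_vector_derivative \<i> * of_real (2 * pi * of_int k) * cis (2 * pi * (of_int k * x))) (at x within {-1/2..1/2})"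
      by (simp add: o_def cis_conv_exp)
    from has_vector_derivative_divide[OF this, of "2 * pi * \<i> * of_int k"]
    show "(?F has_vector_derivative cis (2 * pi * (of_int k * x))) (at x within {-1/2..1/2})"
      using False by (simp add: field_simps)
  qed auto
  moreover have "?F (1/2) = ?F (-1/2)"
  proof -
    have "cis (2 * pi * (of_int k * (1/2))) = cis (2 * pi * (of_int k * (-1/2)) + 2 * pi * of_int k)" by simp
    also have "\<dots> = cis (2 * pi * (of_int k * (-1/2))) * cis (2 * pi * of_int k)" by (rule cis_mult[symmetric])
    also have "cis (2 * pi * of_int k) = 1" by (intro cis_multiple_2pi) auto
    finally show ?thesis by simp
  qed
  ultimately show ?thesis using False by (simp add: integral_unique)
qed

lemma torus_orthonormal: "(\<integral>\<xi>. character n \<xi> \<partial>torus_measure) = (if n = 0 then 1 else 0)"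
proof -
  have "(\<integral>\<xi>. character n \<xi> \<partial>torus_measure) = (\<Prod>j\<in>UNIV. \<integral>x. indicator {-1/2<..1/2} x *\<^sub>R cis (2 * pi * (of_int (n $ j) * x)) \<partial>lborel)"
    unfolding character_prod by (rule torus_integral_prod[where B = 1])
      (auto intro!: borel_measurable_continuous_onI continuous_intros)
  also have "\<dots> = (\<Prod>j\<in>UNIV. if n $ j = 0 then 1 else 0)"
  proof (intro prod.cong refl)
    fix j
    show "(\<integral>x. indicator {-1/2<..1/2} x *\<^sub>R cis (2 * pi * (of_int (n $ j) * x)) \<partial>lborel) = (if n $ j = 0 then 1 else 0)"
      by (subst lborel_integral_Ioc_eq, intro continuous_intros) (rule integral_cis_int)
  qed
  also have "\<dots> = (if n = 0 then 1 else 0)"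
    by (auto simp: vec_eq_iff)
  finally show ?thesis .
qed

lemma prob_torus: "emeasure (torus_measure :: (real ^ 'd) measure) (space torus_measure) = 1"
  and finite_torus: "finite_measure (torus_measure :: (real ^ 'd) measure)"
proof -
  let ?T = "torus_measure :: (real ^ 'd) measure"
  have "space ?T = torus" by (simp add: torus_measure_def space_restrict_space)
  have "emeasure ?T (space ?T) = emeasure lborel (torus :: (real ^ 'd) set)"
    unfolding torus_measure_def by (subst emeasure_restrict_space) (auto simp: space_restrict_space)
  also have "\<dots> \<le> emeasure lborel (cbox (\<chi> j. -1/2) (\<chi> j. 1/2) :: (real ^ 'd) set)"
    by (intro emeasure_mono) (auto simp: torus_def mem_box_cart less_eq_real_def)
  also have "\<dots> < \<infinity>" by (rule emeasure_lborel_cbox_finite)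
  finally have fin: "emeasure ?T (space ?T) < \<infinity>" .
  then show f: "finite_measure ?T" by (intro finite_measureI) auto
  interpret finite_measure ?T by (rule f)
  have "(\<integral>\<xi>. character 0 \<xi> \<partial>?T) = 1" by (subst torus_orthonormal) simp
  then have "measure ?T (space ?T) = 1" by (simp add: scaleR_conv_of_real)
  then show "emeasure ?T (space ?T) = 1" by (simp add: emeasure_eq_measure)
qed

interpretation torus: finite_measure "torus_measure :: (real ^ 'd::finite) measure"
  by (rule finite_torus)

lemma torus_integrable:
  fixes f :: "real ^ 'd::finite \<Rightarrow> 'b::{banach,second_countable_topology}"
  assumes "f \<in> borel_measurable borel" "\<And>\<xi>. norm (f \<xi>) \<le> B"
  shows "integrable torus_measure f"
  by (rule torus.integrable_const_bound[where B = B]) (use assms in \<open>auto intro: torus_measurableI\<close>)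

lemma measure_torus: "measure (torus_measure :: (real ^ 'd::finite) measure) (space torus_measure) = 1"
  by (simp add: measure_def prob_torus)

text \<open>
  The partial sums of the Fourier series, in the sign convention of \<open>has_fourier\<close>.
\<close>
definition trig_sum :: "(int ^ 'd) set \<Rightarrow> (int ^ 'd \<Rightarrow> complex) \<Rightarrow> real ^ 'd \<Rightarrow> complex" where
  "trig_sum A f \<xi> = (\<Sum>n\<in>A. f n * character (- n) \<xi>)"

lemma trig_sum_measurable [measurable]: "trig_sum A f \<in> borel_measurable borel"
  unfolding trig_sum_def[abs_def] by measurable

lemma trig_sum_measurable_torus [measurable]: "trig_sum A f \<in> borel_measurable torus_measure"
  by (rule torus_measurableI) simp

lemma norm_trig_sum_le: "cmod (trig_sum A f \<xi>) \<le> (\<Sum>n\<in>A. cmod (f n))"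
  unfolding trig_sum_def by (intro sum_norm_le) (simp add: norm_mult)

lemma trig_sum_continuous: "continuous_on S (trig_sum A f)"
  unfolding trig_sum_def[abs_def] by (intro continuous_intros)

text \<open>
  The matrix of a Fourier multiplier in the basis of characters: this turns a bound on the symbol
  into a bound on the bilinear form, with finite sums only.
\<close>
lemma trig_sum_form:
  fixes f g :: "int ^ 'd::finite \<Rightarrow> complex" and m :: "real ^ 'd \<Rightarrow> complex"
  assumes [measurable]: "m \<in> borel_measurable borel" and bd: "\<And>\<xi>. cmod (m \<xi>) \<le> B"
  shows "(\<integral>\<xi>. m \<xi> * trig_sum A f \<xi> * cnj (trig_sum A' g \<xi>) \<partial>torus_measure)
     = (\<Sum>k\<in>A. \<Sum>n\<in>A'. f k * cnj (g n) * (\<integral>\<xi>. m \<xi> * character (n - k) \<xi> \<partial>torus_measure))"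
proof -
  have int: "integrable torus_measure (\<lambda>\<xi>. m \<xi> * character k \<xi>)" for k :: "int ^ 'd"
    by (rule torus_integrable[where B = B]) (auto simp: norm_mult bd)
  have "m \<xi> * trig_sum A f \<xi> * cnj (trig_sum A' g \<xi>) = (\<Sum>k\<in>A. \<Sum>n\<in>A'. f k * cnj (g n) * (m \<xi> * character (n - k) \<xi>))" for \<xi>
    by (simp add: trig_sum_def sum_product sum_distrib_left character_minus character_diff mult_ac)
  then have "(\<integral>\<xi>. m \<xi> * trig_sum A f \<xi> * cnj (trig_sum A' g \<xi>) \<partial>torus_measure)
     = (\<integral>\<xi>. (\<Sum>k\<in>A. \<Sum>n\<in>A'. f k * cnj (g n) * (m \<xi> * character (n - k) \<xi>)) \<partial>torus_measure)" by simp
  also have "\<dots> = (\<Sum>k\<in>A. \<Sum>n\<in>A'. \<integral>\<xi>. f k * cnj (g n) * (m \<xi> * character (n - k) \<xi>) \<partial>torus_measure)"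
    by (subst Bochner_Integration.integral_sum; (intro Bochner_Integration.integrable_sum integrable_mult_right int)?)
       (subst Bochner_Integration.integral_sum; (intro integrable_mult_right int refl)?)
  also have "\<dots> = (\<Sum>k\<in>A. \<Sum>n\<in>A'. f k * cnj (g n) * (\<integral>\<xi>. m \<xi> * character (n - k) \<xi> \<partial>torus_measure))"
    by (simp add: integral_mult_right_zero)
  finally show ?thesis .
qed

lemma parseval:
  fixes f :: "int ^ 'd::finite \<Rightarrow> complex"
  assumes "finite A"
  shows "(\<integral>\<xi>. (cmod (trig_sum A f \<xi>))\<^sup>2 \<partial>torus_measure) = (\<Sum>n\<in>A. (cmod (f n))\<^sup>2)"
proof -
  have "complex_of_real (\<integral>\<xi>. (cmod (trig_sum A f \<xi>))\<^sup>2 \<partial>torus_measure) = (\<integral>\<xi>. 1 * trig_sum A f \<xi> * cnj (trig_sum A f \<xi>) \<partial>torus_measure)"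
    by (subst integral_complex_of_real[symmetric]) (simp only: complex_norm_square mult_1)
  also have "\<dots> = (\<Sum>k\<in>A. \<Sum>n\<in>A. f k * cnj (f n) * (if n = k then 1 else 0))"
    by (subst trig_sum_form[where B = 1]) (auto simp: torus_orthonormal)
  also have "\<dots> = (\<Sum>k\<in>A. f k * cnj (f k))"
    using assms by (intro sum.cong) (auto simp: if_distrib[of "\<lambda>x. _ * x"] cong: if_cong)
  also have "\<dots> = complex_of_real (\<Sum>n\<in>A. (cmod (f n))\<^sup>2)"
    by (simp only: of_real_sum complex_norm_square)
  finally show ?thesis by (simp only: of_real_eq_iff)
qed

text \<open>
  The squared \<open>L\<^sup>2\<close> norm. It is extended-valued because the functions to which a Fourier series
  converges are only known to be measurable.
\<close>
definition L2_sq :: "(real ^ 'd \<Rightarrow> complex) \<Rightarrow> ennreal" where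
  "L2_sq F = (\<integral>\<^sup>+\<xi>. ennreal ((cmod (F \<xi>))\<^sup>2) \<partial>torus_measure)"

lemma L2_sq_trig_sum:
  fixes f :: "int ^ 'd::finite \<Rightarrow> complex"
  assumes "finite A" shows "L2_sq (trig_sum A f) = ennreal (\<Sum>n\<in>A. (cmod (f n))\<^sup>2)"
proof -
  have "(cmod (trig_sum A f \<xi>))\<^sup>2 \<le> (\<Sum>n\<in>A. cmod (f n))\<^sup>2" for \<xi>
    using norm_trig_sum_le by (intro power_mono) auto
  then have "integrable torus_measure (\<lambda>\<xi>. (cmod (trig_sum A f \<xi>))\<^sup>2)"
    by (intro torus_integrable[where B = "(\<Sum>n\<in>A. cmod (f n))\<^sup>2"]) auto
  then show ?thesis unfolding L2_sq_def
    by (subst nn_integral_eq_integral) (auto simp: parseval[OF assms])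
qed

lemma L2_sq_add:
  assumes [measurable]: "F \<in> borel_measurable torus_measure" "G \<in> borel_measurable torus_measure"
  shows "L2_sq (\<lambda>\<xi>. F \<xi> + G \<xi>) \<le> 2 * L2_sq F + 2 * L2_sq G"
proof -
  have pt: "ennreal ((cmod (a + b))\<^sup>2) \<le> 2 * ennreal ((cmod a)\<^sup>2) + 2 * ennreal ((cmod b)\<^sup>2)" for a b :: complex
  proof -
    have "(cmod (a + b))\<^sup>2 \<le> (cmod a + cmod b)\<^sup>2" by (intro power_mono norm_triangle_ineq) auto
    also have "\<dots> \<le> 2 * (cmod a)\<^sup>2 + 2 * (cmod b)\<^sup>2"
      using sum_squares_bound[of "cmod a" "cmod b"] by (simp add: power2_sum)
    finally have "ennreal ((cmod (a + b))\<^sup>2) \<le> ennreal (2 * (cmod a)\<^sup>2 + 2 * (cmod b)\<^sup>2)" by (rule ennreal_leI)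
    then show ?thesis by (simp add: ennreal_mult)
  qed
  have "L2_sq (\<lambda>\<xi>. F \<xi> + G \<xi>) \<le> (\<integral>\<^sup>+\<xi>. 2 * ennreal ((cmod (F \<xi>))\<^sup>2) + 2 * ennreal ((cmod (G \<xi>))\<^sup>2) \<partial>torus_measure)"
    unfolding L2_sq_def by (intro nn_integral_mono pt)
  also have "\<dots> = 2 * L2_sq F + 2 * L2_sq G"
    unfolding L2_sq_def by (subst nn_integral_add, measurable) (simp add: nn_integral_cmult)
  finally show ?thesis .
qed

lemma has_fourier_iff:
  "has_fourier f F \<longleftrightarrow> F \<in> borel_measurable torus_measure \<and>
     ((\<lambda>A. L2_sq (\<lambda>\<xi>. F \<xi> - trig_sum A f \<xi>)) \<longlongrightarrow> 0) (finite_subsets_at_top UNIV)"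
  unfolding has_fourier_def L2_sq_def trig_sum_def exp_eq_character ..

lemma tendsto_zero_ennreal_mono:
  fixes X Y :: "'x \<Rightarrow> ennreal"
  assumes "(Y \<longlongrightarrow> 0) F" "eventually (\<lambda>x. X x \<le> Y x) F"
  shows "(X \<longlongrightarrow> 0) F"
  by (rule tendsto_sandwich[OF _ assms(2) tendsto_const assms(1)]) simp

lemma tendsto_cmult_ennreal_zero:
  fixes X :: "'x \<Rightarrow> ennreal"
  assumes "(X \<longlongrightarrow> 0) F" "c < \<infinity>"
  shows "((\<lambda>x. c * X x) \<longlongrightarrow> 0) F"
  using ennreal_tendsto_cmult[OF _ assms(1), of c] assms(2) by simp

lemma has_fourier_add:
  assumes "has_fourier f F" "has_fourier g G"
  shows "has_fourier (\<lambda>n. f n + g n) (\<lambda>\<xi>. F \<xi> + G \<xi>)"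
proof -
  from assms have [measurable]: "F \<in> borel_measurable torus_measure" "G \<in> borel_measurable torus_measure"
    and lim: "((\<lambda>A. L2_sq (\<lambda>\<xi>. F \<xi> - trig_sum A f \<xi>)) \<longlongrightarrow> 0) (finite_subsets_at_top UNIV)"
      "((\<lambda>A. L2_sq (\<lambda>\<xi>. G \<xi> - trig_sum A g \<xi>)) \<longlongrightarrow> 0) (finite_subsets_at_top UNIV)"
    by (auto simp: has_fourier_iff)
  have "((\<lambda>A. 2 * L2_sq (\<lambda>\<xi>. F \<xi> - trig_sum A f \<xi>) + 2 * L2_sq (\<lambda>\<xi>. G \<xi> - trig_sum A g \<xi>)) \<longlongrightarrow> 0 + 0) (finite_subsets_at_top UNIV)"
    by (intro tendsto_add tendsto_cmult_ennreal_zero lim) auto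
  then have "((\<lambda>A. 2 * L2_sq (\<lambda>\<xi>. F \<xi> - trig_sum A f \<xi>) + 2 * L2_sq (\<lambda>\<xi>. G \<xi> - trig_sum A g \<xi>)) \<longlongrightarrow> 0) (finite_subsets_at_top UNIV)" by simp
  then have "((\<lambda>A. L2_sq (\<lambda>\<xi>. (F \<xi> + G \<xi>) - trig_sum A (\<lambda>n. f n + g n) \<xi>)) \<longlongrightarrow> 0) (finite_subsets_at_top UNIV)"
  proof (rule tendsto_zero_ennreal_mono, intro always_eventually allI)
    fix A
    have "L2_sq (\<lambda>\<xi>. (F \<xi> + G \<xi>) - trig_sum A (\<lambda>n. f n + g n) \<xi>) = L2_sq (\<lambda>\<xi>. (F \<xi> - trig_sum A f \<xi>) + (G \<xi> - trig_sum A g \<xi>))"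
      by (intro arg_cong[where f = L2_sq]) (auto simp: trig_sum_def fun_eq_iff distrib_right sum.distrib)
    also have "\<dots> \<le> 2 * L2_sq (\<lambda>\<xi>. F \<xi> - trig_sum A f \<xi>) + 2 * L2_sq (\<lambda>\<xi>. G \<xi> - trig_sum A g \<xi>)"
      by (rule L2_sq_add) measurable
    finally show "L2_sq (\<lambda>\<xi>. (F \<xi> + G \<xi>) - trig_sum A (\<lambda>n. f n + g n) \<xi>) \<le> \<dots>" .
  qed
  then show ?thesis by (simp add: has_fourier_iff)
qed

lemma L2_sq_cmult:
  assumes [measurable]: "F \<in> borel_measurable torus_measure"
  shows "L2_sq (\<lambda>\<xi>. c * F \<xi>) = ennreal ((cmod c)\<^sup>2) * L2_sq F"
  unfolding L2_sq_def by (simp add: norm_mult power_mult_distrib ennreal_mult nn_integral_cmult)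

lemma has_fourier_cmult:
  assumes "has_fourier f F"
  shows "has_fourier (\<lambda>n. c * f n) (\<lambda>\<xi>. c * F \<xi>)"
proof -
  from assms have [measurable]: "F \<in> borel_measurable torus_measure"
    and lim: "((\<lambda>A. L2_sq (\<lambda>\<xi>. F \<xi> - trig_sum A f \<xi>)) \<longlongrightarrow> 0) (finite_subsets_at_top UNIV)"
    by (auto simp: has_fourier_iff)
  have "L2_sq (\<lambda>\<xi>. c * F \<xi> - trig_sum A (\<lambda>n. c * f n) \<xi>) = ennreal ((cmod c)\<^sup>2) * L2_sq (\<lambda>\<xi>. F \<xi> - trig_sum A f \<xi>)" for A
  proof -
    have "(\<lambda>\<xi>. c * F \<xi> - trig_sum A (\<lambda>n. c * f n) \<xi>) = (\<lambda>\<xi>. c * (F \<xi> - trig_sum A f \<xi>))"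
      by (auto simp: trig_sum_def fun_eq_iff right_diff_distrib sum_distrib_left mult.assoc)
    then show ?thesis by (simp add: L2_sq_cmult)
  qed
  then show ?thesis using tendsto_cmult_ennreal_zero[OF lim] by (simp add: has_fourier_iff)
qed

text \<open>
  Translating the coefficients multiplies the series by a character and permutes the finite sets along which
  convergence is tested.
\<close>
lemma has_fourier_shift:
  fixes f :: "int ^ 'd::finite \<Rightarrow> complex"
  assumes "has_fourier f F"
  shows "has_fourier (\<lambda>n. f (n + a)) (\<lambda>\<xi>. character a \<xi> * F \<xi>)"
proof -
  from assms have [measurable]: "F \<in> borel_measurable torus_measure"
    and lim: "((\<lambda>A. L2_sq (\<lambda>\<xi>. F \<xi> - trig_sum A f \<xi>)) \<longlongrightarrow> 0) (finite_subsets_at_top UNIV)"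
    by (auto simp: has_fourier_iff)
  have [measurable]: "character a \<in> borel_measurable torus_measure" by (rule torus_measurableI) simp
  have eq: "L2_sq (\<lambda>\<xi>. character a \<xi> * F \<xi> - trig_sum A (\<lambda>n. f (n + a)) \<xi>) = L2_sq (\<lambda>\<xi>. F \<xi> - trig_sum ((\<lambda>n. n + a) ` A) f \<xi>)" for A
  proof -
    have "trig_sum A (\<lambda>n. f (n + a)) \<xi> = character a \<xi> * trig_sum ((\<lambda>n. n + a) ` A) f \<xi>" for \<xi>
    proof -
      have "character a \<xi> * (f (n + a) * character (- (n + a)) \<xi>) = f (n + a) * character (- n) \<xi>" for n
        using character_add[of a "- (n + a)" \<xi>] by (simp add: mult.left_commute)
      moreover have "character a \<xi> * trig_sum ((\<lambda>n. n + a) ` A) f \<xi> = (\<Sum>n\<in>A. character a \<xi> * (f (n + a) * character (- (n + a)) \<xi>))"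
        unfolding trig_sum_def by (subst sum.reindex) (auto simp: inj_on_def sum_distrib_left)
      ultimately show ?thesis by (simp only: trig_sum_def)
    qed
    then show ?thesis unfolding L2_sq_def
      by (simp add: norm_mult flip: right_diff_distrib)
  qed
  have "filterlim (\<lambda>A. (\<lambda>n. n + a) ` A) (finite_subsets_at_top UNIV) (finite_subsets_at_top (UNIV :: (int ^ 'd) set))"
    unfolding filterlim_def le_filter_def eventually_filtermap
  proof (intro allI impI)
    fix P :: "(int ^ 'd) set \<Rightarrow> bool" assume "eventually P (finite_subsets_at_top UNIV)"
    then obtain X where X: "finite X" "\<And>Y. finite Y \<Longrightarrow> X \<subseteq> Y \<Longrightarrow> P Y"
      by (auto simp: eventually_finite_subsets_at_top)
    show "\<forall>\<^sub>F A in finite_subsets_at_top UNIV. P ((\<lambda>n. n + a) ` A)"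
      unfolding eventually_finite_subsets_at_top
    proof (intro exI[of _ "(\<lambda>n. n - a) ` X"] conjI allI impI)
      fix Y assume Y: "finite Y \<and> (\<lambda>n. n - a) ` X \<subseteq> Y \<and> Y \<subseteq> UNIV"
      show "P ((\<lambda>n. n + a) ` Y)"
      proof (rule X(2))
        show "X \<subseteq> (\<lambda>n. n + a) ` Y"
        proof
          fix x assume "x \<in> X"
          then have "x - a \<in> Y" using Y by auto
          then show "x \<in> (\<lambda>n. n + a) ` Y" by (rule rev_image_eqI) simp
        qed
      qed (use Y in auto)
    qed (use X in auto)
  qed
  from filterlim_compose[OF lim this]
  show ?thesis by (simp add: has_fourier_iff eq)
qed

lemma fourier_zero_unique:
  assumes "has_fourier (\<lambda>_. 0) F"
  shows "AE \<xi> in torus_measure. F \<xi> = 0"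
proof -
  from assms have [measurable]: "F \<in> borel_measurable torus_measure"
    and lim: "((\<lambda>A. L2_sq (\<lambda>\<xi>. F \<xi> - trig_sum A (\<lambda>_. 0) \<xi>)) \<longlongrightarrow> 0) (finite_subsets_at_top UNIV)"
    by (auto simp: has_fourier_iff)
  from lim have "((\<lambda>A::(int ^ 'a) set. L2_sq F) \<longlongrightarrow> 0) (finite_subsets_at_top UNIV)" by (simp add: trig_sum_def)
  then have "L2_sq F = 0" by (simp add: tendsto_const_iff)
  then show ?thesis unfolding L2_sq_def by (subst (asm) nn_integral_0_iff_AE) auto
qed

text \<open>
  Together with uniqueness of the limit this makes the multiplier a well-defined operator: a null
  function has vanishing coefficients, since each of them is bounded by the \<open>L\<^sup>2\<close> distance to the partial sums.
\<close>
lemma fourier_of_null: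
  fixes f :: "int ^ 'd::finite \<Rightarrow> complex"
  assumes "has_fourier f F" "AE \<xi> in torus_measure. F \<xi> = 0"
  shows "f n = 0"
proof -
  from assms have [measurable]: "F \<in> borel_measurable torus_measure"
    and lim: "((\<lambda>A. L2_sq (\<lambda>\<xi>. F \<xi> - trig_sum A f \<xi>)) \<longlongrightarrow> 0) (finite_subsets_at_top UNIV)"
    by (auto simp: has_fourier_iff)
  have eq: "L2_sq (\<lambda>\<xi>. F \<xi> - trig_sum A f \<xi>) = L2_sq (trig_sum A f)" for A
    unfolding L2_sq_def by (intro nn_integral_cong_AE, use assms(2) in eventually_elim) simp
  have "ennreal ((cmod (f n))\<^sup>2) \<le> 0"
  proof (rule tendsto_lowerbound[OF lim])
    show "\<forall>\<^sub>F A in finite_subsets_at_top UNIV. ennreal ((cmod (f n))\<^sup>2) \<le> L2_sq (\<lambda>\<xi>. F \<xi> - trig_sum A f \<xi>)"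
      unfolding eventually_finite_subsets_at_top
    proof (intro exI[of _ "{n}"] conjI allI impI)
      fix Y assume "finite Y \<and> {n} \<subseteq> Y \<and> Y \<subseteq> UNIV"
      then show "ennreal ((cmod (f n))\<^sup>2) \<le> L2_sq (\<lambda>\<xi>. F \<xi> - trig_sum Y f \<xi>)"
        unfolding eq by (subst L2_sq_trig_sum) (auto intro!: ennreal_leI member_le_sum)
    qed auto
  qed auto
  then show ?thesis by simp
qed

lemma ell2_iff: "f \<in> ell 2 \<longleftrightarrow> (\<lambda>n. (cmod (f n))\<^sup>2) summable_on UNIV"
proof -
  have "cmod z powr real_of_ereal 2 = (cmod z)\<^sup>2" for z :: complex
    by (cases "z = 0") (auto simp: powr_numeral)
  then show ?thesis by (simp add: ell_def)
qed

lemma ell2I: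
  assumes "\<And>A. finite A \<Longrightarrow> (\<Sum>n\<in>A. (cmod (f n))\<^sup>2) \<le> K"
  shows "f \<in> ell 2"
  unfolding ell2_iff using assms by (intro nonneg_bdd_above_summable_on) (auto intro!: bdd_aboveI2)

lemma ell2_bound:
  assumes "f \<in> ell 2" "finite A"
  shows "(\<Sum>n\<in>A. (cmod (f n))\<^sup>2) \<le> (\<Sum>\<^sub>\<infinity>n. (cmod (f n))\<^sup>2)"
  using assms(2) by (intro finite_sum_le_infsum assms(1)[unfolded ell2_iff]) auto

lemma ell2_tail:
  assumes "f \<in> ell 2" "0 < \<epsilon>"
  shows "\<exists>X. finite X \<and> (\<forall>B. finite B \<longrightarrow> B \<inter> X = {} \<longrightarrow> (\<Sum>n\<in>B. (cmod (f n))\<^sup>2) \<le> \<epsilon>)"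
proof -
  let ?S = "\<Sum>\<^sub>\<infinity>n. (cmod (f n))\<^sup>2"
  have "((\<lambda>A. \<Sum>n\<in>A. (cmod (f n))\<^sup>2) \<longlongrightarrow> ?S) (finite_subsets_at_top UNIV)"
    by (intro infsum_tendsto assms(1)[unfolded ell2_iff])
  then have "\<forall>\<^sub>F A in finite_subsets_at_top UNIV. ?S - \<epsilon> < (\<Sum>n\<in>A. (cmod (f n))\<^sup>2)"
    using assms by (intro order_tendstoD) auto
  then obtain X where X: "finite X" "?S - \<epsilon> < (\<Sum>n\<in>X. (cmod (f n))\<^sup>2)"
    by (auto simp: eventually_finite_subsets_at_top)
  show ?thesis
  proof (intro exI[of _ X] conjI allI impI)
    fix B assume B: "finite B" "B \<inter> X = {}"
    have "(\<Sum>n\<in>B. (cmod (f n))\<^sup>2) + (\<Sum>n\<in>X. (cmod (f n))\<^sup>2) = (\<Sum>n\<in>B \<union> X. (cmod (f n))\<^sup>2)"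
      using B X by (simp add: sum.union_disjoint)
    also have "\<dots> \<le> ?S" using B X assms by (intro ell2_bound) auto
    finally show "(\<Sum>n\<in>B. (cmod (f n))\<^sup>2) \<le> \<epsilon>" using X by linarith
  qed (rule X)
qed

lemma ell2_add:
  assumes "f \<in> ell 2" "g \<in> ell 2" shows "(\<lambda>n. f n + g n) \<in> ell 2"
proof (rule ell2I)
  fix A :: "'a set" assume A: "finite A"
  have pt: "(cmod (a + b))\<^sup>2 \<le> 2 * (cmod a)\<^sup>2 + 2 * (cmod b)\<^sup>2" for a b :: complex
  proof -
    have "(cmod (a + b))\<^sup>2 \<le> (cmod a + cmod b)\<^sup>2" by (intro power_mono norm_triangle_ineq) auto
    also have "\<dots> \<le> 2 * (cmod a)\<^sup>2 + 2 * (cmod b)\<^sup>2"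
      using sum_squares_bound[of "cmod a" "cmod b"] by (simp add: power2_sum)
    finally show ?thesis .
  qed
  have "(\<Sum>n\<in>A. (cmod (f n + g n))\<^sup>2) \<le> (\<Sum>n\<in>A. 2 * (cmod (f n))\<^sup>2 + 2 * (cmod (g n))\<^sup>2)" by (intro sum_mono pt)
  also have "\<dots> = 2 * (\<Sum>n\<in>A. (cmod (f n))\<^sup>2) + 2 * (\<Sum>n\<in>A. (cmod (g n))\<^sup>2)"
    by (simp add: sum.distrib sum_distrib_left)
  also have "\<dots> \<le> 2 * (\<Sum>\<^sub>\<infinity>n. (cmod (f n))\<^sup>2) + 2 * (\<Sum>\<^sub>\<infinity>n. (cmod (g n))\<^sup>2)"
    using ell2_bound[OF assms(1) A] ell2_bound[OF assms(2) A] by linarith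
  finally show "(\<Sum>n\<in>A. (cmod (f n + g n))\<^sup>2) \<le> \<dots>" .
qed

lemma ell2_cmult:
  assumes "f \<in> ell 2" shows "(\<lambda>n. c * f n) \<in> ell 2"
  using assms unfolding ell2_iff by (simp add: norm_mult power_mult_distrib summable_on_cmult_right)

lemma ell2_shift:
  fixes f :: "'a::ab_group_add \<Rightarrow> complex"
  assumes "f \<in> ell 2" shows "(\<lambda>n. f (n + a)) \<in> ell 2"
proof (rule ell2I)
  fix A :: "'a set" assume "finite A"
  then have "(\<Sum>n\<in>(\<lambda>n. n + a) ` A. (cmod (f n))\<^sup>2) \<le> (\<Sum>\<^sub>\<infinity>n. (cmod (f n))\<^sup>2)"
    using assms by (intro ell2_bound) auto
  then show "(\<Sum>n\<in>A. (cmod (f (n + a)))\<^sup>2) \<le> (\<Sum>\<^sub>\<infinity>n. (cmod (f n))\<^sup>2)"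
    by (simp add: sum.reindex inj_on_def)
qed

lemma ell2_sum:
  assumes "finite J" "\<And>j. j \<in> J \<Longrightarrow> f j \<in> ell 2" shows "(\<lambda>n. \<Sum>j\<in>J. f j n) \<in> ell 2"
  using assms
proof (induction J)
  case empty then show ?case by (intro ell2I[where K = 0]) auto
next
  case (insert j J)
  show ?case unfolding sum.insert[OF insert(1,2)] by (rule ell2_add) (use insert in blast)+
qed

lemma has_fourier_sum:
  assumes "finite J" "\<And>j. j \<in> J \<Longrightarrow> has_fourier (f j) (F j)"
  shows "has_fourier (\<lambda>n. \<Sum>j\<in>J. f j n) (\<lambda>\<xi>. \<Sum>j\<in>J. F j \<xi>)"
  using assms
proof (induction J)
  case empty then show ?case by (auto simp: has_fourier_iff L2_sq_def trig_sum_def)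
next
  case (insert j J) then show ?case by (auto intro!: has_fourier_add)
qed

text \<open>
  Along finite sets \<open>X k\<close> whose complements carry at most \<open>(1/4) ^ k\<close> of the square sum, consecutive partial sums differ
  by a summable amount in \<open>L\<^sup>1\<close>; hence they converge almost everywhere, and Fatou's lemma bounds the
  \<open>L\<^sup>2\<close> distance of the limit to every partial sum over a set containing \<open>X j\<close>.
\<close>
lemma riesz_fischer:
  fixes f :: "int ^ 'd::finite \<Rightarrow> complex"
  assumes f: "f \<in> ell 2"
  shows "\<exists>F. has_fourier f F"
proof -
  have "\<forall>k::nat. \<exists>X. finite X \<and> (\<forall>B. finite B \<longrightarrow> B \<inter> X = {} \<longrightarrow> (\<Sum>n\<in>B. (cmod (f n))\<^sup>2) \<le> (1/4) ^ k)"
    by (intro allI ell2_tail[OF f]) auto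
  then obtain X where X: "\<And>k. finite (X k)"
      "\<And>k B. finite B \<Longrightarrow> B \<inter> X k = {} \<Longrightarrow> (\<Sum>n\<in>B. (cmod (f n))\<^sup>2) \<le> (1/4) ^ k"
    by metis
  have diff: "L2_sq (\<lambda>\<xi>. trig_sum (X k) f \<xi> - trig_sum A f \<xi>) \<le> ennreal (2 * (1/4) ^ j)"
    if "finite A" "X j \<subseteq> A \<or> (\<exists>i\<ge>j. A = X i)" "j \<le> k" for j k A
  proof -
    let ?D = "(X k - A) \<union> (A - X k)"
    define h where "h = (\<lambda>n. if n \<in> A then - f n else f n)"
    have h: "cmod (h n) = cmod (f n)" for n by (simp add: h_def)
    have "trig_sum (X k) f \<xi> - trig_sum A f \<xi> = trig_sum ?D h \<xi>" for \<xi>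
    proof -
      have 1: "trig_sum (X k) f \<xi> = trig_sum (X k - A) f \<xi> + trig_sum (X k \<inter> A) f \<xi>"
        unfolding trig_sum_def using X(1)[of k] by (subst sum.union_disjoint[symmetric]) (auto intro: sum.cong simp: Un_commute Int_Diff_Un)
      have 2: "trig_sum A f \<xi> = trig_sum (A - X k) f \<xi> + trig_sum (X k \<inter> A) f \<xi>"
        unfolding trig_sum_def using that X(1)[of k] by (subst sum.union_disjoint[symmetric]) (auto intro!: sum.cong)
      have "trig_sum ?D h \<xi> = trig_sum (X k - A) h \<xi> + trig_sum (A - X k) h \<xi>"
        unfolding trig_sum_def using that X(1)[of k] by (subst sum.union_disjoint) auto
      also have "trig_sum (X k - A) h \<xi> = trig_sum (X k - A) f \<xi>"
        unfolding trig_sum_def by (intro sum.cong) (auto simp: h_def)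
      also have "trig_sum (A - X k) h \<xi> = - trig_sum (A - X k) f \<xi>"
        unfolding trig_sum_def by (subst sum_negf[symmetric], intro sum.cong) (auto simp: h_def)
      finally show ?thesis using 1 2 by simp
    qed
    then have eq: "L2_sq (\<lambda>\<xi>. trig_sum (X k) f \<xi> - trig_sum A f \<xi>) = ennreal (\<Sum>n\<in>?D. (cmod (h n))\<^sup>2)"
      using that X(1)[of k] by (simp add: L2_sq_trig_sum)
    have "(\<Sum>n\<in>?D. (cmod (h n))\<^sup>2) = (\<Sum>n\<in>X k - A. (cmod (f n))\<^sup>2) + (\<Sum>n\<in>A - X k. (cmod (f n))\<^sup>2)"
      using that X(1)[of k] by (subst sum.union_disjoint) (auto simp: h)
    also have "\<dots> \<le> (1/4) ^ j + (1/4) ^ j"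
    proof (rule add_mono)
      have p: "(1/4 :: real) ^ i \<le> (1/4) ^ j" if "j \<le> i" for i using that by (intro power_decreasing) auto
      show "(\<Sum>n\<in>A - X k. (cmod (f n))\<^sup>2) \<le> (1/4) ^ j"
        by (rule order_trans[OF X(2) p[OF that(3)]]) (use that in auto)
      from that(2) show "(\<Sum>n\<in>X k - A. (cmod (f n))\<^sup>2) \<le> (1/4) ^ j"
      proof
        assume "X j \<subseteq> A" then show ?thesis using X(1)[of k] by (intro X(2)) auto
      next
        assume "\<exists>i\<ge>j. A = X i"
        then obtain i where "j \<le> i" "A = X i" by auto
        then show ?thesis using X(1)[of k] by (intro order_trans[OF X(2) p[of i]]) auto
      qed
    qed
    finally show ?thesis unfolding eq by (intro ennreal_leI) simp
  qed
  define D where "D = (\<lambda>k \<xi>. trig_sum (X (Suc k)) f \<xi> - trig_sum (X k) f \<xi>)"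
  have Dm [measurable]: "D k \<in> borel_measurable torus_measure" for k unfolding D_def by measurable
  have Dint: "(\<integral>\<^sup>+\<xi>. ennreal (cmod (D k \<xi>)) \<partial>torus_measure) \<le> ennreal (3 * (1/2) ^ k)" for k
  proof -
    \<comment> \<open>Trades the square bound \<open>(1/4) ^ k\<close> for a bound of order \<open>(1/2) ^ k\<close> in \<open>L\<^sup>1\<close>; the torus has mass one.\<close>
    have pt: "x \<le> 2 ^ k * x\<^sup>2 + (1/2) ^ k" if "0 \<le> x" for x :: real
    proof -
      have "0 \<le> (2 ^ k * x - 1)\<^sup>2 + 2 ^ k * x" using that by simp
      then have "2 ^ k * x \<le> (2 ^ k * x)\<^sup>2 + 1" by (simp only: power2_diff power_one mult_1_right)
      also have "\<dots> = 2 ^ k * (2 ^ k * x\<^sup>2 + (1/2) ^ k)"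
        by (simp add: power_mult_distrib distrib_left power2_eq_square power_one_over)
      finally show ?thesis by (rule mult_left_le_imp_le) simp
    qed
    have "(\<integral>\<^sup>+\<xi>. ennreal (cmod (D k \<xi>)) \<partial>torus_measure) \<le> (\<integral>\<^sup>+\<xi>. ennreal (2 ^ k) * ennreal ((cmod (D k \<xi>))\<^sup>2) + ennreal ((1/2) ^ k) \<partial>torus_measure)"
      by (intro nn_integral_mono) (simp add: ennreal_mult[symmetric] ennreal_plus[symmetric] pt ennreal_leI del: ennreal_plus)
    also have "\<dots> = ennreal (2 ^ k) * L2_sq (D k) + ennreal ((1/2) ^ k)"
      by (simp add: nn_integral_add nn_integral_cmult L2_sq_def prob_torus)
    also have "\<dots> \<le> ennreal (2 ^ k) * ennreal (2 * (1/4) ^ k) + ennreal ((1/2) ^ k)"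
      unfolding D_def by (intro add_mono mult_left_mono diff X) auto
    also have "\<dots> = ennreal (2 ^ k * (2 * (1/4) ^ k) + (1/2) ^ k)"
      by (simp add: ennreal_mult[symmetric] ennreal_plus[symmetric] del: ennreal_plus)
    also have "2 ^ k * (2 * (1/4) ^ k) + (1/2) ^ k = 3 * (1/2 :: real) ^ k"
    proof -
      have "2 ^ k * (1/4) ^ k = (1/2 :: real) ^ k" by (simp flip: power_mult_distrib)
      then show ?thesis by (simp add: mult.left_commute)
    qed
    finally show ?thesis .
  qed
  have "(\<integral>\<^sup>+\<xi>. (\<Sum>k. ennreal (cmod (D k \<xi>))) \<partial>torus_measure) = (\<Sum>k. \<integral>\<^sup>+\<xi>. ennreal (cmod (D k \<xi>)) \<partial>torus_measure)"
    by (intro nn_integral_suminf) measurable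
  also have "\<dots> \<le> (\<Sum>k. ennreal (3 * (1/2) ^ k))"
    by (intro suminf_le Dint) auto
  also have "\<dots> = ennreal (\<Sum>k. 3 * (1/2) ^ k)"
    by (intro suminf_ennreal2) (auto intro!: summable_mult summable_geometric)
  finally have "(\<integral>\<^sup>+\<xi>. (\<Sum>k. ennreal (cmod (D k \<xi>))) \<partial>torus_measure) \<noteq> \<infinity>"
    by (auto simp: top_unique)
  then have "AE \<xi> in torus_measure. (\<Sum>k. ennreal (cmod (D k \<xi>))) \<noteq> \<infinity>"
    by (intro nn_integral_PInf_AE) auto
  then have conv: "AE \<xi> in torus_measure. convergent (\<lambda>k. trig_sum (X k) f \<xi>)"
  proof eventually_elim
    fix \<xi> assume "(\<Sum>k. ennreal (cmod (D k \<xi>))) \<noteq> \<infinity>"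
    then have "summable (\<lambda>k. cmod (D k \<xi>))" by (intro summable_suminf_not_top) auto
    then have "summable (\<lambda>k. D k \<xi>)" by (rule summable_norm_cancel)
    then have "summable (\<lambda>k. trig_sum (X (Suc k)) f \<xi> - trig_sum (X k) f \<xi>)" by (simp add: D_def)
    then have "convergent (\<lambda>k. trig_sum (X k) f \<xi> - trig_sum (X 0) f \<xi>)"
      unfolding summable_iff_convergent by (simp only: sum_lessThan_telescope[of "\<lambda>k. trig_sum (X k) f \<xi>"])
    then show "convergent (\<lambda>k. trig_sum (X k) f \<xi>)" by (simp only: convergent_diff_const_right_iff)
  qed
  define F where "F = (\<lambda>\<xi>. lim (\<lambda>k. trig_sum (X k) f \<xi>))"
  have Fm [measurable]: "F \<in> borel_measurable torus_measure"
    unfolding F_def by (intro borel_measurable_lim_metric) measurable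
  have bound: "L2_sq (\<lambda>\<xi>. F \<xi> - trig_sum A f \<xi>) \<le> ennreal (2 * (1/4) ^ j)" if "finite A" "X j \<subseteq> A" for A j
  proof -
    have "L2_sq (\<lambda>\<xi>. F \<xi> - trig_sum A f \<xi>) = (\<integral>\<^sup>+\<xi>. liminf (\<lambda>k. ennreal ((cmod (trig_sum (X k) f \<xi> - trig_sum A f \<xi>))\<^sup>2)) \<partial>torus_measure)"
      unfolding L2_sq_def
    proof (rule nn_integral_cong_AE, use conv in eventually_elim)
      fix \<xi> assume "convergent (\<lambda>k. trig_sum (X k) f \<xi>)"
      then have "(\<lambda>k. trig_sum (X k) f \<xi>) \<longlonglongrightarrow> F \<xi>" by (simp add: F_def convergent_LIMSEQ_iff)
      then have "(\<lambda>k. ennreal ((cmod (trig_sum (X k) f \<xi> - trig_sum A f \<xi>))\<^sup>2)) \<longlonglongrightarrow> ennreal ((cmod (F \<xi> - trig_sum A f \<xi>))\<^sup>2)"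
        by (intro tendsto_intros) auto
      then show "ennreal ((cmod (F \<xi> - trig_sum A f \<xi>))\<^sup>2) = liminf (\<lambda>k. ennreal ((cmod (trig_sum (X k) f \<xi> - trig_sum A f \<xi>))\<^sup>2))"
        by (rule lim_imp_Liminf[OF trivial_limit_sequentially, symmetric])
    qed
    also have "\<dots> \<le> liminf (\<lambda>k. L2_sq (\<lambda>\<xi>. trig_sum (X k) f \<xi> - trig_sum A f \<xi>))"
      unfolding L2_sq_def by (rule nn_integral_liminf) measurable
    also have "\<dots> \<le> liminf (\<lambda>k. ennreal (2 * (1/4) ^ j))"
      by (intro Liminf_mono) (use that in \<open>auto simp: eventually_sequentially intro!: exI[of _ j] diff\<close>)
    also have "\<dots> = ennreal (2 * (1/4) ^ j)" by (simp add: Liminf_const)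
    finally show ?thesis .
  qed
  have "((\<lambda>A. L2_sq (\<lambda>\<xi>. F \<xi> - trig_sum A f \<xi>)) \<longlongrightarrow> 0) (finite_subsets_at_top UNIV)"
  proof (rule order_tendstoI)
    fix a :: ennreal assume "0 < a"
    have "(\<lambda>j. 2 * (1/4) ^ j :: real) \<longlonglongrightarrow> 2 * 0" by (intro tendsto_intros) auto
    then have "(\<lambda>j. ennreal (2 * (1/4) ^ j)) \<longlonglongrightarrow> ennreal (2 * 0)" by (rule tendsto_ennrealI)
    then have "\<forall>\<^sub>F j in sequentially. ennreal (2 * (1/4) ^ j) < a" using \<open>0 < a\<close> by (intro order_tendstoD) auto
    then obtain j where j: "ennreal (2 * (1/4) ^ j) < a" by (auto simp: eventually_sequentially)
    show "\<forall>\<^sub>F A in finite_subsets_at_top UNIV. L2_sq (\<lambda>\<xi>. F \<xi> - trig_sum A f \<xi>) < a"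
      unfolding eventually_finite_subsets_at_top
      by (intro exI[of _ "X j"]) (use X(1) le_less_trans[OF bound j] in auto)
  qed simp
  then show ?thesis by (intro exI[of _ F]) (simp add: has_fourier_iff)
qed

section \<open>The free resolvent as a convolution\<close>

lemma h0_eq_character:
  "complex_of_real (h0 \<xi>) = (\<Sum>j\<in>UNIV. 2 - character (axis j 1) \<xi> - character (- axis j 1) \<xi>)"
proof -
  have pt: "complex_of_real (4 * (sin (pi * x))\<^sup>2) = 2 - cis (2 * pi * x) - cnj (cis (2 * pi * x))" for x :: real
  proof -
    have "cos (2 * pi * x) = 1 - 2 * (sin (pi * x))\<^sup>2" using cos_double_sin[of "pi * x"] by (simp add: mult.assoc)
    then show ?thesis by (simp add: complex_eq_iff)
  qed
  have "complex_of_real (h0 \<xi>) = (\<Sum>j\<in>UNIV. complex_of_real (4 * (sin (pi * \<xi> $ j))\<^sup>2))"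
    by (simp only: h0_def sum_distrib_left of_real_sum)
  then show ?thesis by (simp only: pt character_axis character_minus)
qed

lemma h0_measurable [measurable]: "h0 \<in> borel_measurable borel"
  unfolding h0_def[abs_def] by (intro borel_measurable_continuous_onI continuous_intros)

lemma h0_continuous: "continuous_on S h0"
  unfolding h0_def[abs_def] by (intro continuous_intros)

lemma h0_nonneg: "0 \<le> h0 \<xi>" by (simp add: h0_def sum_nonneg)

lemma h0_le: "h0 (\<xi> :: real ^ 'd::finite) \<le> 4 * CARD('d)"
proof -
  have "(\<Sum>j\<in>UNIV. (sin (pi * \<xi> $ j))\<^sup>2) \<le> (\<Sum>j\<in>(UNIV :: 'd set). 1)"
    by (intro sum_mono) (simp add: abs_square_le_1)
  then show ?thesis by (simp add: h0_def)
qed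

text \<open>
  The difference operator with symbol \<open>h0\<close>, defined on all functions.
\<close>
definition discrete_laplacian :: "(int ^ 'd \<Rightarrow> complex) \<Rightarrow> int ^ 'd \<Rightarrow> complex" where
  "discrete_laplacian u n = (\<Sum>j\<in>UNIV. 2 * u n - u (n + axis j 1) - u (n - axis j 1))"

lemma ell2_discrete_laplacian:
  fixes u :: "int ^ 'd::finite \<Rightarrow> complex"
  assumes "u \<in> ell 2" shows "discrete_laplacian u \<in> ell 2"
proof -
  have "(\<lambda>n. 2 * u n + ((- 1) * u (n + axis j 1) + (- 1) * u (n + - axis j 1))) \<in> ell 2" for j
    using assms by (intro ell2_add ell2_cmult ell2_shift)
  from ell2_sum[OF finite_class.finite_UNIV this]
  have "(\<lambda>n. \<Sum>j\<in>UNIV. 2 * u n + ((- 1) * u (n + axis j 1) + (- 1) * u (n + - axis j 1))) \<in> ell 2" .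
  moreover have "discrete_laplacian u = (\<lambda>n. \<Sum>j\<in>UNIV. 2 * u n + ((- 1) * u (n + axis j 1) + (- 1) * u (n + - axis j 1)))"
    by (simp add: discrete_laplacian_def fun_eq_iff algebra_simps)
  ultimately show ?thesis by simp
qed

lemma has_fourier_discrete_laplacian:
  fixes u :: "int ^ 'd::finite \<Rightarrow> complex"
  assumes "has_fourier u F" shows "has_fourier (discrete_laplacian u) (\<lambda>\<xi>. of_real (h0 \<xi>) * F \<xi>)"
proof -
  have "has_fourier (\<lambda>n. 2 * u n + ((- 1) * u (n + axis j 1) + (- 1) * u (n + - axis j 1)))
     (\<lambda>\<xi>. 2 * F \<xi> + ((- 1) * (character (axis j 1) \<xi> * F \<xi>) + (- 1) * (character (- axis j 1) \<xi> * F \<xi>)))" for j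
    using assms by (intro has_fourier_add has_fourier_cmult has_fourier_shift)
  from has_fourier_sum[OF finite_class.finite_UNIV this]
  have "has_fourier (\<lambda>n. \<Sum>j\<in>UNIV. 2 * u n + ((- 1) * u (n + axis j 1) + (- 1) * u (n + - axis j 1)))
     (\<lambda>\<xi>. \<Sum>j\<in>UNIV. 2 * F \<xi> + ((- 1) * (character (axis j 1) \<xi> * F \<xi>) + (- 1) * (character (- axis j 1) \<xi> * F \<xi>)))" .
  moreover have "discrete_laplacian u = (\<lambda>n. \<Sum>j\<in>UNIV. 2 * u n + ((- 1) * u (n + axis j 1) + (- 1) * u (n + - axis j 1)))"
    by (simp add: discrete_laplacian_def fun_eq_iff algebra_simps)
  moreover have "(\<Sum>j\<in>UNIV. 2 * F \<xi> + ((- 1) * (character (axis j 1) \<xi> * F \<xi>) + (- 1) * (character (- axis j 1) \<xi> * F \<xi>)))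
     = of_real (h0 \<xi>) * F \<xi>" for \<xi>
    unfolding h0_eq_character sum_distrib_right by (intro sum.cong refl) (simp add: algebra_simps)
  ultimately show ?thesis by simp
qed

text \<open>
  The definite description in the definition of the multiplier is resolved here: existence needs some
  \<open>F\<close> with Fourier coefficients \<open>u\<close>, uniqueness needs that \<open>F\<close> is determined up to null sets.
\<close>
lemma H0_eq_discrete_laplacian:
  fixes u :: "int ^ 'd::finite \<Rightarrow> complex"
  assumes "u \<in> ell 2" shows "H0 u = discrete_laplacian u"
  unfolding H0_def fourier_multiplier_def
proof (rule the_equality)
  obtain F where F: "has_fourier u F" using riesz_fischer[OF assms] by blast
  then show "discrete_laplacian u \<in> ell 2 \<and> (\<exists>F. has_fourier u F \<and> has_fourier (discrete_laplacian u) (\<lambda>\<xi>. complex_of_real (h0 \<xi>) * F \<xi>))"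
    using ell2_discrete_laplacian[OF assms] has_fourier_discrete_laplacian by blast
  fix g assume "g \<in> ell 2 \<and> (\<exists>F. has_fourier u F \<and> has_fourier g (\<lambda>\<xi>. complex_of_real (h0 \<xi>) * F \<xi>))"
  then obtain G where G: "has_fourier u G" "has_fourier g (\<lambda>\<xi>. complex_of_real (h0 \<xi>) * G \<xi>)" by blast
  have "has_fourier (\<lambda>n. u n + (- 1) * u n) (\<lambda>\<xi>. F \<xi> + (- 1) * G \<xi>)"
    by (intro has_fourier_add has_fourier_cmult F G)
  then have ae: "AE \<xi> in torus_measure. F \<xi> + (- 1) * G \<xi> = 0"
    by (intro fourier_zero_unique) simp
  have "has_fourier (\<lambda>n. g n + (- 1) * discrete_laplacian u n) (\<lambda>\<xi>. complex_of_real (h0 \<xi>) * G \<xi> + (- 1) * (complex_of_real (h0 \<xi>) * F \<xi>))"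
    by (intro has_fourier_add has_fourier_cmult has_fourier_discrete_laplacian F G)
  moreover have "AE \<xi> in torus_measure. complex_of_real (h0 \<xi>) * G \<xi> + (- 1) * (complex_of_real (h0 \<xi>) * F \<xi>) = 0"
    using ae by eventually_elim simp
  ultimately have "g n + (- 1) * discrete_laplacian u n = 0" for n by (rule fourier_of_null)
  then show "g = discrete_laplacian u" by (auto simp: fun_eq_iff)
qed

definition resolvent_symbol :: "complex \<Rightarrow> real ^ 'd \<Rightarrow> complex" where
  "resolvent_symbol z \<xi> = 1 / (of_real (h0 \<xi>) - z)"

definition resolvent_kernel :: "complex \<Rightarrow> int ^ 'd \<Rightarrow> complex" where
  "resolvent_kernel z k = (\<integral>\<xi>. resolvent_symbol z \<xi> * character k \<xi> \<partial>torus_measure)"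

lemma resolvent_symbol_measurable [measurable]: "resolvent_symbol z \<in> borel_measurable borel"
  unfolding resolvent_symbol_def[abs_def] by measurable

lemma h0_minus_nz: "Im z \<noteq> 0 \<Longrightarrow> of_real (h0 \<xi>) - z \<noteq> 0"
  by (auto simp: complex_eq_iff)

lemma norm_resolvent_symbol: "Im z \<noteq> 0 \<Longrightarrow> cmod (resolvent_symbol z \<xi>) \<le> 1 / \<bar>Im z\<bar>"
  using abs_Im_le_cmod[of "of_real (h0 \<xi>) - z"] by (simp add: resolvent_symbol_def norm_divide frac_le)

lemma resolvent_kernel_integrable:
  assumes "Im z \<noteq> 0"
  shows "integrable torus_measure (\<lambda>\<xi>. resolvent_symbol z \<xi> * character k (\<xi> :: real ^ 'd::finite))"
  using norm_resolvent_symbol[OF assms] by (intro torus_integrable[where B = "1 / \<bar>Im z\<bar>"]) (auto simp: norm_mult)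

text \<open>
  The kernel is the fundamental solution of \<open>H0 - z\<close>.
\<close>
lemma resolvent_kernel_equation:
  fixes k :: "int ^ 'd::finite"
  assumes z: "Im z \<noteq> 0"
  shows "discrete_laplacian (resolvent_kernel z) k - z * resolvent_kernel z k = (if k = 0 then 1 else 0)"
proof -
  note int = resolvent_kernel_integrable[OF z]
  have "discrete_laplacian (resolvent_kernel z) k - z * resolvent_kernel z k
     = (\<integral>\<xi>. (\<Sum>j\<in>UNIV. 2 * (resolvent_symbol z \<xi> * character k \<xi>) - resolvent_symbol z \<xi> * character (k + axis j 1) \<xi> - resolvent_symbol z \<xi> * character (k - axis j 1) \<xi>)
        - z * (resolvent_symbol z \<xi> * character k \<xi>) \<partial>torus_measure)"
    unfolding discrete_laplacian_def resolvent_kernel_def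
    by (subst Bochner_Integration.integral_diff Bochner_Integration.integral_sum integral_mult_right_zero
      | intro Bochner_Integration.integrable_diff Bochner_Integration.integrable_sum integrable_mult_right int sum.cong refl arg_cong2[of _ _ _ _ "(-)"])+
  also have "\<dots> = (\<integral>\<xi>. character k \<xi> \<partial>torus_measure)"
  proof (intro Bochner_Integration.integral_cong refl)
    fix \<xi> :: "real ^ 'd"
    have "(\<Sum>j\<in>UNIV. 2 * (resolvent_symbol z \<xi> * character k \<xi>) - resolvent_symbol z \<xi> * character (k + axis j 1) \<xi> - resolvent_symbol z \<xi> * character (k - axis j 1) \<xi>)
        = of_real (h0 \<xi>) * (resolvent_symbol z \<xi> * character k \<xi>)"
      unfolding h0_eq_character sum_distrib_right
      by (intro sum.cong refl) (simp add: character_add character_diff character_minus algebra_simps)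
    then have "(\<Sum>j\<in>UNIV. 2 * (resolvent_symbol z \<xi> * character k \<xi>) - resolvent_symbol z \<xi> * character (k + axis j 1) \<xi> - resolvent_symbol z \<xi> * character (k - axis j 1) \<xi>)
        - z * (resolvent_symbol z \<xi> * character k \<xi>) = (of_real (h0 \<xi>) - z) * resolvent_symbol z \<xi> * character k \<xi>"
      by (simp add: algebra_simps)
    also have "\<dots> = character k \<xi>" using h0_minus_nz[OF z, of \<xi>] by (simp add: resolvent_symbol_def)
    finally show "(\<Sum>j\<in>UNIV. 2 * (resolvent_symbol z \<xi> * character k \<xi>) - resolvent_symbol z \<xi> * character (k + axis j 1) \<xi> - resolvent_symbol z \<xi> * character (k - axis j 1) \<xi>)
        - z * (resolvent_symbol z \<xi> * character k \<xi>) = character k \<xi>" .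
  qed
  finally show ?thesis by (simp add: torus_orthonormal)
qed

lemma cnj_trig_sum_measurable [measurable]: "(\<lambda>\<xi>. cnj (trig_sum A f \<xi>)) \<in> borel_measurable borel"
  by (intro borel_measurable_continuous_onI continuous_intros trig_sum_continuous)

text \<open>
  The projection of \<open>G\<close> to the span of finitely many characters has norm at most that of \<open>G\<close>.
\<close>
lemma bessel_inequality:
  fixes G :: "real ^ 'd::finite \<Rightarrow> complex"
  assumes [measurable]: "G \<in> borel_measurable borel" and bd: "\<And>\<xi>. cmod (G \<xi>) \<le> B" and "finite A"
  shows "(\<Sum>n\<in>A. (cmod (\<integral>\<xi>. G \<xi> * character n \<xi> \<partial>torus_measure))\<^sup>2) \<le> (\<integral>\<xi>. (cmod (G \<xi>))\<^sup>2 \<partial>torus_measure)"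
proof -
  define c where "c = (\<lambda>n. \<integral>\<xi>. G \<xi> * character n \<xi> \<partial>torus_measure)"
  have B: "0 \<le> B" using bd[of 0] norm_ge_zero order_trans by blast
  have Q: "cmod (trig_sum A c \<xi>) \<le> (\<Sum>n\<in>A. cmod (c n))" for \<xi> by (rule norm_trig_sum_le)
  let ?Q = "\<Sum>n\<in>A. cmod (c n)"
  have i1: "integrable torus_measure (\<lambda>\<xi>. (cmod (G \<xi>))\<^sup>2)"
    using bd by (intro torus_integrable[where B = "B\<^sup>2"]) (auto intro: power_mono)
  have i2: "integrable torus_measure (\<lambda>\<xi>. (cmod (trig_sum A c \<xi>))\<^sup>2)"
    using Q by (intro torus_integrable[where B = "?Q\<^sup>2"]) (auto intro: power_mono)
  have i3: "integrable torus_measure (\<lambda>\<xi>. G \<xi> * cnj (trig_sum A c \<xi>))"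
    using Q bd B by (intro torus_integrable[where B = "B * ?Q"]) (auto simp: norm_mult intro!: mult_mono)
  have i4: "integrable torus_measure (\<lambda>\<xi>. G \<xi> * character n \<xi>)" for n
    using bd by (intro torus_integrable[where B = B]) (auto simp: norm_mult)
  have "(\<integral>\<xi>. G \<xi> * cnj (trig_sum A c \<xi>) \<partial>torus_measure) = (\<integral>\<xi>. (\<Sum>n\<in>A. cnj (c n) * (G \<xi> * character n \<xi>)) \<partial>torus_measure)"
    by (intro Bochner_Integration.integral_cong refl) (simp add: trig_sum_def sum_distrib_left character_minus mult_ac)
  also have "\<dots> = (\<Sum>n\<in>A. cnj (c n) * c n)"
    unfolding c_def by (subst Bochner_Integration.integral_sum) (auto intro!: integrable_mult_right i4)
  also have "\<dots> = of_real (\<Sum>n\<in>A. (cmod (c n))\<^sup>2)"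
    by (simp only: of_real_sum complex_norm_square mult.commute)
  finally have cross: "Re (\<integral>\<xi>. G \<xi> * cnj (trig_sum A c \<xi>) \<partial>torus_measure) = (\<Sum>n\<in>A. (cmod (c n))\<^sup>2)" by simp
  have "0 \<le> (\<integral>\<xi>. (cmod (G \<xi> - trig_sum A c \<xi>))\<^sup>2 \<partial>torus_measure)" by (intro integral_nonneg_AE) auto
  also have "\<dots> = (\<integral>\<xi>. (cmod (G \<xi>))\<^sup>2 + (cmod (trig_sum A c \<xi>))\<^sup>2 - 2 * Re (G \<xi> * cnj (trig_sum A c \<xi>)) \<partial>torus_measure)"
    by (intro Bochner_Integration.integral_cong refl) (simp add: cmod_power2 power2_diff algebra_simps)
  also have "\<dots> = (\<integral>\<xi>. (cmod (G \<xi>))\<^sup>2 \<partial>torus_measure) + (\<integral>\<xi>. (cmod (trig_sum A c \<xi>))\<^sup>2 \<partial>torus_measure) - 2 * (\<integral>\<xi>. Re (G \<xi> * cnj (trig_sum A c \<xi>)) \<partial>torus_measure)"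
  proof -
    have "(\<integral>\<xi>. a \<xi> + b \<xi> - 2 * c \<xi> \<partial>torus_measure) = (\<integral>\<xi>. a \<xi> \<partial>torus_measure) + (\<integral>\<xi>. b \<xi> \<partial>torus_measure) - 2 * (\<integral>\<xi>. c \<xi> \<partial>torus_measure)"
      if "integrable torus_measure a" "integrable torus_measure b" "integrable torus_measure c" for a b c :: "real ^ 'd \<Rightarrow> real"
      using that by simp
    from this[OF i1 i2 integrable_Re[OF i3]] show ?thesis .
  qed
  also have "(\<integral>\<xi>. Re (G \<xi> * cnj (trig_sum A c \<xi>)) \<partial>torus_measure) = Re (\<integral>\<xi>. G \<xi> * cnj (trig_sum A c \<xi>) \<partial>torus_measure)"
    by (rule integral_Re[OF i3])
  finally show ?thesis using cross parseval[OF \<open>finite A\<close>, of c] unfolding c_def by simp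
qed

text \<open>
  The convolution with \<open>f\<close> consists of the Fourier coefficients of the symbol times the series of \<open>f\<close>, so Bessel's inequality
  and the bound \<open>1 / \<bar>Im z\<bar>\<close> for the symbol apply.
\<close>
lemma resolvent_kernel_convolution_ell2:
  fixes f :: "int ^ 'd::finite \<Rightarrow> complex"
  assumes z: "Im z \<noteq> 0" and fin: "finite A" "finite B"
  shows "(\<Sum>n\<in>B. (cmod (\<Sum>m\<in>A. f m * resolvent_kernel z (n - m)))\<^sup>2) \<le> (1 / \<bar>Im z\<bar>)\<^sup>2 * (\<Sum>m\<in>A. (cmod (f m))\<^sup>2)"
proof -
  let ?G = "\<lambda>\<xi>. resolvent_symbol z \<xi> * trig_sum A f \<xi>"
  have bd: "cmod (?G \<xi>) \<le> 1 / \<bar>Im z\<bar> * (\<Sum>n\<in>A. cmod (f n))" for \<xi>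
    unfolding norm_mult using z by (intro mult_mono norm_resolvent_symbol norm_trig_sum_le) auto
  have "(\<Sum>m\<in>A. f m * resolvent_kernel z (n - m)) = (\<integral>\<xi>. ?G \<xi> * character n \<xi> \<partial>torus_measure)" for n
  proof -
    have "(\<integral>\<xi>. ?G \<xi> * character n \<xi> \<partial>torus_measure) = (\<integral>\<xi>. (\<Sum>m\<in>A. f m * (resolvent_symbol z \<xi> * character (n - m) \<xi>)) \<partial>torus_measure)"
      by (intro Bochner_Integration.integral_cong refl) (simp add: trig_sum_def sum_distrib_left sum_distrib_right character_diff character_minus mult_ac)
    also have "\<dots> = (\<Sum>m\<in>A. f m * resolvent_kernel z (n - m))"
      unfolding resolvent_kernel_def by (subst Bochner_Integration.integral_sum) (auto intro!: integrable_mult_right resolvent_kernel_integrable z)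
    finally show ?thesis by simp
  qed
  then have "(\<Sum>n\<in>B. (cmod (\<Sum>m\<in>A. f m * resolvent_kernel z (n - m)))\<^sup>2) \<le> (\<integral>\<xi>. (cmod (?G \<xi>))\<^sup>2 \<partial>torus_measure)"
    using bessel_inequality[of ?G, OF _ bd fin(2)] by simp
  also have "\<dots> \<le> (\<integral>\<xi>. (1 / \<bar>Im z\<bar>)\<^sup>2 * (cmod (trig_sum A f \<xi>))\<^sup>2 \<partial>torus_measure)"
  proof (rule integral_mono)
    show "integrable torus_measure (\<lambda>\<xi>. (cmod (?G \<xi>))\<^sup>2)"
      using bd by (intro torus_integrable[where B = "(1 / \<bar>Im z\<bar> * (\<Sum>n\<in>A. cmod (f n)))\<^sup>2"]) (auto simp del: norm_mult intro!: power_mono)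
    show "integrable torus_measure (\<lambda>\<xi>. (1 / \<bar>Im z\<bar>)\<^sup>2 * (cmod (trig_sum A f \<xi>))\<^sup>2)"
      using norm_trig_sum_le[of A f] by (intro integrable_mult_right torus_integrable[where B = "(\<Sum>n\<in>A. cmod (f n))\<^sup>2"]) (auto intro!: power_mono)
    show "(cmod (?G \<xi>))\<^sup>2 \<le> (1 / \<bar>Im z\<bar>)\<^sup>2 * (cmod (trig_sum A f \<xi>))\<^sup>2" for \<xi>
      unfolding norm_mult power_mult_distrib using z by (intro mult_right_mono power_mono norm_resolvent_symbol) auto
  qed
  also have "\<dots> = (1 / \<bar>Im z\<bar>)\<^sup>2 * (\<Sum>m\<in>A. (cmod (f m))\<^sup>2)"
    using parseval[OF fin(1), of f] by (simp add: integral_mult_right_zero)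
  finally show ?thesis .
qed

lemma resolvent_kernel_ell2:
  assumes z: "Im z \<noteq> 0" shows "(resolvent_kernel z :: int ^ 'd::finite \<Rightarrow> complex) \<in> ell 2"
proof (rule ell2I)
  fix B :: "(int ^ 'd) set" assume "finite B"
  from resolvent_kernel_convolution_ell2[OF z finite.insertI[OF finite.emptyI, of 0] this, of "\<lambda>_. 1"]
  show "(\<Sum>n\<in>B. (cmod (resolvent_kernel z n))\<^sup>2) \<le> (1 / \<bar>Im z\<bar>)\<^sup>2" by simp
qed

lemma resolvent_series_summable:
  fixes f :: "int ^ 'd::finite \<Rightarrow> complex"
  assumes z: "Im z \<noteq> 0" and f: "f \<in> ell 2"
  shows "(\<lambda>m. f m * resolvent_kernel z (n - m)) summable_on UNIV"
proof (rule abs_summable_summable)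
  show "(\<lambda>m. norm (f m * resolvent_kernel z (n - m))) summable_on UNIV"
  proof (rule nonneg_bdd_above_summable_on)
    let ?K = "(\<Sum>\<^sub>\<infinity>n. (cmod (f n))\<^sup>2) + (\<Sum>\<^sub>\<infinity>n::int ^ 'd. (cmod (resolvent_kernel z n))\<^sup>2)"
    show "bdd_above (sum (\<lambda>m. norm (f m * resolvent_kernel z (n - m))) ` {F. F \<subseteq> UNIV \<and> finite F})"
    proof (rule bdd_aboveI2)
      fix F :: "(int ^ 'd) set" assume "F \<in> {F. F \<subseteq> UNIV \<and> finite F}"
      then have F: "finite F" by auto
      have "(\<Sum>m\<in>F. cmod (f m * resolvent_kernel z (n - m))) \<le> (\<Sum>m\<in>F. (cmod (f m))\<^sup>2 + (cmod (resolvent_kernel z (n - m)))\<^sup>2)"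
      proof (intro sum_mono)
        fix m
        have "2 * (cmod (f m) * cmod (resolvent_kernel z (n - m))) \<le> (cmod (f m))\<^sup>2 + (cmod (resolvent_kernel z (n - m)))\<^sup>2"
          using sum_squares_bound[of "cmod (f m)" "cmod (resolvent_kernel z (n - m))"] by simp
        then show "cmod (f m * resolvent_kernel z (n - m)) \<le> (cmod (f m))\<^sup>2 + (cmod (resolvent_kernel z (n - m)))\<^sup>2"
          using mult_nonneg_nonneg[OF norm_ge_zero[of "f m"] norm_ge_zero[of "resolvent_kernel z (n - m)"]] unfolding norm_mult by linarith
      qed
      also have "\<dots> = (\<Sum>m\<in>F. (cmod (f m))\<^sup>2) + (\<Sum>k\<in>(\<lambda>m. n - m) ` F. (cmod (resolvent_kernel z k))\<^sup>2)"
        by (simp add: sum.distrib sum.reindex inj_on_def)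
      also have "\<dots> \<le> ?K" using F by (intro add_mono ell2_bound f resolvent_kernel_ell2 z) auto
      finally show "(\<Sum>m\<in>F. cmod (f m * resolvent_kernel z (n - m))) \<le> ?K" .
    qed
  qed auto
qed

lemma resolvent_series_solves:
  fixes f :: "int ^ 'd::finite \<Rightarrow> complex"
  assumes z: "Im z \<noteq> 0" and f: "f \<in> ell 2"
  defines "u \<equiv> \<lambda>n. \<Sum>\<^sub>\<infinity>m. f m * resolvent_kernel z (n - m)"
  shows "u \<in> ell 2" and "discrete_laplacian u n - z * u n = f n"
proof -
  have hs: "((\<lambda>m. f m * resolvent_kernel z (n - m)) has_sum u n) UNIV" for n
    unfolding u_def by (intro has_sum_infsum resolvent_series_summable z f)
  show "u \<in> ell 2"
  proof (rule ell2I)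
    fix B :: "(int ^ 'd) set" assume B: "finite B"
    have "((\<lambda>A. \<Sum>n\<in>B. (cmod (\<Sum>m\<in>A. f m * resolvent_kernel z (n - m)))\<^sup>2) \<longlongrightarrow> (\<Sum>n\<in>B. (cmod (u n))\<^sup>2)) (finite_subsets_at_top UNIV)"
      using hs unfolding has_sum_def by (intro tendsto_intros) auto
    moreover have "\<forall>\<^sub>F A in finite_subsets_at_top UNIV. (\<Sum>n\<in>B. (cmod (\<Sum>m\<in>A. f m * resolvent_kernel z (n - m)))\<^sup>2) \<le> (1 / \<bar>Im z\<bar>)\<^sup>2 * (\<Sum>\<^sub>\<infinity>n. (cmod (f n))\<^sup>2)"
    proof (rule eventually_finite_subsets_at_top_weakI)
      fix A :: "(int ^ 'd) set" assume "finite A"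
      then show "(\<Sum>n\<in>B. (cmod (\<Sum>m\<in>A. f m * resolvent_kernel z (n - m)))\<^sup>2) \<le> (1 / \<bar>Im z\<bar>)\<^sup>2 * (\<Sum>\<^sub>\<infinity>n. (cmod (f n))\<^sup>2)"
        using f by (intro order_trans[OF resolvent_kernel_convolution_ell2[OF z _ B]] mult_left_mono ell2_bound) auto
    qed
    ultimately show "(\<Sum>n\<in>B. (cmod (u n))\<^sup>2) \<le> (1 / \<bar>Im z\<bar>)\<^sup>2 * (\<Sum>\<^sub>\<infinity>n. (cmod (f n))\<^sup>2)"
      by (rule tendsto_upperbound) simp
  qed
  have hsum: "((\<lambda>m. \<Sum>j\<in>J. g j m) has_sum (\<Sum>j\<in>J. s j)) UNIV"
    if "finite J" "\<And>j. (g j has_sum s j) UNIV" for J :: "'d set" and g :: "'d \<Rightarrow> int ^ 'd \<Rightarrow> complex" and s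
    using that by (induction J) (auto intro!: has_sum_add)
  have "((\<lambda>m. (\<Sum>j\<in>UNIV. 2 * (f m * resolvent_kernel z (n - m)) + ((- 1) * (f m * resolvent_kernel z (n + axis j 1 - m)) + (- 1) * (f m * resolvent_kernel z (n - axis j 1 - m)))) + (- z) * (f m * resolvent_kernel z (n - m)))
     has_sum ((\<Sum>j\<in>UNIV. 2 * u n + ((- 1) * u (n + axis j 1) + (- 1) * u (n - axis j 1))) + (- z) * u n)) UNIV"
    by (intro has_sum_add hsum has_sum_cmult_right hs) auto
  then have "((\<lambda>m. (\<Sum>j\<in>UNIV. 2 * (f m * resolvent_kernel z (n - m)) - f m * resolvent_kernel z (n + axis j 1 - m) - f m * resolvent_kernel z (n - axis j 1 - m)) - z * (f m * resolvent_kernel z (n - m)))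
     has_sum (discrete_laplacian u n - z * u n)) UNIV"
  proof -
    have pm: "2 * a + ((- 1) * b + (- 1) * c) = 2 * a - b - c" "a + (- z) * b = a - z * b" for a b c :: complex
      by simp_all
    assume "((\<lambda>m. (\<Sum>j\<in>UNIV. 2 * (f m * resolvent_kernel z (n - m)) + ((- 1) * (f m * resolvent_kernel z (n + axis j 1 - m)) + (- 1) * (f m * resolvent_kernel z (n - axis j 1 - m)))) + (- z) * (f m * resolvent_kernel z (n - m)))
     has_sum ((\<Sum>j\<in>UNIV. 2 * u n + ((- 1) * u (n + axis j 1) + (- 1) * u (n - axis j 1))) + (- z) * u n)) UNIV"
    then show ?thesis by (simp only: discrete_laplacian_def pm)
  qed
  moreover have "(\<Sum>j\<in>UNIV. 2 * (f m * resolvent_kernel z (n - m)) - f m * resolvent_kernel z (n + axis j 1 - m) - f m * resolvent_kernel z (n - axis j 1 - m)) - z * (f m * resolvent_kernel z (n - m))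
     = (if m = n then f n else 0)" for m
  proof -
    have "(\<Sum>j\<in>UNIV. 2 * (f m * resolvent_kernel z (n - m)) - f m * resolvent_kernel z (n + axis j 1 - m) - f m * resolvent_kernel z (n - axis j 1 - m)) - z * (f m * resolvent_kernel z (n - m))
        = f m * (discrete_laplacian (resolvent_kernel z) (n - m) - z * resolvent_kernel z (n - m))"
      by (simp add: discrete_laplacian_def sum_distrib_left algebra_simps)
    then show ?thesis by (simp add: resolvent_kernel_equation[OF z])
  qed
  ultimately have "((\<lambda>m. if m = n then f n else 0) has_sum (discrete_laplacian u n - z * u n)) UNIV" by simp
  moreover have "((\<lambda>m. if m = n then f n else 0) has_sum f n) UNIV"
    by (rule has_sum_finite_neutralI[of "{n}"]) auto
  ultimately show "discrete_laplacian u n - z * u n = f n" by (rule has_sum_unique)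
qed

text \<open>
  The inverse in the definition of \<open>R0\<close> is a choice of preimage, so both halves are needed: the
  convolution solves the equation in \<open>\<ell>\<^sup>2\<close>, and the solution is unique because \<open>h0 - z\<close> has no zero.
\<close>
lemma R0_has_sum:
  fixes f :: "int ^ 'd::finite \<Rightarrow> complex"
  assumes z: "Im z \<noteq> 0" and f: "f \<in> ell 2"
  shows "((\<lambda>m. f m * resolvent_kernel z (n - m)) has_sum R0 z f n) UNIV"
proof -
  define u where "u = (\<lambda>n. \<Sum>\<^sub>\<infinity>m. f m * resolvent_kernel z (n - m))"
  have u: "u \<in> ell 2" unfolding u_def by (rule resolvent_series_solves(1)[OF z f])
  have u2: "discrete_laplacian u n - z * u n = f n" for n
    using resolvent_series_solves(2)[OF z f, of n] by (simp only: u_def)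
  have "R0 z f = u"
    unfolding R0_def
  proof (rule inv_into_f_eq)
    show "u \<in> ell 2" by (rule u)
    show "(\<lambda>n. H0 u n - z * u n) = f" using u2 by (simp add: H0_eq_discrete_laplacian[OF u] fun_eq_iff)
    show "inj_on (\<lambda>(u :: int ^ 'd \<Rightarrow> complex) n. H0 u n - z * u n) (ell 2)"
    proof (rule inj_onI)
      fix v w :: "int ^ 'd \<Rightarrow> complex" assume vw: "v \<in> ell 2" "w \<in> ell 2" "(\<lambda>n. H0 v n - z * v n) = (\<lambda>n. H0 w n - z * w n)"
      obtain F G where FG: "has_fourier v F" "has_fourier w G" using riesz_fischer vw by blast
      let ?x = "\<lambda>n. v n + (- 1) * w n" and ?D = "\<lambda>\<xi>. F \<xi> + (- 1) * G \<xi>"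
      have D: "has_fourier ?x ?D" by (intro has_fourier_add has_fourier_cmult FG)
      have "has_fourier (\<lambda>n. discrete_laplacian v n + (- 1) * discrete_laplacian w n + (- z) * ?x n)
         (\<lambda>\<xi>. of_real (h0 \<xi>) * F \<xi> + (- 1) * (of_real (h0 \<xi>) * G \<xi>) + (- z) * ?D \<xi>)"
        by (intro has_fourier_add has_fourier_cmult has_fourier_discrete_laplacian FG D)
      moreover have "discrete_laplacian v n + (- 1) * discrete_laplacian w n + (- z) * ?x n = 0" for n
        using fun_cong[OF vw(3), of n] vw(1,2) by (simp add: H0_eq_discrete_laplacian algebra_simps)
      ultimately have "AE \<xi> in torus_measure. of_real (h0 \<xi>) * F \<xi> + (- 1) * (of_real (h0 \<xi>) * G \<xi>) + (- z) * ?D \<xi> = 0"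
        by (intro fourier_zero_unique) simp
      then have "AE \<xi> in torus_measure. ?D \<xi> = 0"
      proof eventually_elim
        fix \<xi> assume "of_real (h0 \<xi>) * F \<xi> + (- 1) * (of_real (h0 \<xi>) * G \<xi>) + (- z) * ?D \<xi> = 0"
        then have "(of_real (h0 \<xi>) - z) * ?D \<xi> = 0" by (simp add: algebra_simps)
        then show "?D \<xi> = 0" using h0_minus_nz[OF z, of \<xi>] by simp
      qed
      from fourier_of_null[OF D this] show "v = w" by (simp add: fun_eq_iff)
    qed
  qed
  then show ?thesis using has_sum_infsum[OF resolvent_series_summable[OF z f, of n]] by (simp add: u_def)
qed

section \<open>The Laplace transform of powers\<close>

text \<open>
  The function \<open>t powr (s - 1)\<close> for complex \<open>s\<close>, extended by zero to \<open>t \<le> 0\<close> so that integrals run over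
  the whole line.
\<close>
definition mellin_weight :: "complex \<Rightarrow> real \<Rightarrow> complex" where
  "mellin_weight s t = indicator {0<..} t *\<^sub>R exp ((s - 1) * of_real (ln t))"

lemma mellin_weight_measurable [measurable]: "mellin_weight s \<in> borel_measurable borel"
  unfolding mellin_weight_def[abs_def] by measurable

lemma norm_mellin_weight: "cmod (mellin_weight s t) = indicator {0<..} t * t powr (Re s - 1)"
  by (auto simp: mellin_weight_def powr_def indicator_def)

lemma mellin_weight_mult_power: "mellin_weight s t * of_real t ^ k = mellin_weight (s + of_nat k) t"
proof (cases "0 < t")
  case True
  have "complex_of_real t = exp (of_real (ln t))" using True by (simp add: exp_of_real)
  then have "complex_of_real t ^ k = exp (of_nat k * of_real (ln t))"
    by (simp only: exp_of_nat_mult)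
  then show ?thesis using True by (simp add: mellin_weight_def exp_add[symmetric] algebra_simps)
qed (simp add: mellin_weight_def)

lemma mellin_weight_scale: "0 < r \<Longrightarrow> mellin_weight s (r * t) = exp ((s - 1) * of_real (ln r)) * mellin_weight s t"
  by (cases "0 < t") (auto simp: mellin_weight_def ln_mult exp_add[symmetric] algebra_simps zero_less_mult_iff)

lemma Laplace_1:
  assumes "0 < Re s"
  shows "integrable lborel (\<lambda>t. mellin_weight s t * of_real (exp (- t)))" (is "integrable _ ?f")
    and "(\<integral>t. mellin_weight s t * of_real (exp (- t)) \<partial>lborel) = Gamma s"
proof -
  let ?g = "\<lambda>t. complex_of_real t powr (s - 1) / of_real (exp t)"
  have eq: "indicator {0<..} t *\<^sub>R ?g t = ?f t" for t
    by (cases "0 < t") (auto simp: mellin_weight_def powr_def Ln_of_real exp_minus divide_inverse)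
  have i: "set_integrable lebesgue {0<..} ?g" using absolutely_integrable_Gamma_integral'[OF assms] .
  then have "integrable lebesgue ?f" unfolding set_integrable_def eq .
  then show "integrable lborel ?f" by (subst (asm) integrable_completion) auto
  have "(\<integral>t. ?f t \<partial>lborel) = (\<integral>t. ?f t \<partial>lebesgue)" by (subst integral_completion) auto
  also have "\<dots> = integral {0<..} ?g"
    using set_lebesgue_integral_eq_integral(2)[OF i] unfolding set_lebesgue_integral_def eq .
  also have "\<dots> = Gamma s" using Gamma_integral_complex'[OF assms] by (rule integral_unique)
  finally show "(\<integral>t. ?f t \<partial>lborel) = Gamma s" .
qed

lemma Laplace_real:
  assumes "0 < Re s" "0 < r"
  shows "integrable lborel (\<lambda>t. mellin_weight s t * of_real (exp (- r * t)))" (is "integrable _ ?f")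
    and "(\<integral>t. mellin_weight s t * of_real (exp (- r * t)) \<partial>lborel) = Gamma s * exp (- s * of_real (ln r))"
proof -
  let ?E = "\<lambda>t. mellin_weight s t * of_real (exp (- t))"
  let ?c = "exp ((s - 1) * of_real (ln r))"
  have E: "?E (0 + r * t) = ?c * ?f t" for t using assms by (simp add: mellin_weight_scale mult.assoc)
  have "integrable lborel (\<lambda>t. ?E (0 + r * t))"
    using assms by (intro lborel_integrable_real_affine Laplace_1) auto
  then have "integrable lborel (\<lambda>t. ?c * ?f t)" unfolding E .
  then have "integrable lborel (\<lambda>t. inverse ?c * (?c * ?f t))" by (rule integrable_mult_right)
  moreover have "inverse ?c * (?c * y) = y" for y by simp
  ultimately show "integrable lborel ?f" by (simp only:)
  have "Gamma s = \<bar>r\<bar> *\<^sub>R (\<integral>t. ?E (0 + r * t) \<partial>lborel)"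
    unfolding Laplace_1(2)[OF assms(1), symmetric] using assms by (intro lborel_integral_real_affine) auto
  also have "\<dots> = of_real r * ?c * (\<integral>t. ?f t \<partial>lborel)"
    unfolding E using assms by (simp add: scaleR_conv_of_real)
  also have "of_real r * ?c = exp (s * of_real (ln r))"
  proof -
    have "of_real r * ?c = exp (of_real (ln r)) * ?c" using assms by (simp add: exp_of_real)
    then show ?thesis by (simp only: exp_add[symmetric]) (simp add: algebra_simps)
  qed
  finally show "(\<integral>t. ?f t \<partial>lborel) = Gamma s * exp (- s * of_real (ln r))"
    by (simp add: exp_minus field_simps)
qed

lemma Laplace_real_norm:
  fixes \<sigma> r :: real
  assumes "0 < \<sigma>" "0 < r"
  shows "integrable lborel (\<lambda>t. indicator {0<..} t * t powr (\<sigma> - 1) * exp (- r * t))"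
    and "(\<integral>t. indicator {0<..} t * t powr (\<sigma> - 1) * exp (- r * t) \<partial>lborel) = Gamma \<sigma> * exp (- \<sigma> * ln r)"
proof -
  have eq: "complex_of_real (indicator {0<..} (t :: real) * t powr (\<sigma> - 1) * exp (- r * t)) = mellin_weight (of_real \<sigma>) t * of_real (exp (- r * t))" for t
    by (cases "0 < t") (auto simp: mellin_weight_def powr_def exp_of_real[symmetric])
  have "integrable lborel (\<lambda>t. complex_of_real (indicator {0<..} t * t powr (\<sigma> - 1) * exp (- r * t)))"
    unfolding eq using assms by (intro Laplace_real) auto
  then show "integrable lborel (\<lambda>t. indicator {0<..} t * t powr (\<sigma> - 1) * exp (- r * t))"
    by (simp only: complex_of_real_integrable_eq)
  have "complex_of_real (\<integral>t. indicator {0<..} t * t powr (\<sigma> - 1) * exp (- r * t) \<partial>lborel) = complex_of_real (Gamma \<sigma> * exp (- \<sigma> * ln r))"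
    unfolding integral_complex_of_real[symmetric] eq using assms
    by (subst Laplace_real) (auto simp: Gamma_complex_of_real exp_of_real[symmetric])
  then show "(\<integral>t. indicator {0<..} t * t powr (\<sigma> - 1) * exp (- r * t) \<partial>lborel) = Gamma \<sigma> * exp (- \<sigma> * ln r)"
    by (simp only: of_real_eq_iff)
qed

lemma Laplace_complex_integrable:
  assumes "0 < Re s" "0 < Re w"
  shows "integrable lborel (\<lambda>t. mellin_weight s t * exp (- of_real t * w))"
proof (rule Bochner_Integration.integrable_bound[OF Laplace_real_norm(1)[OF assms]])
  show "AE t in lborel. norm (mellin_weight s t * exp (- of_real t * w)) \<le> norm (indicator {0<..} t * t powr (Re s - 1) * exp (- Re w * t))"
    by (auto simp: norm_mult norm_mellin_weight abs_mult mult.commute)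
qed measurable

lemma pochhammer_term:
  fixes s x :: "'a::field_char_0"
  shows "(- s gchoose k) * (- x) ^ k = pochhammer s k / fact k * x ^ k"
proof -
  have "(- s gchoose k) * (- x) ^ k = ((- 1) ^ k * (- 1) ^ k) * (pochhammer s k / fact k * x ^ k)"
    by (simp add: gbinomial_pochhammer power_minus[of x])
  also have "(- 1 :: 'a) ^ k * (- 1) ^ k = 1" by (simp flip: power_mult_distrib)
  finally show ?thesis by simp
qed

text \<open>
  For positive \<open>w\<close> this is a scaling of the integral of the Gamma function. A general \<open>w\<close> lies in the
  disc of convergence around a positive number \<open>r\<close>: with \<open>r = \<bar>w\<bar>\<^sup>2 / Re w\<close> one has
  \<open>cmod (r - w) < r\<close>. Expanding \<open>exp (t * (r - w))\<close> and integrating termwise produces the binomial series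
  of \<open>w powr (- s)\<close> at \<open>r\<close>.
\<close>
lemma Laplace_complex:
  assumes s: "0 < Re s" and w: "0 < Re w"
  shows "(\<integral>t. mellin_weight s t * exp (- of_real t * w) \<partial>lborel) = Gamma s * w powr (- s)"
proof -
  define r where "r = (cmod w)\<^sup>2 / Re w"
  have w0: "w \<noteq> 0" using w by auto
  have r: "0 < r" using w w0 by (simp add: r_def)
  define x where "x = (of_real r - w) / of_real r"
  have x1: "cmod x < 1"
  proof -
    have "(cmod (of_real r - w))\<^sup>2 = r\<^sup>2 - 2 * (r * Re w) + (cmod w)\<^sup>2"
      unfolding cmod_power2 by (simp add: power2_eq_square algebra_simps)
    also have "r * Re w = (cmod w)\<^sup>2" using w by (simp add: r_def)
    also have "r\<^sup>2 - 2 * (cmod w)\<^sup>2 + (cmod w)\<^sup>2 < r\<^sup>2" using w0 by simp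
    finally have "cmod (of_real r - w) < r" using r by (auto intro: power2_less_imp_less)
    then show ?thesis using r by (simp add: x_def norm_divide)
  qed
  have rx: "of_real r - w = of_real r * x" using r by (simp add: x_def)
  define f where "f = (\<lambda>k t. (of_real r * x) ^ k / fact k * (mellin_weight (s + of_nat k) t * of_real (exp (- r * t))))"
  have sk: "0 < Re (s + of_nat k)" for k using s by simp
  have poch: "pochhammer z k * Gamma z = Gamma (z + of_nat k)" if "0 < Re z" for z :: complex and k
  proof -
    have "z \<notin> \<int>\<^sub>\<le>\<^sub>0" using that by (auto elim!: nonpos_Ints_cases)
    then show ?thesis using pochhammer_Gamma[of z k] by (simp add: Gamma_eq_zero_iff)
  qed
  have expk: "exp (- (z + of_nat k) * of_real (ln r)) * of_real r ^ k = exp (- z * of_real (ln r))" for z :: complex and k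
  proof -
    have "complex_of_real r = exp (of_real (ln r))" using r by (simp add: exp_of_real)
    then have "complex_of_real r ^ k = exp (of_nat k * of_real (ln r))"
      by (simp only: exp_of_nat_mult)
    then show ?thesis by (simp only: exp_add[symmetric]) (simp add: algebra_simps)
  qed
  have int_f: "integrable lborel (f k)" for k
    unfolding f_def using r by (intro integrable_mult_right Laplace_real sk)
  have val: "(\<integral>t. f k t \<partial>lborel) = Gamma s * exp (- s * of_real (ln r)) * ((- (s) gchoose k) * (- x) ^ k)" for k
  proof -
    have "(\<integral>t. f k t \<partial>lborel) = (of_real r * x) ^ k / fact k * (Gamma (s + of_nat k) * exp (- (s + of_nat k) * of_real (ln r)))"
      unfolding f_def by (simp only: integral_mult_right_zero Laplace_real(2)[OF sk r])
    also have "\<dots> = (Gamma (s + of_nat k)) * (x ^ k / fact k) * (exp (- (s + of_nat k) * of_real (ln r)) * of_real r ^ k)"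
      by (simp add: power_mult_distrib mult_ac)
    also have "\<dots> = Gamma s * exp (- s * of_real (ln r)) * (pochhammer s k / fact k * x ^ k)"
      unfolding expk poch[OF s, symmetric] by (simp add: mult_ac)
    finally show ?thesis by (simp only: pochhammer_term)
  qed
  let ?\<sigma> = "complex_of_real (Re s)" and ?x = "complex_of_real (cmod x)"
  have nval: "complex_of_real (\<integral>t. norm (f k t) \<partial>lborel) = Gamma ?\<sigma> * exp (- ?\<sigma> * of_real (ln r)) * ((- ?\<sigma> gchoose k) * (- ?x) ^ k)" for k
  proof -
    have nf: "complex_of_real (norm (f k t)) = (of_real r * ?x) ^ k / fact k * (mellin_weight (?\<sigma> + of_nat k) t * of_real (exp (- r * t)))" for t
      using r by (cases "0 < t") (auto simp: f_def norm_mult norm_divide norm_power mellin_weight_def exp_of_real[symmetric])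
    have "0 < Re ?\<sigma>" using s by simp
    then have sk': "0 < Re (?\<sigma> + of_nat k)" by simp
    have "complex_of_real (\<integral>t. norm (f k t) \<partial>lborel) = (of_real r * ?x) ^ k / fact k * (Gamma (?\<sigma> + of_nat k) * exp (- (?\<sigma> + of_nat k) * of_real (ln r)))"
      unfolding integral_complex_of_real[symmetric] nf by (simp only: integral_mult_right_zero Laplace_real(2)[OF sk' r])
    also have "\<dots> = (Gamma (?\<sigma> + of_nat k)) * (?x ^ k / fact k) * (exp (- (?\<sigma> + of_nat k) * of_real (ln r)) * of_real r ^ k)"
      by (simp add: power_mult_distrib mult_ac)
    also have "\<dots> = Gamma ?\<sigma> * exp (- ?\<sigma> * of_real (ln r)) * (pochhammer ?\<sigma> k / fact k * ?x ^ k)"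
      unfolding expk poch[OF \<open>0 < Re ?\<sigma>\<close>, symmetric] by (simp add: mult_ac)
    finally show ?thesis by (simp only: pochhammer_term)
  qed
  have "summable (\<lambda>k. complex_of_real (\<integral>t. norm (f k t) \<partial>lborel))"
    unfolding nval using gen_binomial_complex[of "- ?x" "- ?\<sigma>"] x1
    by (intro summable_mult) (auto simp: sums_iff)
  then have sum_n: "summable (\<lambda>k. \<integral>t. norm (f k t) \<partial>lborel)" by (simp only: summable_of_real_iff)
  have ptw: "(\<lambda>k. f k t) sums (mellin_weight s t * exp (- of_real t * w))" for t
  proof -
    have "(\<lambda>k. (of_real t * (of_real r * x)) ^ k /\<^sub>R fact k) sums exp (of_real t * (of_real r * x))" by (rule exp_converges)
    from sums_mult[OF this, of "mellin_weight s t * of_real (exp (- r * t))"]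
    have "(\<lambda>k. mellin_weight s t * of_real (exp (- r * t)) * ((of_real t * (of_real r * x)) ^ k /\<^sub>R fact k)) sums
        (mellin_weight s t * of_real (exp (- r * t)) * exp (of_real t * (of_real r * x)))" .
    moreover have "mellin_weight s t * of_real (exp (- r * t)) * ((of_real t * (of_real r * x)) ^ k /\<^sub>R fact k) = f k t" for k
      unfolding f_def mellin_weight_mult_power[symmetric] by (simp add: power_mult_distrib scaleR_conv_of_real divide_inverse mult_ac)
    moreover have "mellin_weight s t * of_real (exp (- r * t)) * exp (of_real t * (of_real r * x)) = mellin_weight s t * exp (- of_real t * w)"
      unfolding rx[symmetric] mult.assoc by (simp add: exp_of_real[symmetric] exp_add[symmetric] algebra_simps)
    ultimately show ?thesis by (simp only:)
  qed
  have nsum: "summable (\<lambda>k. norm (f k t))" for t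
  proof -
    have "summable (\<lambda>k. cmod ((of_real t * (of_real r * x)) ^ k /\<^sub>R fact k))" by (rule summable_norm_exp)
    from summable_mult[OF this, of "cmod (mellin_weight s t * of_real (exp (- r * t)))"]
    show ?thesis unfolding f_def mellin_weight_mult_power[symmetric]
      by (simp add: norm_mult norm_divide norm_power norm_inverse power_mult_distrib divide_inverse mult_ac)
  qed
  have "(\<lambda>k. \<integral>t. f k t \<partial>lborel) sums (\<integral>t. (\<Sum>k. f k t) \<partial>lborel)"
    by (rule sums_integral) (auto intro: int_f nsum sum_n)
  then have 1: "(\<lambda>k. Gamma s * exp (- s * of_real (ln r)) * ((- (s) gchoose k) * (- x) ^ k)) sums (\<integral>t. mellin_weight s t * exp (- of_real t * w) \<partial>lborel)"
    unfolding val sums_unique[OF ptw, symmetric] .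
  have 2: "(\<lambda>k. Gamma s * exp (- s * of_real (ln r)) * ((- (s) gchoose k) * (- x) ^ k)) sums (Gamma s * exp (- s * of_real (ln r)) * (1 + - x) powr (- s))"
    using gen_binomial_complex[of "- x" "- s"] x1 by (intro sums_mult) auto
  have "(\<integral>t. mellin_weight s t * exp (- of_real t * w) \<partial>lborel) = Gamma s * (exp (- s * of_real (ln r)) * (1 + - x) powr (- s))"
    using sums_unique2[OF 1 2] by simp
  also have "exp (- s * of_real (ln r)) * (1 + - x) powr (- s) = w powr (- s)"
  proof -
    have y: "1 + - x = w / of_real r" using r by (simp add: x_def field_simps)
    have "Ln w = Ln (of_real r * (w / of_real r))" using r by simp
    also have "\<dots> = of_real (ln r) + Ln (w / of_real r)" using r w0 by (subst Ln_times_of_real) (auto simp: Ln_of_real)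
    finally show ?thesis unfolding y powr_def using r w0 by (simp add: exp_add[symmetric] algebra_simps)
  qed
  finally show ?thesis .
qed

lemma norm_Gamma_le: "0 < Re s \<Longrightarrow> cmod (Gamma s) \<le> Gamma (Re s)"
proof -
  assume s: "0 < Re s"
  have "cmod (Gamma s) = cmod (\<integral>t. mellin_weight s t * of_real (exp (- 1 * t)) \<partial>lborel)"
    using Laplace_real(2)[OF s, of 1] by simp
  also have "\<dots> \<le> (\<integral>t. cmod (mellin_weight s t * of_real (exp (- 1 * t))) \<partial>lborel)" by (rule integral_norm_bound)
  also have "\<dots> = (\<integral>t. indicator {0<..} t * t powr (Re s - 1) * exp (- 1 * t) \<partial>lborel)"
    by (intro Bochner_Integration.integral_cong refl) (simp add: norm_mult norm_mellin_weight)
  also have "\<dots> = Gamma (Re s)" using Laplace_real_norm(2)[OF s, of 1] by simp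
  finally show ?thesis .
qed

section \<open>Powers of the resolvent and their kernels\<close>

text \<open>
  Rotating by \<open>\<i>\<close> moves the values of \<open>h0 - z\<close> into the right half plane, where principal powers are
  analytic and the Laplace transform applies.
\<close>
definition rotated_symbol :: "complex \<Rightarrow> real ^ 'd \<Rightarrow> complex" where
  "rotated_symbol z \<xi> = \<i> * (of_real (h0 \<xi>) - z)"

lemma Re_rotated_symbol [simp]: "Re (rotated_symbol z \<xi>) = Im z"
  by (simp add: rotated_symbol_def)

lemma rotated_symbol_measurable [measurable]: "rotated_symbol z \<in> borel_measurable borel"
  unfolding rotated_symbol_def[abs_def] by measurable

lemma rotated_symbol_continuous: "continuous_on S (rotated_symbol z)"
  unfolding rotated_symbol_def[abs_def] by (intro continuous_intros h0_continuous)

lemma rotated_symbol_nz: "0 < Im z \<Longrightarrow> rotated_symbol z \<xi> \<noteq> 0"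
  using Re_rotated_symbol[of z \<xi>] by fastforce

lemma norm_rotated_symbol_ge: "Im z \<le> cmod (rotated_symbol z \<xi>)"
  using complex_Re_le_cmod[of "rotated_symbol z \<xi>"] by simp

lemma norm_rotated_symbol_powr:
  assumes "0 < Im z"
  shows "cmod (rotated_symbol z \<xi> powr (- s)) \<le> cmod (rotated_symbol z \<xi>) powr (- Re s) * exp (pi * \<bar>Im s\<bar>)"
proof -
  let ?w = "rotated_symbol z \<xi>"
  have w: "?w \<noteq> 0" by (rule rotated_symbol_nz[OF assms])
  have "cmod (?w powr (- s)) = exp (- Re s * ln (cmod ?w) + Im s * Im (Ln ?w))"
    using w by (simp add: powr_def)
  also have "\<dots> \<le> exp (- Re s * ln (cmod ?w) + pi * \<bar>Im s\<bar>)"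
  proof -
    have "\<bar>Im (Ln ?w)\<bar> \<le> pi" using mpi_less_Im_Ln[OF w] Im_Ln_le_pi[OF w] by (simp add: abs_le_iff)
    then have "\<bar>Im (Ln ?w)\<bar> * \<bar>Im s\<bar> \<le> pi * \<bar>Im s\<bar>" by (intro mult_right_mono) auto
    then have "Im s * Im (Ln ?w) \<le> pi * \<bar>Im s\<bar>"
      using abs_ge_self[of "Im s * Im (Ln ?w)"] by (simp add: abs_mult mult.commute)
    then show ?thesis by simp
  qed
  also have "\<dots> = cmod ?w powr (- Re s) * exp (pi * \<bar>Im s\<bar>)"
    unfolding exp_add using w by (simp add: powr_def)
  finally show ?thesis .
qed

text \<open>
  The convolution kernel of the power \<open>- s\<close> of \<open>\<i> * (H0 - z)\<close>.
\<close>
definition power_kernel :: "complex \<Rightarrow> complex \<Rightarrow> int ^ 'd \<Rightarrow> complex" where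
  "power_kernel z s k = (\<integral>\<xi>. rotated_symbol z \<xi> powr (- s) * character k \<xi> \<partial>torus_measure)"

lemma rotated_symbol_powr_measurable [measurable]: "(\<lambda>\<xi>. rotated_symbol z \<xi> powr s) \<in> borel_measurable borel"
  if "0 < Im z"
proof -
  have "(\<lambda>\<xi>. rotated_symbol z \<xi> powr s) = (\<lambda>\<xi>. exp (s * Ln (rotated_symbol z \<xi>)))"
    by (simp add: powr_def fun_eq_iff rotated_symbol_nz[OF that])
  then show ?thesis by simp
qed

lemma torus_integral_cbox:
  fixes f :: "real ^ 'd::finite \<Rightarrow> complex"
  assumes c: "continuous_on UNIV f"
  shows "(\<integral>\<xi>. f \<xi> \<partial>torus_measure) = integral (cbox (\<chi> j. -1/2) (\<chi> j. 1/2)) f"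
proof -
  let ?a = "\<chi> j. -1/2 :: real ^ 'd" and ?b = "\<chi> j. 1/2 :: real ^ 'd"
  have m [measurable]: "f \<in> borel_measurable borel" by (rule borel_measurable_continuous_onI[OF c])
  have "(\<integral>\<xi>. f \<xi> \<partial>torus_measure) = (\<integral>\<xi>. indicator torus \<xi> *\<^sub>R f \<xi> \<partial>lborel)"
    unfolding torus_measure_def by (subst integral_restrict_space) auto
  also have "\<dots> = (\<integral>\<xi>. indicator (cbox ?a ?b) \<xi> *\<^sub>R f \<xi> \<partial>lborel)"
  proof (rule integral_cong_AE)
    have "negligible (cbox ?a ?b - box ?a ?b)" by (rule negligible_frontier_interval)
    moreover have "cbox ?a ?b - box ?a ?b \<in> sets borel" by (intro sets.Diff) auto
    ultimately have "cbox ?a ?b - box ?a ?b \<in> null_sets lborel"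
      by (simp add: negligible_iff_null_sets null_sets_completion_iff)
    from AE_not_in[OF this]
    show "AE \<xi> in lborel. indicator torus \<xi> *\<^sub>R f \<xi> = indicator (cbox ?a ?b) \<xi> *\<^sub>R f \<xi>"
    proof eventually_elim
      fix \<xi> :: "real ^ 'd" assume n: "\<xi> \<notin> cbox ?a ?b - box ?a ?b"
      have "torus \<subseteq> cbox ?a ?b" "box ?a ?b \<subseteq> torus" by (auto simp: torus_def mem_box_cart less_eq_real_def)
      then show "indicator torus \<xi> *\<^sub>R f \<xi> = indicator (cbox ?a ?b) \<xi> *\<^sub>R f \<xi>"
        using n by (cases "\<xi> \<in> cbox ?a ?b") (auto simp: indicator_def)
    qed
  qed measurable
  also have "\<dots> = integral (cbox ?a ?b) f"
  proof -
    have "set_integrable lborel (cbox ?a ?b) f"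
      by (rule borel_integrable_compact[unfolded set_integrable_def[symmetric]]) (auto intro: continuous_on_subset[OF c])
    from set_borel_integral_eq_integral(2)[OF this] show ?thesis by (simp add: set_lebesgue_integral_def)
  qed
  finally show ?thesis .
qed

lemma power_kernel_holomorphic:
  fixes k :: "int ^ 'd::finite"
  assumes z: "0 < Im z"
  shows "(\<lambda>s. power_kernel z s k) holomorphic_on UNIV"
proof -
  have np: "rotated_symbol z \<xi> \<notin> \<real>\<^sub>\<le>\<^sub>0" for \<xi> :: "real ^ 'd" using z by (auto simp: complex_nonpos_Reals_iff)
  have pw: "rotated_symbol z \<xi> powr (- s) = exp (- s * Ln (rotated_symbol z \<xi>))" for s and \<xi> :: "real ^ 'd"
    by (simp add: powr_def rotated_symbol_nz[OF z])
  have cL: "continuous_on S (\<lambda>\<xi>. Ln (rotated_symbol z \<xi>))" for S :: "(real ^ 'd) set"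
    by (intro continuous_on_Ln' rotated_symbol_continuous) (auto simp: np)
  have cf: "continuous_on S (\<lambda>\<xi>. exp (- s * Ln (rotated_symbol z \<xi>)) * character k \<xi>)" for s S
    by (intro continuous_intros cL)
  have "(\<lambda>s. integral (cbox (\<chi> j. -1/2) (\<chi> j. 1/2)) (\<lambda>\<xi>. exp (- s * Ln (rotated_symbol z \<xi>)) * character k \<xi>)) holomorphic_on UNIV"
  proof (rule leibniz_rule_holomorphic)
    fix s \<xi>
    show "((\<lambda>s. exp (- s * Ln (rotated_symbol z \<xi>)) * character k \<xi>) has_field_derivative (- Ln (rotated_symbol z \<xi>) * (exp (- s * Ln (rotated_symbol z \<xi>)) * character k \<xi>))) (at s within UNIV)"
      by (auto intro!: derivative_eq_intros)
    show "(\<lambda>\<xi>. exp (- s * Ln (rotated_symbol z \<xi>)) * character k \<xi>) integrable_on cbox (\<chi> j. -1/2) (\<chi> j. 1/2)"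
      by (intro integrable_continuous cf)
    show "continuous_on (UNIV \<times> cbox (\<chi> j. -1/2) (\<chi> j. 1/2)) (\<lambda>(s, \<xi>). - Ln (rotated_symbol z \<xi>) * (exp (- s * Ln (rotated_symbol z \<xi>)) * character k \<xi>))"
    proof -
      have 1: "continuous_on (UNIV \<times> cbox (\<chi> j. -1/2) (\<chi> j. 1/2)) (\<lambda>p :: complex \<times> (real ^ 'd). Ln (rotated_symbol z (snd p)))"
        by (rule continuous_on_compose2[OF cL[of UNIV]]) (auto intro: continuous_intros)
      have 2: "continuous_on (UNIV \<times> cbox (\<chi> j. -1/2) (\<chi> j. 1/2)) (\<lambda>p :: complex \<times> (real ^ 'd). character k (snd p))"
        by (rule continuous_on_compose2[OF character_continuous[of UNIV]]) (auto intro: continuous_intros)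
      show ?thesis unfolding split_def by (intro continuous_intros 1 2)
    qed
  qed auto
  moreover have "power_kernel z s k = integral (cbox (\<chi> j. -1/2) (\<chi> j. 1/2)) (\<lambda>\<xi>. exp (- s * Ln (rotated_symbol z \<xi>)) * character k \<xi>)" for s
    unfolding power_kernel_def pw by (rule torus_integral_cbox[OF cf])
  ultimately show ?thesis by simp
qed

lemma norm_power_kernel_le:
  fixes k :: "int ^ 'd::finite"
  assumes z: "0 < Im z" and s: "0 \<le> Re s"
  shows "cmod (power_kernel z s k) \<le> Im z powr (- Re s) * exp (pi * \<bar>Im s\<bar>)"
proof -
  let ?B = "Im z powr (- Re s) * exp (pi * \<bar>Im s\<bar>)"
  note [measurable] = rotated_symbol_powr_measurable[OF z]
  have bd: "cmod (rotated_symbol z \<xi> powr (- s) * character k \<xi>) \<le> ?B" for \<xi>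
  proof -
    have "cmod (rotated_symbol z \<xi>) powr (- Re s) \<le> Im z powr (- Re s)"
      using z s norm_rotated_symbol_ge[of z \<xi>] by (intro powr_mono2') auto
    then have "cmod (rotated_symbol z \<xi>) powr (- Re s) * exp (pi * \<bar>Im s\<bar>) \<le> ?B" by (intro mult_right_mono) auto
    from order_trans[OF norm_rotated_symbol_powr[OF z] this] show ?thesis by (simp only: norm_mult norm_character mult_1_right)
  qed
  have i: "integrable torus_measure (\<lambda>\<xi>. rotated_symbol z \<xi> powr (- s) * character k \<xi>)"
    by (rule torus_integrable[OF _ bd]) simp
  have "cmod (power_kernel z s k) \<le> (\<integral>\<xi>. cmod (rotated_symbol z \<xi> powr (- s) * character k \<xi>) \<partial>torus_measure)"
    unfolding power_kernel_def by (rule integral_norm_bound)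
  also have "\<dots> \<le> (\<integral>\<xi>. ?B \<partial>(torus_measure :: (real ^ 'd) measure))"
    by (intro integral_mono integrable_norm i bd) auto
  also have "\<dots> = ?B" by (simp add: measure_torus)
  finally show ?thesis .
qed

text \<open>
  The convolution kernel of \<open>exp (- \<i> * t * (H0 - z))\<close>, written in its factorised form.
\<close>
definition propagator :: "complex \<Rightarrow> int ^ 'd \<Rightarrow> real \<Rightarrow> complex" where
  "propagator z k t = exp (\<i> * of_real t * z) * (\<Prod>j\<in>UNIV. cis (- 2 * t) * bessel (k $ j) t)"

lemma norm_propagator: "cmod (propagator z k t) = exp (- Im z * t) * (\<Prod>j\<in>UNIV. cmod (bessel (k $ j) t))"
  by (simp add: propagator_def norm_mult prod_norm[symmetric] mult.commute)

lemma bessel_measurable [measurable]: "bessel n \<in> borel_measurable borel"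
  by (rule borel_measurable_continuous_onI[OF bessel_continuous])

lemma propagator_measurable [measurable]: "propagator z k \<in> borel_measurable borel"
proof -
  have [measurable]: "(\<lambda>t. cis (- 2 * t)) \<in> borel_measurable borel"
    by (intro borel_measurable_continuous_onI continuous_intros)
  have [measurable]: "(\<lambda>t. cis (- 2 * t) * bessel n t) \<in> borel_measurable borel" for n by measurable
  show ?thesis unfolding propagator_def[abs_def]
    by (intro borel_measurable_times borel_measurable_prod) measurable
qed

lemma torus_integral_time:
  fixes k :: "int ^ 'd::finite"
  shows "(\<integral>\<xi>. exp (- of_real t * rotated_symbol z \<xi>) * character k \<xi> \<partial>torus_measure) = propagator z k t"
proof -
  let ?g = "\<lambda>j x. cis (- 2 * t) * cis (bessel_phase (k $ j) (2 * t) (2 * pi * x))"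
  have h0c: "h0 \<xi> = (\<Sum>j\<in>UNIV. 2 - 2 * cos (2 * pi * \<xi> $ j))" for \<xi> :: "real ^ 'd"
  proof -
    have "4 * (sin (pi * x))\<^sup>2 = 2 - 2 * cos (2 * pi * x)" for x :: real
      using cos_double_sin[of "pi * x"] by (simp add: mult.assoc)
    then show ?thesis by (simp add: h0_def sum_distrib_left)
  qed
  have cs: "(\<Prod>j\<in>J. cis (f j)) = cis (\<Sum>j\<in>J. f j)" if "finite J" for J and f :: "'d \<Rightarrow> real"
    using that by induction (auto simp: cis_mult)
  have pt: "exp (- of_real t * rotated_symbol z \<xi>) * character k \<xi> = exp (\<i> * of_real t * z) * (\<Prod>j\<in>UNIV. ?g j (\<xi> $ j))" for \<xi>
  proof -
    have "exp (- of_real t * rotated_symbol z \<xi>) = exp (\<i> * of_real t * z) * cis (- t * h0 \<xi>)"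
      by (simp add: rotated_symbol_def cis_conv_exp exp_add[symmetric] algebra_simps)
    moreover have "cis (- t * h0 \<xi>) * character k \<xi> = (\<Prod>j\<in>UNIV. ?g j (\<xi> $ j))"
    proof -
      have "cis (- t * h0 \<xi>) * character k \<xi> = cis (\<Sum>j\<in>UNIV. - t * (2 - 2 * cos (2 * pi * \<xi> $ j)) + 2 * pi * (of_int (k $ j) * \<xi> $ j))"
        unfolding character_def cis_mult h0c sum_distrib_left sum.distrib[symmetric] ..
      also have "\<dots> = cis (\<Sum>j\<in>UNIV. - 2 * t + bessel_phase (k $ j) (2 * t) (2 * pi * \<xi> $ j))"
        by (intro arg_cong[where f = cis] sum.cong refl) (simp add: bessel_phase_def algebra_simps)
      also have "\<dots> = (\<Prod>j\<in>UNIV. cis (- 2 * t + bessel_phase (k $ j) (2 * t) (2 * pi * \<xi> $ j)))"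
        by (rule cs[symmetric]) simp
      finally show ?thesis by (simp only: cis_mult)
    qed
    ultimately show ?thesis by simp
  qed
  have gc: "continuous_on S (?g j)" for S j
    unfolding bessel_phase_def by (intro continuous_intros)
  have "(\<integral>\<xi>. exp (- of_real t * rotated_symbol z \<xi>) * character k \<xi> \<partial>torus_measure) = exp (\<i> * of_real t * z) * (\<integral>\<xi>. (\<Prod>j\<in>UNIV. ?g j (\<xi> $ j)) \<partial>torus_measure)"
    unfolding pt by (rule integral_mult_right_zero)
  also have "(\<integral>\<xi>. (\<Prod>j\<in>UNIV. ?g j (\<xi> $ j)) \<partial>(torus_measure :: (real ^ 'd) measure)) = (\<Prod>j\<in>UNIV. \<integral>x. indicator {-1/2<..1/2} x *\<^sub>R ?g j x \<partial>lborel)"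
  proof (rule torus_integral_prod[where B = 1])
    show "?g j \<in> borel_measurable borel" for j by (intro borel_measurable_continuous_onI gc)
    show "cmod (?g j x) \<le> 1" for j x by (simp add: norm_mult)
  qed
  also have "\<dots> = (\<Prod>j\<in>UNIV. cis (- 2 * t) * bessel (k $ j) t)"
  proof (intro prod.cong refl)
    fix j :: 'd
    have "(\<integral>x. indicator {-1/2<..1/2} x *\<^sub>R ?g j x \<partial>lborel) = integral {-1/2..1/2} (?g j)"
      by (rule lborel_integral_Ioc_eq[OF gc])
    then show "(\<integral>x. indicator {-1/2<..1/2} x *\<^sub>R ?g j x \<partial>lborel) = cis (- 2 * t) * bessel (k $ j) t"
      by (simp add: bessel_def)
  qed
  finally show ?thesis by (simp add: propagator_def)
qed

text \<open>
  Fubini for the Laplace transform; absolute convergence comes from \<open>Re (rotated_symbol z \<xi>) = Im z\<close>.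
\<close>
lemma Gamma_power_kernel:
  fixes k :: "int ^ 'd::finite"
  assumes z: "0 < Im z" and s: "0 < Re s"
  shows "integrable lborel (\<lambda>t. mellin_weight s t * propagator z k t)"
    and "Gamma s * power_kernel z s k = (\<integral>t. mellin_weight s t * propagator z k t \<partial>lborel)"
proof -
  let ?T = "torus_measure :: (real ^ 'd) measure"
  have [measurable]: "rotated_symbol z \<in> borel_measurable ?T" "character k \<in> borel_measurable ?T"
    by (auto intro: torus_measurableI)
  interpret P: pair_sigma_finite "lborel :: real measure" ?T
    by (intro pair_sigma_finite.intro lborel.sigma_finite_measure_axioms torus.sigma_finite_measure_axioms)
  define f where "f = (\<lambda>t \<xi>. mellin_weight s t * exp (- of_real t * rotated_symbol z \<xi>) * character k \<xi>)"
  have nf: "norm (f t \<xi>) = indicator {0<..} t * t powr (Re s - 1) * exp (- Im z * t)" for t \<xi>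
    by (simp add: f_def norm_mult norm_mellin_weight mult.commute)
  have fm: "case_prod f \<in> borel_measurable (lborel \<Otimes>\<^sub>M ?T)" unfolding f_def by measurable
  have Pint: "integrable (lborel \<Otimes>\<^sub>M ?T) (case_prod f)"
  proof (rule P.Fubini_integrable[OF fm])
    show "integrable lborel (\<lambda>t. \<integral>\<xi>. norm (case_prod f (t, \<xi>)) \<partial>?T)"
      using Laplace_real_norm(1)[OF s z] by (simp add: nf measure_torus)
    show "AE t in lborel. integrable ?T (\<lambda>\<xi>. case_prod f (t, \<xi>))"
    proof (rule AE_I2)
      fix t :: real
      show "integrable ?T (\<lambda>\<xi>. case_prod f (t, \<xi>))"
        by (rule torus_integrable[where B = "indicator {0<..} t * t powr (Re s - 1) * exp (- Im z * t)"])
          (simp_all add: nf, simp add: f_def)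
    qed
  qed
  have inner: "(\<integral>\<xi>. f t \<xi> \<partial>?T) = mellin_weight s t * propagator z k t" for t
    unfolding f_def mult.assoc torus_integral_time[symmetric] by (rule integral_mult_right_zero)
  show "integrable lborel (\<lambda>t. mellin_weight s t * propagator z k t)"
    using P.integrable_fst[OF Pint] unfolding inner .
  have "Gamma s * power_kernel z s k = (\<integral>\<xi>. (\<integral>t. f t \<xi> \<partial>lborel) \<partial>?T)"
  proof -
    have "(\<integral>t. f t \<xi> \<partial>lborel) = Gamma s * (rotated_symbol z \<xi> powr (- s) * character k \<xi>)" for \<xi>
      unfolding f_def using Laplace_complex[OF s, of "rotated_symbol z \<xi>"] z by (simp add: integral_mult_left_zero)
    then show ?thesis by (simp add: power_kernel_def integral_mult_right_zero)
  qed
  also have "\<dots> = (\<integral>t. (\<integral>\<xi>. f t \<xi> \<partial>?T) \<partial>lborel)" by (rule P.Fubini_integral[OF Pint])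
  also have "\<dots> = (\<integral>t. mellin_weight s t * propagator z k t \<partial>lborel)" by (simp only: inner)
  finally show "Gamma s * power_kernel z s k = (\<integral>t. mellin_weight s t * propagator z k t \<partial>lborel)" .
qed

lemma Re_pos_not_nonpos_Ints: "0 < Re z \<Longrightarrow> z \<notin> \<int>\<^sub>\<le>\<^sub>0"
  by (auto elim!: nonpos_Ints_cases)

section \<open>From kernel bounds to a bilinear estimate\<close>

text \<open>
  The bound \<open>C\<close> for \<open>W1 R0 W2\<close> on \<open>\<ell>\<^sup>2\<close>, with normalised weights and tested on functions supported
  in a finite set. Phases of the weights can be absorbed into \<open>x\<close> and \<open>y\<close>, so the weights are taken nonnegative.
  The first argument only carries the index type of the lattice.
\<close>
definition bilinear_bound :: "'d::finite itself \<Rightarrow> real \<Rightarrow> complex \<Rightarrow> real \<Rightarrow> bool" where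
  "bilinear_bound _ r z C \<longleftrightarrow> (\<forall>A V1 V2 x y. finite A \<longrightarrow> (\<forall>n. 0 \<le> V1 n) \<longrightarrow> (\<forall>n. 0 \<le> V2 n) \<longrightarrow>
     (\<Sum>n\<in>A. V1 n powr r) \<le> 1 \<longrightarrow> (\<Sum>n\<in>A. V2 n powr r) \<le> 1 \<longrightarrow>
     (\<Sum>n\<in>A. (cmod (x n))\<^sup>2) \<le> 1 \<longrightarrow> (\<Sum>n\<in>A. (cmod (y n))\<^sup>2) \<le> 1 \<longrightarrow>
     cmod (\<Sum>m\<in>A. \<Sum>n\<in>A. resolvent_kernel z (n - m) * (of_real (V2 m) * x m) * (of_real (V1 n) * y (n :: int ^ 'd))) \<le> C)"

lemma exp_quadratic_le: "exp (- y\<^sup>2 + pi * \<bar>y\<bar>) \<le> exp (pi\<^sup>2 / 4)" for y :: real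
proof -
  have "0 \<le> (\<bar>y\<bar> - pi / 2)\<^sup>2" by simp
  also have "(\<bar>y\<bar> - pi / 2)\<^sup>2 = y\<^sup>2 - pi * \<bar>y\<bar> + pi\<^sup>2 / 4" by (simp add: power2_diff power_divide mult.commute)
  finally have "- y\<^sup>2 + pi * \<bar>y\<bar> \<le> pi\<^sup>2 / 4" by simp
  then show ?thesis by simp
qed

lemma norm_exp_square: "cmod (exp (s\<^sup>2)) = exp ((Re s)\<^sup>2 - (Im s)\<^sup>2)"
  by (simp add: power2_eq_square)

lemma power_kernel_l2_bound:
  fixes f g :: "int ^ 'd::finite \<Rightarrow> complex"
  assumes z: "0 < Im z" and s: "Re s = 0" and fin: "finite A"
    and f: "(\<Sum>m\<in>A. (cmod (f m))\<^sup>2) \<le> 1" and g: "(\<Sum>m\<in>A. (cmod (g m))\<^sup>2) \<le> 1"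
  shows "cmod (\<Sum>m\<in>A. \<Sum>n\<in>A. power_kernel z s (n - m) * f m * g n) \<le> exp (pi * \<bar>Im s\<bar>)"
proof -
  let ?g = "\<lambda>n. cnj (g n)" and ?E = "exp (pi * \<bar>Im s\<bar>)"
  note [measurable] = rotated_symbol_powr_measurable[OF z]
  have bd: "cmod (rotated_symbol z \<xi> powr (- s)) \<le> ?E" for \<xi> :: "real ^ 'd"
    using norm_rotated_symbol_powr[OF z, of \<xi> s] rotated_symbol_nz[OF z, of \<xi>] s by simp
  have i2: "integrable torus_measure (\<lambda>\<xi>. (cmod (trig_sum A h \<xi>))\<^sup>2)" for h :: "int ^ 'd \<Rightarrow> complex"
    using norm_trig_sum_le[of A h] by (intro torus_integrable[where B = "(\<Sum>n\<in>A. cmod (h n))\<^sup>2"]) (auto intro: power_mono)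
  have "(\<Sum>m\<in>A. \<Sum>n\<in>A. power_kernel z s (n - m) * f m * g n) = (\<integral>\<xi>. rotated_symbol z \<xi> powr (- s) * trig_sum A f \<xi> * cnj (trig_sum A ?g \<xi>) \<partial>torus_measure)"
    by (subst trig_sum_form[OF _ bd]) (simp_all add: power_kernel_def mult_ac)
  also have "cmod \<dots> \<le> (\<integral>\<xi>. cmod (rotated_symbol z \<xi> powr (- s) * trig_sum A f \<xi> * cnj (trig_sum A ?g \<xi>)) \<partial>torus_measure)"
    by (rule integral_norm_bound)
  also have "\<dots> \<le> (\<integral>\<xi>. ?E * ((cmod (trig_sum A f \<xi>))\<^sup>2 / 2 + (cmod (trig_sum A ?g \<xi>))\<^sup>2 / 2) \<partial>torus_measure)"
  proof (rule integral_mono_AE')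
    show "integrable torus_measure (\<lambda>\<xi>. ?E * ((cmod (trig_sum A f \<xi>))\<^sup>2 / 2 + (cmod (trig_sum A ?g \<xi>))\<^sup>2 / 2))"
      by (intro integrable_mult_right Bochner_Integration.integrable_add integrable_divide i2)
    show "AE \<xi> in torus_measure. cmod (rotated_symbol z \<xi> powr (- s) * trig_sum A f \<xi> * cnj (trig_sum A ?g \<xi>)) \<le> ?E * ((cmod (trig_sum A f \<xi>))\<^sup>2 / 2 + (cmod (trig_sum A ?g \<xi>))\<^sup>2 / 2)"
    proof (rule AE_I2)
      fix \<xi> :: "real ^ 'd"
      have "cmod (trig_sum A f \<xi>) * cmod (trig_sum A ?g \<xi>) \<le> (cmod (trig_sum A f \<xi>))\<^sup>2 / 2 + (cmod (trig_sum A ?g \<xi>))\<^sup>2 / 2"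
        using sum_squares_bound[of "cmod (trig_sum A f \<xi>)" "cmod (trig_sum A ?g \<xi>)"] by simp
      then show "cmod (rotated_symbol z \<xi> powr (- s) * trig_sum A f \<xi> * cnj (trig_sum A ?g \<xi>)) \<le> ?E * ((cmod (trig_sum A f \<xi>))\<^sup>2 / 2 + (cmod (trig_sum A ?g \<xi>))\<^sup>2 / 2)"
        using bd[of \<xi>] unfolding norm_mult mult.assoc complex_mod_cnj by (intro mult_mono) auto
    qed
  qed auto
  also have "\<dots> = ?E * ((\<Sum>m\<in>A. (cmod (f m))\<^sup>2) / 2 + (\<Sum>m\<in>A. (cmod (g m))\<^sup>2) / 2)"
    using parseval[OF fin, of f] parseval[OF fin, of ?g] i2 by simp
  also have "\<dots> \<le> ?E * 1" using f g by (intro mult_left_mono) auto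
  finally show ?thesis by simp
qed

text \<open>
  The interpolated family is \<open>exp (s\<^sup>2) * Gamma (s + 1)\<close> times the powers of the resolvent. The
  Gaussian factor absorbs the growth \<open>exp (pi * \<bar>Im s\<bar>)\<close> of the symbol, and \<open>Gamma (s + 1)\<close> stands in place of
  \<open>Gamma s\<close>, the factor produced by the Laplace transform, because the latter has a pole at \<open>0\<close>. At \<open>s = 1\<close>
  the family is \<open>- \<i> * exp 1\<close> times the resolvent.
\<close>
lemma bilinear_bound_from_kernel:
  assumes z: "0 < Im z" and L: "1 \<le> L" and D: "0 < D"
    and ker: "\<And>s (k :: int ^ 'd::finite). Re s = L \<Longrightarrow> cmod (exp (s\<^sup>2) * (Gamma (s + 1) * power_kernel z s k)) \<le> D"
  shows "bilinear_bound TYPE('d) (2 * L) z (exp (pi\<^sup>2 / 4) * D powr (1 / L))"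
  unfolding bilinear_bound_def
proof (intro allI impI)
  fix A :: "(int ^ 'd) set" and V1 V2 :: "int ^ 'd \<Rightarrow> real" and x y :: "int ^ 'd \<Rightarrow> complex"
  assume fin: "finite A" and V: "\<forall>n. 0 \<le> V1 n" "\<forall>n. 0 \<le> V2 n"
    "(\<Sum>n\<in>A. V1 n powr (2 * L)) \<le> 1" "(\<Sum>n\<in>A. V2 n powr (2 * L)) \<le> 1"
    and x: "(\<Sum>n\<in>A. (cmod (x n))\<^sup>2) \<le> 1" and y: "(\<Sum>n\<in>A. (cmod (y n))\<^sup>2) \<le> 1"
  define a where "a = (\<lambda>s m n. exp (s\<^sup>2) * (Gamma (s + 1) * power_kernel z s (n - m :: int ^ 'd)))"
  let ?M0 = "exp (pi\<^sup>2 / 4)"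
  \<comment> \<open>The half plane contains the closed strip and avoids the poles of \<open>Gamma (s + 1)\<close>.\<close>
  have hol: "(\<lambda>s. a s m n) holomorphic_on {s. -1 < Re s}" for m n
  proof -
    have nz: "z + 1 \<notin> \<int>\<^sub>\<le>\<^sub>0" if "- 1 < Re z" for z :: complex
      using Re_pos_not_nonpos_Ints[of "z + 1"] that by simp
    show ?thesis unfolding a_def
      by (intro holomorphic_intros holomorphic_on_subset[OF power_kernel_holomorphic[OF z]]) (auto simp: nz)
  qed
  have "continuous_on {0..L} (\<lambda>\<sigma>::real. Gamma (\<sigma> + 1))"
    proof (rule continuous_on_compose2[of "{1..}" Gamma])
    show "continuous_on {1..} (Gamma :: real \<Rightarrow> real)"
      by (rule continuous_on_Gamma) (auto elim!: nonpos_Ints_cases)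
  qed (auto intro!: continuous_intros)
  then have "bounded ((\<lambda>\<sigma>::real. Gamma (\<sigma> + 1)) ` {0..L})"
    by (intro compact_imp_bounded compact_continuous_image) auto
  then obtain K where K0: "\<forall>x\<in>(\<lambda>\<sigma>::real. Gamma (\<sigma> + 1)) ` {0..L}. norm x \<le> K"
    unfolding bounded_iff by blast
  have K: "Gamma (\<sigma> + 1) \<le> K" if "0 \<le> \<sigma>" "\<sigma> \<le> L" for \<sigma> :: real
  proof -
    have "norm (Gamma (\<sigma> + 1)) \<le> K" by (rule bspec[OF K0]) (use that in auto)
    then show ?thesis using abs_ge_self[of "Gamma (\<sigma> + 1)"] by simp
  qed
  have "cmod (\<Sum>m\<in>A. \<Sum>n\<in>A. a 1 m n * (V2 m * x m) * (V1 n * y n)) \<le> ?M0 powr (1 - 1 / L) * D powr (1 / L)"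
  proof (rule stein_interpolation_weighted[OF fin L _ D, where B = "exp (L\<^sup>2 + pi\<^sup>2 / 4) * (K * (1 + 1 / Im z) powr L)"])
    show "(\<lambda>s. a s m n) holomorphic_on {s. 0 < Re s \<and> Re s < L}" for m n
      by (rule holomorphic_on_subset[OF hol]) auto
    show "continuous_on {s. 0 \<le> Re s \<and> Re s \<le> L} (\<lambda>s. a s m n)" for m n
      by (rule continuous_on_subset[OF holomorphic_on_imp_continuous_on[OF hol]]) auto
  next
    fix s :: complex and m n :: "int ^ 'd" assume s: "0 \<le> Re s" "Re s \<le> L"
    have "cmod (Gamma (s + 1)) \<le> Gamma (Re s + 1)" using norm_Gamma_le[of "s + 1"] s by simp
    also have "\<dots> \<le> K" by (rule K[OF s])
    finally have G: "cmod (Gamma (s + 1)) \<le> K" .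
    have "Im z powr (- Re s) = (1 / Im z) powr Re s" using z by (simp add: powr_minus_divide powr_divide)
    also have "\<dots> \<le> (1 + 1 / Im z) powr Re s" using z s by (intro powr_mono2) auto
    also have "\<dots> \<le> (1 + 1 / Im z) powr L" using z s by (intro powr_mono) auto
    finally have F: "Im z powr (- Re s) \<le> (1 + 1 / Im z) powr L" .
    have "cmod (power_kernel z s (n - m)) \<le> (1 + 1 / Im z) powr L * exp (pi * \<bar>Im s\<bar>)"
      by (rule order_trans[OF norm_power_kernel_le[OF z s(1)]]) (intro mult_right_mono F, simp)
    then have "cmod (a s m n) \<le> exp ((Re s)\<^sup>2 - (Im s)\<^sup>2) * (K * ((1 + 1 / Im z) powr L * exp (pi * \<bar>Im s\<bar>)))"
      unfolding a_def norm_mult norm_exp_square using G by (intro mult_mono) (auto intro: order_trans[OF norm_ge_zero])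
    also have "\<dots> = (exp ((Re s)\<^sup>2) * exp (- (Im s)\<^sup>2 + pi * \<bar>Im s\<bar>)) * (K * (1 + 1 / Im z) powr L)"
      by (simp add: exp_add exp_diff exp_minus field_simps)
    also have "\<dots> \<le> (exp (L\<^sup>2) * exp (pi\<^sup>2 / 4)) * (K * (1 + 1 / Im z) powr L)"
      using s order_trans[OF norm_ge_zero G] by (intro mult_right_mono mult_mono exp_quadratic_le) (auto intro!: power_mono)
    finally show "cmod (a s m n) \<le> exp (L\<^sup>2 + pi\<^sup>2 / 4) * (K * (1 + 1 / Im z) powr L)" by (simp add: exp_add)
  next
    fix s and f g :: "int ^ 'd \<Rightarrow> complex"
    assume s: "Re s = 0" and f: "(\<Sum>m\<in>A. (cmod (f m))\<^sup>2) \<le> 1" and g: "(\<Sum>m\<in>A. (cmod (g m))\<^sup>2) \<le> 1"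
    have "(\<Sum>m\<in>A. \<Sum>n\<in>A. a s m n * f m * g n) = exp (s\<^sup>2) * Gamma (s + 1) * (\<Sum>m\<in>A. \<Sum>n\<in>A. power_kernel z s (n - m) * f m * g n)"
      by (simp add: a_def sum_distrib_left mult_ac)
    also have "cmod \<dots> \<le> exp (- (Im s)\<^sup>2) * 1 * exp (pi * \<bar>Im s\<bar>)"
      unfolding norm_mult norm_exp_square using norm_Gamma_le[of "s + 1"] s power_kernel_l2_bound[OF z s fin f g]
      by (intro mult_mono) auto
    also have "\<dots> = exp (- (Im s)\<^sup>2 + pi * \<bar>Im s\<bar>)" by (simp only: exp_add mult_1_right)
    also have "\<dots> \<le> ?M0" by (rule exp_quadratic_le)
    finally show "cmod (\<Sum>m\<in>A. \<Sum>n\<in>A. a s m n * f m * g n) \<le> ?M0" .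
  next
    show "cmod (a s m n) \<le> D" if "Re s = L" for s and m n :: "int ^ 'd" unfolding a_def by (rule ker[OF that])
  qed (use V x y in auto)
  also have "\<dots> \<le> ?M0 * D powr (1 / L)"
  proof (intro mult_right_mono)
    have "?M0 powr (1 - 1 / L) \<le> ?M0 powr 1" using L by (intro powr_mono) auto
    then show "?M0 powr (1 - 1 / L) \<le> ?M0" by simp
  qed simp
  finally have B: "cmod (\<Sum>m\<in>A. \<Sum>n\<in>A. a 1 m n * (V2 m * x m) * (V1 n * y n)) \<le> ?M0 * D powr (1 / L)" .
  have a1: "a 1 m n = (- \<i> * exp 1) * resolvent_kernel z (n - m)" for m n :: "int ^ 'd"
  proof -
    have "rotated_symbol z \<xi> powr (- 1) = - \<i> * resolvent_symbol z \<xi>" for \<xi> :: "real ^ 'd"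
      using rotated_symbol_nz[OF z, of \<xi>] by (simp add: powr_minus resolvent_symbol_def rotated_symbol_def divide_inverse)
    then have "power_kernel z 1 (n - m) = - \<i> * resolvent_kernel z (n - m)"
      by (simp add: power_kernel_def resolvent_kernel_def mult.assoc integral_mult_right_zero)
    moreover have "Gamma (1 + 1 :: complex) = 1" using Gamma_fact[of 1, where 'a = complex] by simp
    ultimately show ?thesis by (simp add: a_def)
  qed
  have "(\<Sum>m\<in>A. \<Sum>n\<in>A. a 1 m n * (V2 m * x m) * (V1 n * y n)) = (- \<i> * exp 1) * (\<Sum>m\<in>A. \<Sum>n\<in>A. resolvent_kernel z (n - m) * (V2 m * x m) * (V1 n * y n))"
    unfolding a1 by (simp add: sum_distrib_left mult_ac)
  then have "exp 1 * cmod (\<Sum>m\<in>A. \<Sum>n\<in>A. resolvent_kernel z (n - m) * (V2 m * x m) * (V1 n * y n)) \<le> ?M0 * D powr (1 / L)"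
    using B by (simp add: norm_mult)
  moreover have "1 * cmod (\<Sum>m\<in>A. \<Sum>n\<in>A. resolvent_kernel z (n - m) * (V2 m * x m) * (V1 n * y n)) \<le> exp 1 * cmod (\<Sum>m\<in>A. \<Sum>n\<in>A. resolvent_kernel z (n - m) * (V2 m * x m) * (V1 n * y n))"
    by (intro mult_right_mono) auto
  ultimately show "cmod (\<Sum>m\<in>A. \<Sum>n\<in>A. resolvent_kernel z (n - m) * (V2 m * x m) * (V1 n * y n)) \<le> ?M0 * D powr (1 / L)"
    by simp
qed

section \<open>Kernel bounds\<close>

text \<open>
  The three Bessel bounds have different constants; \<open>22\<close>, the one from the region away from the
  turning point, serves for all of them, except that \<open>14 / \<bar>n\<bar>\<close> has to be read against
  \<open>22 / N = 44 / \<bar>n\<bar>\<close>.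
\<close>
lemma bessel_profile: "airy_profile (\<lambda>t. cmod (bessel n t)) (real_of_int \<bar>n\<bar> / 2) 22"
proof
  show "cmod (bessel n t) \<le> 22 / (real_of_int \<bar>n\<bar> / 2)" if "0 < t" "t \<le> real_of_int \<bar>n\<bar> / 2 / 2" for t
  proof -
    have "14 / real_of_int \<bar>n\<bar> \<le> 22 / (real_of_int \<bar>n\<bar> / 2)" by (simp add: divide_right_mono)
    then show ?thesis using bessel_small[of t n] that by (intro order_trans[OF bessel_small]) auto
  qed
qed (use bessel_airy bessel_far bessel_le_1 in auto)

lemma prod_le_sum_power:
  fixes x :: "'a \<Rightarrow> real"
  assumes "finite J" "J \<noteq> {}" "\<And>j. 0 \<le> x j"
  shows "(\<Prod>j\<in>J. x j) \<le> (\<Sum>j\<in>J. x j ^ card J)"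
proof -
  have "Max (x ` J) \<in> x ` J" using assms by (intro Max_in) auto
  then obtain i where i: "i \<in> J" "x i = Max (x ` J)" by auto
  have "(\<Prod>j\<in>J. x j) \<le> (\<Prod>j\<in>J. x i)" using assms i by (intro prod_mono) auto
  also have "\<dots> = x i ^ card J" by simp
  also have "\<dots> \<le> (\<Sum>j\<in>J. x j ^ card J)" using assms i by (intro member_le_sum) auto
  finally show ?thesis .
qed

text \<open>
  Reduces a product of Bessel functions of different orders to a power of a single one.
\<close>
lemma weighted_prod_bound:
  fixes J :: "'d::finite set" and k :: "int ^ 'd" and D :: real and \<phi> :: "real \<Rightarrow> real"
  assumes [measurable]: "\<phi> \<in> borel_measurable borel" and \<phi>: "\<And>t. 0 \<le> \<phi> t" and J: "J \<noteq> {}" and D: "0 \<le> D"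
    and b: "\<And>n. (\<integral>\<^sup>+t. ennreal (indicator {0<..} t * (\<phi> t * cmod (bessel n t) ^ card J)) \<partial>lborel) \<le> ennreal D"
  shows "(\<integral>\<^sup>+t. ennreal (indicator {0<..} t * (\<phi> t * (\<Prod>j\<in>J. cmod (bessel (k $ j) t)))) \<partial>lborel) \<le> ennreal (card J * D)"
proof -
  have "(\<integral>\<^sup>+t. ennreal (indicator {0<..} t * (\<phi> t * (\<Prod>j\<in>J. cmod (bessel (k $ j) t)))) \<partial>lborel)
     \<le> (\<integral>\<^sup>+t. (\<Sum>j\<in>J. ennreal (indicator {0<..} t * (\<phi> t * cmod (bessel (k $ j) t) ^ card J))) \<partial>lborel)"
  proof (rule nn_integral_mono)
    fix t :: real
    have "indicator {0<..} t * (\<phi> t * (\<Prod>j\<in>J. cmod (bessel (k $ j) t))) \<le> indicator {0<..} t * (\<phi> t * (\<Sum>j\<in>J. cmod (bessel (k $ j) t) ^ card J))"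
      using \<phi> J by (intro mult_left_mono prod_le_sum_power) auto
    also have "\<dots> = (\<Sum>j\<in>J. indicator {0<..} t * (\<phi> t * cmod (bessel (k $ j) t) ^ card J))"
      by (simp add: sum_distrib_left)
    finally show "ennreal (indicator {0<..} t * (\<phi> t * (\<Prod>j\<in>J. cmod (bessel (k $ j) t))))
        \<le> (\<Sum>j\<in>J. ennreal (indicator {0<..} t * (\<phi> t * cmod (bessel (k $ j) t) ^ card J)))"
      using \<phi> by (subst sum_ennreal) (auto intro: ennreal_leI)
  qed
  also have "\<dots> = (\<Sum>j\<in>J. \<integral>\<^sup>+t. ennreal (indicator {0<..} t * (\<phi> t * cmod (bessel (k $ j) t) ^ card J)) \<partial>lborel)"
    by (rule nn_integral_sum) measurable
  also have "\<dots> \<le> (\<Sum>j\<in>J. ennreal D)" by (intro sum_mono b)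
  also have "\<dots> = ennreal (card J * D)" using D by (simp add: ennreal_mult ennreal_of_nat_eq_real_of_nat)
  finally show ?thesis .
qed

lemma Gamma_power_kernel_bound:
  fixes k :: "int ^ 'd::finite"
  assumes z: "0 < Im z" and s: "0 < Re s" and D: "0 \<le> D"
    and b: "(\<integral>\<^sup>+t. ennreal (indicator {0<..} t * (t powr (Re s - 1) * exp (- Im z * t) * (\<Prod>j\<in>UNIV. cmod (bessel (k $ j) t)))) \<partial>lborel) \<le> ennreal D"
  shows "cmod (Gamma s * power_kernel z s k) \<le> D"
proof -
  have "ennreal (cmod (Gamma s * power_kernel z s k)) \<le> (\<integral>\<^sup>+t. ennreal (cmod (mellin_weight s t * propagator z k t)) \<partial>lborel)"
    unfolding Gamma_power_kernel(2)[OF z s] by (rule integral_norm_bound_ennreal[OF Gamma_power_kernel(1)[OF z s]])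
  also have "\<dots> = (\<integral>\<^sup>+t. ennreal (indicator {0<..} t * (t powr (Re s - 1) * exp (- Im z * t) * (\<Prod>j\<in>UNIV. cmod (bessel (k $ j) t)))) \<partial>lborel)"
    by (intro nn_integral_cong) (simp add: norm_mult norm_mellin_weight norm_propagator mult.assoc)
  also note b
  finally show ?thesis using D by simp
qed

lemma gaussian_linear:
  fixes L y :: real assumes "0 \<le> L" shows "exp (- y\<^sup>2) * (L + \<bar>y\<bar>) \<le> L + 1"
proof -
  have "0 \<le> (\<bar>y\<bar> - 1 / 2)\<^sup>2" by simp
  then have "\<bar>y\<bar> \<le> 1 + y\<^sup>2" by (simp add: power2_diff power_divide)
  also have "\<dots> \<le> exp (y\<^sup>2)" by (rule exp_ge_add_one_self)
  finally have "exp (- y\<^sup>2) * \<bar>y\<bar> \<le> 1" by (simp add: exp_minus field_simps)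
  moreover have "exp (- y\<^sup>2) * L \<le> 1 * L" using assms by (intro mult_right_mono) auto
  ultimately show ?thesis by (simp add: distrib_left)
qed

text \<open>
  The Gaussian factor of the family also absorbs polynomial growth in \<open>Im s\<close>.
\<close>
lemma gaussian_quadratic:
  fixes L y :: real assumes "0 \<le> L" shows "exp (- y\<^sup>2) * (L + \<bar>y\<bar>)\<^sup>2 \<le> (L + 1)\<^sup>2"
proof -
  let ?e = "exp (- y\<^sup>2 / 2)"
  have "0 \<le> (\<bar>y\<bar> - 1)\<^sup>2" by simp
  then have "\<bar>y\<bar> \<le> 1 + y\<^sup>2 / 2" by (simp add: power2_diff)
  also have "\<dots> \<le> exp (y\<^sup>2 / 2)" by (rule exp_ge_add_one_self)
  finally have "?e * \<bar>y\<bar> \<le> 1" by (simp add: exp_minus field_simps)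
  moreover have "?e * L \<le> 1 * L" using assms by (intro mult_right_mono) auto
  ultimately have "?e * (L + \<bar>y\<bar>) \<le> L + 1" by (simp add: distrib_left)
  then have "(?e * (L + \<bar>y\<bar>))\<^sup>2 \<le> (L + 1)\<^sup>2" using assms by (intro power_mono) auto
  moreover have "exp (- y\<^sup>2) = ?e\<^sup>2" by (simp add: power2_eq_square flip: exp_add)
  ultimately show ?thesis by (simp add: power_mult_distrib)
qed

lemma Gamma_plus1_pos: "0 < Re s \<Longrightarrow> Gamma (s + 1) = s * Gamma s"
  by (rule Gamma_plus1) (rule Re_pos_not_nonpos_Ints)

lemma interpolation_family_bound:
  fixes k :: "int ^ 'd::finite"
  assumes s: "Re s = L" "1 \<le> L" and D: "0 \<le> D" and b: "cmod (Gamma s * power_kernel z s k) \<le> D"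
  shows "cmod (exp (s\<^sup>2) * (Gamma (s + 1) * power_kernel z s k)) \<le> exp (L\<^sup>2) * (L + 1) * D"
proof -
  have "cmod s \<le> L + \<bar>Im s\<bar>" using cmod_le[of s] s by simp
  have "cmod (exp (s\<^sup>2) * (Gamma (s + 1) * power_kernel z s k)) = exp (L\<^sup>2 - (Im s)\<^sup>2) * (cmod s * cmod (Gamma s * power_kernel z s k))"
    using s by (simp add: Gamma_plus1_pos norm_mult norm_exp_square mult.assoc del: norm_exp_eq_Re)
  also have "\<dots> \<le> exp (L\<^sup>2 - (Im s)\<^sup>2) * ((L + \<bar>Im s\<bar>) * D)"
    using \<open>cmod s \<le> L + \<bar>Im s\<bar>\<close> b s by (intro mult_left_mono mult_mono) auto
  also have "\<dots> = exp (L\<^sup>2) * (exp (- (Im s)\<^sup>2) * (L + \<bar>Im s\<bar>)) * D"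
    by (simp add: exp_diff exp_minus field_simps)
  also have "\<dots> \<le> exp (L\<^sup>2) * (L + 1) * D"
    using s D by (intro mult_right_mono mult_left_mono gaussian_linear) auto
  finally show ?thesis .
qed

lemma exp_decay_le:
  fixes e t a b :: real
  assumes "0 \<le> e" "0 \<le> a" "0 \<le> b"
  shows "indicator {0<..} t * (a * exp (- e * t) * b) \<le> indicator {0<..} t * (a * b)"
proof (cases "0 < t")
  case True
  then have "exp (- e * t) \<le> 1" using assms by simp
  then have "a * exp (- e * t) * b \<le> a * 1 * b" using assms by (intro mult_right_mono mult_left_mono) auto
  then show ?thesis using True by simp
qed simp

text \<open>
  The weight \<open>t powr (L - 1)\<close> is the one of \<open>integral_high_power\<close> exactly for \<open>L = (d + 2) / 3\<close>; this
  bound is uniform in \<open>Im z\<close>.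
\<close>
lemma bilinear_bound_high_dim:
  assumes d: "5 \<le> CARD('d::finite)"
  shows "\<exists>C. \<forall>z. 0 < Im z \<longrightarrow> bilinear_bound TYPE('d) (2 * (real CARD('d) + 2) / 3) z C"
proof -
  let ?d = "CARD('d)"
  define L where "L = (real ?d + 2) / 3"
  define D where "D = real ?d * (22 ^ (?d - 5) * (1 + 212 * 22 ^ 5))"
  have L: "1 \<le> L" using d by (simp add: L_def)
  have D: "0 < D" using d by (simp add: D_def)
  have "bilinear_bound TYPE('d) (2 * L) z (exp (pi\<^sup>2 / 4) * (exp (L\<^sup>2) * (L + 1) * D) powr (1 / L))" if z: "0 < Im z" for z
  proof (rule bilinear_bound_from_kernel[OF z L])
    show "0 < exp (L\<^sup>2) * (L + 1) * D" using L D by simp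
    fix s and k :: "int ^ 'd" assume s: "Re s = L"
    show "cmod (exp (s\<^sup>2) * (Gamma (s + 1) * power_kernel z s k)) \<le> exp (L\<^sup>2) * (L + 1) * D"
    proof (rule interpolation_family_bound[OF s L])
      show "cmod (Gamma s * power_kernel z s k) \<le> D"
      proof (rule Gamma_power_kernel_bound[OF z])
        have "(\<integral>\<^sup>+t. ennreal (indicator {0<..} t * (t powr (Re s - 1) * exp (- Im z * t) * (\<Prod>j\<in>UNIV. cmod (bessel (k $ j) t)))) \<partial>lborel)
          \<le> (\<integral>\<^sup>+t. ennreal (indicator {0<..} t * (t powr ((real ?d - 1) / 3) * (\<Prod>j\<in>UNIV. cmod (bessel (k $ j) t)))) \<partial>lborel)"
        proof (intro nn_integral_mono ennreal_leI)
          fix t :: real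
          have "Re s - 1 = (real ?d - 1) / 3" using s by (simp add: L_def field_simps)
          then show "indicator {0<..} t * (t powr (Re s - 1) * exp (- Im z * t) * (\<Prod>j\<in>UNIV. cmod (bessel (k $ j) t)))
            \<le> indicator {0<..} t * (t powr ((real ?d - 1) / 3) * (\<Prod>j\<in>UNIV. cmod (bessel (k $ j) t)))"
            using z by (simp only:) (intro exp_decay_le, auto intro!: prod_nonneg)
        qed
        also have "\<dots> \<le> ennreal (card (UNIV :: 'd set) * ((22 :: real) ^ (?d - 5) * (1 + 212 * 22 ^ 5)))"
        proof (rule weighted_prod_bound[where \<phi> = "\<lambda>t. t powr ((real ?d - 1) / 3)" and J = UNIV and k = k])
          fix n
          show "(\<integral>\<^sup>+t. ennreal (indicator {0<..} t * (t powr ((real ?d - 1) / 3) * cmod (bessel n t) ^ ?d)) \<partial>lborel) \<le> ennreal (22 ^ (?d - 5) * (1 + 212 * 22 ^ 5))"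
            by (rule airy_profile.integral_high_power[OF bessel_profile d])
        qed auto
        finally show "(\<integral>\<^sup>+t. ennreal (indicator {0<..} t * (t powr (Re s - 1) * exp (- Im z * t) * (\<Prod>j\<in>UNIV. cmod (bessel (k $ j) t)))) \<partial>lborel) \<le> ennreal D"
          by (simp add: D_def)
      qed (use s L D in auto)
    qed (use D in simp)
  qed
  moreover have "2 * L = 2 * (real ?d + 2) / 3" by (simp add: L_def)
  ultimately show ?thesis by metis
qed

lemma bilinear_bound_dim4_subcritical:
  assumes d: "CARD('d::finite) = 4" and l: "1 < l" "l < 2"
  shows "\<exists>C. \<forall>z. 0 < Im z \<longrightarrow> bilinear_bound TYPE('d) (2 * l) z C"
proof -
  define K :: real where "K = 1 + 16 * 22 ^ 4 / (2 - l) + 2 * 22 ^ 4 * (2 + 2 / (2 - l))"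
  have K: "0 < K" unfolding K_def using l by (intro add_pos_nonneg) auto
  have "bilinear_bound TYPE('d) (2 * l) z (exp (pi\<^sup>2 / 4) * (exp (l\<^sup>2) * (l + 1) * (4 * K)) powr (1 / l))" if z: "0 < Im z" for z
  proof (rule bilinear_bound_from_kernel[OF z])
    show "1 \<le> l" "0 < exp (l\<^sup>2) * (l + 1) * (4 * K)" using l K by auto
    fix s and k :: "int ^ 'd" assume s: "Re s = l"
    show "cmod (exp (s\<^sup>2) * (Gamma (s + 1) * power_kernel z s k)) \<le> exp (l\<^sup>2) * (l + 1) * (4 * K)"
    proof (rule interpolation_family_bound[OF s])
      show "cmod (Gamma s * power_kernel z s k) \<le> 4 * K"
      proof (rule Gamma_power_kernel_bound[OF z])
        have "(\<integral>\<^sup>+t. ennreal (indicator {0<..} t * (t powr (Re s - 1) * exp (- Im z * t) * (\<Prod>j\<in>UNIV. cmod (bessel (k $ j) t)))) \<partial>lborel)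
          \<le> (\<integral>\<^sup>+t. ennreal (indicator {0<..} t * (t powr (l - 1) * (\<Prod>j\<in>UNIV. cmod (bessel (k $ j) t)))) \<partial>lborel)"
          unfolding s using z by (intro nn_integral_mono ennreal_leI exp_decay_le) (auto intro!: prod_nonneg)
        also have "\<dots> \<le> ennreal (card (UNIV :: 'd set) * K)"
        proof (rule weighted_prod_bound[where \<phi> = "\<lambda>t. t powr (l - 1)" and J = UNIV and k = k])
          fix n
          show "(\<integral>\<^sup>+t. ennreal (indicator {0<..} t * (t powr (l - 1) * cmod (bessel n t) ^ card (UNIV :: 'd set))) \<partial>lborel) \<le> ennreal K"
            unfolding d K_def by (rule airy_profile.integral4_subcritical[OF bessel_profile l])
        qed (use K in auto)
        finally show "(\<integral>\<^sup>+t. ennreal (indicator {0<..} t * (t powr (Re s - 1) * exp (- Im z * t) * (\<Prod>j\<in>UNIV. cmod (bessel (k $ j) t)))) \<partial>lborel) \<le> ennreal (4 * K)"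
          by (simp add: d)
      qed (use s l K in auto)
    qed (use l K in auto)
  qed
  then show ?thesis by blast
qed

text \<open>
  The kernel bound is a multiple of the logarithm, and interpolation raises it to the power \<open>1 / L = 1 / 2\<close>.
\<close>
lemma bilinear_bound_dim4_critical:
  assumes d: "CARD('d::finite) = 4"
  shows "\<exists>C. 0 < C \<and> (\<forall>z. 0 < Im z \<longrightarrow> bilinear_bound TYPE('d) 4 z (C * ln (2 + 1 / Im z) powr (1/2)))"
proof -
  define M where "M = exp 4 * 3 * (4 * (60 * 22 ^ 4 :: real))"
  have "bilinear_bound TYPE('d) 4 z (exp (pi\<^sup>2 / 4) * M powr (1/2) * ln (2 + 1 / Im z) powr (1/2))" if z: "0 < Im z" for z
  proof -
    define K :: real where "K = 60 * 22 ^ 4 * ln (2 + 1 / Im z)"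
    have "0 < ln (2 + 1 / Im z)" using z by (intro ln_gt_zero) (simp add: add_strict_increasing2)
    then have K: "0 < K" by (simp add: K_def)
    have "bilinear_bound TYPE('d) (2 * 2) z (exp (pi\<^sup>2 / 4) * (exp (2\<^sup>2) * (2 + 1) * (4 * K)) powr (1 / 2))"
    proof (rule bilinear_bound_from_kernel[OF z])
      show "1 \<le> (2::real)" "0 < exp (2\<^sup>2) * (2 + 1) * (4 * K)" using K by auto
      fix s and k :: "int ^ 'd" assume s: "Re s = 2"
      show "cmod (exp (s\<^sup>2) * (Gamma (s + 1) * power_kernel z s k)) \<le> exp (2\<^sup>2) * (2 + 1) * (4 * K)"
      proof (rule interpolation_family_bound[OF s])
        show "cmod (Gamma s * power_kernel z s k) \<le> 4 * K"
        proof (rule Gamma_power_kernel_bound[OF z])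
          have "(\<integral>\<^sup>+t. ennreal (indicator {0<..} t * (t powr (Re s - 1) * exp (- Im z * t) * (\<Prod>j\<in>UNIV. cmod (bessel (k $ j) t)))) \<partial>lborel)
            = (\<integral>\<^sup>+t. ennreal (indicator {0<..} t * (\<bar>t\<bar> * exp (- Im z * t) * (\<Prod>j\<in>UNIV. cmod (bessel (k $ j) t)))) \<partial>lborel)"
            unfolding s by (intro nn_integral_cong) (simp add: indicator_def)
          also have "\<dots> \<le> ennreal (card (UNIV :: 'd set) * K)"
          proof (rule weighted_prod_bound[where \<phi> = "\<lambda>t. \<bar>t\<bar> * exp (- Im z * t)" and J = UNIV and k = k])
            fix n
            have "(\<integral>\<^sup>+t. ennreal (indicator {0<..} t * (\<bar>t\<bar> * exp (- Im z * t) * cmod (bessel n t) ^ card (UNIV :: 'd set))) \<partial>lborel)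
              = (\<integral>\<^sup>+t. ennreal (indicator {0<..} t * (t * exp (- Im z * t) * cmod (bessel n t) ^ 4)) \<partial>lborel)"
              unfolding d by (intro nn_integral_cong) (simp add: indicator_def)
            also have "\<dots> \<le> ennreal K"
              unfolding K_def by (rule airy_profile.integral4_critical[OF bessel_profile z])
            finally show "(\<integral>\<^sup>+t. ennreal (indicator {0<..} t * (\<bar>t\<bar> * exp (- Im z * t) * cmod (bessel n t) ^ card (UNIV :: 'd set))) \<partial>lborel) \<le> ennreal K" .
          qed (use K in auto)
          finally show "(\<integral>\<^sup>+t. ennreal (indicator {0<..} t * (t powr (Re s - 1) * exp (- Im z * t) * (\<Prod>j\<in>UNIV. cmod (bessel (k $ j) t)))) \<partial>lborel) \<le> ennreal (4 * K)"
            by (simp add: d)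
        qed (use s K in auto)
      qed (use K in auto)
    qed
    moreover have "(exp (2\<^sup>2) * (2 + 1) * (4 * K)) powr (1 / 2) = M powr (1/2) * ln (2 + 1 / Im z) powr (1/2)"
    proof -
      have "exp (2\<^sup>2) * (2 + 1) * (4 * K) = M * ln (2 + 1 / Im z)" by (simp add: M_def K_def)
      then show ?thesis using \<open>0 < ln (2 + 1 / Im z)\<close> by (simp add: powr_mult M_def)
    qed
    ultimately show ?thesis by (simp add: mult.assoc)
  qed
  moreover have "0 < exp (pi\<^sup>2 / 4) * M powr (1/2)" by (simp add: M_def)
  ultimately show ?thesis by blast
qed

section \<open>Gaining a derivative away from the centre of the spectrum\<close>

definition bessel_prod :: "int ^ 'd \<Rightarrow> real \<Rightarrow> complex" where
  "bessel_prod k t = (\<Prod>j\<in>UNIV. bessel (k $ j) t)"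

definition bessel_prod' :: "int ^ 'd \<Rightarrow> real \<Rightarrow> complex" where
  "bessel_prod' k t = (\<Sum>i\<in>UNIV. bessel' (k $ i) t * (\<Prod>j\<in>UNIV - {i}. bessel (k $ j) t))"

lemma bessel_prod_deriv: "(bessel_prod k has_vector_derivative bessel_prod' k t) (at t)" for k :: "int ^ 'd::finite"
proof -
  have "((\<lambda>t. \<Prod>j\<in>UNIV. bessel (k $ j) t) has_derivative
      (\<lambda>y. \<Sum>i\<in>UNIV. (y *\<^sub>R bessel' (k $ i) t) * (\<Prod>j\<in>UNIV - {i}. bessel (k $ j) t))) (at t)"
    by (rule has_derivative_prod) (use bessel_deriv in \<open>simp add: has_vector_derivative_def\<close>)
  then show ?thesis
    unfolding has_vector_derivative_def bessel_prod_def[abs_def] bessel_prod'_def by (simp add: scaleR_sum_right)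
qed

lemma bessel_prod_continuous: "continuous_on S (bessel_prod k)" for k :: "int ^ 'd::finite"
  unfolding bessel_prod_def[abs_def] by (intro continuous_on_prod bessel_continuous)

lemma bessel_prod'_continuous: "continuous_on UNIV (bessel_prod' k)" for k :: "int ^ 'd::finite"
  unfolding bessel_prod'_def[abs_def] by (intro continuous_on_sum continuous_on_mult continuous_on_prod bessel_continuous bessel'_continuous)

lemma bessel_prod_measurable [measurable]: "bessel_prod k \<in> borel_measurable borel" "bessel_prod' k \<in> borel_measurable borel" for k :: "int ^ 'd::finite"
  by (intro borel_measurable_continuous_onI bessel_prod_continuous bessel_prod'_continuous)+

lemma norm_bessel_prod_le_1: "cmod (bessel_prod k t) \<le> 1" for k :: "int ^ 'd::finite"
  unfolding bessel_prod_def prod_norm[symmetric] by (intro prod_le_1) (auto simp: bessel_le_1)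

text \<open>
  All oscillation in \<open>t\<close> not contained in the Bessel functions has the single frequency \<open>z - 2 d\<close>, the
  distance from the centre of the spectrum.
\<close>
lemma propagator_eq_bessel_prod:
  fixes k :: "int ^ 'd::finite"
  shows "propagator z k t = exp (\<i> * of_real t * (z - 2 * of_nat CARD('d))) * bessel_prod k t"
proof -
  have "(\<Prod>j\<in>UNIV. cis (- 2 * t) * bessel (k $ j) t) = cis (- 2 * t) ^ CARD('d) * bessel_prod k t"
    by (simp add: prod.distrib bessel_prod_def)
  also have "cis (- 2 * t) ^ CARD('d) = exp (\<i> * of_real t * (- 2 * of_nat CARD('d)))"
  proof -
    have "\<i> * of_real t * (- 2 * of_nat n) = of_nat n * (\<i> * complex_of_real (- 2 * t))" for n by simp
    then show ?thesis by (simp only: cis_conv_exp exp_of_nat_mult)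
  qed
  finally show ?thesis unfolding propagator_def
    by (simp add: exp_add[symmetric] ring_distribs mult.assoc[symmetric] flip: mult.assoc)
qed

text \<open>
  The boundary terms vanish at \<open>0\<close> because \<open>Re s > 1\<close>, and at infinity by the damping, which also
  justifies the splitting of the integral.
\<close>
lemma oscillation_by_parts:
  fixes k :: "int ^ 'd::finite"
  defines "c \<equiv> (2 * of_nat CARD('d) :: complex)"
  assumes z: "0 < Im z" and s: "1 < Re s"
  defines "E \<equiv> \<lambda>t. exp ((s - 1) * of_real (ln t) + \<i> * of_real t * (z - c))"
  defines "g \<equiv> \<lambda>t. indicator {0<..} t *\<^sub>R (((s - 1) / of_real t * E t * bessel_prod k t + E t * bessel_prod' k t) / (\<i> * (z - c)))"
  assumes g: "integrable lborel g"
  shows "Gamma s * power_kernel z s k = - (\<integral>t. g t \<partial>lborel)"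
proof -
  have Imc: "Im (z - c) = Im z" by (simp add: c_def)
  have zc: "z - c \<noteq> 0" using z Imc by auto
  have s0: "0 < Re s" using s by simp
  have E0: "mellin_weight s t * propagator z k t = indicator {0<..} t *\<^sub>R (E t * bessel_prod k t)" for t
    unfolding propagator_eq_bessel_prod mellin_weight_def E_def c_def by (simp add: exp_add)
  have dE: "(E has_vector_derivative ((s - 1) / of_real t + \<i> * (z - c)) * E t) (at t)" if "0 < t" for t
  proof -
    have "((\<lambda>t. (s - 1) * of_real (ln t) + \<i> * of_real t * (z - c)) has_vector_derivative
       ((s - 1) * of_real (1 / t) + \<i> * of_real 1 * (z - c))) (at t)"
      using that
      by (intro has_vector_derivative_add has_vector_derivative_mult_right has_vector_derivative_mult_left has_vector_derivative_of_real)
         (auto intro!: derivative_eq_intros)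
    from field_vector_diff_chain_within[OF this has_field_derivative_at_within[OF DERIV_exp]]
    show ?thesis unfolding E_def o_def by (simp add: divide_inverse)
  qed
  define F where "F = (\<lambda>t. E t * bessel_prod k t / (\<i> * (z - c)))"
  define f where "f = (\<lambda>t. E t * bessel_prod k t + ((s - 1) / of_real t * E t * bessel_prod k t + E t * bessel_prod' k t) / (\<i> * (z - c)))"
  have dF: "(F has_vector_derivative f t) (at t)" if "0 < t" for t
  proof -
    have "((\<lambda>t. E t * bessel_prod k t / (\<i> * (z - c))) has_vector_derivative
      (E t * bessel_prod' k t + ((s - 1) / of_real t + \<i> * (z - c)) * E t * bessel_prod k t) / (\<i> * (z - c))) (at t)"
      by (intro has_vector_derivative_divide has_vector_derivative_mult dE that bessel_prod_deriv)
    also have "(E t * bessel_prod' k t + ((s - 1) / of_real t + \<i> * (z - c)) * E t * bessel_prod k t) / (\<i> * (z - c)) = f t"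
    proof -
      have "(E t * bessel_prod' k t + ((s - 1) / of_real t + \<i> * (z - c)) * E t * bessel_prod k t)
        = ((s - 1) / of_real t * E t * bessel_prod k t + E t * bessel_prod' k t) + (\<i> * (z - c)) * (E t * bessel_prod k t)"
        by (simp add: ring_distribs)
      then show ?thesis unfolding f_def using zc by (simp only: add_divide_distrib) simp
    qed
    finally show ?thesis unfolding F_def .
  qed
  have fcont: "isCont f t" if "0 < t" for t
  proof -
    have "continuous_on {0<..} f"
      unfolding f_def E_def using zc
      by (intro continuous_intros continuous_on_subset[OF bessel_prod'_continuous] bessel_prod_continuous) auto
    then show ?thesis using that by (simp add: continuous_on_eq_continuous_at)
  qed
  have split: "indicator {0<..} t *\<^sub>R f t = mellin_weight s t * propagator z k t + g t" for t
    unfolding E0 f_def g_def by (simp add: scaleR_add_right)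
  have f_integrable: "set_integrable lborel {0<..} f"
    unfolding set_integrable_def split by (intro Bochner_Integration.integrable_add Gamma_power_kernel(1) z s0 g)
  have normF: "cmod (F t) \<le> (t powr (Re s - 1) * exp (- Im z * t)) / cmod (z - c)" if "0 < t" for t
  proof -
    have "cmod (E t) = t powr (Re s - 1) * exp (- Im z * t)"
      using that Imc by (simp add: E_def powr_def exp_add[symmetric] mult.commute)
    moreover have "cmod (F t) = cmod (E t) * cmod (bessel_prod k t) / cmod (z - c)"
      by (simp add: F_def norm_divide norm_mult)
    moreover have "cmod (E t) * cmod (bessel_prod k t) \<le> cmod (E t)"
      by (intro mult_left_le norm_bessel_prod_le_1) simp
    ultimately show ?thesis by (simp add: divide_right_mono)
  qed
  have lim0: "(F \<longlongrightarrow> 0) (at_right 0)"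
  proof (rule Lim_null_comparison)
    show "\<forall>\<^sub>F t in at_right 0. norm (F t) \<le> (t powr (Re s - 1) * exp (- Im z * t)) / cmod (z - c)"
      using eventually_at_right_less[of "0::real"] by eventually_elim (rule normF)
    have "((\<lambda>t. t powr (Re s - 1) * exp (- Im z * t)) \<longlongrightarrow> 0) (at_right 0)"
      using s z by real_asymp
    from tendsto_divide[OF this tendsto_const[of "cmod (z - c)"]] zc
    show "((\<lambda>t. (t powr (Re s - 1) * exp (- Im z * t)) / cmod (z - c)) \<longlongrightarrow> 0) (at_right 0)" by simp
  qed
  have limI: "(F \<longlongrightarrow> 0) at_top"
  proof (rule Lim_null_comparison)
    show "\<forall>\<^sub>F t in at_top. norm (F t) \<le> (t powr (Re s - 1) * exp (- Im z * t)) / cmod (z - c)"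
      using eventually_gt_at_top[of "0::real"] by eventually_elim (rule normF)
    have "((\<lambda>t. t powr (Re s - 1) * exp (- Im z * t)) \<longlongrightarrow> 0) at_top"
      using s z by real_asymp
    from tendsto_divide[OF this tendsto_const[of "cmod (z - c)"]] zc
    show "((\<lambda>t. (t powr (Re s - 1) * exp (- Im z * t)) / cmod (z - c)) \<longlongrightarrow> 0) at_top" by simp
  qed
  have ein: "einterval 0 \<infinity> = {0::real<..}" by (auto simp: einterval_def zero_ereal_def)
  have "(LBINT t=0..\<infinity>. f t) = 0 - 0"
  proof (rule interval_integral_FTC_integrable)
    show "((F \<circ> real_of_ereal) \<longlongrightarrow> 0) (at_right 0)" using lim0 by (simp add: zero_ereal_def ereal_tendsto_simps)
    show "((F \<circ> real_of_ereal) \<longlongrightarrow> 0) (at_left \<infinity>)" using limI by (simp add: ereal_tendsto_simps)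
    show "set_integrable lborel (einterval 0 \<infinity>) f" using f_integrable by (simp only: ein)
  qed (use dF fcont in \<open>auto simp: zero_ereal_def\<close>)
  then have "(\<integral>t. indicator {0<..} t *\<^sub>R f t \<partial>lborel) = 0"
    by (simp add: interval_lebesgue_integral_def ein set_lebesgue_integral_def)
  then have "(\<integral>t. mellin_weight s t * propagator z k t \<partial>lborel) + (\<integral>t. g t \<partial>lborel) = 0"
    unfolding split using Bochner_Integration.integral_add[OF Gamma_power_kernel(1)[OF z s0, of k] g] by simp
  then show ?thesis using Gamma_power_kernel(2)[OF z s0, of k] by (simp add: eq_neg_iff_add_eq_0)
qed

text \<open>
  After integration by parts a derivative falls either on the power of \<open>t\<close>, which gains \<open>1 / t\<close>, or
  on one Bessel function, which gains \<open>t powr (-1/2)\<close> and costs that factor. The first term is also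
  dominated by the second kind, as dropping one Bessel function costs nothing. With \<open>d - 1\<close> factors left, the
  admissible weight is \<open>t powr ((d - 2) / 3)\<close>, and this is \<open>t powr (L - 3/2)\<close> for \<open>L = (2 d + 5) / 6\<close>.
\<close>
lemma Gamma_power_kernel_bound_off_centre:
  fixes k :: "int ^ 'd::finite"
  defines "d \<equiv> CARD('d)"
  defines "K \<equiv> 1 + real d * (real (d - 1) * (22 ^ (d - 6) * (1 + 212 * 22 ^ 5)))"
  assumes d: "6 \<le> d" and z: "0 < Im z" and s: "Re s = (2 * real d + 5) / 6"
  shows "cmod (Gamma s * power_kernel z s k) \<le> (cmod (s - 1) + 32) / cmod (z - 2 * of_nat d) * K"
proof -
  define L where "L = Re s"
  have L: "2 \<le> L" using d s by (simp add: L_def)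
  define c where "c = (2 * of_nat CARD('d) :: complex)"
  have Imc: "Im (z - c) = Im z" by (simp add: c_def)
  have zc: "z - c \<noteq> 0" using z Imc by auto
  define E where "E = (\<lambda>t. exp ((s - 1) * of_real (ln t) + \<i> * of_real t * (z - c)))"
  define g where "g = (\<lambda>t. indicator {0<..} t *\<^sub>R (((s - 1) / of_real t * E t * bessel_prod k t + E t * bessel_prod' k t) / (\<i> * (z - c))))"
  have gm [measurable]: "g \<in> borel_measurable borel" unfolding g_def E_def by measurable
  define S where "S = (\<lambda>t. \<Sum>i\<in>UNIV. indicator {0<..} t * (t powr (L - 3/2) * (\<Prod>j\<in>UNIV - {i}. cmod (bessel (k $ j) t))))"
  have S0: "0 \<le> S t" for t unfolding S_def by (intro sum_nonneg mult_nonneg_nonneg prod_nonneg) auto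
  define Q where "Q = (cmod (s - 1) + 32) / cmod (z - c)"
  have Q: "0 \<le> Q" by (simp add: Q_def)
  have pw: "cmod (g t) \<le> Q * (indicator {0..1} t + S t)" for t
  proof (cases "0 < t")
    case False then show ?thesis using S0[of t] Q by (simp add: g_def)
  next
    case True
    have "cmod (E t) = t powr (L - 1) * exp (- Im z * t)"
      using True Imc by (simp add: E_def L_def powr_def exp_add[symmetric] mult.commute)
    also have "\<dots> \<le> t powr (L - 1) * 1" using True z by (intro mult_left_mono) auto
    finally have E: "cmod (E t) \<le> t powr (L - 1)" by simp
    have one: "cmod (((s - 1) / of_real t) * E t * bessel_prod k t) \<le> cmod (s - 1) * (indicator {0..1} t + S t)"
    proof -
      have "cmod (((s - 1) / of_real t) * E t * bessel_prod k t) \<le> (cmod (s - 1) / t) * t powr (L - 1) * cmod (bessel_prod k t)"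
        unfolding norm_mult norm_divide using True E by (intro mult_right_mono mult_mono) auto
      also have "\<dots> = cmod (s - 1) * (t powr (L - 2) * cmod (bessel_prod k t))"
        using True powr_diff[of t "L - 1" 1] by simp
      also have "\<dots> \<le> cmod (s - 1) * (indicator {0..1} t + S t)"
      proof (rule mult_left_mono)
        \<comment> \<open>For \<open>t \<le> 1\<close> the left side is at most one; for larger \<open>t\<close> raising the exponent to \<open>L - 3/2\<close> costs nothing.\<close>
        show "t powr (L - 2) * cmod (bessel_prod k t) \<le> indicator {0..1} t + S t"
        proof (cases "t \<le> 1")
          case t1: True
          have "t powr (L - 2) * cmod (bessel_prod k t) \<le> 1 * 1"
            using True t1 L norm_bessel_prod_le_1 by (intro mult_mono powr_le1) auto
          then show ?thesis using True t1 S0[of t] by simp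
        next
          case t1: False
          \<comment> \<open>Any coordinate may be dropped; the index type is nonempty.\<close>
          obtain i :: 'd where True by simp
          have "cmod (bessel_prod k t) = cmod (bessel (k $ i) t) * (\<Prod>j\<in>UNIV - {i}. cmod (bessel (k $ j) t))"
            unfolding bessel_prod_def prod_norm[symmetric] by (subst prod.remove[of UNIV i]) auto
          also have "\<dots> \<le> 1 * (\<Prod>j\<in>UNIV - {i}. cmod (bessel (k $ j) t))"
            by (intro mult_right_mono bessel_le_1 prod_nonneg) auto
          finally have "t powr (L - 2) * cmod (bessel_prod k t) \<le> t powr (L - 3/2) * (\<Prod>j\<in>UNIV - {i}. cmod (bessel (k $ j) t))"
            using t1 by (intro mult_mono powr_mono) auto
          also have "\<dots> = indicator {0<..} t * (t powr (L - 3/2) * (\<Prod>j\<in>UNIV - {i}. cmod (bessel (k $ j) t)))" using True by simp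
          also have "\<dots> \<le> S t" unfolding S_def
            by (rule member_le_sum[of i UNIV "\<lambda>i. indicator {0<..} t * (t powr (L - 3/2) * (\<Prod>j\<in>UNIV - {i}. cmod (bessel (k $ j) t)))"])
               (auto intro!: mult_nonneg_nonneg prod_nonneg)
          finally show ?thesis by (simp add: add_increasing)
        qed
      qed simp
      finally show ?thesis .
    qed
    have two: "cmod (E t * bessel_prod' k t) \<le> 32 * (indicator {0..1} t + S t)"
    proof -
      have "cmod (bessel_prod' k t) \<le> (\<Sum>i\<in>UNIV. (32 * t powr (-1/2)) * (\<Prod>j\<in>UNIV - {i}. cmod (bessel (k $ j) t)))"
        unfolding bessel_prod'_def
      proof (intro sum_norm_le)
        fix i :: 'd
        show "cmod (bessel' (k $ i) t * (\<Prod>j\<in>UNIV - {i}. bessel (k $ j) t)) \<le> (32 * t powr (-1/2)) * (\<Prod>j\<in>UNIV - {i}. cmod (bessel (k $ j) t))"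
          unfolding norm_mult prod_norm[symmetric] by (intro mult_right_mono bessel'_bound[OF True] prod_nonneg) auto
      qed
      then have "cmod (E t * bessel_prod' k t) \<le> t powr (L - 1) * (\<Sum>i\<in>UNIV. (32 * t powr (-1/2)) * (\<Prod>j\<in>UNIV - {i}. cmod (bessel (k $ j) t)))"
        unfolding norm_mult using E by (intro mult_mono) auto
      also have "\<dots> = 32 * S t"
      proof -
        have "t powr (L - 1) * t powr (-1/2) = t powr (L - 3/2)" by (simp flip: powr_add)
        then have eqx: "t powr (L - 1) * ((32 * t powr (-1/2)) * x) = 32 * (indicator {0<..} t * (t powr (L - 3/2) * x))" for x
          using True by (simp add: mult_ac)
        show ?thesis unfolding S_def sum_distrib_left by (simp only: eqx)
      qed
      also have "\<dots> \<le> 32 * (indicator {0..1} t + S t)" by simp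
      finally show ?thesis .
    qed
    have "cmod (g t) = cmod ((s - 1) / of_real t * E t * bessel_prod k t + E t * bessel_prod' k t) / cmod (z - c)"
      using True by (simp add: g_def norm_divide norm_mult)
    also have "\<dots> \<le> (cmod (s - 1) * (indicator {0..1} t + S t) + 32 * (indicator {0..1} t + S t)) / cmod (z - c)"
      using norm_triangle_ineq[of "(s - 1) / of_real t * E t * bessel_prod k t" "E t * bessel_prod' k t"] one two
      by (intro divide_right_mono) auto
    also have "\<dots> = Q * (indicator {0..1} t + S t)" by (simp add: Q_def distrib_right)
    finally show ?thesis .
  qed
  let ?D = "22 ^ (d - 6) * (1 + 212 * 22 ^ 5) :: real"
  have Sint: "(\<integral>\<^sup>+t. ennreal (S t) \<partial>lborel) \<le> ennreal (real d * (real (d - 1) * ?D))"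
  proof -
    have "(\<integral>\<^sup>+t. ennreal (S t) \<partial>lborel) = (\<integral>\<^sup>+t. (\<Sum>i\<in>UNIV. ennreal (indicator {0<..} t * (t powr (L - 3/2) * (\<Prod>j\<in>UNIV - {i}. cmod (bessel (k $ j) t))))) \<partial>lborel)"
      unfolding S_def by (intro nn_integral_cong, subst sum_ennreal) (auto intro!: mult_nonneg_nonneg prod_nonneg)
    also have "\<dots> = (\<Sum>i\<in>UNIV. \<integral>\<^sup>+t. ennreal (indicator {0<..} t * (t powr (L - 3/2) * (\<Prod>j\<in>UNIV - {i}. cmod (bessel (k $ j) t)))) \<partial>lborel)"
      by (rule nn_integral_sum) measurable
    also have "\<dots> \<le> (\<Sum>i\<in>(UNIV :: 'd set). ennreal (real (d - 1) * ?D))"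
    proof (rule sum_mono)
      fix i :: 'd
      have cJ: "card (UNIV - {i}) = d - 1" by (simp add: d_def card_Diff_singleton)
      have "(\<integral>\<^sup>+t. ennreal (indicator {0<..} t * (t powr (L - 3/2) * (\<Prod>j\<in>UNIV - {i}. cmod (bessel (k $ j) t)))) \<partial>lborel) \<le> ennreal (card (UNIV - {i}) * ?D)"
      proof (rule weighted_prod_bound[where \<phi> = "\<lambda>t. t powr (L - 3/2)" and J = "UNIV - {i}" and k = k])
        show "UNIV - {i} \<noteq> {}"
        proof
          assume "UNIV - {i} = {}"
          then have "card (UNIV - {i}) = 0" by (simp only: card.empty)
          then show False using cJ d by simp
        qed
        fix n
        have eL: "L - 3/2 = (real (d - 1) - 1) / 3" using s d by (simp add: L_def of_nat_diff field_simps)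
        have d5: "d - 1 - 5 = d - 6" and d1: "5 \<le> d - 1" using d by auto
        show "(\<integral>\<^sup>+t. ennreal (indicator {0<..} t * (t powr (L - 3/2) * cmod (bessel n t) ^ card (UNIV - {i}))) \<partial>lborel) \<le> ennreal ?D"
          unfolding cJ eL by (rule airy_profile.integral_high_power[OF bessel_profile d1, unfolded d5])
      qed auto
      then show "(\<integral>\<^sup>+t. ennreal (indicator {0<..} t * (t powr (L - 3/2) * (\<Prod>j\<in>UNIV - {i}. cmod (bessel (k $ j) t)))) \<partial>lborel) \<le> ennreal (real (d - 1) * ?D)"
        unfolding cJ .
    qed
    also have "\<dots> = ennreal (real d * (real (d - 1) * ?D))"
      by (simp add: d_def ennreal_mult ennreal_of_nat_eq_real_of_nat)
    finally show ?thesis .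
  qed
  have Sm [measurable]: "S \<in> borel_measurable borel" unfolding S_def by measurable
  have K0: "0 \<le> K" unfolding K_def by simp
  have gbound: "(\<integral>\<^sup>+t. ennreal (cmod (g t)) \<partial>lborel) \<le> ennreal (Q * K)"
  proof -
    have "(\<integral>\<^sup>+t. ennreal (cmod (g t)) \<partial>lborel) \<le> (\<integral>\<^sup>+t. ennreal Q * (indicator {0..1} t + ennreal (S t)) \<partial>lborel)"
    proof (rule nn_integral_mono)
      fix t :: real
      have "ennreal (cmod (g t)) \<le> ennreal (Q * (indicator {0..1} t + S t))" by (rule ennreal_leI[OF pw])
      also have "\<dots> = ennreal Q * (indicator {0..1} t + ennreal (S t))"
        using Q S0[of t] by (simp add: ennreal_mult ennreal_indicator)
      finally show "ennreal (cmod (g t)) \<le> \<dots>" .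
    qed
    also have "\<dots> = ennreal Q * (1 + (\<integral>\<^sup>+t. ennreal (S t) \<partial>lborel))"
      by (simp add: nn_integral_cmult nn_integral_add)
    also have "\<dots> \<le> ennreal Q * (1 + ennreal (real d * (real (d - 1) * ?D)))"
      by (intro mult_left_mono add_left_mono Sint) auto
    also have "\<dots> = ennreal (Q * K)"
    proof -
      have "1 + ennreal x = ennreal (1 + x)" if "0 \<le> x" for x using that by simp
      then show ?thesis using Q K0 unfolding K_def by (simp add: ennreal_mult)
    qed
    finally show ?thesis .
  qed
  have gint: "integrable lborel g"
    by (rule integrableI_bounded) (use le_less_trans[OF gbound] in auto)
  have s1: "1 < Re s" using L by (simp add: L_def)
  have "Gamma s * power_kernel z s k = - (\<integral>t. g t \<partial>lborel)"
    unfolding g_def E_def c_def by (rule oscillation_by_parts[OF z s1 gint[unfolded g_def E_def c_def]])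
  then have "ennreal (cmod (Gamma s * power_kernel z s k)) \<le> (\<integral>\<^sup>+t. ennreal (cmod (g t)) \<partial>lborel)"
    using integral_norm_bound_ennreal[OF gint] by simp
  also note gbound
  finally have "cmod (Gamma s * power_kernel z s k) \<le> Q * K" using Q K0 by simp
  then show ?thesis by (simp add: Q_def c_def d_def)
qed

lemma bilinear_bound_off_centre:
  assumes d: "6 \<le> CARD('d::finite)" and \<delta>: "0 < \<delta>"
  shows "\<exists>C. \<forall>z. 0 < Im z \<longrightarrow> \<delta> \<le> cmod (z - 2 * of_nat CARD('d)) \<longrightarrow> bilinear_bound TYPE('d) ((2 * real CARD('d) + 5) / 3) z C"
proof -
  let ?d = "CARD('d)"
  define L where "L = (2 * real ?d + 5) / 6"
  define K where "K = 1 + real ?d * (real (?d - 1) * (22 ^ (?d - 6) * (1 + 212 * 22 ^ 5)))"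
  have L: "2 \<le> L" using d by (simp add: L_def)
  have K: "1 \<le> K" unfolding K_def by simp
  define D where "D = exp (L\<^sup>2) * (L + 33)\<^sup>2 * (K / \<delta>)"
  have "bilinear_bound TYPE('d) (2 * L) z (exp (pi\<^sup>2 / 4) * D powr (1 / L))"
    if z: "0 < Im z" and far: "\<delta> \<le> cmod (z - 2 * of_nat ?d)" for z
  proof (rule bilinear_bound_from_kernel[OF z])
    show "1 \<le> L" "0 < D" using L K \<delta> by (auto simp: D_def)
    fix s and k :: "int ^ 'd" assume s: "Re s = L"
    have "cmod s \<le> L + \<bar>Im s\<bar>" using cmod_le[of s] s L by simp
    moreover have "cmod (s - 1) \<le> L + \<bar>Im s\<bar>" using cmod_le[of "s - 1"] s L by simp
    ultimately have n: "cmod s \<le> L + 32 + \<bar>Im s\<bar>" "cmod (s - 1) + 32 \<le> L + 32 + \<bar>Im s\<bar>" by auto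
    have b: "cmod (Gamma s * power_kernel z s k) \<le> (cmod (s - 1) + 32) / cmod (z - 2 * of_nat ?d) * K"
      unfolding K_def by (rule Gamma_power_kernel_bound_off_centre[OF d z]) (simp add: s L_def)
    also have "\<dots> \<le> (L + 32 + \<bar>Im s\<bar>) / \<delta> * K"
      using n far \<delta> K L by (intro mult_right_mono frac_le) auto
    finally have b: "cmod (Gamma s * power_kernel z s k) \<le> (L + 32 + \<bar>Im s\<bar>) / \<delta> * K" .
    have "cmod (exp (s\<^sup>2) * (Gamma (s + 1) * power_kernel z s k)) = exp (L\<^sup>2 - (Im s)\<^sup>2) * (cmod s * cmod (Gamma s * power_kernel z s k))"
      using s L by (simp add: Gamma_plus1_pos norm_mult norm_exp_square mult.assoc del: norm_exp_eq_Re)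
    also have "\<dots> \<le> exp (L\<^sup>2 - (Im s)\<^sup>2) * ((L + 32 + \<bar>Im s\<bar>) * ((L + 32 + \<bar>Im s\<bar>) / \<delta> * K))"
      using n b L by (intro mult_left_mono mult_mono) auto
    also have "\<dots> = exp (L\<^sup>2) * (exp (- (Im s)\<^sup>2) * ((L + 32) + \<bar>Im s\<bar>)\<^sup>2) * (K / \<delta>)"
      by (simp add: exp_diff exp_minus field_simps power2_eq_square)
    also have "\<dots> \<le> exp (L\<^sup>2) * ((L + 32) + 1)\<^sup>2 * (K / \<delta>)"
      using L K \<delta> by (intro mult_right_mono mult_left_mono gaussian_quadratic) auto
    finally show "cmod (exp (s\<^sup>2) * (Gamma (s + 1) * power_kernel z s k)) \<le> D" by (simp add: D_def add.assoc)
  qed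
  moreover have "2 * L = (2 * real ?d + 5) / 3" by (simp add: L_def)
  ultimately show ?thesis by metis
qed

section \<open>From the bilinear estimate to operator norms\<close>

lemma bilinear_bound_mono: "bilinear_bound TYPE('d::finite) r z C \<Longrightarrow> C \<le> C' \<Longrightarrow> bilinear_bound TYPE('d) r z C'"
  unfolding bilinear_bound_def by (meson order_trans)

text \<open>
  Conjugating \<open>z\<close> passes to the adjoint, which exchanges the two weights in the bilinear estimate.
\<close>
lemma resolvent_kernel_cnj: "resolvent_kernel (cnj z) k = cnj (resolvent_kernel z (- k))"
proof -
  have "resolvent_kernel (cnj z) k = (\<integral>\<xi>. cnj (resolvent_symbol z \<xi> * character (- k) \<xi>) \<partial>torus_measure)"
    unfolding resolvent_kernel_def by (intro Bochner_Integration.integral_cong refl) (simp add: resolvent_symbol_def character_minus)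
  also have "\<dots> = cnj (resolvent_kernel z (- k))" unfolding resolvent_kernel_def by (rule Bochner_Integration.integral_cnj)
  finally show ?thesis .
qed

lemma bilinear_bound_cnj:
  assumes "bilinear_bound TYPE('d::finite) r z C"
  shows "bilinear_bound TYPE('d) r (cnj z) C"
  unfolding bilinear_bound_def
proof (intro allI impI)
  fix A :: "(int ^ 'd) set" and V1 V2 :: "int ^ 'd \<Rightarrow> real" and x y :: "int ^ 'd \<Rightarrow> complex"
  assume a: "finite A" "\<forall>n. 0 \<le> V1 n" "\<forall>n. 0 \<le> V2 n" "(\<Sum>n\<in>A. V1 n powr r) \<le> 1" "(\<Sum>n\<in>A. V2 n powr r) \<le> 1"
    "(\<Sum>n\<in>A. (cmod (x n))\<^sup>2) \<le> 1" "(\<Sum>n\<in>A. (cmod (y n))\<^sup>2) \<le> 1"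
  have "(\<Sum>m\<in>A. \<Sum>n\<in>A. resolvent_kernel (cnj z) (n - m) * (of_real (V2 m) * x m) * (of_real (V1 n) * y n))
     = cnj (\<Sum>n\<in>A. \<Sum>m\<in>A. resolvent_kernel z (m - n) * (of_real (V1 n) * cnj (y n)) * (of_real (V2 m) * cnj (x m)))"
    unfolding cnj_sum by (subst sum.swap) (simp add: resolvent_kernel_cnj mult_ac)
  moreover have "cmod (\<Sum>n\<in>A. \<Sum>m\<in>A. resolvent_kernel z (m - n) * (of_real (V1 n) * cnj (y n)) * (of_real (V2 m) * cnj (x m))) \<le> C"
    using assms[unfolded bilinear_bound_def, rule_format, of A V2 V1 "\<lambda>n. cnj (y n)" "\<lambda>n. cnj (x n)"] a by simp
  ultimately show "cmod (\<Sum>m\<in>A. \<Sum>n\<in>A. resolvent_kernel (cnj z) (n - m) * (of_real (V2 m) * x m) * (of_real (V1 n) * y n)) \<le> C"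
    by (simp only: complex_mod_cnj)
qed

text \<open>
  One of the two functions may have infinite support, by convergence of the series for \<open>R0\<close>; the finite set in the
  bilinear estimate must then contain both supports, which is why the data on \<open>A\<close> are extended by zero.
\<close>
lemma bilinear_bound_limit:
  fixes h :: "int ^ 'd::finite \<Rightarrow> complex"
  assumes bil: "bilinear_bound TYPE('d) r z C" and z: "Im z \<noteq> 0" and h: "h \<in> ell 2" and r: "0 < r"
    and V2: "\<And>n. 0 \<le> V2 n" "\<And>B. finite B \<Longrightarrow> (\<Sum>n\<in>B. V2 n powr r) \<le> 1"
    and x: "\<And>B. finite B \<Longrightarrow> (\<Sum>n\<in>B. (cmod (x n))\<^sup>2) \<le> 1"
    and hx: "\<And>n. h n = of_real (V2 n) * x n"
    and A: "finite A" and V1: "\<And>n. 0 \<le> V1 n" "(\<Sum>n\<in>A. V1 n powr r) \<le> 1" and y: "(\<Sum>n\<in>A. (cmod (y n))\<^sup>2) \<le> 1"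
  shows "cmod (\<Sum>n\<in>A. R0 z h n * (of_real (V1 n) * y n)) \<le> C"
proof -
  have lim: "((\<lambda>B. \<Sum>n\<in>A. (\<Sum>m\<in>B. h m * resolvent_kernel z (n - m)) * (of_real (V1 n) * y n)) \<longlongrightarrow> (\<Sum>n\<in>A. R0 z h n * (of_real (V1 n) * y n))) (finite_subsets_at_top UNIV)"
    using R0_has_sum[OF z h] unfolding has_sum_def by (intro tendsto_intros) auto
  show ?thesis
  proof (rule tendsto_upperbound[OF tendsto_norm[OF lim]])
    show "\<forall>\<^sub>F B in finite_subsets_at_top UNIV. cmod (\<Sum>n\<in>A. (\<Sum>m\<in>B. h m * resolvent_kernel z (n - m)) * (of_real (V1 n) * y n)) \<le> C"
      unfolding eventually_finite_subsets_at_top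
    proof (intro exI[of _ A] conjI allI impI A subset_UNIV)
      fix B assume "finite B \<and> A \<subseteq> B \<and> B \<subseteq> (UNIV :: (int ^ 'd) set)"
      then have B: "finite B" "A \<subseteq> B" by auto
      define W where "W = (\<lambda>n. if n \<in> A then V1 n else 0)"
      define w where "w = (\<lambda>n. if n \<in> A then y n else 0)"
      have "(\<Sum>n\<in>B. W n powr r) = (\<Sum>n\<in>A. V1 n powr r)"
        using B r by (intro sum.mono_neutral_cong_right) (auto simp: W_def)
      moreover have "(\<Sum>n\<in>B. (cmod (w n))\<^sup>2) = (\<Sum>n\<in>A. (cmod (y n))\<^sup>2)"
        using B by (intro sum.mono_neutral_cong_right) (auto simp: w_def)
      ultimately have "cmod (\<Sum>m\<in>B. \<Sum>n\<in>B. resolvent_kernel z (n - m) * (of_real (V2 m) * x m) * (of_real (W n) * w n)) \<le> C"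
        using bil[unfolded bilinear_bound_def, rule_format, of B W V2 x w] B V1 V2 x y by (simp add: W_def)
      also have "(\<Sum>m\<in>B. \<Sum>n\<in>B. resolvent_kernel z (n - m) * (of_real (V2 m) * x m) * (of_real (W n) * w n))
         = (\<Sum>n\<in>B. (\<Sum>m\<in>B. h m * resolvent_kernel z (n - m)) * (of_real (W n) * w n))"
        unfolding sum_distrib_right by (subst sum.swap) (simp add: hx mult_ac)
      also have "\<dots> = (\<Sum>n\<in>A. (\<Sum>m\<in>B. h m * resolvent_kernel z (n - m)) * (of_real (V1 n) * y n))"
        using B by (intro sum.mono_neutral_cong_right) (auto simp: W_def w_def)
      finally show "cmod (\<Sum>n\<in>A. (\<Sum>m\<in>B. h m * resolvent_kernel z (n - m)) * (of_real (V1 n) * y n)) \<le> C" .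
    qed
  qed simp
qed

lemma ell_norm_nonneg: "0 \<le> ell_norm (ereal p) f"
  by (simp add: ell_norm_def)

lemma ell_finite_sum:
  assumes "0 < p" "f \<in> ell (ereal p)" "finite A"
  shows "(\<Sum>n\<in>A. cmod (f n) powr p) \<le> ell_norm (ereal p) f powr p"
proof -
  have s: "(\<lambda>n. cmod (f n) powr p) summable_on UNIV" using assms by (simp add: ell_def)
  have "(\<Sum>n\<in>A. cmod (f n) powr p) \<le> (\<Sum>\<^sub>\<infinity>n. cmod (f n) powr p)"
    using assms s by (intro finite_sum_le_infsum) auto
  also have "\<dots> = ell_norm (ereal p) f powr p"
    using assms infsum_nonneg[of UNIV "\<lambda>n. cmod (f n) powr p"] by (simp add: ell_norm_def powr_powr)
  finally show ?thesis .
qed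

lemma ell_normI:
  assumes "0 < p" "0 \<le> K" "\<And>A. finite A \<Longrightarrow> (\<Sum>n\<in>A. cmod (f n) powr p) \<le> K powr p"
  shows "f \<in> ell (ereal p)" "ell_norm (ereal p) f \<le> K"
proof -
  have s: "(\<lambda>n. cmod (f n) powr p) summable_on UNIV"
    using assms by (intro nonneg_bdd_above_summable_on) (auto intro!: bdd_aboveI2)
  then show "f \<in> ell (ereal p)" by (simp add: ell_def)
  have "(\<Sum>\<^sub>\<infinity>n. cmod (f n) powr p) \<le> K powr p" using s assms by (intro infsum_le_finite_sums) auto
  then have "(\<Sum>\<^sub>\<infinity>n. cmod (f n) powr p) powr (1 / p) \<le> (K powr p) powr (1 / p)"
    using assms by (intro powr_mono2) (auto intro!: infsum_nonneg)
  also have "\<dots> = K" using assms by (simp add: powr_powr)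
  finally show "ell_norm (ereal p) f \<le> K" by (simp add: ell_norm_def)
qed

text \<open>
  The contractive inclusion of \<open>\<ell>\<^sup>p\<close> in \<open>\<ell>\<^sup>q\<close>, on finite sets: all terms are at most \<open>K\<close>.
\<close>
lemma sum_powr_mono:
  fixes x :: "'a \<Rightarrow> real"
  assumes "0 < p" "p \<le> q" "finite A" "\<And>n. 0 \<le> x n" and K: "0 \<le> K" "(\<Sum>n\<in>A. x n powr p) \<le> K powr p"
  shows "(\<Sum>n\<in>A. x n powr q) \<le> K powr q"
proof -
  have xK: "x n \<le> K" if "n \<in> A" for n
  proof -
    have "x n powr p \<le> (\<Sum>n\<in>A. x n powr p)" using that assms by (intro member_le_sum) auto
    then have "x n powr p \<le> K powr p" using K by simp
    then show ?thesis using assms(1,4) K(1) by (metis not_le powr_less_mono2)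
  qed
  have "(\<Sum>n\<in>A. x n powr q) = (\<Sum>n\<in>A. x n powr (q - p) * x n powr p)" by (simp flip: powr_add)
  also have "\<dots> \<le> (\<Sum>n\<in>A. K powr (q - p) * x n powr p)"
    using assms xK by (intro sum_mono mult_right_mono powr_mono2) auto
  also have "\<dots> \<le> K powr (q - p) * K powr p" unfolding sum_distrib_left[symmetric] using K by (intro mult_left_mono) auto
  also have "\<dots> = K powr q" by (simp flip: powr_add)
  finally show ?thesis .
qed

lemma ell_mem_norm_le:
  assumes "0 < p" "f \<in> ell (ereal p)" shows "cmod (f n) \<le> ell_norm (ereal p) f"
proof -
  have "cmod (f n) powr p \<le> ell_norm (ereal p) f powr p" using ell_finite_sum[OF assms, of "{n}"] by simp
  then show ?thesis using assms(1) ell_norm_nonneg[of p f] by (metis not_le powr_less_mono2)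
qed

lemma two_ereal: "(2::ereal) = ereal 2" and four_ereal: "(4::ereal) = ereal 4" by simp_all

lemma cmod_powr2: "cmod z powr 2 = (cmod z)\<^sup>2"
  by (cases "z = 0") (auto simp: powr_numeral)

lemma ell2_norm_le_1:
  assumes "f \<in> ell 2" "ell_norm 2 f \<le> 1" "finite A" shows "(\<Sum>n\<in>A. (cmod (f n))\<^sup>2) \<le> 1"
proof -
  have "(\<Sum>n\<in>A. cmod (f n) powr 2) \<le> ell_norm (ereal 2) f powr 2"
    by (rule ell_finite_sum[OF zero_less_numeral assms(1)[unfolded two_ereal] assms(3)])
  also have "\<dots> \<le> 1 powr 2" using assms ell_norm_nonneg[of 2 f] unfolding two_ereal by (intro powr_mono2) auto
  finally show ?thesis by (simp only: cmod_powr2 powr_one_eq_one)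
qed

text \<open>
  The \<open>\<ell>\<^sup>2\<close> norm of \<open>W1 R0 W2 f\<close> on a finite set is attained against the normalised conjugate of that
  function. The phases of \<open>W1\<close> and \<open>W2\<close> go into the functions \<open>x\<close> and \<open>y\<close> of the bilinear estimate. Weights of norm zero
  are treated separately, since they cannot be normalised.
\<close>
lemma weighted_estimate:
  fixes W1 W2 :: "int ^ 'd::finite \<Rightarrow> complex"
  assumes bil: "bilinear_bound TYPE('d) r z C" and C: "0 \<le> C" and z: "Im z \<noteq> 0" and q: "0 < q" "q \<le> r"
    and W: "W1 \<in> ell (ereal q)" "W2 \<in> ell (ereal q)"
  shows "opnorm 2 2 (mult_op W1 \<circ> R0 z \<circ> mult_op W2) \<le> ennreal (C * ell_norm (ereal q) W1 * ell_norm (ereal q) W2)"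
  unfolding opnorm_def
proof (rule SUP_least)
  let ?N1 = "ell_norm (ereal q) W1" and ?N2 = "ell_norm (ereal q) W2"
  fix f :: "int ^ 'd \<Rightarrow> complex" assume "f \<in> {f \<in> ell 2. ell_norm 2 f \<le> 1}"
  then have f: "f \<in> ell 2" "ell_norm 2 f \<le> 1" by auto
  have N: "0 \<le> ?N1" "0 \<le> ?N2" by (auto simp: ell_norm_nonneg)
  define h where "h = mult_op W2 f"
  have f2: "(\<Sum>n\<in>A. (cmod (f n))\<^sup>2) \<le> 1" if "finite A" for A by (rule ell2_norm_le_1[OF f that])
  have h: "h \<in> ell 2"
  proof (rule ell2I)
    fix A :: "(int ^ 'd) set" assume A: "finite A"
    have "(\<Sum>n\<in>A. (cmod (h n))\<^sup>2) \<le> (\<Sum>n\<in>A. ?N2\<^sup>2 * (cmod (f n))\<^sup>2)"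
      unfolding h_def mult_op_def norm_mult power_mult_distrib
      by (intro sum_mono mult_right_mono power_mono ell_mem_norm_le q W) auto
    also have "\<dots> \<le> ?N2\<^sup>2 * 1" unfolding sum_distrib_left[symmetric] by (intro mult_left_mono f2 A) auto
    finally show "(\<Sum>n\<in>A. (cmod (h n))\<^sup>2) \<le> ?N2\<^sup>2 * 1" .
  qed
  define u where "u = R0 z h"
  have V: "(\<Sum>n\<in>B. (cmod (W n) / ell_norm (ereal q) W) powr r) \<le> 1"
    if "finite B" "W \<in> ell (ereal q)" "ell_norm (ereal q) W \<noteq> 0" for B and W :: "int ^ 'd \<Rightarrow> complex"
  proof -
    let ?N = "ell_norm (ereal q) W"
    have N: "0 < ?N" using that ell_norm_nonneg[of q W] by simp
    have "(\<Sum>n\<in>B. (cmod (W n) / ?N) powr q) = (\<Sum>n\<in>B. cmod (W n) powr q) / ?N powr q"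
      using N by (simp add: powr_divide sum_divide_distrib)
    also have "\<dots> \<le> 1" using ell_finite_sum[OF q(1) that(2,1)] N by simp
    finally have "(\<Sum>n\<in>B. (cmod (W n) / ?N) powr q) \<le> 1 powr q" by simp
    from sum_powr_mono[OF q that(1) _ _ this] N show ?thesis by simp
  qed
  have main: "(\<Sum>n\<in>A. (cmod (W1 n * u n))\<^sup>2) \<le> (C * ?N1 * ?N2)\<^sup>2" if A: "finite A" for A
  proof (cases "(\<Sum>n\<in>A. (cmod (W1 n * u n))\<^sup>2) = 0")
    case True then show ?thesis by simp
  next
    case False
    define S where "S = (\<Sum>n\<in>A. (cmod (W1 n * u n))\<^sup>2)"
    have S: "0 < S" using False sum_nonneg[of A "\<lambda>n. (cmod (W1 n * u n))\<^sup>2"] by (simp add: S_def less_le)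
    have N1: "?N1 \<noteq> 0"
    proof
      assume "?N1 = 0"
      then have "W1 n = 0" for n using ell_mem_norm_le[OF q(1) W(1), of n] by simp
      then show False using S by (simp add: S_def)
    qed
    have N2: "?N2 \<noteq> 0"
    proof
      assume "?N2 = 0"
      then have "W2 n = 0" for n using ell_mem_norm_le[OF q(1) W(2), of n] by simp
      then have "h m * resolvent_kernel z (n - m) = 0" for m n by (simp add: h_def mult_op_def)
      then have "((\<lambda>m :: int ^ 'd. 0) has_sum u n) UNIV" for n using R0_has_sum[OF z h, of n] by (simp only: u_def)
      then have "u n = 0" for n by (rule has_sum_unique) simp
      then show False using S by (simp add: S_def)
    qed
    define y where "y = (\<lambda>n. sgn (W1 n) * cnj (W1 n * u n) / of_real (sqrt S))"
    have Nc: "complex_of_real ?N1 \<noteq> 0" "complex_of_real ?N2 \<noteq> 0" using N1 N2 by auto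
    have sg: "of_real (cmod w) * sgn w = w" for w :: complex by (simp add: sgn_eq)
    have ysum: "(\<Sum>n\<in>A. (cmod (y n))\<^sup>2) \<le> 1"
    proof -
      have "(cmod (y n))\<^sup>2 \<le> (cmod (W1 n * u n))\<^sup>2 / S" for n
        using S by (auto simp: y_def norm_mult norm_divide norm_sgn power_divide power_mult_distrib)
      then have "(\<Sum>n\<in>A. (cmod (y n))\<^sup>2) \<le> (\<Sum>n\<in>A. (cmod (W1 n * u n))\<^sup>2 / S)" by (intro sum_mono)
      also have "\<dots> = 1" using S by (simp add: sum_divide_distrib[symmetric] S_def[symmetric])
      finally show ?thesis .
    qed
    have hu: "(\<lambda>n. h n / of_real ?N2) \<in> ell 2" using ell2_cmult[OF h, of "1 / of_real ?N2"] by simp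
    have R0lin: "R0 z (\<lambda>n. h n / of_real ?N2) n = u n / of_real ?N2" for n
    proof -
      have "((\<lambda>m. h m * resolvent_kernel z (n - m) / of_real ?N2) has_sum (u n / of_real ?N2)) UNIV"
        unfolding u_def divide_inverse by (intro has_sum_cmult_left R0_has_sum z h)
      moreover have "((\<lambda>m. h m * resolvent_kernel z (n - m) / of_real ?N2) has_sum R0 z (\<lambda>n. h n / of_real ?N2) n) UNIV"
        using R0_has_sum[OF z hu, of n] by simp
      ultimately show ?thesis by (rule has_sum_unique[symmetric])
    qed
    have "cmod (\<Sum>n\<in>A. R0 z (\<lambda>n. h n / of_real ?N2) n * (of_real (cmod (W1 n) / ?N1) * y n)) \<le> C"
    proof (rule bilinear_bound_limit[OF bil z hu _ _ _ _ _ A])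
      show "0 < r" using q by simp
      show "(\<Sum>n\<in>B. (cmod (W2 n) / ?N2) powr r) \<le> 1" if "finite B" for B by (rule V[OF that W(2) N2])
      show "(\<Sum>n\<in>A. (cmod (W1 n) / ?N1) powr r) \<le> 1" by (rule V[OF A W(1) N1])
      show "(\<Sum>n\<in>B. (cmod (sgn (W2 n) * f n))\<^sup>2) \<le> 1" if "finite B" for B
      proof -
        have "(cmod (sgn (W2 n) * f n))\<^sup>2 \<le> (cmod (f n))\<^sup>2" for n by (auto simp: norm_mult norm_sgn)
        then have "(\<Sum>n\<in>B. (cmod (sgn (W2 n) * f n))\<^sup>2) \<le> (\<Sum>n\<in>B. (cmod (f n))\<^sup>2)" by (intro sum_mono)
        then show ?thesis using f2[OF that] by simp
      qed
      show "h n / of_real ?N2 = of_real (cmod (W2 n) / ?N2) * (sgn (W2 n) * f n)" for n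
      proof -
        have "of_real (cmod (W2 n) / ?N2) * (sgn (W2 n) * f n) = (of_real (cmod (W2 n)) * sgn (W2 n)) * f n / of_real ?N2" by simp
        then show ?thesis by (simp only: sg h_def mult_op_def)
      qed
    qed (use N ysum in auto)
    also have "(\<Sum>n\<in>A. R0 z (\<lambda>n. h n / of_real ?N2) n * (of_real (cmod (W1 n) / ?N1) * y n))
      = of_real (sqrt S / (?N1 * ?N2))"
    proof -
      have "R0 z (\<lambda>n. h n / of_real ?N2) n * (of_real (cmod (W1 n) / ?N1) * y n)
        = of_real ((cmod (W1 n * u n))\<^sup>2) * (1 / (of_real (sqrt S) * of_real ?N1 * of_real ?N2))" for n
      proof -
        have "R0 z (\<lambda>n. h n / of_real ?N2) n * (of_real (cmod (W1 n) / ?N1) * y n)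
          = ((of_real (cmod (W1 n)) * sgn (W1 n)) * u n) * cnj (W1 n * u n) * (1 / (of_real (sqrt S) * of_real ?N1 * of_real ?N2))"
          unfolding R0lin y_def by (simp add: mult_ac)
        also have "((of_real (cmod (W1 n)) * sgn (W1 n)) * u n) * cnj (W1 n * u n) = of_real ((cmod (W1 n * u n))\<^sup>2)"
          unfolding sg by (rule complex_norm_square[symmetric])
        finally show ?thesis .
      qed
      then have "(\<Sum>n\<in>A. R0 z (\<lambda>n. h n / of_real ?N2) n * (of_real (cmod (W1 n) / ?N1) * y n))
        = of_real S * (1 / (of_real (sqrt S) * of_real ?N1 * of_real ?N2))"
        by (simp only: sum_distrib_right[symmetric] of_real_sum[symmetric] S_def)
      also have "\<dots> = of_real (sqrt S * sqrt S) * (1 / (of_real (sqrt S) * of_real ?N1 * of_real ?N2))" using S by simp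
      also have "\<dots> = of_real (sqrt S * sqrt S * (1 / (sqrt S * ?N1 * ?N2)))"
        by (simp only: of_real_mult of_real_divide of_real_1)
      also have "sqrt S * sqrt S * (1 / (sqrt S * ?N1 * ?N2)) = sqrt S / (?N1 * ?N2)"
        using S by (simp del: real_sqrt_mult_self)
      finally show ?thesis .
    qed
    finally have "\<bar>sqrt S / (?N1 * ?N2)\<bar> \<le> C" by (simp only: norm_of_real)
    then have "sqrt S / (?N1 * ?N2) \<le> C" by (rule order_trans[OF abs_ge_self])
    then have "sqrt S \<le> C * ?N1 * ?N2" using N N1 N2 by (simp add: field_simps)
    then have "(sqrt S)\<^sup>2 \<le> (C * ?N1 * ?N2)\<^sup>2" using S by (intro power_mono) auto
    then show ?thesis using S by (simp add: S_def)
  qed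
  let ?T = "(mult_op W1 \<circ> R0 z \<circ> mult_op W2) f"
  have T: "?T n = W1 n * u n" for n by (simp add: mult_op_def u_def h_def o_def)
  have b: "0 \<le> C * ?N1 * ?N2" using C N by simp
  have "(\<Sum>n\<in>A. cmod (?T n) powr 2) \<le> (C * ?N1 * ?N2) powr 2" if "finite A" for A
    using main[OF that] b unfolding cmod_powr2 T by (simp add: powr_numeral)
  from ell_normI[OF _ b this] have "?T \<in> ell 2" "ell_norm 2 ?T \<le> C * ?N1 * ?N2" unfolding two_ereal by auto
  then show "(if ?T \<in> ell 2 then ennreal (ell_norm 2 ?T) else \<infinity>) \<le> ennreal (C * ?N1 * ?N2)"
    by (simp only: if_True ennreal_leI)
qed

text \<open>
  For \<open>q = 2 r / (r + 2)\<close> a function \<open>f\<close> of norm at most one in \<open>\<ell>\<^sup>q\<close> is the product of the weight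
  \<open>\<bar>f\<bar> powr (1 - q/2)\<close>, which lies in the unit ball of \<open>\<ell>\<^sup>r\<close>, and a function with modulus
  \<open>\<bar>f\<bar> powr (q/2)\<close> in the unit ball of \<open>\<ell>\<^sup>2\<close>. The bilinear estimate then bounds the pairing of \<open>R0 f\<close> with all \<open>g\<close> in the
  unit ball of \<open>\<ell>\<^sup>q\<close>, hence the norm for the dual exponent. Smaller \<open>p\<close> shrinks the source and enlarges
  the target.
\<close>
lemma resolvent_estimate:
  assumes bil: "bilinear_bound TYPE('d::finite) r z C" and C: "0 \<le> C" and z: "Im z \<noteq> 0" and r: "2 < r"
    and p: "1 \<le> p" "p \<le> 2 * r / (r + 2)"
  shows "opnorm (ereal p) (hoelder_conj p) (R0 z :: (int ^ 'd \<Rightarrow> complex) \<Rightarrow> int ^ 'd \<Rightarrow> complex) \<le> ennreal C"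
  unfolding opnorm_def
proof (rule SUP_least)
  define q where "q = 2 * r / (r + 2)"
  define q' where "q' = 2 * r / (r - 2)"
  have q: "1 < q" "q < 2" "p \<le> q" "0 < q'" using r p by (auto simp: q_def q'_def field_simps)
  have qr: "(1 - q / 2) * r = q" using r by (simp add: q_def field_simps)
  have "q' - 1 = (r + 2) / (r - 2)" using r by (simp add: q'_def field_simps)
  then have q'q: "(q' - 1) * q = q'" using r by (simp add: q_def q'_def)
  fix f :: "int ^ 'd \<Rightarrow> complex" assume "f \<in> {f \<in> ell (ereal p). ell_norm (ereal p) f \<le> 1}"
  then have f: "f \<in> ell (ereal p)" "ell_norm (ereal p) f \<le> 1" by auto
  have fp: "(\<Sum>n\<in>A. cmod (f n) powr p) \<le> 1 powr p" if "finite A" for A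
    using order_trans[OF ell_finite_sum[OF _ f(1) that] powr_mono2[OF _ ell_norm_nonneg f(2)]] p by simp
  have fq: "(\<Sum>n\<in>A. cmod (f n) powr q) \<le> 1" if "finite A" for A
    using sum_powr_mono[OF _ q(3) that _ _ fp[OF that]] p by simp
  have f2: "f \<in> ell 2"
  proof (rule ell2I)
    fix A :: "(int ^ 'd) set" assume A: "finite A"
    have "(\<Sum>n\<in>A. cmod (f n) powr 2) \<le> 1 powr 2"
      by (rule sum_powr_mono[OF _ _ A _ _ fp[OF A]]) (use p q in auto)
    then show "(\<Sum>n\<in>A. (cmod (f n))\<^sup>2) \<le> 1" by (simp only: cmod_powr2 powr_one_eq_one)
  qed
  define u where "u = R0 z f"
  have sg: "of_real (cmod w) * sgn w = w" for w :: complex by (simp add: sgn_eq)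
  have dual: "cmod (\<Sum>n\<in>A. u n * g n) \<le> C" if A: "finite A" and g: "(\<Sum>n\<in>A. cmod (g n) powr q) \<le> 1" for A g
  proof -
    have fac: "of_real (cmod w powr (1 - q / 2)) * (sgn w * of_real (cmod w powr (q / 2))) = w" for w :: complex
    proof -
      have "of_real (cmod w powr (1 - q / 2)) * (sgn w * of_real (cmod w powr (q / 2))) = of_real (cmod w powr (1 - q / 2) * cmod w powr (q / 2)) * sgn w" by simp
      also have "cmod w powr (1 - q / 2) * cmod w powr (q / 2) = cmod w" by (simp flip: powr_add)
      finally show ?thesis by (simp only: sg)
    qed
    have sq: "(cmod (sgn w * of_real (cmod w powr (q / 2))))\<^sup>2 = cmod w powr q" for w :: complex
      by (cases "w = 0") (auto simp: norm_mult norm_sgn power2_eq_square simp flip: powr_add)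
    have pr: "(cmod w powr (1 - q / 2)) powr r = cmod w powr q" for w :: complex by (simp add: powr_powr qr)
    have "cmod (\<Sum>n\<in>A. R0 z f n * (of_real (cmod (g n) powr (1 - q / 2)) * (sgn (g n) * of_real (cmod (g n) powr (q / 2))))) \<le> C"
      by (rule bilinear_bound_limit[OF bil z f2, where ?V2.0 = "\<lambda>n. cmod (f n) powr (1 - q / 2)" and x = "\<lambda>n. sgn (f n) * of_real (cmod (f n) powr (q / 2))"])
         (use r A g fq in \<open>simp_all only: fac sq pr\<close>, auto)
    then show ?thesis by (simp only: fac u_def)
  qed
  have uq': "(\<Sum>n\<in>A. cmod (u n) powr q') \<le> C powr q'" if A: "finite A" for A
  proof (cases "(\<Sum>n\<in>A. cmod (u n) powr q') = 0")
    case True then show ?thesis by simp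
  next
    case False
    define S where "S = (\<Sum>n\<in>A. cmod (u n) powr q')"
    have S: "0 < S" using False sum_nonneg[of A "\<lambda>n. cmod (u n) powr q'"] by (simp add: S_def less_le)
    \<comment> \<open>The function on \<open>A\<close> that attains equality in the inequality of Hoelder.\<close>
    define g where "g = (\<lambda>n. cnj (sgn (u n)) * of_real (cmod (u n) powr (q' - 1) / S powr (1 / q)))"
    have gq: "cmod (g n) powr q = cmod (u n) powr q' / S" for n
    proof (cases "u n = 0")
      case True then show ?thesis by (simp add: g_def)
    next
      case False
      then have "cmod (g n) = cmod (u n) powr (q' - 1) / S powr (1 / q)" by (simp add: g_def norm_mult norm_divide norm_sgn)
      then show ?thesis using S q by (simp add: powr_divide powr_powr q'q)
    qed
    have "(\<Sum>n\<in>A. cmod (g n) powr q) \<le> 1"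
      unfolding gq sum_divide_distrib[symmetric] using S by (simp add: S_def[symmetric])
    from dual[OF A this] have "cmod (\<Sum>n\<in>A. u n * g n) \<le> C" .
    also have "(\<Sum>n\<in>A. u n * g n) = of_real (S powr (1 / q'))"
    proof -
      have "u n * g n = of_real (cmod (u n) powr q' * (1 / S powr (1 / q)))" for n
      proof -
        have "u n * cnj (sgn (u n)) = of_real (cmod (u n))"
          by (cases "u n = 0") (auto simp: sgn_eq complex_norm_square[symmetric] power2_eq_square)
        then have "u n * g n = of_real (cmod (u n) * cmod (u n) powr (q' - 1) * (1 / S powr (1 / q)))"
          unfolding g_def mult.assoc[symmetric] by simp
        also have "cmod (u n) * cmod (u n) powr (q' - 1) = cmod (u n) powr q'"
          by (cases "u n = 0") (auto simp: powr_mult_base)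
        finally show ?thesis .
      qed
      then have "(\<Sum>n\<in>A. u n * g n) = of_real (S * (1 / S powr (1 / q)))"
        by (simp only: of_real_sum[symmetric] sum_distrib_right[symmetric] S_def)
      also have "S * (1 / S powr (1 / q)) = S powr (1 - 1 / q)" using S by (simp add: powr_diff)
      also have "1 - 1 / q = 1 / q'" using r by (simp add: q_def q'_def field_simps)
      finally show ?thesis .
    qed
    finally have "S powr (1 / q') \<le> C" by simp
    then have "(S powr (1 / q')) powr q' \<le> C powr q'" using q by (intro powr_mono2) auto
    then show ?thesis using S q by (simp add: powr_powr S_def[symmetric])
  qed
  have "u \<in> ell (hoelder_conj p) \<and> ell_norm (hoelder_conj p) u \<le> C"
  proof (cases "p = 1")
    case True
    have "cmod (u n) \<le> C" for n
    proof -
      have "cmod (u n) powr q' \<le> C powr q'" using uq'[of "{n}"] by simp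
      then show ?thesis using q C by (metis norm_ge_zero not_le powr_less_mono2)
    qed
    then show ?thesis unfolding hoelder_conj_def using True
      by (auto simp: ell_def ell_norm_def bounded_iff intro: cSUP_least)
  next
    case False
    then have p1: "1 < p" using p by simp
    define p' where "p' = p / (p - 1)"
    have "q - 1 = (r - 2) / (r + 2)" using r by (simp add: q_def field_simps)
    then have "q' = q / (q - 1)" using r by (simp add: q_def q'_def)
    also have "\<dots> \<le> p'" unfolding p'_def using p1 q by (simp add: field_simps)
    finally have q'p': "q' \<le> p'" .
    have b: "(\<Sum>n\<in>A. cmod (u n) powr p') \<le> C powr p'" if "finite A" for A
      by (rule sum_powr_mono[OF q(4) q'p' that _ C uq'[OF that]]) simp
    have "0 < p'" using q q'p' by simp
    from ell_normI[OF this C b] show ?thesis unfolding hoelder_conj_def using False by (simp add: p'_def)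
  qed
  then show "(if R0 z f \<in> ell (hoelder_conj p) then ennreal (ell_norm (hoelder_conj p) (R0 z f)) else \<infinity>) \<le> ennreal C"
    unfolding u_def by (simp add: ennreal_leI)
qed

section \<open>The distance to the spectrum\<close>

text \<open>
  A symbol that is pointwise dominated by a nonnegative one inherits its bilinear bound: the form at
  \<open>f, g\<close> is at most the mean of the dominating quadratic forms at \<open>f\<close> and at \<open>g\<close>, and these are diagonal
  cases of the bilinear form at \<open>w\<close>. The sign \<open>\<sigma>\<close> is the one that makes the real part nonnegative.
\<close>
lemma bilinear_bound_dominated:
  assumes z: "Im z \<noteq> 0" and w: "Im w \<noteq> 0" and \<sigma>: "\<bar>\<sigma>\<bar> = 1" and \<kappa>: "0 \<le> \<kappa>"
    and dom: "\<And>\<xi> :: real ^ 'd. cmod (resolvent_symbol z \<xi>) \<le> \<kappa> * (\<sigma> * Re (resolvent_symbol w \<xi>))"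
    and bil: "bilinear_bound TYPE('d::finite) r w C"
  shows "bilinear_bound TYPE('d) r z (\<kappa> * C)"
  unfolding bilinear_bound_def
proof (intro allI impI)
  fix A :: "(int ^ 'd) set" and V1 V2 :: "int ^ 'd \<Rightarrow> real" and x y :: "int ^ 'd \<Rightarrow> complex"
  assume fin: "finite A" and V: "\<forall>n. 0 \<le> V1 n" "\<forall>n. 0 \<le> V2 n"
    "(\<Sum>n\<in>A. V1 n powr r) \<le> 1" "(\<Sum>n\<in>A. V2 n powr r) \<le> 1"
    and x: "(\<Sum>n\<in>A. (cmod (x n))\<^sup>2) \<le> 1" and y: "(\<Sum>n\<in>A. (cmod (y n))\<^sup>2) \<le> 1"
  define f where "f = (\<lambda>n. of_real (V2 n) * x n)"
  define g where "g = (\<lambda>n. of_real (V1 n) * cnj (y n))"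
  have int: "integrable torus_measure (\<lambda>\<xi>. resolvent_symbol w \<xi> * trig_sum A h \<xi> * cnj (trig_sum A h \<xi>))" for h :: "int ^ 'd \<Rightarrow> complex"
    by (rule torus_integrable[where B = "1 / \<bar>Im w\<bar> * (\<Sum>n\<in>A. cmod (h n)) * (\<Sum>n\<in>A. cmod (h n))"])
       (auto simp: norm_mult simp del: times_divide_eq_left intro!: mult_mono norm_resolvent_symbol w norm_trig_sum_le sum_nonneg mult_nonneg_nonneg)
  let ?q = "\<lambda>h \<xi>. \<sigma> * Re (resolvent_symbol w \<xi>) * (cmod (trig_sum A h \<xi>))\<^sup>2"
  have q_eq: "?q h \<xi> = \<sigma> * Re (resolvent_symbol w \<xi> * trig_sum A h \<xi> * cnj (trig_sum A h \<xi>))" for h \<xi>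
  proof -
    have eq: "resolvent_symbol w \<xi> * trig_sum A h \<xi> * cnj (trig_sum A h \<xi>) = of_real ((cmod (trig_sum A h \<xi>))\<^sup>2) * resolvent_symbol w \<xi>"
      by (simp only: mult_ac complex_norm_square)
    show ?thesis unfolding eq by (simp del: of_real_power add: mult_ac)
  qed
  have qint: "integrable torus_measure (?q h)" for h
    unfolding q_eq by (intro integrable_mult_right integrable_Re int)
  have quad: "(\<integral>\<xi>. ?q h \<xi> \<partial>torus_measure) \<le> C"
    if h: "\<And>n. h n = of_real (W n) * v n" and W: "\<forall>n. 0 \<le> W n" "(\<Sum>n\<in>A. W n powr r) \<le> 1"
      and v: "(\<Sum>n\<in>A. (cmod (v n))\<^sup>2) \<le> 1" for h W v
  proof -
    let ?I = "\<integral>\<xi>. resolvent_symbol w \<xi> * trig_sum A h \<xi> * cnj (trig_sum A h \<xi>) \<partial>torus_measure"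
    have "?I = (\<Sum>m\<in>A. \<Sum>n\<in>A. resolvent_kernel w (n - m) * (of_real (W m) * v m) * (of_real (W n) * cnj (v n)))"
      by (subst trig_sum_form[OF _ norm_resolvent_symbol[OF w]]) (simp_all add: resolvent_kernel_def h mult_ac)
    then have "cmod ?I \<le> C"
      using bil[unfolded bilinear_bound_def, rule_format, of A W W v "\<lambda>n. cnj (v n)"] fin W v by simp
    moreover have "(\<integral>\<xi>. ?q h \<xi> \<partial>torus_measure) = \<sigma> * Re ?I"
      unfolding q_eq by (subst integral_mult_right_zero, subst integral_Re[OF int]) simp
    moreover have "\<sigma> * Re ?I \<le> \<bar>\<sigma>\<bar> * cmod ?I"
      using order_trans[OF abs_ge_self, of "\<sigma> * Re ?I"] abs_Re_le_cmod[of ?I] by (simp add: abs_mult \<sigma>)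
    ultimately show ?thesis by (simp add: \<sigma>)
  qed
  have pt: "cmod (resolvent_symbol z \<xi> * trig_sum A f \<xi> * cnj (trig_sum A g \<xi>)) \<le> \<kappa> / 2 * (?q f \<xi> + ?q g \<xi>)" for \<xi>
  proof -
    let ?a = "cmod (trig_sum A f \<xi>)" and ?b = "cmod (trig_sum A g \<xi>)"
    have "?a * ?b \<le> (?a\<^sup>2 + ?b\<^sup>2) / 2" using sum_squares_bound[of ?a ?b] by simp
    then have "cmod (resolvent_symbol z \<xi>) * (?a * ?b) \<le> \<kappa> * (\<sigma> * Re (resolvent_symbol w \<xi>)) * ((?a\<^sup>2 + ?b\<^sup>2) / 2)"
      using dom[of \<xi>] order_trans[OF norm_ge_zero dom[of \<xi>]] by (intro mult_mono) auto
    also have "\<dots> = \<kappa> / 2 * (?q f \<xi> + ?q g \<xi>)" by (simp add: algebra_simps)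
    finally show ?thesis by (simp only: norm_mult complex_mod_cnj mult.assoc)
  qed
  have "(\<Sum>m\<in>A. \<Sum>n\<in>A. resolvent_kernel z (n - m) * (of_real (V2 m) * x m) * (of_real (V1 n) * y n))
     = (\<integral>\<xi>. resolvent_symbol z \<xi> * trig_sum A f \<xi> * cnj (trig_sum A g \<xi>) \<partial>torus_measure)"
    by (subst trig_sum_form[OF _ norm_resolvent_symbol[OF z]]) (simp_all add: resolvent_kernel_def f_def g_def mult_ac)
  also have "cmod \<dots> \<le> (\<integral>\<xi>. cmod (resolvent_symbol z \<xi> * trig_sum A f \<xi> * cnj (trig_sum A g \<xi>)) \<partial>torus_measure)"
    by (rule integral_norm_bound)
  also have "\<dots> \<le> (\<integral>\<xi>. \<kappa> / 2 * (?q f \<xi> + ?q g \<xi>) \<partial>torus_measure)"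
  proof (rule integral_mono_AE')
    show "integrable torus_measure (\<lambda>\<xi>. \<kappa> / 2 * (?q f \<xi> + ?q g \<xi>))"
      by (intro integrable_mult_right Bochner_Integration.integrable_add qint)
  qed (rule AE_I2, rule pt, rule AE_I2, rule order_trans[OF norm_ge_zero pt])
  also have "\<dots> = \<kappa> / 2 * ((\<integral>\<xi>. ?q f \<xi> \<partial>torus_measure) + (\<integral>\<xi>. ?q g \<xi> \<partial>torus_measure))"
    by (subst integral_mult_right_zero, subst Bochner_Integration.integral_add[OF qint qint]) simp
  also have "\<dots> \<le> \<kappa> / 2 * (C + C)"
    using V x y \<kappa> by (intro mult_left_mono add_mono quad[of f V2 x] quad[of g V1 "\<lambda>n. cnj (y n)"]) (auto simp: f_def g_def)
  finally show "cmod (\<Sum>m\<in>A. \<Sum>n\<in>A. resolvent_kernel z (n - m) * (of_real (V2 m) * x m) * (of_real (V1 n) * y n)) \<le> \<kappa> * C" by simp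
qed

lemma infdist_real_interval:
  fixes a b :: real and z :: complex assumes "a \<le> b"
  shows "\<bar>Im z\<bar> \<le> infdist z (of_real ` {a..b})"
proof -
  have "\<bar>Im z\<bar> \<le> dist z (of_real t)" for t using abs_Im_le_cmod[of "z - of_real t"] by (simp add: dist_norm)
  then have "\<bar>Im z\<bar> \<le> (INF x\<in>of_real ` {a..b}. dist z x)" using assms by (intro cINF_greatest) auto
  then show ?thesis using assms by (simp add: infdist_def)
qed

lemma infdist_cnj_real:
  fixes T :: "real set" shows "infdist (cnj z) (complex_of_real ` T) = infdist z (of_real ` T)"
proof -
  have "dist (cnj z) (of_real t) = dist z (of_real t)" for t
    using complex_mod_cnj[of "z - of_real t"] by (simp add: dist_norm)
  then show ?thesis by (simp add: infdist_def image_image)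
qed

text \<open>
  Let \<open>D\<close> be the distance to the spectrum. If \<open>Im z \<ge> D / 2\<close>, the bound in terms of \<open>Im z\<close>
  suffices. Otherwise \<open>\<bar>h0 - Re z\<bar> > D / 2\<close> everywhere, and with \<open>u = h0 - Re z\<close> and \<open>w = Re z + \<i> D\<close> the symbol at \<open>z\<close> is at most
  \<open>1 / \<bar>u\<bar> \<le> 5 * \<bar>u\<bar> / (u\<^sup>2 + D\<^sup>2)\<close>, the latter being \<open>5\<close> times the modulus of the real part of the symbol at \<open>w\<close>.
\<close>
lemma bilinear_bound_dim4_endpoint:
  assumes d: "CARD('d::finite) = 4"
  shows "\<exists>C\<ge>0. \<forall>z. Im z \<noteq> 0 \<longrightarrow> bilinear_bound TYPE('d) 4 z (C * ln (2 + 1 / infdist z (complex_of_real ` {0..16})) powr (1/2))"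
proof -
  obtain C where C: "0 < C" "\<And>z. 0 < Im z \<Longrightarrow> bilinear_bound TYPE('d) 4 z (C * ln (2 + 1 / Im z) powr (1/2))"
    using bilinear_bound_dim4_critical[OF d] by blast
  let ?S = "complex_of_real ` {0..16}"
  have upper: "bilinear_bound TYPE('d) 4 z (5 * C * ln (2 + 1 / infdist z ?S) powr (1/2))" if z: "0 < Im z" for z
  proof -
    define D where "D = infdist z ?S"
    have D: "Im z \<le> D" using infdist_real_interval[of 0 16 z] by (simp add: D_def)
    then have D0: "0 < D" using z by simp
    have L: "0 < ln (2 + 1 / D)" using D0 by (intro ln_gt_zero) (simp add: field_simps)
    show ?thesis
    proof (cases "D / 2 \<le> Im z")
      case True
      have "2 + 1 / Im z \<le> 2 + 2 / D" using True D0 z by (simp add: field_simps)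
      also have "\<dots> \<le> (2 + 1 / D)\<^sup>2" using D0 by (simp add: power2_sum add_increasing divide_right_mono)
      finally have "2 + 1 / Im z \<le> (2 + 1 / D)\<^sup>2" .
      moreover have "0 < 2 + 1 / Im z" "0 < (2 + 1 / D)\<^sup>2" using z D0 by (intro zero_less_power add_pos_pos; simp)+
      ultimately have "ln (2 + 1 / Im z) \<le> ln ((2 + 1 / D)\<^sup>2)" by (simp only: ln_le_cancel_iff)
      also have "\<dots> = 2 * ln (2 + 1 / D)" using D0 by (simp add: ln_realpow add_pos_pos)
      \<comment> \<open>The factor \<open>25\<close> produces, after the square root, the same constant \<open>5\<close> as in the other case.\<close>
      also have "\<dots> \<le> 25 * ln (2 + 1 / D)" using L by simp
      finally have "ln (2 + 1 / Im z) powr (1/2) \<le> (25 * ln (2 + 1 / D)) powr (1/2)"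
        using z by (intro powr_mono2) (auto intro!: ln_ge_zero)
      also have "\<dots> = 5 * ln (2 + 1 / D) powr (1/2)"
        using L by (simp add: powr_mult powr_half_sqrt)
      finally have "C * ln (2 + 1 / Im z) powr (1/2) \<le> 5 * C * ln (2 + 1 / D) powr (1/2)" using C(1) by simp
      then show ?thesis using bilinear_bound_mono[OF C(2)[OF z]] by (simp add: D_def)
    next
      case False
      define w where "w = Complex (Re z) D"
      have far: "D / 2 < \<bar>t - Re z\<bar>" if "t \<in> {0..16}" for t
      proof -
        have "D \<le> dist z (of_real t)" unfolding D_def by (rule infdist_le) (use that in auto)
        also have "\<dots> \<le> \<bar>t - Re z\<bar> + \<bar>Im z\<bar>" using cmod_le[of "z - of_real t"] by (simp add: dist_norm)
        finally show ?thesis using False z by simp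
      qed
      have out: "Re z \<notin> {0..16}" using far[of "Re z"] D0 by auto
      define \<sigma> :: real where "\<sigma> = (if Re z < 0 then 1 else -1)"
      have "bilinear_bound TYPE('d) 4 z (5 * (C * ln (2 + 1 / D) powr (1/2)))"
      proof (rule bilinear_bound_dominated[where w = w and \<sigma> = \<sigma>])
        show "Im z \<noteq> 0" "Im w \<noteq> 0" "\<bar>\<sigma>\<bar> = 1" "(0::real) \<le> 5" using z D0 by (auto simp: w_def \<sigma>_def)
        show "bilinear_bound TYPE('d) 4 w (C * ln (2 + 1 / D) powr (1/2))" using C(2)[of w] D0 by (simp add: w_def)
        fix \<xi> :: "real ^ 'd"
        define u where "u = h0 \<xi> - Re z"
        have h: "h0 \<xi> \<in> {0..16}" using h0_nonneg[of \<xi>] h0_le[of \<xi>] d by simp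
        have u: "D / 2 < \<bar>u\<bar>" using far[OF h] by (simp add: u_def)
        have su: "\<sigma> * u = \<bar>u\<bar>" using h out by (auto simp: \<sigma>_def u_def)
        have "cmod (resolvent_symbol z \<xi>) \<le> 1 / \<bar>u\<bar>"
          using abs_Re_le_cmod[of "of_real (h0 \<xi>) - z"] u D0
          by (auto simp: resolvent_symbol_def norm_divide u_def intro!: frac_le)
        also have "\<dots> \<le> 5 * (\<bar>u\<bar> / (u\<^sup>2 + D\<^sup>2))"
        proof -
          have "(D / 2)\<^sup>2 \<le> \<bar>u\<bar>\<^sup>2" using u D0 by (intro power_mono) auto
          then have "u\<^sup>2 + D\<^sup>2 \<le> 5 * u\<^sup>2" by (simp add: power_divide)
          moreover have "0 < u\<^sup>2 + D\<^sup>2" using D0 by (simp add: add_nonneg_pos)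
          ultimately have "1 \<le> 5 * u\<^sup>2 / (u\<^sup>2 + D\<^sup>2)" by (simp only: le_divide_eq_1_pos)
          also have "\<dots> = 5 * (\<bar>u\<bar> / (u\<^sup>2 + D\<^sup>2)) * \<bar>u\<bar>"
            by (simp only: times_divide_eq_left times_divide_eq_right mult.assoc abs_mult_self_eq power2_eq_square)
          finally show ?thesis using u D0 by (subst pos_divide_le_eq) auto
        qed
        also have "\<bar>u\<bar> / (u\<^sup>2 + D\<^sup>2) = \<sigma> * Re (resolvent_symbol w \<xi>)"
          unfolding su[symmetric] by (simp add: resolvent_symbol_def w_def Re_divide u_def)
        finally show "cmod (resolvent_symbol z \<xi>) \<le> 5 * (\<sigma> * Re (resolvent_symbol w \<xi>))" .
      qed
      then show ?thesis by (simp add: D_def mult.assoc)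
    qed
  qed
  have "bilinear_bound TYPE('d) 4 z (5 * C * ln (2 + 1 / infdist z ?S) powr (1/2))" if z: "Im z \<noteq> 0" for z
  proof (cases "0 < Im z")
    case False
    then have "bilinear_bound TYPE('d) 4 (cnj z) (5 * C * ln (2 + 1 / infdist (cnj z) ?S) powr (1/2))"
      using z by (intro upper) simp
    from bilinear_bound_cnj[OF this] show ?thesis by (simp add: infdist_cnj_real)
  qed (rule upper)
  moreover have "0 \<le> 5 * C" using C by simp
  ultimately show ?thesis by blast
qed

section \<open>The resolvent estimates\<close>

lemma bilinear_bound_both_half_planes:
  assumes "\<exists>C. \<forall>z. 0 < Im z \<longrightarrow> P z \<longrightarrow> bilinear_bound TYPE('d::finite) r z C" and P: "\<And>z. P (cnj z) = P z"
  shows "\<exists>C\<ge>0. \<forall>z. Im z \<noteq> 0 \<longrightarrow> P z \<longrightarrow> bilinear_bound TYPE('d) r z C"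
proof -
  from assms(1) obtain C where C: "\<And>z. 0 < Im z \<Longrightarrow> P z \<Longrightarrow> bilinear_bound TYPE('d) r z C" by blast
  have "bilinear_bound TYPE('d) r z C" if "Im z \<noteq> 0" "P z" for z
    using C[of z] bilinear_bound_cnj[OF C[of "cnj z"]] that P by (cases "0 < Im z") auto
  then have "bilinear_bound TYPE('d) r z (max C 0)" if "Im z \<noteq> 0" "P z" for z
    using that by (intro bilinear_bound_mono[OF _ max.cobounded1]) blast
  moreover have "0 \<le> max C 0" by simp
  ultimately show ?thesis by blast
qed

lemma WE_if_bilinear_bound:
  assumes C: "0 \<le> C" and bil: "\<And>z. z \<in> Z \<Longrightarrow> Im z \<noteq> 0 \<and> bilinear_bound TYPE('d::finite) r z C" and q: "0 < q" "q \<le> r"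
  shows "WE TYPE('d) q Z"
  unfolding WE_def
proof (intro exI[of _ C] ballI SUP_least)
  fix W1 W2 :: "int ^ 'd \<Rightarrow> complex" and z
  assume "W1 \<in> ell (ereal q)" "W2 \<in> ell (ereal q)" "z \<in> Z"
  then show "opnorm 2 2 (mult_op W1 \<circ> R0 z \<circ> mult_op W2) \<le> ennreal (C * ell_norm (ereal q) W1 * ell_norm (ereal q) W2)"
    using bil[of z] by (intro weighted_estimate[OF _ C _ q]) auto
qed

lemma SUP_opnorm_finite:
  assumes C: "0 \<le> C" and bil: "\<And>z. z \<in> Z \<Longrightarrow> Im z \<noteq> 0 \<and> bilinear_bound TYPE('d::finite) r z C"
    and r: "2 < r" and p: "1 \<le> p" "p \<le> 2 * r / (r + 2)"
  shows "(SUP z\<in>Z. opnorm (ereal p) (hoelder_conj p) (R0 z :: (int ^ 'd \<Rightarrow> complex) \<Rightarrow> int ^ 'd \<Rightarrow> complex)) < \<infinity>"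
proof -
  have "(SUP z\<in>Z. opnorm (ereal p) (hoelder_conj p) (R0 z :: (int ^ 'd \<Rightarrow> complex) \<Rightarrow> int ^ 'd \<Rightarrow> complex)) \<le> ennreal C"
    using bil by (intro SUP_least resolvent_estimate[OF _ C _ r p]) auto
  then show ?thesis by (rule le_less_trans) simp
qed

theorem theorem1p2:
  fixes d :: nat
  assumes "d = CARD('d::finite)" and "d \<ge> 4"
  shows
  "(d = 4 \<longrightarrow>
      (\<forall>p. 1 \<le> p \<and> p < 4/3 \<longrightarrow>
         (SUP z \<in> - \<real>. opnorm (ereal p) (hoelder_conj p)
            (R0 z :: (int ^ 'd \<Rightarrow> complex) \<Rightarrow> int ^ 'd \<Rightarrow> complex)) < \<infinity>) \<and>
      (\<forall>r. 2 \<le> r \<and> r < 4 \<longrightarrow> WE TYPE('d) r (- \<real>)) \<and>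
      (\<forall>r. 1 \<le> r \<and> r < 2 \<longrightarrow> WE TYPE('d) r (- \<real>)) \<and>
      (\<exists>C::real. \<forall>z \<in> - \<real>.
         opnorm (ereal (4/3)) (ereal 4) (R0 z :: (int ^ 'd \<Rightarrow> complex) \<Rightarrow> int ^ 'd \<Rightarrow> complex)
           \<le> ennreal (C * (ln (2 + 1 / infdist z (complex_of_real ` {0..16}))) powr (1/2))) \<and>
      (\<exists>C::real. \<forall>z \<in> - \<real>.
         \<forall>W1 \<in> (ell 4 :: (int ^ 'd \<Rightarrow> complex) set). \<forall>W2 \<in> (ell 4 :: (int ^ 'd \<Rightarrow> complex) set).
         opnorm 2 2 (mult_op W1 \<circ> R0 z \<circ> mult_op W2)
           \<le> ennreal (C * (ln (2 + 1 / infdist z (complex_of_real ` {0..16}))) powr (1/2)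
                        * ell_norm 4 W1 * ell_norm 4 W2)))
   \<and>
   (d \<ge> 5 \<longrightarrow>
      (\<forall>p. 1 \<le> p \<and> p \<le> 2 * (real d + 2) / (real d + 5) \<longrightarrow>
         (SUP z \<in> - \<real>. opnorm (ereal p) (hoelder_conj p)
            (R0 z :: (int ^ 'd \<Rightarrow> complex) \<Rightarrow> int ^ 'd \<Rightarrow> complex)) < \<infinity>) \<and>
      (\<forall>r. 1 \<le> r \<and> r \<le> 2 * (real d + 2) / 3 \<longrightarrow> WE TYPE('d) r (- \<real>)))
   \<and>
   (\<forall>\<delta>>0.
      (d \<ge> 5 \<and> odd d \<longrightarrow>
         (\<forall>p. 1 \<le> p \<and> p \<le> 2 * (real d + 2) / (real d + 5) \<longrightarrow>
            (SUP z \<in> thresholds_removed d \<delta> - \<real>. opnorm (ereal p) (hoelder_conj p)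
               (R0 z :: (int ^ 'd \<Rightarrow> complex) \<Rightarrow> int ^ 'd \<Rightarrow> complex)) < \<infinity>) \<and>
         (\<forall>r. 1 \<le> r \<and> r \<le> 2 * (real d + 2) / 3 \<longrightarrow>
            WE TYPE('d) r (thresholds_removed d \<delta> - \<real>))) \<and>
      (d \<ge> 6 \<and> even d \<longrightarrow>
         (\<forall>p. 1 \<le> p \<and> p \<le> 2 * (2 * real d + 5) / (2 * real d + 11) \<longrightarrow>
            (SUP z \<in> thresholds_removed d \<delta> - \<real>. opnorm (ereal p) (hoelder_conj p)
               (R0 z :: (int ^ 'd \<Rightarrow> complex) \<Rightarrow> int ^ 'd \<Rightarrow> complex)) < \<infinity>) \<and>
         (\<forall>r. 1 \<le> r \<and> r \<le> (2 * real d + 5) / 3 \<longrightarrow>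
            WE TYPE('d) r (thresholds_removed d \<delta> - \<real>))))"
proof (intro conjI impI)
  have real: "Im z \<noteq> 0" if "z \<in> - \<real>" for z using that by (simp add: complex_is_Real_iff)
  {
    assume "d = 4"
    then have d: "CARD('d) = 4" using assms(1) by simp
    have sub: "\<exists>C\<ge>0. \<forall>z. Im z \<noteq> 0 \<longrightarrow> bilinear_bound TYPE('d) (2 * l) z C" if "1 < l" "l < 2" for l
      using bilinear_bound_both_half_planes[where 'd = 'd and P = "\<lambda>_. True"] bilinear_bound_dim4_subcritical[OF d that] by simp
    obtain C where C: "0 \<le> C" "\<And>z. Im z \<noteq> 0 \<Longrightarrow> bilinear_bound TYPE('d) 4 z (C * ln (2 + 1 / infdist z (complex_of_real ` {0..16})) powr (1/2))"
      using bilinear_bound_dim4_endpoint[OF d] by blast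
    have C0: "0 \<le> C * ln (2 + 1 / infdist z (complex_of_real ` {0..16})) powr (1/2)" for z using C(1) by simp
    show "\<forall>p. 1 \<le> p \<and> p < 4/3 \<longrightarrow>
         (SUP z \<in> - \<real>. opnorm (ereal p) (hoelder_conj p)
            (R0 z :: (int ^ 'd \<Rightarrow> complex) \<Rightarrow> int ^ 'd \<Rightarrow> complex)) < \<infinity>"
    proof (intro allI impI, elim conjE)
      fix p :: real assume p: "1 \<le> p" "p < 4/3"
      \<comment> \<open>The condition \<open>p \<le> 4 l / (2 l + 2)\<close> means \<open>p / (2 - p) \<le> l\<close>; the value \<open>3/2\<close> only keeps \<open>l\<close> above \<open>1\<close>.\<close>
      define l where "l = max (3/2) (p / (2 - p))"
      have l: "1 < l" "l < 2" "p / (2 - p) \<le> l" using p by (auto simp: l_def field_simps)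
      then obtain K where K: "0 \<le> K" "\<And>z. Im z \<noteq> 0 \<Longrightarrow> bilinear_bound TYPE('d) (2 * l) z K" using sub by blast
      have "p \<le> 2 * (2 * l) / (2 * l + 2)" using l p by (simp add: field_simps)
      then show "(SUP z \<in> - \<real>. opnorm (ereal p) (hoelder_conj p)
            (R0 z :: (int ^ 'd \<Rightarrow> complex) \<Rightarrow> int ^ 'd \<Rightarrow> complex)) < \<infinity>"
        using K real l p by (intro SUP_opnorm_finite[of K _ "2 * l"]) auto
    qed
    have we: "WE TYPE('d) r (- \<real>)" if r: "1 \<le> r" "r < 4" for r
    proof -
      define l where "l = max (3/2) (r / 2)"
      have l: "1 < l" "l < 2" "r \<le> 2 * l" using r by (auto simp: l_def)
      then obtain K where K: "0 \<le> K" "\<And>z. Im z \<noteq> 0 \<Longrightarrow> bilinear_bound TYPE('d) (2 * l) z K" using sub by blast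
      show ?thesis by (rule WE_if_bilinear_bound[OF K(1), of _ "2 * l"]) (use K real r l in auto)
    qed
    show "\<forall>r. 2 \<le> r \<and> r < 4 \<longrightarrow> WE TYPE('d) r (- \<real>)"
      and "\<forall>r. 1 \<le> r \<and> r < 2 \<longrightarrow> WE TYPE('d) r (- \<real>)" by (auto intro!: we)
    show "\<exists>C::real. \<forall>z \<in> - \<real>.
         opnorm (ereal (4/3)) (ereal 4) (R0 z :: (int ^ 'd \<Rightarrow> complex) \<Rightarrow> int ^ 'd \<Rightarrow> complex)
           \<le> ennreal (C * (ln (2 + 1 / infdist z (complex_of_real ` {0..16}))) powr (1/2))"
    proof (intro exI[of _ C] ballI)
      fix z :: complex assume "z \<in> - \<real>"
      then have z: "Im z \<noteq> 0" by (rule real)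
      have "hoelder_conj (4/3) = ereal 4" by (simp add: hoelder_conj_def)
      then show "opnorm (ereal (4/3)) (ereal 4) (R0 z :: (int ^ 'd \<Rightarrow> complex) \<Rightarrow> int ^ 'd \<Rightarrow> complex)
           \<le> ennreal (C * (ln (2 + 1 / infdist z (complex_of_real ` {0..16}))) powr (1/2))"
        using resolvent_estimate[OF C(2)[OF z] C0 z, of "4/3"] by simp
    qed
    show "\<exists>C::real. \<forall>z \<in> - \<real>.
         \<forall>W1 \<in> (ell 4 :: (int ^ 'd \<Rightarrow> complex) set). \<forall>W2 \<in> (ell 4 :: (int ^ 'd \<Rightarrow> complex) set).
         opnorm 2 2 (mult_op W1 \<circ> R0 z \<circ> mult_op W2)
           \<le> ennreal (C * (ln (2 + 1 / infdist z (complex_of_real ` {0..16}))) powr (1/2)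
                        * ell_norm 4 W1 * ell_norm 4 W2)"
      unfolding four_ereal
      by (intro exI[of _ C] ballI weighted_estimate[OF C(2) C0] real) simp_all
  }
  {
    assume d: "5 \<le> d"
    let ?r = "2 * (real d + 2) / 3"
    have "\<exists>C. \<forall>z. 0 < Im z \<longrightarrow> bilinear_bound TYPE('d) ?r z C" using bilinear_bound_high_dim[where 'd = 'd] d assms(1) by simp
    then have "\<exists>C\<ge>0. \<forall>z. Im z \<noteq> 0 \<longrightarrow> bilinear_bound TYPE('d) ?r z C"
      using bilinear_bound_both_half_planes[where 'd = 'd and P = "\<lambda>_. True" and r = ?r] by simp
    then obtain C where C: "0 \<le> C" "\<And>z. Im z \<noteq> 0 \<Longrightarrow> bilinear_bound TYPE('d) ?r z C" by blast
    have p: "2 * (real d + 2) / (real d + 5) \<le> 2 * ?r / (?r + 2)" by (simp add: field_simps)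
    have sup: "(SUP z \<in> Z. opnorm (ereal p) (hoelder_conj p)
            (R0 z :: (int ^ 'd \<Rightarrow> complex) \<Rightarrow> int ^ 'd \<Rightarrow> complex)) < \<infinity>"
      if "1 \<le> p" "p \<le> 2 * (real d + 2) / (real d + 5)" "Z \<subseteq> - \<real>" for p Z
      by (rule SUP_opnorm_finite[OF C(1), of _ ?r]) (use C real that d order_trans[OF that(2) p] in auto)
    have we: "WE TYPE('d) r Z" if "1 \<le> r" "r \<le> ?r" "Z \<subseteq> - \<real>" for r Z
      by (rule WE_if_bilinear_bound[OF C(1), of _ ?r]) (use C real that in auto)
    note sup we
  }
  note high_dim = this
  show "\<forall>p. 1 \<le> p \<and> p \<le> 2 * (real d + 2) / (real d + 5) \<longrightarrow>
         (SUP z \<in> - \<real>. opnorm (ereal p) (hoelder_conj p)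
            (R0 z :: (int ^ 'd \<Rightarrow> complex) \<Rightarrow> int ^ 'd \<Rightarrow> complex)) < \<infinity>"
    and "\<forall>r. 1 \<le> r \<and> r \<le> 2 * (real d + 2) / 3 \<longrightarrow> WE TYPE('d) r (- \<real>)" if "d \<ge> 5"
    using high_dim[OF that] by simp_all
  show "\<forall>\<delta>>0.
      (d \<ge> 5 \<and> odd d \<longrightarrow>
         (\<forall>p. 1 \<le> p \<and> p \<le> 2 * (real d + 2) / (real d + 5) \<longrightarrow>
            (SUP z \<in> thresholds_removed d \<delta> - \<real>. opnorm (ereal p) (hoelder_conj p)
               (R0 z :: (int ^ 'd \<Rightarrow> complex) \<Rightarrow> int ^ 'd \<Rightarrow> complex)) < \<infinity>) \<and>
         (\<forall>r. 1 \<le> r \<and> r \<le> 2 * (real d + 2) / 3 \<longrightarrow>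
            WE TYPE('d) r (thresholds_removed d \<delta> - \<real>))) \<and>
      (d \<ge> 6 \<and> even d \<longrightarrow>
         (\<forall>p. 1 \<le> p \<and> p \<le> 2 * (2 * real d + 5) / (2 * real d + 11) \<longrightarrow>
            (SUP z \<in> thresholds_removed d \<delta> - \<real>. opnorm (ereal p) (hoelder_conj p)
               (R0 z :: (int ^ 'd \<Rightarrow> complex) \<Rightarrow> int ^ 'd \<Rightarrow> complex)) < \<infinity>) \<and>
         (\<forall>r. 1 \<le> r \<and> r \<le> (2 * real d + 5) / 3 \<longrightarrow>
            WE TYPE('d) r (thresholds_removed d \<delta> - \<real>)))"
  proof (intro allI impI conjI; (elim conjE)?)
    fix \<delta> :: real assume \<delta>: "0 < \<delta>"
    let ?Z = "thresholds_removed d \<delta> - \<real>"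
    have sub: "?Z \<subseteq> - \<real>" by blast
    show "(SUP z \<in> ?Z. opnorm (ereal p) (hoelder_conj p)
               (R0 z :: (int ^ 'd \<Rightarrow> complex) \<Rightarrow> int ^ 'd \<Rightarrow> complex)) < \<infinity>"
      if "5 \<le> d" "1 \<le> p" "p \<le> 2 * (real d + 2) / (real d + 5)" for p
      by (rule high_dim(1)[OF that sub])
    show "WE TYPE('d) r ?Z" if "5 \<le> d" "1 \<le> r" "r \<le> 2 * (real d + 2) / 3" for r
      by (rule high_dim(2)[OF that sub])
    assume d: "6 \<le> d" "even d"
    let ?r = "(2 * real d + 5) / 3"
    have "\<exists>C. \<forall>z. 0 < Im z \<longrightarrow> \<delta> \<le> cmod (z - 2 * of_nat d) \<longrightarrow> bilinear_bound TYPE('d) ?r z C"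
      using bilinear_bound_off_centre[where 'd = 'd, OF _ \<delta>] d(1) assms(1) by simp
    moreover have "(\<delta> \<le> cmod (cnj z - 2 * of_nat d)) = (\<delta> \<le> cmod (z - 2 * of_nat d))" for z
      using complex_mod_cnj[of "z - 2 * of_nat d"] by simp
    ultimately obtain C where C: "0 \<le> C" "\<And>z. Im z \<noteq> 0 \<Longrightarrow> \<delta> \<le> cmod (z - 2 * of_nat d) \<Longrightarrow> bilinear_bound TYPE('d) ?r z C"
      using bilinear_bound_both_half_planes[where P = "\<lambda>z. \<delta> \<le> cmod (z - 2 * of_nat d)" and 'd = 'd and r = ?r] by blast
    have far: "\<delta> \<le> cmod (z - 2 * of_nat d)" if "z \<in> ?Z" for z
    proof -
      \<comment> \<open>For even \<open>d\<close> the threshold \<open>4 * (d / 2)\<close> is the centre of the spectrum.\<close>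
      from d obtain k where k: "d = 2 * k" by (elim evenE)
      have "\<delta> \<le> (MIN j\<in>{0..d}. cmod (z - 4 * of_nat j))" using that by (simp add: thresholds_removed_def)
      also have "\<dots> \<le> cmod (z - 4 * of_nat k)" using k by (intro Min_le) auto
      finally show ?thesis by (simp add: k)
    qed
    have bil: "Im z \<noteq> 0 \<and> bilinear_bound TYPE('d) ?r z C" if "z \<in> ?Z" for z
      using C(2)[OF _ far[OF that]] real that sub by blast
    show "(SUP z \<in> ?Z. opnorm (ereal p) (hoelder_conj p)
               (R0 z :: (int ^ 'd \<Rightarrow> complex) \<Rightarrow> int ^ 'd \<Rightarrow> complex)) < \<infinity>"
      if p: "1 \<le> p" "p \<le> 2 * (2 * real d + 5) / (2 * real d + 11)" for p
    proof (rule SUP_opnorm_finite[OF C(1) bil _ p(1)])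
      show "2 < ?r" using d by simp
      show "p \<le> 2 * ?r / (?r + 2)" using p(2) by (simp add: field_simps)
    qed
    show "WE TYPE('d) r ?Z" if "1 \<le> r" "r \<le> ?r" for r
      by (rule WE_if_bilinear_bound[OF C(1) bil]) (use that in auto)
  qed
qed

end
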